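(* Let $M\subseteq\mathbb{R}^3$ be a properly embedded surface which is a translating solution of mean curvature flow, i.e. $H=\langle\tau,\nu\rangle$ with $\tau=\frac{\partial}{\partial z}$, and let $M_t:=M+t\tau$ be the corresponding mean curvature flow. Suppose that $M_t/\sqrt{-t}\to S^1(\sqrt{2})\times\mathbb{R}$ (the round cylinder with axis the $z$-axis) smoothly on compact subsets as $t\to-\infty$. Then $M$ is the bowl soliton.
   Context: $\nu$ is the unit normal and $H$ the mean curvature of $M$ (with respect to $\nu$). The bowl soliton is the unique (up to translation) complete, rotationally symmetric, strictly convex translating surface in $\mathbb{R}^3$ with $H=\langle\tau,\nu\rangle$ that is an entire graph over the $xy$-plane (asymptotic, up to logarithmic terms, to the paraboloid $z=\frac12(x^2+y^2)$). *)

theory Defs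
  imports "HOL-Analysis.Analysis"
begin

definition D1 :: "(real \<times> real \<Rightarrow> real) \<Rightarrow> real \<times> real \<Rightarrow> real" where
  "D1 f = (\<lambda>(x, y). deriv (\<lambda>s. f (s, y)) x)"

definition D2 :: "(real \<times> real \<Rightarrow> real) \<Rightarrow> real \<times> real \<Rightarrow> real" where
  "D2 f = (\<lambda>(x, y). deriv (\<lambda>s. f (x, s)) y)"

fun Ck :: "nat \<Rightarrow> (real \<times> real) set \<Rightarrow> (real \<times> real \<Rightarrow> real) \<Rightarrow> bool" where
  "Ck 0 U f = continuous_on U f"
| "Ck (Suc k) U f =
     ((\<forall>z\<in>U. f differentiable (at z)) \<and> Ck k U (D1 f) \<and> Ck k U (D2 f))"

definition smooth2 :: "(real \<times> real) set \<Rightarrow> (real \<times> real \<Rightarrow> real) \<Rightarrow> bool" where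
  "smooth2 U f = (\<forall>k. Ck k U f)"

definition orthonormal3 :: "real^3 \<Rightarrow> real^3 \<Rightarrow> real^3 \<Rightarrow> bool" where
  "orthonormal3 e1 e2 n =
     (norm e1 = 1 \<and> norm e2 = 1 \<and> norm n = 1 \<and>
      e1 \<bullet> e2 = 0 \<and> e1 \<bullet> n = 0 \<and> e2 \<bullet> n = 0)"

definition graph_map ::
  "real^3 \<Rightarrow> real^3 \<Rightarrow> real^3 \<Rightarrow> real^3 \<Rightarrow> (real \<times> real \<Rightarrow> real) \<Rightarrow> real \<times> real \<Rightarrow> real^3" where
  "graph_map q e1 e2 n u = (\<lambda>(x, y). q + x *\<^sub>R e1 + y *\<^sub>R e2 + u (x, y) *\<^sub>R n)"

definition graph_normal ::
  "real^3 \<Rightarrow> real^3 \<Rightarrow> real^3 \<Rightarrow> (real \<times> real \<Rightarrow> real) \<Rightarrow> real \<times> real \<Rightarrow> real^3" where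
  "graph_normal e1 e2 n u z =
     (1 / sqrt (1 + (D1 u z)\<^sup>2 + (D2 u z)\<^sup>2)) *\<^sub>R (n - D1 u z *\<^sub>R e1 - D2 u z *\<^sub>R e2)"

text \<open>Mean curvature of the graph of u with respect to graph_normal
  (convention: mean curvature vector = H nu; H = div (grad u / W)).\<close>
definition graph_mean_curv :: "(real \<times> real \<Rightarrow> real) \<Rightarrow> real \<times> real \<Rightarrow> real" where
  "graph_mean_curv u z =
     (let p = D1 u z; q = D2 u z;
          r = D1 (D1 u) z; s = D1 (D2 u) z; t = D2 (D2 u) z
      in ((1 + q\<^sup>2) * r - 2 * p * q * s + (1 + p\<^sup>2) * t) / (sqrt (1 + p\<^sup>2 + q\<^sup>2)) ^ 3)"

abbreviation tau :: "real^3" where "tau \<equiv> axis 3 1"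

text \<open>Near p, M is a smooth graph over some plane and satisfies H = <tau, nu> there.
  (The equation is invariant under nu \<mapsto> -nu, so a local choice of normal suffices.)\<close>
definition translator_patch :: "(real^3) set \<Rightarrow> real^3 \<Rightarrow> bool" where
  "translator_patch M p =
     (\<exists>e1 e2 n U u r. orthonormal3 e1 e2 n \<and> open U \<and> smooth2 U u \<and> r > 0 \<and>
        M \<inter> ball p r = graph_map p e1 e2 n u ` U \<inter> ball p r \<and>
        (\<forall>z\<in>U. graph_mean_curv u z = graph_normal e1 e2 n u z \<bullet> tau))"

definition properly_embedded_translator :: "(real^3) set \<Rightarrow> bool" where
  "properly_embedded_translator M =
     (closed M \<and> connected M \<and> (\<forall>p\<in>M. translator_patch M p))"

definition rescaled_flow :: "(real^3) set \<Rightarrow> real \<Rightarrow> (real^3) set" where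
  "rescaled_flow M t = (\<lambda>x. (1 / sqrt (- t)) *\<^sub>R (x + t *\<^sub>R tau)) ` M"

definition cyl_map :: "(real \<times> real \<Rightarrow> real) \<Rightarrow> real \<times> real \<Rightarrow> real^3" where
  "cyl_map w = (\<lambda>(\<theta>, z). vector [(sqrt 2 + w (\<theta>, z)) * cos \<theta>, (sqrt 2 + w (\<theta>, z)) * sin \<theta>, z])"

definition converges_to_cylinder :: "(real^3) set \<Rightarrow> bool" where
  "converges_to_cylinder M =
     (\<forall>R>0. \<forall>k::nat. \<forall>\<epsilon>>0. \<forall>\<^sub>F t in at_bot.
        \<exists>w. smooth2 UNIV w \<and> (\<forall>\<theta> z. w (\<theta> + 2 * pi, z) = w (\<theta>, z)) \<and>
            (\<forall>i j \<theta> z. i + j \<le> k \<and> \<bar>z\<bar> \<le> R \<longrightarrow> \<bar>(D1 ^^ i) ((D2 ^^ j) w) (\<theta>, z)\<bar> \<le> \<epsilon>) \<and>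
            rescaled_flow M t \<inter> ball 0 R = cyl_map w ` UNIV \<inter> ball 0 R)"

text \<open>Translate of an entire, rotationally symmetric, strictly convex graph
  z = u(x,y) solving the translator equation H = <tau, nu> (upward normal).\<close>
definition is_bowl_soliton :: "(real^3) set \<Rightarrow> bool" where
  "is_bowl_soliton M =
     (\<exists>u a. smooth2 UNIV u \<and>
        (\<forall>x y x' y'. x\<^sup>2 + y\<^sup>2 = x'\<^sup>2 + y'\<^sup>2 \<longrightarrow> u (x, y) = u (x', y')) \<and>
        (\<forall>z. D1 (D1 u) z > 0 \<and> D1 (D1 u) z * D2 (D2 u) z - (D1 (D2 u) z)\<^sup>2 > 0) \<and>
        (\<forall>z. graph_mean_curv u z = 1 / sqrt (1 + (D1 u z)\<^sup>2 + (D2 u z)\<^sup>2)) \<and>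
        M = (\<lambda>(x, y). a + vector [x, y, u (x, y)]) ` UNIV)"

end

theory Submission
imports Defs
begin

notation inner (infix "<.>" 70)

text \<open>
 Barriers given by shrinking spheres and paraboloids confine \<open>M\<close> and bound it from below; the assumed
 convergence makes its end a polar graph \<open>r = \<rho>(\<theta>, z)\<close> with \<open>\<rho> \<sim> \<surd>(2z)\<close>. Put \<open>b = \<rho>\<^sup>2/2\<close> and \<open>q = b\<^sub>\<theta>\<close>: the equation reads
 \<open>b\<^sub>z = 1 - (arctan (\<rho>\<^sub>\<theta>/\<rho>))\<^sub>\<theta> + O(1/z)\<close>, a backward heat equation in \<open>z\<close>. The modes of \<open>q\<close> of order at least two would
 grow like a power of \<open>z\<close> above \<open>2\<close>, which is incompatible with \<open>q = o(z)\<close>; hence only the first mode survives and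
 \<open>\<rho>\<^sub>\<theta>\<close> converges to \<open>\<langle>a, e\<^sub>\<theta>\<rangle>\<close> for a vector \<open>a\<close>. With the strong maximum principle, comparing \<open>M\<close> with its vertical
 translates shows that \<open>M\<close> is an entire graph, and moving planes show that it is rotationally symmetric about
 the axis through \<open>a\<close>. The slope ratio \<open>\<phi>'/r\<close> of a rotationally symmetric translator stays in \<open>(0, 1)\<close>, which gives strict convexity.\<close>

text \<open>As \<open>z\<close> grows the equation is a backward heat equation, so no estimate
  propagates upward; information comes from growth alone: a quantity that must grow faster than it
  is allowed to cannot be positive. For the linear part the squared norm of the mode
  \<open>k\<close> of \<open>q\<close> behaves like \<open>z^(k^2)\<close>: exponent 1 for the first
  harmonic, at least 4 for the others, while the known bound is \<open>z^2\<close>. Any gap constant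
  above 2 separates them, so the non-sharp 12/5 suffices. The analysis runs twice: errors that are
  small multiples of the main terms give almost the right growth, interpolation turns it into
  pointwise bounds, and with these the errors become integrable. The reflections require this
  precision: across a plane that misses the axis through \<open>a\<close>, the squared distance to
  that axis changes in proportion to the displacement, and the error in the angular derivative of
  the radius must be \<open>o(1)\<close> to be beaten by it. Vertical tangent planes survive until
  the end, so the maximum principle works with level functions of patches, and the height function
  is shown to be smooth only once its symmetry is known.\<close>

section \<open>Partial derivatives and the classes \<open>Ck\<close>\<close>

lemma has_derivative_D:
 assumes "f differentiable (at z)"
 shows "(f has_derivative (%h. fst h * D1 f z + snd h * D2 f z)) (at z)"
proof -
 obtain f' where f': "(f has_derivative f') (at z)" using assms unfolding differentiable_def by blast
 obtain x y where z: "z = (x, y)" by fastforce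
 have lin: "linear f'" using f' has_derivative_linear by blast
 have "((%s. f (s, y)) has_derivative (%h. f' (h, 0))) (at x)"
  by (rule has_derivative_compose[of "%s. (s, y)" "%h. (h, 0)", OF _ f'[unfolded z]])
  (intro has_derivative_Pair has_derivative_ident has_derivative_const)
 moreover have "(%h. f' (h, 0)) = (*) (f' (1, 0))"
 proof
  fix h :: real
  have "(h, 0) = h *\<^sub>R ((1, 0) :: real \<times> real)" by simp
  then show "f' (h, 0) = f' (1, 0) * h"
  by (metis linear_scale[OF lin] real_scaleR_def mult.commute)
 qed
 ultimately have "((%s. f (s, y)) has_field_derivative f' (1, 0)) (at x)"
  unfolding has_field_derivative_def by simp
 then have 1: "D1 f z = f' (1, 0)" unfolding D1_def z by (simp add: DERIV_imp_deriv)
 have "((%s. f (x, s)) has_derivative (%h. f' (0, h))) (at y)"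
  by (rule has_derivative_compose[of "%s. (x, s)" "%h. (0, h)", OF _ f'[unfolded z]])
  (intro has_derivative_Pair has_derivative_ident has_derivative_const)
 moreover have "(%h. f' (0, h)) = (*) (f' (0, 1))"
 proof
  fix h :: real
  have "(0, h) = h *\<^sub>R ((0, 1) :: real \<times> real)" by simp
  then show "f' (0, h) = f' (0, 1) * h"
  by (metis linear_scale[OF lin] real_scaleR_def mult.commute)
 qed
 ultimately have "((%s. f (x, s)) has_field_derivative f' (0, 1)) (at y)"
  unfolding has_field_derivative_def by simp
 then have 2: "D2 f z = f' (0, 1)" unfolding D2_def z by (simp add: DERIV_imp_deriv)
 have "f' h = fst h * D1 f z + snd h * D2 f z" for h
 proof -
  have "f' h = f' (fst h *\<^sub>R (1, 0) + snd h *\<^sub>R (0, 1))" by (cases h) simp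
  also have "... = fst h * f' (1, 0) + snd h * f' (0, 1)"
  unfolding linear_add[OF lin] linear_scale[OF lin] by simp
  finally show ?thesis using 1 2 by simp
 qed
 then have "f' = (%h. fst h * D1 f z + snd h * D2 f z)" by blast
 then show ?thesis using f' by simp
qed

lemma D_eqI:
 assumes "(f has_derivative (%h. fst h * a + snd h * b)) (at z)"
 shows "f differentiable (at z)" "D1 f z = a" "D2 f z = b"
proof -
 show d: "f differentiable (at z)" using assms unfolding differentiable_def by blast
 have "(%h. fst h * D1 f z + snd h * D2 f z) = (%h. fst h * a + snd h * b)"
  using has_derivative_unique[OF has_derivative_D[OF d] assms] .
 from fun_cong[OF this, of "(1,0)"] fun_cong[OF this, of "(0,1)"]
 show "D1 f z = a" "D2 f z = b" by auto
qed

lemma DERIV_D1: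
 assumes "f differentiable (at (x, y))"
 shows "((%s. f (s, y)) has_field_derivative D1 f (x, y)) (at x)"
proof -
 have 1: "((%s::real. (s, y)) has_derivative (%h. (h, 0))) (at x)"
  by (intro has_derivative_Pair has_derivative_ident has_derivative_const)
 show ?thesis
  using has_derivative_compose[OF 1 has_derivative_D[OF assms]]
  unfolding has_field_derivative_def by (simp add: mult_commute_abs)
qed

lemma DERIV_D2:
 assumes "f differentiable (at (x, y))"
 shows "((%s. f (x, s)) has_field_derivative D2 f (x, y)) (at y)"
proof -
 have 1: "((%s::real. (x, s)) has_derivative (%h. (0, h))) (at y)"
  by (intro has_derivative_Pair has_derivative_ident has_derivative_const)
 show ?thesis
  using has_derivative_compose[OF 1 has_derivative_D[OF assms]]
  unfolding has_field_derivative_def by (simp add: mult_commute_abs)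
qed

lemma D_const [simp]: "D1 (%z. c) = (%z. 0)" "D2 (%z. c) = (%z. 0)"
 by (auto simp: D1_def D2_def)

lemma D_fst [simp]: "D1 fst = (%z. 1)" "D2 fst = (%z. 0)"
 and D_snd [simp]: "D1 snd = (%z. 0)" "D2 snd = (%z. 1)"
 by (auto simp: D1_def D2_def)

lemma D_add:
 assumes "f differentiable (at z)" "g differentiable (at z)"
 shows "(%z. f z + g z) differentiable (at z)"
  "D1 (%z. f z + g z) z = D1 f z + D1 g z" "D2 (%z. f z + g z) z = D2 f z + D2 g z"
proof -
 have "((%z. f z + g z) has_derivative (%h. fst h * (D1 f z + D1 g z) + snd h * (D2 f z + D2 g z))) (at z)"
  by (rule has_derivative_eq_rhs[OF has_derivative_add[OF has_derivative_D[OF assms(1)] has_derivative_D[OF assms(2)]]])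
  (auto simp: algebra_simps)
 from D_eqI[OF this] show "(%z. f z + g z) differentiable (at z)"
  "D1 (%z. f z + g z) z = D1 f z + D1 g z" "D2 (%z. f z + g z) z = D2 f z + D2 g z" .
qed

lemma D_mult:
 assumes "f differentiable (at z)" "g differentiable (at z)"
 shows "(%z. f z * g z) differentiable (at z)"
  "D1 (%z. f z * g z) z = D1 f z * g z + f z * D1 g z" "D2 (%z. f z * g z) z = D2 f z * g z + f z * D2 g z"
proof -
 have "((%z. f z * g z) has_derivative (%h. fst h * (D1 f z * g z + f z * D1 g z) + snd h * (D2 f z * g z + f z * D2 g z))) (at z)"
  by (rule has_derivative_eq_rhs[OF has_derivative_mult[OF has_derivative_D[OF assms(1)] has_derivative_D[OF assms(2)]]])
  (auto simp: algebra_simps)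
 from D_eqI[OF this] show "(%z. f z * g z) differentiable (at z)"
  "D1 (%z. f z * g z) z = D1 f z * g z + f z * D1 g z" "D2 (%z. f z * g z) z = D2 f z * g z + f z * D2 g z" .
qed

lemma D_comp1:
 assumes "f differentiable (at z)" "(g has_field_derivative g') (at (f z))"
 shows "(%z. g (f z)) differentiable (at z)"
  "D1 (%z. g (f z)) z = g' * D1 f z" "D2 (%z. g (f z)) z = g' * D2 f z"
proof -
 have "((%z. g (f z)) has_derivative (%h. fst h * (g' * D1 f z) + snd h * (g' * D2 f z))) (at z)"
  by (rule has_derivative_eq_rhs[OF has_derivative_compose[OF has_derivative_D[OF assms(1)] assms(2)[unfolded has_field_derivative_def]]])
  (auto simp: algebra_simps)
 from D_eqI[OF this] show "(%z. g (f z)) differentiable (at z)"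
  "D1 (%z. g (f z)) z = g' * D1 f z" "D2 (%z. g (f z)) z = g' * D2 f z" .
qed

lemma D_inverse:
 assumes "f differentiable (at z)" "f z ~= 0"
 shows "(%z. inverse (f z)) differentiable (at z)"
  "D1 (%z. inverse (f z)) z = - D1 f z * (inverse (f z) * inverse (f z))"
  "D2 (%z. inverse (f z)) z = - D2 f z * (inverse (f z) * inverse (f z))"
 using D_comp1[OF assms(1), of inverse "- (inverse (f z) ^ Suc (Suc 0))"] DERIV_inverse[OF assms(2)]
 by (auto simp: algebra_simps)

lemma D_comp2:
 assumes "ph differentiable (at z)" "ps differentiable (at z)" "f differentiable (at (ph z, ps z))"
 shows "(%z. f (ph z, ps z)) differentiable (at z)"
  "D1 (%z. f (ph z, ps z)) z = D1 f (ph z, ps z) * D1 ph z + D2 f (ph z, ps z) * D1 ps z"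
  "D2 (%z. f (ph z, ps z)) z = D1 f (ph z, ps z) * D2 ph z + D2 f (ph z, ps z) * D2 ps z"
proof -
 have "((%z. f (ph z, ps z)) has_derivative
  (%h. fst h * (D1 f (ph z, ps z) * D1 ph z + D2 f (ph z, ps z) * D1 ps z)
  + snd h * (D1 f (ph z, ps z) * D2 ph z + D2 f (ph z, ps z) * D2 ps z))) (at z)"
  by (rule has_derivative_eq_rhs[OF has_derivative_compose[OF has_derivative_Pair[OF has_derivative_D[OF assms(1)]
  has_derivative_D[OF assms(2)]] has_derivative_D[OF assms(3)]]])
  (auto simp: algebra_simps)
 from D_eqI[OF this] show "(%z. f (ph z, ps z)) differentiable (at z)"
  "D1 (%z. f (ph z, ps z)) z = D1 f (ph z, ps z) * D1 ph z + D2 f (ph z, ps z) * D1 ps z"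
  "D2 (%z. f (ph z, ps z)) z = D1 f (ph z, ps z) * D2 ph z + D2 f (ph z, ps z) * D2 ps z" .
qed

lemma differentiable_cong_open:
 assumes "open U" "z \<in> U" "!!w. w \<in> U ==> f w = g w" "f differentiable (at z)"
 shows "g differentiable (at z)"
 using assms unfolding differentiable_def by (meson has_derivative_transform_within_open)

lemma D_cong_open:
 assumes "open U" "z \<in> U" "!!w. w \<in> U ==> f w = g w"
 shows "D1 f z = D1 g z" "D2 f z = D2 g z"
proof -
 obtain x y where z: "z = (x, y)" by fastforce
 have o1: "open ((%s. (s, y)) -` U)" and o2: "open ((%s. (x, s)) -` U)"
  using assms(1) by (auto intro!: open_vimage continuous_intros)
 have "\<forall>\<^sub>F s in nhds x. f (s, y) = g (s, y)"
  using eventually_nhds_in_open[OF o1, of x] assms z by (auto elim: eventually_mono)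
 then show "D1 f z = D1 g z" unfolding D1_def z by (auto intro!: deriv_cong_ev)
 have "\<forall>\<^sub>F s in nhds y. f (x, s) = g (x, s)"
  using eventually_nhds_in_open[OF o2, of y] assms z by (auto elim: eventually_mono)
 then show "D2 f z = D2 g z" unfolding D2_def z by (auto intro!: deriv_cong_ev)
qed

lemma Ck_cong:
 assumes "open U" "!!w. w \<in> U ==> f w = g w" "Ck k U f"
 shows "Ck k U g"
 using assms(2,3)
proof (induction k arbitrary: f g)
 case 0
 then show ?case by (simp cong: continuous_on_cong)
next
 case (Suc k)
 have "Ck k U (D1 g)" "Ck k U (D2 g)"
  using Suc.IH[of "D1 f" "D1 g"] Suc.IH[of "D2 f" "D2 g"] D_cong_open[OF assms(1) _ Suc.prems(1)] Suc.prems(2)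
  by auto
 then show ?case using differentiable_cong_open[OF assms(1) _ Suc.prems(1)] Suc.prems(2) by auto
qed

lemma Ck_SucD: "Ck (Suc k) U f ==> Ck k U f"
proof (induction k arbitrary: f)
 case 0
 then show ?case
  by (auto intro!: continuous_at_imp_continuous_on differentiable_imp_continuous_within)
next
 case (Suc k)
 then show ?case by (metis Ck.simps(2))
qed

lemma Ck_subset: "Ck k U f ==> V \<subseteq> U ==> Ck k V f"
 by (induction k arbitrary: f) (auto intro: continuous_on_subset)

lemma Ck_const [simp]: "Ck k U (%z. c)"
 by (induction k arbitrary: c) auto

lemma Ck_fst [simp]: "Ck k U fst" and Ck_snd [simp]: "Ck k U snd"
 by (induction k; auto simp: continuous_on_fst continuous_on_snd continuous_on_id intro!: bounded_linear_imp_differentiable bounded_linear_fst bounded_linear_snd)+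

lemma Ck_add:
 assumes "open U" "Ck k U f" "Ck k U g"
 shows "Ck k U (%z. f z + g z)"
 using assms(2,3)
proof (induction k arbitrary: f g)
 case 0
 then show ?case by (auto intro: continuous_on_add)
next
 case (Suc k)
 have "Ck k U (D1 (%z. f z + g z))"
  by (rule Ck_cong[OF assms(1) _ Suc.IH[of "D1 f" "D1 g"]]) (use Suc.prems in "auto simp: D_add")
 moreover have "Ck k U (D2 (%z. f z + g z))"
  by (rule Ck_cong[OF assms(1) _ Suc.IH[of "D2 f" "D2 g"]]) (use Suc.prems in "auto simp: D_add")
 ultimately show ?case using Suc.prems by (auto simp: D_add)
qed

lemma Ck_mult:
 assumes "open U" "Ck k U f" "Ck k U g"
 shows "Ck k U (%z. f z * g z)"
 using assms(2,3)
proof (induction k arbitrary: f g)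
 case 0
 then show ?case by (auto intro: continuous_on_mult)
next
 case (Suc k)
 note p = Suc.prems Ck_SucD[OF Suc.prems(1)] Ck_SucD[OF Suc.prems(2)]
 have "Ck k U (D1 (%z. f z * g z))"
  by (rule Ck_cong[OF assms(1) _ Ck_add[OF assms(1) Suc.IH[of "D1 f" g] Suc.IH[of f "D1 g"]]])
  (use p in "auto simp: D_mult")
 moreover have "Ck k U (D2 (%z. f z * g z))"
  by (rule Ck_cong[OF assms(1) _ Ck_add[OF assms(1) Suc.IH[of "D2 f" g] Suc.IH[of f "D2 g"]]])
  (use p in "auto simp: D_mult")
 ultimately show ?case using Suc.prems by (auto simp: D_mult)
qed

lemma Ck_uminus: "open U ==> Ck k U f ==> Ck k U (%z. - f z)"
 using Ck_mult[of U k "%z. -1" f] by simp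

lemma Ck_diff: "open U ==> Ck k U f ==> Ck k U g ==> Ck k U (%z. f z - g z)"
 using Ck_add[of U k f "%z. - g z"] Ck_uminus[of U k g] by simp

lemma Ck_inverse:
 assumes "open U" "Ck k U f" "!!z. z \<in> U ==> f z ~= 0"
 shows "Ck k U (%z. inverse (f z))"
 using assms(2)
proof (induction k)
 case 0
 then show ?case using assms(3) by (auto intro: continuous_on_inverse)
next
 case (Suc k)
 note i = Suc.IH[OF Ck_SucD[OF Suc.prems]]
 have "Ck k U (D1 (%z. inverse (f z)))"
  by (rule Ck_cong[OF assms(1) _ Ck_mult[OF assms(1) Ck_uminus[OF assms(1), of k "D1 f"] Ck_mult[OF assms(1) i i]]])
  (use Suc.prems assms(3) in "auto simp: D_inverse")
 moreover have "Ck k U (D2 (%z. inverse (f z)))"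
  by (rule Ck_cong[OF assms(1) _ Ck_mult[OF assms(1) Ck_uminus[OF assms(1), of k "D2 f"] Ck_mult[OF assms(1) i i]]])
  (use Suc.prems assms(3) in "auto simp: D_inverse")
 ultimately show ?case using Suc.prems assms(3) by (auto simp: D_inverse)
qed

lemma Ck_compose:
 assumes "open V" "Ck k V ph" "Ck k V ps" "Ck k U f" "!!z. z \<in> V ==> (ph z, ps z) \<in> U"
 shows "Ck k V (%z. f (ph z, ps z))"
 using assms(2-4)
proof (induction k arbitrary: f)
 case 0
 then have "continuous_on V (%z. (ph z, ps z))" by (auto intro: continuous_on_Pair)
 moreover have "(%z. (ph z, ps z)) ` V \<subseteq> U" using assms(5) by blast
 ultimately show ?case using 0 continuous_on_compose2[of U f V "%z. (ph z, ps z)"] by auto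
next
 case (Suc k)
 have i: "Ck k V (%z. D1 f (ph z, ps z))" "Ck k V (%z. D2 f (ph z, ps z))"
  using Suc.IH[of "D1 f"] Suc.IH[of "D2 f"] Suc.prems(3) Ck_SucD[OF Suc.prems(1)] Ck_SucD[OF Suc.prems(2)] by auto
 have 1: "Ck k V (D1 (%z. f (ph z, ps z)))"
  by (rule Ck_cong[OF assms(1) _ Ck_add[OF assms(1) Ck_mult[OF assms(1) i(1), of "D1 ph"] Ck_mult[OF assms(1) i(2), of "D1 ps"]]])
  (use Suc.prems assms(5) in "auto simp: D_comp2")
 have 2: "Ck k V (D2 (%z. f (ph z, ps z)))"
  by (rule Ck_cong[OF assms(1) _ Ck_add[OF assms(1) Ck_mult[OF assms(1) i(1), of "D2 ph"] Ck_mult[OF assms(1) i(2), of "D2 ps"]]])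
  (use Suc.prems assms(5) in "auto simp: D_comp2")
 have "(%z. f (ph z, ps z)) differentiable (at z)" if "z \<in> V" for z
  by (rule D_comp2(1)) (use Suc.prems assms(5) that in simp_all)
 then show ?case using 1 2 by simp
qed

text \<open>Every clause of \<open>Ck\<close> is a condition at single points or a continuity
  statement on open sets. This glues the local charts of the end and the local patches of the
  surface.\<close>

lemma Ck_local:
 assumes "!!z. z \<in> U ==> EX V. open V & z \<in> V & Ck k V f"
 shows "Ck k U f"
 using assms
proof (induction k arbitrary: f)
 case 0
 then have "EX V. open V & z \<in> V & continuous_on V f" if "z \<in> U" for z using that by auto
 then have "\<forall>z\<in>U. isCont f z" by (meson continuous_on_eq_continuous_at)
 then show ?case by (simp add: continuous_at_imp_continuous_on)
next
 case (Suc k)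
 have "\<forall>z\<in>U. f differentiable (at z)" using Suc.prems by (meson Ck.simps(2))
 moreover have "Ck k U (D1 f)" by (rule Suc.IH) (meson Suc.prems Ck.simps(2))
 moreover have "Ck k U (D2 f)" by (rule Suc.IH) (meson Suc.prems Ck.simps(2))
 ultimately show ?case by simp
qed

lemma smooth2_D: "smooth2 U f ==> smooth2 U (D1 f)" "smooth2 U f ==> smooth2 U (D2 f)"
 unfolding smooth2_def by (metis Ck.simps(2))+

lemma smooth2_differentiable: "smooth2 U f ==> z \<in> U ==> f differentiable (at z)"
 unfolding smooth2_def by (metis Ck.simps(2))

lemma smooth2_continuous: "smooth2 U f ==> continuous_on U f"
 unfolding smooth2_def by (metis Ck.simps(1))

lemma smooth2_cong: "open U ==> (!!w. w \<in> U ==> f w = g w) ==> smooth2 U f ==> smooth2 U g"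
 unfolding smooth2_def using Ck_cong by blast

lemma smooth2_subset: "smooth2 U f ==> V \<subseteq> U ==> smooth2 V f"
 unfolding smooth2_def using Ck_subset by blast

lemma smooth2_const [simp]: "smooth2 U (%z. c)"
 and smooth2_fst [simp]: "smooth2 U fst" and smooth2_snd [simp]: "smooth2 U snd"
 unfolding smooth2_def by auto

lemma smooth2_add: "open U ==> smooth2 U f ==> smooth2 U g ==> smooth2 U (%z. f z + g z)"
 and smooth2_diff: "open U ==> smooth2 U f ==> smooth2 U g ==> smooth2 U (%z. f z - g z)"
 and smooth2_mult: "open U ==> smooth2 U f ==> smooth2 U g ==> smooth2 U (%z. f z * g z)"
 and smooth2_uminus: "open U ==> smooth2 U f ==> smooth2 U (%z. - f z)"
 and smooth2_inverse: "open U ==> smooth2 U f ==> (!!z. z \<in> U ==> f z ~= 0) ==> smooth2 U (%z. inverse (f z))"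
 unfolding smooth2_def by (auto intro: Ck_add Ck_mult Ck_uminus Ck_inverse Ck_diff)

lemma smooth2_compose:
 "open V ==> smooth2 V ph ==> smooth2 V ps ==> smooth2 U f ==> (!!z. z \<in> V ==> (ph z, ps z) \<in> U)
  ==> smooth2 V (%z. f (ph z, ps z))"
 unfolding smooth2_def by (auto intro: Ck_compose)

lemma smooth2_local:
 "(!!z. z \<in> U ==> EX V. open V & z \<in> V & smooth2 V f) ==> smooth2 U f"
 unfolding smooth2_def by (intro allI Ck_local) metis

text \<open>The mean value theorem, first in the first variable and then in the second, applied to
  the second difference over a square. The companion lemma takes the opposite order; comparing the
  two on shrinking squares is the classical proof that mixed derivatives commute.\<close>

lemma mixed_difference:
 assumes "h > 0"
  and d: "!!s t. x <= s ==> s <= x + h ==> y <= t ==> t <= y + h ==> f differentiable (at (s, t)) & D1 f differentiable (at (s, t))"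
 shows "EX s t. x < s & s < x + h & y < t & t < y + h &
  f (x + h, y + h) - f (x + h, y) - f (x, y + h) + f (x, y) = h * h * D2 (D1 f) (s, t)"
proof -
 have "\<exists>s>x. s < x + h & (f (x + h, y + h) - f (x + h, y)) - (f (x, y + h) - f (x, y))
  = (x + h - x) * (D1 f (s, y + h) - D1 f (s, y))"
  by (rule MVT2[of x "x + h" "%s. f (s, y + h) - f (s, y)"])
  (use assms(1) d in "auto intro!: DERIV_diff DERIV_D1")
 then obtain s where s: "x < s" "s < x + h" "(f (x + h, y + h) - f (x + h, y)) - (f (x, y + h) - f (x, y))
  = h * (D1 f (s, y + h) - D1 f (s, y))" by auto
 have "\<exists>t>y. t < y + h & D1 f (s, y + h) - D1 f (s, y) = (y + h - y) * D2 (D1 f) (s, t)"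
  by (rule MVT2[of y "y + h" "%t. D1 f (s, t)"])
  (use assms(1) d s in "auto intro!: DERIV_D2")
 then obtain t where "y < t" "t < y + h" "D1 f (s, y + h) - D1 f (s, y) = h * D2 (D1 f) (s, t)" by auto
 then show ?thesis using s by (intro exI[of _ s] exI[of _ t]) auto
qed

lemma mixed_difference':
 assumes "h > 0"
  and d: "!!s t. x <= s ==> s <= x + h ==> y <= t ==> t <= y + h ==> f differentiable (at (s, t)) & D2 f differentiable (at (s, t))"
 shows "EX s t. x < s & s < x + h & y < t & t < y + h &
  f (x + h, y + h) - f (x + h, y) - f (x, y + h) + f (x, y) = h * h * D1 (D2 f) (s, t)"
proof -
 have "\<exists>t>y. t < y + h & (f (x + h, y + h) - f (x, y + h)) - (f (x + h, y) - f (x, y))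
  = (y + h - y) * (D2 f (x + h, t) - D2 f (x, t))"
  by (rule MVT2[of y "y + h" "%t. f (x + h, t) - f (x, t)"])
  (use assms(1) d in "auto intro!: DERIV_diff DERIV_D2")
 then obtain t where t: "y < t" "t < y + h" "(f (x + h, y + h) - f (x, y + h)) - (f (x + h, y) - f (x, y))
  = h * (D2 f (x + h, t) - D2 f (x, t))" by auto
 have "\<exists>s>x. s < x + h & D2 f (x + h, t) - D2 f (x, t) = (x + h - x) * D1 (D2 f) (s, t)"
  by (rule MVT2[of x "x + h" "%s. D2 f (s, t)"])
  (use assms(1) d t in "auto intro!: DERIV_D1")
 then obtain s where "x < s" "s < x + h" "D2 f (x + h, t) - D2 f (x, t) = h * D1 (D2 f) (s, t)" by auto
 then show ?thesis using t by (intro exI[of _ s] exI[of _ t]) auto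
qed

lemma D1_D2_commute:
 assumes "open U" "Ck 2 U f" "z \<in> U"
 shows "D1 (D2 f) z = D2 (D1 f) z"
proof (rule ccontr)
 assume ne: "D1 (D2 f) z ~= D2 (D1 f) z"
 obtain x y where z: "z = (x, y)" by fastforce
 define e where "e = \<bar>D1 (D2 f) z - D2 (D1 f) z\<bar> / 2"
 have e: "e > 0" using ne by (simp add: e_def)
 have c: "continuous_on U (D1 (D2 f))" "continuous_on U (D2 (D1 f))"
  and d: "!!w. w \<in> U ==> f differentiable (at w) & D1 f differentiable (at w) & D2 f differentiable (at w)"
  using assms(2) by (auto simp: numeral_2_eq_2)
 have "isCont (D1 (D2 f)) z" "isCont (D2 (D1 f)) z"
  using c assms(1,3) by (auto simp: continuous_on_eq_continuous_at)
 then obtain d1 d2 where d1: "d1 > 0" "!!w. dist w z < d1 ==> dist (D1 (D2 f) w) (D1 (D2 f) z) < e"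
  and d2: "d2 > 0" "!!w. dist w z < d2 ==> dist (D2 (D1 f) w) (D2 (D1 f) z) < e"
  unfolding continuous_at_eps_delta using e by metis
 obtain d3 where d3: "d3 > 0" "ball z d3 \<subseteq> U" using assms(1,3) open_contains_ball by blast
 \<comment> \<open>Points of the square of side \<open>h\<close> are within \<open>2 * h\<close> of
   \<open>z\<close>, hence within all three radii.\<close>
 define h where "h = min d1 (min d2 d3) / 3"
 have h: "h > 0" using d1 d2 d3 by (simp add: h_def)
 have near: "dist (s, t) z < min d1 (min d2 d3)" if "x <= s" "s <= x + h" "y <= t" "t <= y + h" for s t
 proof -
  have "dist (s, t) z <= \<bar>s - x\<bar> + \<bar>t - y\<bar>"
  unfolding z dist_Pair_Pair dist_real_def using sqrt_sum_squares_le_sum_abs[of "s - x" "t - y"] by simp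
  also have "... <= 2 * h" using that by auto
  also have "... < min d1 (min d2 d3)" using h unfolding h_def by linarith
  finally show ?thesis .
 qed
 have inU: "(s, t) \<in> U" if "x <= s" "s <= x + h" "y <= t" "t <= y + h" for s t
  using near[OF that] d3 by (auto simp: dist_commute subset_eq)
 obtain s t where st: "x < s" "s < x + h" "y < t" "t < y + h"
  "f (x + h, y + h) - f (x + h, y) - f (x, y + h) + f (x, y) = h * h * D2 (D1 f) (s, t)"
  using mixed_difference[of h x y f] h d inU by blast
 obtain s' t' where st': "x < s'" "s' < x + h" "y < t'" "t' < y + h"
  "f (x + h, y + h) - f (x + h, y) - f (x, y + h) + f (x, y) = h * h * D1 (D2 f) (s', t')"
  using mixed_difference'[of h x y f] h d inU by blast
 have "D2 (D1 f) (s, t) = D1 (D2 f) (s', t')" using st(5) st'(5) h by simp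
 moreover have "\<bar>D2 (D1 f) (s, t) - D2 (D1 f) z\<bar> < e" using d2(2)[of "(s, t)"] near[of s t] st by (simp add: dist_real_def)
 moreover have "\<bar>D1 (D2 f) (s', t') - D1 (D2 f) z\<bar> < e" using d1(2)[of "(s', t')"] near[of s' t'] st' by (simp add: dist_real_def)
 ultimately show False unfolding e_def by (auto simp: abs_if split: if_splits)
qed

lemma smooth2_commute: "open U ==> smooth2 U f ==> z \<in> U ==> D1 (D2 f) z = D2 (D1 f) z"
 using D1_D2_commute unfolding smooth2_def by blast

section \<open>Traces, level functions of patches, and minima along a translator\<close>

text \<open>The trace, which together with one quadratic form is all that the level-set equation
  sees of a Hessian. Frames of different patches can then be mixed freely.\<close>

definition tr3 :: "(real^3 => real^3) => real" where
 "tr3 H = (\<Sum>b\<in>Basis. H b <.> b)"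

lemma tr3_rank_one: "tr3 (%v. (v <.> a) *\<^sub>R c) = a <.> c"
 unfolding tr3_def by (subst euclidean_inner) (auto intro!: sum.cong simp: inner_commute)

lemma tr3_add: "tr3 (%v. F v + G v) = tr3 F + tr3 G"
 and tr3_diff: "tr3 (%v. F v - G v) = tr3 F - tr3 G"
 and tr3_scale: "tr3 (%v. c *\<^sub>R F v) = c * tr3 F"
 and tr3_minus: "tr3 (%v. - F v) = - tr3 F"
 unfolding tr3_def by (simp_all add: inner_add_left inner_diff_left sum.distrib sum_subtractf sum_distrib_left sum_negf)

lemma tr3_id: "tr3 (%v. v) = 3"
 unfolding tr3_def by (simp add: inner_same_Basis)

lemma orthonormal3_expand:
 assumes "orthonormal3 a b c"
 shows "v = (v <.> a) *\<^sub>R a + (v <.> b) *\<^sub>R b + (v <.> c) *\<^sub>R c"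
proof -
 have o: "a <.> b = 0" "a <.> c = 0" "b <.> c = 0" "a <.> a = 1" "b <.> b = 1" "c <.> c = 1"
  using assms unfolding orthonormal3_def by (auto simp: norm_eq_1)
 have ne: "a ~= b" "a ~= c" "b ~= c" using o by auto
 let ?S = "{a, b, c}"
 have pw: "pairwise orthogonal ?S"
  using o by (auto simp: pairwise_def orthogonal_def inner_commute)
 have "0 \<notin> ?S" using o by auto
 then have ind: "independent ?S" using pw pairwise_orthogonal_independent by blast
 have "card ?S = 3" using ne by simp
 then have "UNIV \<subseteq> span ?S"
  by (intro card_ge_dim_independent[OF _ ind]) (auto simp: dim_UNIV)
 then have "v \<in> span ?S" by blast
 have "(\<Sum>b\<in>?S. (v <.> b) *\<^sub>R b) = v"
  by (rule orthonormal_basis_expand[OF pw]) (use o \<open>v \<in> span ?S\<close> in "auto simp: norm_eq_1")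
 then show ?thesis using ne by (simp add: algebra_simps)
qed

text \<open>A linear map is the sum of the rank-one maps given by its values on the frame, and the
  trace of a rank-one map is an inner product.\<close>

lemma tr3_frame:
 assumes "orthonormal3 a b c" "linear H"
 shows "tr3 H = H a <.> a + H b <.> b + H c <.> c"
proof -
 have "H v = (v <.> a) *\<^sub>R H a + (v <.> b) *\<^sub>R H b + (v <.> c) *\<^sub>R H c" for v
  by (subst orthonormal3_expand[OF assms(1), of v]) (simp add: linear_add[OF assms(2)] linear_scale[OF assms(2)])
 then have "H = (%v. (v <.> a) *\<^sub>R H a + (v <.> b) *\<^sub>R H b + (v <.> c) *\<^sub>R H c)" by blast
 then have "tr3 H = tr3 (%v. (v <.> a) *\<^sub>R H a + (v <.> b) *\<^sub>R H b + (v <.> c) *\<^sub>R H c)" by simp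
 then show ?thesis by (simp add: tr3_add tr3_rank_one inner_commute)
qed

lemma second_derivative_test:
 fixes f f' :: "real => real"
 assumes "d > 0" "!!s. \<bar>s\<bar> < d ==> DERIV f s :> f' s" "DERIV f' 0 :> c" "!!s. \<bar>s\<bar> < d ==> f 0 <= f s"
 shows "f' 0 = 0" "c >= 0"
proof -
 show f0: "f' 0 = 0" by (rule DERIV_local_min[of f "f' 0" 0 d]) (use assms in auto)
 show "c >= 0"
 proof (rule ccontr)
  assume "\<not> c >= 0"
  then obtain e where e: "e > 0" "!!h. 0 < h ==> h < e ==> f' (0 + h) < f' 0"
  using DERIV_neg_dec_right[OF assms(3)] by auto
  define h where "h = min d e / 2"
  have h: "0 < h" "h < d" "h < e" using assms(1) e(1) by (auto simp: h_def)
  have "\<exists>z>0. z < h & f h - f 0 = (h - 0) * f' z"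
  by (rule MVT2) (use h assms(2) in auto)
  then obtain z where z: "0 < z" "z < h" "f h - f 0 = h * f' z" by auto
  have "f' z < 0" using e(2)[of z] z h f0 by auto
  then have "h * f' z < 0" using h by (simp add: mult_pos_neg)
  then show False using z assms(4)[of h] h by auto
 qed
qed

text \<open>A defining function of the patch on an open set of space. \<open>nrm\<close> is its
  gradient and \<open>hss\<close> its Hessian, both constant along \<open>n\<close> and therefore
  written at the projected point. Unlike \<open>u\<close>, it can be evaluated along another
  surface, whatever the position of the two tangent planes.\<close>

definition lev :: "real^3 => real^3 => real^3 => real^3 => (real \<times> real => real) => real^3 => real" where
 "lev p e1 e2 n u x = (x - p) <.> n - u ((x - p) <.> e1, (x - p) <.> e2)"

definition nrm :: "real^3 => real^3 => real^3 => (real \<times> real => real) => real \<times> real => real^3" where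
 "nrm e1 e2 n u z = n - D1 u z *\<^sub>R e1 - D2 u z *\<^sub>R e2"

definition hss :: "real^3 => real^3 => (real \<times> real => real) => real \<times> real => real^3 => real^3" where
 "hss e1 e2 u z v = - (((v <.> e1) * D1 (D1 u) z + (v <.> e2) * D2 (D1 u) z) *\<^sub>R e1
  + ((v <.> e1) * D1 (D2 u) z + (v <.> e2) * D2 (D2 u) z) *\<^sub>R e2)"

definition proj :: "real^3 => real^3 => real^3 => real^3 => real \<times> real" where
 "proj p e1 e2 x = ((x - p) <.> e1, (x - p) <.> e2)"

lemma orthonormal3_inner:
 assumes "orthonormal3 a b c"
 shows "a <.> b = 0" "a <.> c = 0" "b <.> c = 0" "b <.> a = 0" "c <.> a = 0" "c <.> b = 0"
  "a <.> a = 1" "b <.> b = 1" "c <.> c = 1"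
 using assms unfolding orthonormal3_def by (simp_all add: norm_eq_1 inner_commute)

lemma proj_has_derivative: "(proj p e1 e2 has_derivative (%v. (v <.> e1, v <.> e2))) (at x)"
 unfolding proj_def by (auto intro!: derivative_eq_intros)

lemma lev_has_derivative:
 assumes "u differentiable (at (proj p e1 e2 x))"
 shows "(lev p e1 e2 n u has_derivative (%v. nrm e1 e2 n u (proj p e1 e2 x) <.> v)) (at x)"
proof -
 have "((%x. (x - p) <.> n - u (proj p e1 e2 x)) has_derivative
  (%v. v <.> n - ((v <.> e1) * D1 u (proj p e1 e2 x) + (v <.> e2) * D2 u (proj p e1 e2 x)))) (at x)"
  using has_derivative_compose[OF proj_has_derivative has_derivative_D[OF assms]]
  by (auto intro!: derivative_eq_intros)
 then show ?thesis unfolding lev_def[abs_def] proj_def nrm_def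
  by (simp add: inner_diff_left inner_commute algebra_simps)
qed

lemma nrm_has_derivative:
 assumes "D1 u differentiable (at (proj p e1 e2 x))" "D2 u differentiable (at (proj p e1 e2 x))"
 shows "((%x. nrm e1 e2 n u (proj p e1 e2 x)) has_derivative hss e1 e2 u (proj p e1 e2 x)) (at x)"
proof -
 have "((%x. n - D1 u (proj p e1 e2 x) *\<^sub>R e1 - D2 u (proj p e1 e2 x) *\<^sub>R e2) has_derivative
  (%v. 0 - ((v <.> e1) * D1 (D1 u) (proj p e1 e2 x) + (v <.> e2) * D2 (D1 u) (proj p e1 e2 x)) *\<^sub>R e1
  - ((v <.> e1) * D1 (D2 u) (proj p e1 e2 x) + (v <.> e2) * D2 (D2 u) (proj p e1 e2 x)) *\<^sub>R e2)) (at x)"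
  by (intro has_derivative_diff has_derivative_const has_derivative_scaleR_left)
  (use has_derivative_compose[OF proj_has_derivative has_derivative_D[OF assms(1)]]
  has_derivative_compose[OF proj_has_derivative has_derivative_D[OF assms(2)]] in auto)
 then show ?thesis unfolding nrm_def
  by (rule has_derivative_eq_rhs) (auto simp: hss_def fun_eq_iff)
qed

lemma proj_graph_map:
 assumes "orthonormal3 e1 e2 n"
 shows "proj p e1 e2 (graph_map p e1 e2 n u z) = z" "(graph_map p e1 e2 n u z - p) <.> n = u z"
 using orthonormal3_inner[OF assms] unfolding proj_def graph_map_def
 by (cases z; simp add: inner_add_left)+

lemma graph_map_proj:
 assumes "orthonormal3 e1 e2 n" "lev p e1 e2 n u x = 0"
 shows "graph_map p e1 e2 n u (proj p e1 e2 x) = x"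
proof -
 have "x - p = ((x - p) <.> e1) *\<^sub>R e1 + ((x - p) <.> e2) *\<^sub>R e2 + ((x - p) <.> n) *\<^sub>R n"
  by (rule orthonormal3_expand[OF assms(1)])
 moreover have "(x - p) <.> n = u (proj p e1 e2 x)" using assms(2) unfolding lev_def proj_def by simp
 ultimately show ?thesis unfolding graph_map_def proj_def by (simp add: algebra_simps)
qed

lemma norm_proj_le:
 assumes "orthonormal3 e1 e2 n"
 shows "norm (proj p e1 e2 x) <= norm (x - p)"
proof -
 define v where "v = x - p"
 note o = orthonormal3_inner[OF assms]
 have "0 <= (v - (v <.> e1) *\<^sub>R e1 - (v <.> e2) *\<^sub>R e2) <.> (v - (v <.> e1) *\<^sub>R e1 - (v <.> e2) *\<^sub>R e2)" by simp
 also have "... = v <.> v - (v <.> e1)^2 - (v <.> e2)^2"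
  by (simp add: inner_diff_left inner_diff_right o inner_commute[of e1 v] inner_commute[of e2 v] power2_eq_square)
 finally have "(norm (proj p e1 e2 x))^2 <= (norm v)^2"
  unfolding proj_def norm_Pair v_def by (simp add: power2_norm_eq_inner)
 then show ?thesis unfolding v_def by (simp add: power2_le_iff_abs_le)
qed

text \<open>Two radii occur: in the ball of radius \<open>dl\<close> the set \<open>M\<close> is
  exactly the zero set of \<open>lev\<close>, and parameters below \<open>eta\<close> are mapped
  into that ball. The equation has its denominators cleared.\<close>

definition tframe where
 "tframe M p e1 e2 n u dl eta \<longleftrightarrow> orthonormal3 e1 e2 n & 0 < eta & eta <= dl & smooth2 (ball 0 dl) u & u 0 = 0 &
  (\<forall>x\<in>ball p dl. x \<in> M \<longleftrightarrow> lev p e1 e2 n u x = 0) &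
  (\<forall>z\<in>ball 0 dl. (1 + (D2 u z)^2) * D1 (D1 u) z - 2 * D1 u z * D2 u z * D1 (D2 u) z + (1 + (D1 u z)^2) * D2 (D2 u) z
  = (1 + (D1 u z)^2 + (D2 u z)^2) * (nrm e1 e2 n u z <.> tau)) &
  (\<forall>z\<in>ball 0 eta. graph_map p e1 e2 n u z \<in> ball p dl)"

lemma graph_map_continuous:
 assumes "continuous_on S u"
 shows "continuous_on S (graph_map p e1 e2 n u)"
proof -
 have "continuous_on S (%z. p + fst z *\<^sub>R e1 + snd z *\<^sub>R e2 + u z *\<^sub>R n)"
  using assms by (intro continuous_intros)
 then show ?thesis unfolding graph_map_def by (simp add: case_prod_unfold)
qed

lemma quotient_cube:
 fixes A W C :: real
 assumes "A / W ^ 3 = (1 / W) * C" "W > 0"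
 shows "A = W^2 * C"
 using assms by (simp add: field_simps power2_eq_square power3_eq_cube)

lemma translator_patch_tframe:
 assumes "translator_patch M p" "p \<in> M"
 obtains e1 e2 n u dl eta where "tframe M p e1 e2 n u dl eta"
proof -
 obtain e1 e2 n U u r where P: "orthonormal3 e1 e2 n" "open U" "smooth2 U u" "r > 0"
  "M \<inter> ball p r = graph_map p e1 e2 n u ` U \<inter> ball p r"
  "\<forall>z\<in>U. graph_mean_curv u z = graph_normal e1 e2 n u z <.> tau"
  using assms(1) unfolding translator_patch_def by blast
 have "p \<in> graph_map p e1 e2 n u ` U" using P(4,5) assms(2) by (metis IntI Int_iff centre_in_ball)
 then obtain z0 where z0: "z0 \<in> U" "p = graph_map p e1 e2 n u z0" by blast
 \<comment> \<open>The frame is centred at \<open>p\<close>, so the parameter of \<open>p\<close>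
   must be the origin.\<close>
 have "z0 = proj p e1 e2 p" using proj_graph_map(1)[OF P(1), of p u z0] z0 by simp
 then have z00: "z0 = 0" by (simp add: proj_def zero_prod_def)
 have u0: "u 0 = 0" using proj_graph_map(2)[OF P(1), of p u z0] z0 z00 by simp
 obtain dl0 where d0: "dl0 > 0" "ball 0 dl0 \<subseteq> U" using P(2) z0 z00 open_contains_ball by blast
 define dl where "dl = min dl0 r"
 have d: "dl > 0" "ball 0 dl \<subseteq> U" "dl <= r" using d0 P(4) by (auto simp: dl_def)
 have sm: "smooth2 (ball 0 dl) u" using P(3) d(2) smooth2_subset by blast
 have "isCont (graph_map p e1 e2 n u) 0"
  using graph_map_continuous[OF smooth2_continuous[OF sm]] d(1)
  by (auto simp: continuous_on_eq_continuous_at)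
 moreover have g0: "graph_map p e1 e2 n u 0 = p" using u0 by (simp add: graph_map_def zero_prod_def)
 ultimately obtain eta0 where e0: "eta0 > 0" "!!z. dist z 0 < eta0 ==> dist (graph_map p e1 e2 n u z) p < dl"
  unfolding continuous_at_eps_delta using d(1) by metis
 define eta where "eta = min eta0 dl"
 have iff: "x \<in> M \<longleftrightarrow> lev p e1 e2 n u x = 0" if x: "x \<in> ball p dl" for x
 proof
  assume "x \<in> M"
  then have "x \<in> graph_map p e1 e2 n u ` U" using P(5) x d(3) by auto
  then obtain z where "x = graph_map p e1 e2 n u z" by blast
  then show "lev p e1 e2 n u x = 0"
  using proj_graph_map[OF P(1), of p u z] unfolding lev_def proj_def by simp
 next
  assume l: "lev p e1 e2 n u x = 0"
  have "norm (proj p e1 e2 x) < dl" using norm_proj_le[OF P(1), of p x] x by (simp add: dist_norm norm_minus_commute)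
  then have "proj p e1 e2 x \<in> U" using d(2) by auto
  then have "x \<in> graph_map p e1 e2 n u ` U" using graph_map_proj[OF P(1) l] by (metis imageI)
  then show "x \<in> M" using P(5) x d(3) by auto
 qed
 have eq: "(1 + (D2 u z)^2) * D1 (D1 u) z - 2 * D1 u z * D2 u z * D1 (D2 u) z + (1 + (D1 u z)^2) * D2 (D2 u) z
  = (1 + (D1 u z)^2 + (D2 u z)^2) * (nrm e1 e2 n u z <.> tau)" (is "?A = ?B * ?C") if z: "z \<in> ball 0 dl" for z
 proof -
  define W where "W = sqrt (1 + (D1 u z)^2 + (D2 u z)^2)"
  have W2: "W^2 = ?B" unfolding W_def by (simp add: add_nonneg_nonneg)
  have Wpos: "W > 0" unfolding W_def by (simp add: add_pos_nonneg)
  have "?A / W ^ 3 = (1 / W) * ?C"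
  using P(6) z d(2) unfolding graph_mean_curv_def graph_normal_def Let_def W_def nrm_def by auto
  from quotient_cube[OF this Wpos] have "?A = W^2 * ?C" .
  then show ?thesis using W2 by simp
 qed
 have "tframe M p e1 e2 n u dl eta"
  unfolding tframe_def using P(1) sm u0 iff eq d e0 by (auto simp: eta_def dist_commute)
 then show ?thesis using that by blast
qed

lemma tframeD:
 assumes "tframe M p e1 e2 n u dl eta"
 shows "orthonormal3 e1 e2 n" "0 < eta" "eta <= dl" "smooth2 (ball 0 dl) u" "u 0 = 0"
  "!!x. x \<in> ball p dl ==> x \<in> M \<longleftrightarrow> lev p e1 e2 n u x = 0"
  "!!z. z \<in> ball 0 dl ==> (1 + (D2 u z)^2) * D1 (D1 u) z - 2 * D1 u z * D2 u z * D1 (D2 u) z + (1 + (D1 u z)^2) * D2 (D2 u) z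
  = (1 + (D1 u z)^2 + (D2 u z)^2) * (nrm e1 e2 n u z <.> tau)"
  "!!z. z \<in> ball 0 eta ==> graph_map p e1 e2 n u z \<in> ball p dl"
 using assms unfolding tframe_def by blast+

lemma tframe_graph_in:
 assumes "tframe M p e1 e2 n u dl eta" "z \<in> ball 0 eta"
 shows "graph_map p e1 e2 n u z \<in> M"
proof -
 note t = tframeD[OF assms(1)]
 show ?thesis using t(6)[OF t(8)[OF assms(2)]] proj_graph_map[OF t(1), of p u z] unfolding lev_def proj_def by simp
qed

lemma tframe_proj_in:
 assumes "tframe M p e1 e2 n u dl eta" "x \<in> ball p dl"
 shows "proj p e1 e2 x \<in> ball 0 dl"
 using norm_proj_le[OF tframeD(1)[OF assms(1)], of p x] assms(2) by (simp add: dist_norm norm_minus_commute)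

text \<open>With \<open>G = lev\<close> this is
  \<open>div (grad G / |grad G|) = - <grad G / |grad G|, tau>\<close>. It holds off \<open>M\<close>
  too, because the level sets of \<open>lev\<close> are translates of one another along
  \<open>n\<close>. It is invariant under a change of sign of \<open>G\<close>.\<close>

lemma tframe_level_equation:
 assumes "tframe M p e1 e2 n u dl eta" "z \<in> ball 0 dl"
 defines "g \<equiv> nrm e1 e2 n u z"
 shows "(g <.> g) * (tr3 (hss e1 e2 u z) + g <.> tau) = hss e1 e2 u z g <.> g" "g <.> g = 1 + (D1 u z)^2 + (D2 u z)^2"
proof -
 note t = tframeD[OF assms(1)]
 note o = orthonormal3_inner[OF t(1)]
 have comm: "D2 (D1 u) z = D1 (D2 u) z" using smooth2_commute[OF _ t(4) assms(2)] by simp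
 have "hss e1 e2 u z = (%v. - ((v <.> (D1 (D1 u) z *\<^sub>R e1 + D2 (D1 u) z *\<^sub>R e2)) *\<^sub>R e1
  + (v <.> (D1 (D2 u) z *\<^sub>R e1 + D2 (D2 u) z *\<^sub>R e2)) *\<^sub>R e2))"
  unfolding hss_def by (auto simp: fun_eq_iff inner_add_right mult.commute)
 then have tr: "tr3 (hss e1 e2 u z) = - (D1 (D1 u) z + D2 (D2 u) z)"
  by (simp only: tr3_minus tr3_add tr3_rank_one) (simp add: inner_add_left o)
 have ge: "g <.> e1 = - D1 u z" "g <.> e2 = - D2 u z"
  unfolding g_def nrm_def by (auto simp: inner_diff_left o)
 show gg: "g <.> g = 1 + (D1 u z)^2 + (D2 u z)^2"
  unfolding g_def nrm_def by (simp add: inner_diff_left inner_diff_right o power2_eq_square)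
 have hg: "hss e1 e2 u z g <.> g = - (D1 (D1 u) z * (D1 u z)^2 + 2 * D1 (D2 u) z * D1 u z * D2 u z + D2 (D2 u) z * (D2 u z)^2)"
  unfolding hss_def by (simp add: inner_add_left ge comm inner_commute[of e1 g] inner_commute[of e2 g] power2_eq_square algebra_simps)
 show "(g <.> g) * (tr3 (hss e1 e2 u z) + g <.> tau) = hss e1 e2 u z g <.> g"
  unfolding gg hg tr using t(7)[OF assms(2)] unfolding g_def[symmetric] by (simp add: algebra_simps power2_eq_square)
qed

lemma graph_map_has_derivative:
 assumes "u differentiable (at z)"
 shows "(graph_map p e1 e2 n u has_derivative
  (%h. fst h *\<^sub>R (e1 + D1 u z *\<^sub>R n) + snd h *\<^sub>R (e2 + D2 u z *\<^sub>R n))) (at z)"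
proof -
 have "((%z. p + fst z *\<^sub>R e1 + snd z *\<^sub>R e2 + u z *\<^sub>R n) has_derivative
  (%h. 0 + fst h *\<^sub>R e1 + snd h *\<^sub>R e2 + (fst h * D1 u z + snd h * D2 u z) *\<^sub>R n)) (at z)"
  by (intro has_derivative_add has_derivative_const has_derivative_scaleR_left has_derivative_D assms
  bounded_linear.has_derivative[OF bounded_linear_fst] bounded_linear.has_derivative[OF bounded_linear_snd]
  has_derivative_ident)
 then show ?thesis unfolding graph_map_def
  by (simp add: case_prod_unfold algebra_simps)
qed

text \<open>The chain rule to second order along a straight parameter line: the Hessian of
  \<open>G\<close> on the velocity plus the gradient of \<open>G\<close> on the acceleration of the
  immersion.\<close>

lemma second_along_line:
 fixes X X1 X2 :: "real \<times> real => real^3" and v :: "real \<times> real"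
 assumes S: "open S" "z \<in> S" "!!y. y \<in> S ==> (X has_derivative (%h. fst h *\<^sub>R X1 y + snd h *\<^sub>R X2 y)) (at y)"
  and X1: "(X1 has_derivative (%h. fst h *\<^sub>R X11 + snd h *\<^sub>R X12)) (at z)"
  and X2: "(X2 has_derivative (%h. fst h *\<^sub>R X12 + snd h *\<^sub>R X22)) (at z)"
  and T: "open T" "X z \<in> T" "!!x. x \<in> T ==> (G has_derivative (%v. g x <.> v)) (at x)"
  and H: "(g has_derivative H) (at (X z))"
 defines "c \<equiv> %s::real. z + s *\<^sub>R v"
 defines "W \<equiv> %s. fst v *\<^sub>R X1 (c s) + snd v *\<^sub>R X2 (c s)"
 shows "\<exists>d>0. (ALL s. \<bar>s\<bar> < d --> c s \<in> S & X (c s) \<in> T & DERIV (%s. G (X (c s))) s :> g (X (c s)) <.> W s) &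
  DERIV (%s. g (X (c s)) <.> W s) 0 :> H (W 0) <.> W 0
  + g (X z) <.> ((fst v)^2 *\<^sub>R X11 + (2 * fst v * snd v) *\<^sub>R X12 + (snd v)^2 *\<^sub>R X22)"
proof -
 have cont: "continuous_on S X"
  using S(3) by (meson continuous_at_imp_continuous_on has_derivative_continuous)
 have "open (S \<inter> X -` T)" using continuous_open_preimage[OF cont S(1) T(1)] by simp
 moreover have cc: "continuous_on UNIV c" unfolding c_def by (intro continuous_intros)
 ultimately have "open (c -` (S \<inter> X -` T))" using open_vimage by blast
 moreover have "0 \<in> c -` (S \<inter> X -` T)" using S(2) T(2) by (simp add: c_def)
 ultimately obtain d where d: "d > 0" "ball 0 d \<subseteq> c -` (S \<inter> X -` T)" using open_contains_ball by blast
 have dc: "(c has_derivative (%h. h *\<^sub>R v)) (at s)" for s unfolding c_def by (auto intro!: derivative_eq_intros)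
 have inn: "c s \<in> S & X (c s) \<in> T" if "\<bar>s\<bar> < d" for s using d(2) that by (auto simp: subset_eq)
 have dX: "((%s. X (c s)) has_derivative (%h. h *\<^sub>R W s)) (at s)" if "\<bar>s\<bar> < d" for s
  using has_derivative_compose[OF dc S(3)] inn[OF that] unfolding W_def by (simp add: scaleR_add_right)
 have 1: "DERIV (%s. G (X (c s))) s :> g (X (c s)) <.> W s" if "\<bar>s\<bar> < d" for s
  using has_derivative_compose[OF dX[OF that] T(3)] inn[OF that]
  unfolding has_field_derivative_def by (simp add: mult_commute_abs)
 have c0: "c 0 = z" by (simp add: c_def)
 have W1: "((%s. X1 (c s)) has_derivative (%h. h *\<^sub>R (fst v *\<^sub>R X11 + snd v *\<^sub>R X12))) (at 0)"
 proof -
  have "(X1 has_derivative (%h. fst h *\<^sub>R X11 + snd h *\<^sub>R X12)) (at (c 0))" using X1 c0 by simp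
  from has_derivative_compose[OF dc this] show ?thesis by (simp add: scaleR_add_right)
 qed
 have W2: "((%s. X2 (c s)) has_derivative (%h. h *\<^sub>R (fst v *\<^sub>R X12 + snd v *\<^sub>R X22))) (at 0)"
 proof -
  have "(X2 has_derivative (%h. fst h *\<^sub>R X12 + snd h *\<^sub>R X22)) (at (c 0))" using X2 c0 by simp
  from has_derivative_compose[OF dc this] show ?thesis by (simp add: scaleR_add_right)
 qed
 define Y where "Y = fst v *\<^sub>R (fst v *\<^sub>R X11 + snd v *\<^sub>R X12) + snd v *\<^sub>R (fst v *\<^sub>R X12 + snd v *\<^sub>R X22)"
 have dW: "(W has_derivative (%h. h *\<^sub>R Y)) (at 0)"
  unfolding W_def Y_def using W1 W2
  by (auto intro!: derivative_eq_intros simp: algebra_simps)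
 have dg: "((%s. g (X (c s))) has_derivative (%h. H (h *\<^sub>R W 0))) (at 0)"
  using has_derivative_compose[OF dX[of 0], of g H] H c0 d(1) by simp
 have lin: "linear H" using H has_derivative_linear by blast
 have "((%s. g (X (c s)) <.> W s) has_derivative (%h. g (X (c 0)) <.> (h *\<^sub>R Y) + H (h *\<^sub>R W 0) <.> W 0)) (at 0)"
  by (rule has_derivative_inner[OF dg dW])
 then have 2: "DERIV (%s. g (X (c s)) <.> W s) 0 :> H (W 0) <.> W 0 + g (X z) <.> Y"
  unfolding has_field_derivative_def
  by (rule has_derivative_eq_rhs) (auto simp: fun_eq_iff linear_scale[OF lin] c0 algebra_simps)
 have "Y = (fst v)^2 *\<^sub>R X11 + (2 * fst v * snd v) *\<^sub>R X12 + (snd v)^2 *\<^sub>R X22"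
 proof -
  have "(2 * fst v * snd v) *\<^sub>R X12 = (fst v * snd v) *\<^sub>R X12 + (fst v * snd v) *\<^sub>R X12"
  by (simp only: scaleR_add_left[symmetric]) simp
  then show ?thesis unfolding Y_def by (simp add: scaleR_add_right power2_eq_square mult.commute)
 qed
 then show ?thesis using d(1) 1 2 inn by (intro exI[of _ d]) auto
qed

text \<open>Gram-Schmidt for \<open>X1\<close>, \<open>X2\<close>, completed by the normal.
  \<open>D\<close> is the Gram determinant, and the second vector before normalisation has squared
  length \<open>(X1 <.> X1) * D\<close>.\<close>

lemma tangent_frame:
 fixes X1 X2 N :: "real^3"
 defines "D \<equiv> (X1 <.> X1) * (X2 <.> X2) - (X1 <.> X2)^2"
 assumes "D > 0" "N ~= 0" "N <.> X1 = 0" "N <.> X2 = 0"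
 defines "a \<equiv> (1 / sqrt (X1 <.> X1)) *\<^sub>R X1"
  and "b \<equiv> (1 / sqrt ((X1 <.> X1) * D)) *\<^sub>R ((X1 <.> X1) *\<^sub>R X2 - (X1 <.> X2) *\<^sub>R X1)"
  and "c \<equiv> (1 / sqrt (N <.> N)) *\<^sub>R N"
 shows "X1 <.> X1 > 0" "orthonormal3 a b c"
proof -
 have "X1 ~= 0" using assms(2) unfolding D_def by auto
 then show p: "X1 <.> X1 > 0" by simp
 have NN: "N <.> N > 0" using assms(3) by simp
 have n: "X1 <.> N = 0" "X2 <.> N = 0" using assms(4,5) by (simp_all add: inner_commute)
 have aa: "a <.> a = 1" "c <.> c = 1" using p NN unfolding a_def c_def by (simp_all add: field_simps)
 define V where "V = (X1 <.> X1) *\<^sub>R X2 - (X1 <.> X2) *\<^sub>R X1"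
 have VV: "V <.> V = (X1 <.> X1) * D"
  unfolding V_def D_def by (simp add: inner_diff_left inner_diff_right inner_commute[of X2 X1] power2_eq_square algebra_simps)
 have XV: "X1 <.> V = 0" "V <.> N = 0" unfolding V_def by (simp_all add: inner_diff_left inner_diff_right n)
 have VVp: "V <.> V > 0" unfolding VV using p assms(2) by simp
 then have V0: "V ~= 0" by auto
 have bb: "b <.> b = 1"
  using VVp unfolding b_def V_def[symmetric] VV[symmetric] by simp
 show "orthonormal3 a b c"
  unfolding orthonormal3_def norm_eq_1 using aa bb XV n V0
  by (simp add: a_def b_def c_def V_def[symmetric])
qed

text \<open>The coefficients on the left are the cofactors of the first fundamental form, that is
  \<open>D\<close> times its inverse. So both sides are \<open>D * (N <.> N)\<close> times the trace
  of \<open>H\<close> over the tangent plane, on the right as the full trace minus the normal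
  part.\<close>

lemma tangent_trace:
 fixes X1 X2 N :: "real^3"
 defines "D \<equiv> (X1 <.> X1) * (X2 <.> X2) - (X1 <.> X2)^2"
 assumes "D > 0" "N ~= 0" "N <.> X1 = 0" "N <.> X2 = 0" "linear H"
 shows "(N <.> N) * ((X2 <.> X2) * (H X1 <.> X1) - (X1 <.> X2) * (H X1 <.> X2 + H X2 <.> X1) + (X1 <.> X1) * (H X2 <.> X2))
  = D * ((N <.> N) * tr3 H - H N <.> N)"
proof -
 define G11 where "G11 = X1 <.> X1"
 define G12 where "G12 = X1 <.> X2"
 define G22 where "G22 = X2 <.> X2"
 note f = tangent_frame[of X1 X2 N, folded D_def, OF assms(2-5), folded G11_def G12_def]
 have NN: "N <.> N > 0" using assms(3) by simp
 have sc: "H (k *\<^sub>R x) <.> (k *\<^sub>R x) = k^2 * (H x <.> x)" for k x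
  by (simp add: linear_scale[OF assms(6)] power2_eq_square)
 have "tr3 H = (H X1 <.> X1) / G11 + (H (G11 *\<^sub>R X2 - G12 *\<^sub>R X1) <.> (G11 *\<^sub>R X2 - G12 *\<^sub>R X1)) / (G11 * D)
  + (H N <.> N) / (N <.> N)"
  using tr3_frame[OF f(2) assms(6)] NN f(1) assms(2) unfolding sc by (simp add: power_divide)
 moreover have "H (G11 *\<^sub>R X2 - G12 *\<^sub>R X1) <.> (G11 *\<^sub>R X2 - G12 *\<^sub>R X1)
  = G11^2 * (H X2 <.> X2) - G11 * G12 * (H X1 <.> X2 + H X2 <.> X1) + G12^2 * (H X1 <.> X1)"
  by (simp add: linear_diff[OF assms(6)] linear_scale[OF assms(6)] inner_diff_left inner_diff_right power2_eq_square algebra_simps)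
 ultimately have e1: "D * (N <.> N) * tr3 H = D * (H N <.> N) + (N <.> N) *
  ((D * (H X1 <.> X1) + G11^2 * (H X2 <.> X2) - G11 * G12 * (H X1 <.> X2 + H X2 <.> X1) + G12^2 * (H X1 <.> X1)) / G11)"
  using NN f(1) assms(2) by (simp add: field_simps)
 have e2: "(D * (H X1 <.> X1) + G11^2 * (H X2 <.> X2) - G11 * G12 * (H X1 <.> X2 + H X2 <.> X1) + G12^2 * (H X1 <.> X1)) / G11
  = G22 * (H X1 <.> X1) - G12 * (H X1 <.> X2 + H X2 <.> X1) + G11 * (H X2 <.> X2)"
  using f(1) unfolding D_def G11_def[symmetric] G12_def[symmetric] G22_def[symmetric] by (simp add: field_simps power2_eq_square)
 show ?thesis using e1[unfolded e2] unfolding G11_def[symmetric] G12_def[symmetric] G22_def[symmetric] by (simp add: algebra_simps)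
qed

lemma normal_unique:
 fixes X1 X2 N g :: "real^3"
 assumes "(X1 <.> X1) * (X2 <.> X2) - (X1 <.> X2)^2 > 0" "N ~= 0" "N <.> X1 = 0" "N <.> X2 = 0" "g <.> X1 = 0" "g <.> X2 = 0"
 shows "g = ((g <.> N) / (N <.> N)) *\<^sub>R N"
proof -
 note f = tangent_frame[OF assms(1-4)]
 have NN: "N <.> N > 0" using assms(2) by simp
 show ?thesis
  by (subst orthonormal3_expand[OF f(2), of g]) (use NN assms(5,6) in "simp add: inner_diff_right")
qed

text \<open>Multiplied by \<open>G11\<close>, the expression is the determinant times
  \<open>B11\<close> plus the value of the form at \<open>(- G12, G11)\<close>.\<close>

lemma psd_trace_nonneg:
 fixes B11 B12 B22 G11 G12 G22 :: real
 assumes "!!a b. 0 <= a^2 * B11 + 2 * a * b * B12 + b^2 * B22" "G11 > 0" "G11 * G22 - G12^2 >= 0"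
 shows "0 <= G22 * B11 - 2 * G12 * B12 + G11 * B22"
proof -
 have "0 <= (G11 * G22 - G12^2) * B11" using assms(1)[of 1 0] assms(3) by simp
 moreover have "0 <= G12^2 * B11 + 2 * (- G12) * G11 * B12 + G11^2 * B22" using assms(1)[of "- G12" G11] by simp
 ultimately have "0 <= G11 * (G22 * B11 - 2 * G12 * B12 + G11 * B22)" by (simp add: algebra_simps power2_eq_square)
 then show ?thesis using assms(2) by (simp add: zero_le_mult_iff)
qed

text \<open>At a minimum the form with entries \<open>H (Xi) <.> Xj + g <.> Xij\<close> is positive
  semidefinite. Tracing it against the cofactors of the first fundamental form gives the inequality,
  with the \<open>H\<close> part rewritten by \<open>tangent_trace\<close>.\<close>

lemma immersion_local_min:
 fixes X X1 X2 :: "real \<times> real => real^3"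
 assumes S: "open S" "z \<in> S" "!!y. y \<in> S ==> (X has_derivative (%h. fst h *\<^sub>R X1 y + snd h *\<^sub>R X2 y)) (at y)"
  and X1: "(X1 has_derivative (%h. fst h *\<^sub>R X11 + snd h *\<^sub>R X12)) (at z)"
  and X2: "(X2 has_derivative (%h. fst h *\<^sub>R X12 + snd h *\<^sub>R X22)) (at z)"
  and T: "open T" "X z \<in> T" "!!x. x \<in> T ==> (G has_derivative (%v. g x <.> v)) (at x)"
  and H: "(g has_derivative H) (at (X z))"
  and min: "!!y. y \<in> S ==> G (X z) <= G (X y)"
  and N: "N ~= 0" "N <.> X1 z = 0" "N <.> X2 z = 0"
 defines "D \<equiv> (X1 z <.> X1 z) * (X2 z <.> X2 z) - (X1 z <.> X2 z)^2"
 assumes D: "D > 0"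
 shows "g (X z) <.> X1 z = 0" "g (X z) <.> X2 z = 0"
  "0 <= D * ((N <.> N) * tr3 H - H N <.> N) + (N <.> N) * (g (X z) <.> ((X2 z <.> X2 z) *\<^sub>R X11
  - (2 * (X1 z <.> X2 z)) *\<^sub>R X12 + (X1 z <.> X1 z) *\<^sub>R X22))"
proof -
 have lin: "linear H" using H has_derivative_linear by blast
 have *: "g (X z) <.> (a *\<^sub>R X1 z + b *\<^sub>R X2 z) = 0 &
  0 <= H (a *\<^sub>R X1 z + b *\<^sub>R X2 z) <.> (a *\<^sub>R X1 z + b *\<^sub>R X2 z)
  + g (X z) <.> (a^2 *\<^sub>R X11 + (2 * a * b) *\<^sub>R X12 + b^2 *\<^sub>R X22)" for a b
 proof -
  obtain d where d: "d > 0" "ALL s. \<bar>s\<bar> < d --> z + s *\<^sub>R (a, b) \<in> S & X (z + s *\<^sub>R (a, b)) \<in> T &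
  DERIV (%s. G (X (z + s *\<^sub>R (a, b)))) s :> g (X (z + s *\<^sub>R (a, b))) <.> (a *\<^sub>R X1 (z + s *\<^sub>R (a, b)) + b *\<^sub>R X2 (z + s *\<^sub>R (a, b)))"
  "DERIV (%s. g (X (z + s *\<^sub>R (a, b))) <.> (a *\<^sub>R X1 (z + s *\<^sub>R (a, b)) + b *\<^sub>R X2 (z + s *\<^sub>R (a, b)))) 0 :>
  H (a *\<^sub>R X1 z + b *\<^sub>R X2 z) <.> (a *\<^sub>R X1 z + b *\<^sub>R X2 z)
  + g (X z) <.> (a^2 *\<^sub>R X11 + (2 * a * b) *\<^sub>R X12 + b^2 *\<^sub>R X22)"
  using second_along_line[OF S X1 X2 T H, of "(a, b)"] by (auto simp: zero_prod_def[symmetric])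
  have m: "G (X (z + 0 *\<^sub>R (a, b))) <= G (X (z + s *\<^sub>R (a, b)))" if "\<bar>s\<bar> < d" for s
  using min[of "z + s *\<^sub>R (a, b)"] d(2) that by (simp add: zero_prod_def[symmetric])
  show ?thesis
  using second_derivative_test[where f = "%s. G (X (z + s *\<^sub>R (a, b)))", OF d(1) _ d(3) m] d(2) by (auto simp: zero_prod_def[symmetric])
 qed
 show g1: "g (X z) <.> X1 z = 0" using *[of 1 0] by simp
 show g2: "g (X z) <.> X2 z = 0" using *[of 0 1] by simp
 \<comment> \<open>Symmetry of \<open>H\<close> is not among the facts at hand, so the off-diagonal
   entry is symmetrised.\<close>
 define h where "h = (H (X1 z) <.> X2 z + H (X2 z) <.> X1 z) / 2"
 have hh: "H (X2 z) <.> X1 z = 2 * h - H (X1 z) <.> X2 z" unfolding h_def by (simp add: field_simps)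
 have psd: "0 <= a^2 * (H (X1 z) <.> X1 z + g (X z) <.> X11) + 2 * a * b * (h + g (X z) <.> X12)
  + b^2 * (H (X2 z) <.> X2 z + g (X z) <.> X22)" for a b
  using *[of a b]
  by (simp add: linear_add[OF lin] linear_scale[OF lin] inner_add_left inner_add_right power2_eq_square algebra_simps hh)
 have X11p: "X1 z <.> X1 z > 0" using tangent_frame(1)[of "X1 z" "X2 z" N] D N unfolding D_def by simp
 have "0 <= (X2 z <.> X2 z) * (H (X1 z) <.> X1 z + g (X z) <.> X11) - 2 * (X1 z <.> X2 z) * (h + g (X z) <.> X12)
  + (X1 z <.> X1 z) * (H (X2 z) <.> X2 z + g (X z) <.> X22)"
  by (rule psd_trace_nonneg[OF psd X11p]) (use D in "simp add: D_def")
 then have "0 <= (N <.> N) * ((X2 z <.> X2 z) * (H (X1 z) <.> X1 z + g (X z) <.> X11) - 2 * (X1 z <.> X2 z) * (h + g (X z) <.> X12)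
  + (X1 z <.> X1 z) * (H (X2 z) <.> X2 z + g (X z) <.> X22))" by simp
 also have "... = (N <.> N) * ((X2 z <.> X2 z) * (H (X1 z) <.> X1 z) - (X1 z <.> X2 z) * (H (X1 z) <.> X2 z + H (X2 z) <.> X1 z)
  + (X1 z <.> X1 z) * (H (X2 z) <.> X2 z)) + (N <.> N) * (g (X z) <.> ((X2 z <.> X2 z) *\<^sub>R X11
  - (2 * (X1 z <.> X2 z)) *\<^sub>R X12 + (X1 z <.> X1 z) *\<^sub>R X22))"
  unfolding h_def by (simp add: inner_add_right inner_diff_right algebra_simps)
 also have "(N <.> N) * ((X2 z <.> X2 z) * (H (X1 z) <.> X1 z) - (X1 z <.> X2 z) * (H (X1 z) <.> X2 z + H (X2 z) <.> X1 z)
  + (X1 z <.> X1 z) * (H (X2 z) <.> X2 z)) = D * ((N <.> N) * tr3 H - H N <.> N)"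
  using tangent_trace[of "X1 z" "X2 z" N H] D N lin unfolding D_def by simp
 finally show "0 <= D * ((N <.> N) * tr3 H - H N <.> N) + (N <.> N) * (g (X z) <.> ((X2 z <.> X2 z) *\<^sub>R X11
  - (2 * (X1 z <.> X2 z)) *\<^sub>R X12 + (X1 z <.> X1 z) *\<^sub>R X22))" .
qed

text \<open>The basic touching inequality: the Laplacian along \<open>M\<close> plus the drift in
  direction \<open>tau\<close> is nonnegative at a minimum of \<open>G\<close>. The gradient is
  normal there, \<open>gx = k *\<^sub>R N\<close>, so its pairing with the second derivatives of the
  patch is \<open>k\<close> times the translator expression, and the equation turns it into
  \<open>gx <.> tau\<close>.\<close>

lemma tframe_local_min:
 assumes fr: "tframe M p e1 e2 n u dl eta" "z \<in> ball 0 dl"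
  and T: "open T" "graph_map p e1 e2 n u z \<in> T" "!!x. x \<in> T ==> (G has_derivative (%v. g x <.> v)) (at x)"
  and H: "(g has_derivative H) (at (graph_map p e1 e2 n u z))"
  and S: "open S" "z \<in> S" "!!y. y \<in> S ==> G (graph_map p e1 e2 n u z) <= G (graph_map p e1 e2 n u y)"
 defines "N \<equiv> nrm e1 e2 n u z"
 defines "gx \<equiv> g (graph_map p e1 e2 n u z)"
 shows "gx = (gx <.> n) *\<^sub>R N" "H N <.> N <= (N <.> N) * (tr3 H + gx <.> tau)"
proof -
 let ?X = "graph_map p e1 e2 n u"
 define X1 where "X1 = (%y. e1 + D1 u y *\<^sub>R n)"
 define X2 where "X2 = (%y. e2 + D2 u y *\<^sub>R n)"
 note t = tframeD[OF fr(1)]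
 note o = orthonormal3_inner[OF t(1)]
 have dX: "(?X has_derivative (%h. fst h *\<^sub>R X1 y + snd h *\<^sub>R X2 y)) (at y)" if "y \<in> S \<inter> ball 0 dl" for y
  using graph_map_has_derivative smooth2_differentiable[OF t(4)] that unfolding X1_def X2_def by blast
 have c: "D2 (D1 u) z = D1 (D2 u) z" using smooth2_commute[OF _ t(4) fr(2)] by simp
 have d1: "(X1 has_derivative (%h. fst h *\<^sub>R (D1 (D1 u) z *\<^sub>R n) + snd h *\<^sub>R (D1 (D2 u) z *\<^sub>R n))) (at z)"
  unfolding X1_def using has_derivative_D[OF smooth2_differentiable[OF smooth2_D(1)[OF t(4)] fr(2)]] c
  by (auto intro!: derivative_eq_intros simp: algebra_simps)
 have d2: "(X2 has_derivative (%h. fst h *\<^sub>R (D1 (D2 u) z *\<^sub>R n) + snd h *\<^sub>R (D2 (D2 u) z *\<^sub>R n))) (at z)"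
  unfolding X2_def using has_derivative_D[OF smooth2_differentiable[OF smooth2_D(2)[OF t(4)] fr(2)]]
  by (auto intro!: derivative_eq_intros simp: algebra_simps)
 have g11: "X1 z <.> X1 z = 1 + (D1 u z)^2" and g12: "X1 z <.> X2 z = D1 u z * D2 u z" and g22: "X2 z <.> X2 z = 1 + (D2 u z)^2"
  unfolding X1_def X2_def by (simp_all add: inner_add_left inner_add_right o power2_eq_square)
 note NN = tframe_level_equation(2)[OF fr, folded N_def]
 have NNp: "N <.> N > 0" unfolding NN by (simp add: add_pos_nonneg)
 then have N0: "N ~= 0" by auto
 have Nx: "N <.> X1 z = 0" "N <.> X2 z = 0" "N <.> n = 1"
  unfolding N_def nrm_def X1_def X2_def by (simp_all add: inner_add_right inner_diff_left o)
 have D: "(X1 z <.> X1 z) * (X2 z <.> X2 z) - (X1 z <.> X2 z)^2 = N <.> N"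
  unfolding g11 g12 g22 NN by (simp add: power2_eq_square algebra_simps)
 have "open (S \<inter> ball 0 dl)" "z \<in> S \<inter> ball 0 dl" using S fr(2) by auto
 note r = immersion_local_min[OF this dX d1 d2 T H _ N0 Nx(1,2), folded gx_def]
 have r1: "gx <.> X1 z = 0" "gx <.> X2 z = 0" using r(1,2) S(3) NNp D by auto
 have r3: "0 <= (N <.> N) * ((N <.> N) * tr3 H - H N <.> N) + (N <.> N) * (gx <.> ((X2 z <.> X2 z) *\<^sub>R (D1 (D1 u) z *\<^sub>R n)
  - (2 * (X1 z <.> X2 z)) *\<^sub>R (D1 (D2 u) z *\<^sub>R n) + (X1 z <.> X1 z) *\<^sub>R (D2 (D2 u) z *\<^sub>R n)))"
  using r(3) S(3) NNp unfolding D by auto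
 define k where "k = (gx <.> N) / (N <.> N)"
 have gk: "gx = k *\<^sub>R N" using normal_unique[of "X1 z" "X2 z" N gx] r1 N0 Nx NNp D unfolding k_def by auto
 have kn: "gx <.> n = k" unfolding gk using Nx by simp
 show "gx = (gx <.> n) *\<^sub>R N" unfolding kn by (rule gk)
 have "gx <.> ((X2 z <.> X2 z) *\<^sub>R (D1 (D1 u) z *\<^sub>R n)
  - (2 * (X1 z <.> X2 z)) *\<^sub>R (D1 (D2 u) z *\<^sub>R n) + (X1 z <.> X1 z) *\<^sub>R (D2 (D2 u) z *\<^sub>R n))
  = k * ((1 + (D2 u z)^2) * D1 (D1 u) z - 2 * D1 u z * D2 u z * D1 (D2 u) z + (1 + (D1 u z)^2) * D2 (D2 u) z)"
  unfolding g11 g12 g22 by (simp add: inner_add_right inner_diff_right kn algebra_simps)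
 also have "... = (N <.> N) * (gx <.> tau)"
  unfolding t(7)[OF fr(2)] NN N_def[symmetric] by (simp add: gk)
 finally have "0 <= (N <.> N) * ((N <.> N) * tr3 H - H N <.> N + (N <.> N) * (gx <.> tau))"
  using r3 by (simp add: algebra_simps)
 then have "0 <= (N <.> N) * tr3 H - H N <.> N + (N <.> N) * (gx <.> tau)" using NNp by (simp add: zero_le_mult_iff)
 then show "H N <.> N <= (N <.> N) * (tr3 H + gx <.> tau)" by (simp add: algebra_simps)
qed

lemma tframe_local_min_set:
 assumes M: "translator_patch M p" "p \<in> M"
  and T: "open T" "p \<in> T" "!!x. x \<in> T ==> (G has_derivative (%v. g x <.> v)) (at x)"
  and H: "(g has_derivative H) (at p)"
  and min: "!!x. x \<in> M ==> x \<in> T ==> G p <= G x"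
 obtains N where "N ~= 0" "EX k. g p = k *\<^sub>R N" "H N <.> N <= (N <.> N) * (tr3 H + g p <.> tau)"
proof -
 obtain e1 e2 n u dl eta where fr: "tframe M p e1 e2 n u dl eta" using translator_patch_tframe[OF M] .
 note t = tframeD[OF fr]
 let ?X = "graph_map p e1 e2 n u"
 have X0: "?X 0 = p" using t(5) by (simp add: graph_map_def zero_prod_def)
 have z: "0 \<in> ball 0 dl" "0 \<in> ball (0::real\<times>real) eta" using t(2,3) by auto
 have "continuous_on (ball 0 eta) ?X"
  using graph_map_continuous smooth2_continuous[OF t(4)] t(3)
  by (metis continuous_on_subset subset_ball)
 then have "open (ball 0 eta \<inter> ?X -` T)" using continuous_open_preimage T(1) by blast
 note r = tframe_local_min[OF fr z(1), unfolded X0, OF T H this]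
 have "0 \<in> ball 0 eta \<inter> ?X -` T" using z X0 T(2) by auto
 note r = r[OF _ this]
 have m: "G p <= G (?X y)" if "y \<in> ball 0 eta \<inter> ?X -` T" for y
  using min[of "?X y"] tframe_graph_in[OF fr] that by auto
 have "nrm e1 e2 n u 0 <.> nrm e1 e2 n u 0 > 0"
  unfolding tframe_level_equation(2)[OF fr z(1)] by (simp add: add_pos_nonneg)
 then have "nrm e1 e2 n u 0 ~= 0" by auto
 then show ?thesis using that[of "nrm e1 e2 n u 0"] r(1)[OF _ m] r(2)[OF _ m] by blast
qed

text \<open>The translator equation in arbitrary coordinates. The level function of a patch vanishes
  along the immersion, so both it and its negative have minima there; the two touching inequalities,
  combined with the level-set equation, leave an equality.\<close>

lemma translator_immersion_equation:
 fixes X X1 X2 :: "real \<times> real => real^3"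
 assumes M: "translator_patch M (X z)"
  and S: "open S" "z \<in> S" "!!y. y \<in> S ==> (X has_derivative (%h. fst h *\<^sub>R X1 y + snd h *\<^sub>R X2 y)) (at y)"
  "!!y. y \<in> S ==> X y \<in> M"
  and X1: "(X1 has_derivative (%h. fst h *\<^sub>R X11 + snd h *\<^sub>R X12)) (at z)"
  and X2: "(X2 has_derivative (%h. fst h *\<^sub>R X12 + snd h *\<^sub>R X22)) (at z)"
  and N: "N <.> X1 z = 0" "N <.> X2 z = 0"
 defines "D \<equiv> (X1 z <.> X1 z) * (X2 z <.> X2 z) - (X1 z <.> X2 z)^2"
 assumes D: "D > 0"
 shows "N <.> ((X2 z <.> X2 z) *\<^sub>R X11 - (2 * (X1 z <.> X2 z)) *\<^sub>R X12 + (X1 z <.> X1 z) *\<^sub>R X22) = D * (N <.> tau)"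
proof -
 obtain e1 e2 n u dl eta where fr: "tframe M (X z) e1 e2 n u dl eta" using translator_patch_tframe[OF M S(4)[OF S(2)]] .
 note t = tframeD[OF fr]
 let ?p = "X z"
 let ?L = "lev ?p e1 e2 n u"
 define g where "g = (%x. nrm e1 e2 n u (proj ?p e1 e2 x))"
 define H where "H = hss e1 e2 u (proj ?p e1 e2 ?p)"
 define T where "T = ball ?p dl"
 have T: "open T" "?p \<in> T" using t(2,3) by (auto simp: T_def)
 have pr: "proj ?p e1 e2 x \<in> ball 0 dl" if "x \<in> T" for x using tframe_proj_in[OF fr] that unfolding T_def by blast
 have dL: "(?L has_derivative (%v. g x <.> v)) (at x)" if "x \<in> T" for x
  unfolding g_def by (rule lev_has_derivative[OF smooth2_differentiable[OF t(4) pr[OF that]]])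
 have dH: "(g has_derivative H) (at ?p)"
  unfolding g_def H_def by (intro nrm_has_derivative smooth2_differentiable[OF smooth2_D(1)[OF t(4)]]
  smooth2_differentiable[OF smooth2_D(2)[OF t(4)]] pr T)
 have lin: "linear H" using dH has_derivative_linear by blast
 have cont: "continuous_on S X"
  using S(3) by (meson continuous_at_imp_continuous_on has_derivative_continuous)
 define S' where "S' = S \<inter> X -` T"
 have S': "open S'" "z \<in> S'" "!!y. y \<in> S' ==> (X has_derivative (%h. fst h *\<^sub>R X1 y + snd h *\<^sub>R X2 y)) (at y)"
  using continuous_open_preimage[OF cont S(1) T(1)] S T unfolding S'_def by auto
 have zero: "?L (X y) = 0" if "y \<in> S'" for y using t(6)[of "X y"] S(4)[of y] that unfolding S'_def T_def by auto
 note le = tframe_level_equation[OF fr pr[OF T(2)]]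
 have gg: "g ?p <.> g ?p > 0" unfolding g_def le(2) by (simp add: add_pos_nonneg)
 then have g0: "g ?p ~= 0" by auto
 have lev_eq: "(g ?p <.> g ?p) * (tr3 H + g ?p <.> tau) = H (g ?p) <.> g ?p"
  using le(1) unfolding g_def H_def by simp
 note m = immersion_local_min[OF S' X1 X2 T dL dH, folded D_def]
 have perp: "g ?p <.> X1 z = 0" "g ?p <.> X2 z = 0"
 proof -
  \<comment> \<open>\<open>immersion_local_min\<close> asks for some normal vector before the
    gradient is known to be one; a dimension count supplies it.\<close>
  have "D > 0 ==> EX w. w ~= 0 & w <.> X1 z = 0 & w <.> X2 z = 0"
  proof -
  have "dim {X1 z, X2 z} <= card {X1 z, X2 z}" by (rule dim_le_card') simp
  also have "... <= 2" by (simp add: card_insert_if)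
  also have "2 < DIM(real^3)" by simp
  finally have "dim (span {X1 z, X2 z}) < DIM(real^3)" by simp
  then have "span {X1 z, X2 z} ~= UNIV" using dim_UNIV by (metis less_irrefl)
  then obtain w where "w ~= 0" "\<forall>x\<in>span {X1 z, X2 z}. w <.> x = 0"
  using span_not_univ_subset_hyperplane[of "{X1 z, X2 z}"] unfolding set_eq_iff by blast
  then show ?thesis by (meson insertI1 insertI2 span_base)
  qed
  then obtain w where w: "w ~= 0" "w <.> X1 z = 0" "w <.> X2 z = 0" using D by blast
  show "g ?p <.> X1 z = 0" "g ?p <.> X2 z = 0" using m(1,2)[OF _ _ _ w D] zero S'(2) by auto
 qed
 let ?Y = "(X2 z <.> X2 z) *\<^sub>R X11 - (2 * (X1 z <.> X2 z)) *\<^sub>R X12 + (X1 z <.> X1 z) *\<^sub>R X22"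
 have 1: "0 <= D * ((g ?p <.> g ?p) * tr3 H - H (g ?p) <.> g ?p) + (g ?p <.> g ?p) * (g ?p <.> ?Y)"
  using m(3)[OF _ _ _ g0 perp D] zero S'(2) by auto
 have dL': "((%x. - ?L x) has_derivative (%v. (- g x) <.> v)) (at x)" if "x \<in> T" for x
  using has_derivative_minus[OF dL[OF that]] by simp
 have dH': "((%x. - g x) has_derivative (%v. - H v)) (at ?p)" by (rule has_derivative_minus[OF dH])
 note m' = immersion_local_min[OF S' X1 X2 T dL' dH', folded D_def]
 have 2: "0 <= D * ((g ?p <.> g ?p) * (- tr3 H) + H (g ?p) <.> g ?p) - (g ?p <.> g ?p) * (g ?p <.> ?Y)"
  using m'(3)[OF _ _ _ g0 perp D] zero S'(2) tr3_minus[of H] by auto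
 have "(g ?p <.> g ?p) * (g ?p <.> ?Y) = - D * ((g ?p <.> g ?p) * tr3 H - H (g ?p) <.> g ?p)"
  using 1 2 by (simp add: algebra_simps)
 also have "... = (g ?p <.> g ?p) * (D * (g ?p <.> tau))" using lev_eq[symmetric] by (simp add: algebra_simps)
 finally have gY: "g ?p <.> ?Y = D * (g ?p <.> tau)" using gg by simp
 define k where "k = (N <.> g ?p) / (g ?p <.> g ?p)"
 have Nk: "N = k *\<^sub>R g ?p"
  unfolding k_def by (rule normal_unique[OF D[unfolded D_def] g0 perp N])
 have "N <.> ?Y = k * (g ?p <.> ?Y)" by (subst Nk) simp
 also have "... = D * (k * (g ?p <.> tau))" unfolding gY by simp
 also have "k * (g ?p <.> tau) = N <.> tau" by (metis Nk inner_scaleR_left)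
 finally show ?thesis .
qed

section \<open>Hopf's barrier and the strong maximum principle\<close>

text \<open>In Hopf's argument the level-set equation controls \<open>H\<close> in the direction
  \<open>g\<close>, the touching inequality controls it in the direction \<open>N\<close>, and
  \<open>w\<close> is the gradient of the barrier by which they differ. Expanding
  \<open>g = k *\<^sub>R N + w\<close>, every remaining term carries a factor \<open>w\<close>; the
  contributions 4, 1, 4 and 1 add up to the constant 10.\<close>

lemma quadratic_form_difference_bound:
 fixes g N w :: "real^3"
 assumes lin: "linear H" and C: "!!v. norm (H v) <= C * norm v" "C >= 0"
  and g: "g = k *\<^sub>R N + w" "norm w <= norm g" "g ~= 0"
 shows "((N <.> N) * (H g <.> g)) / (g <.> g) - H N <.> N <= 10 * C * (N <.> N) * (norm w / norm g)"
proof -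
 have bil: "\<bar>H x <.> y\<bar> <= C * norm x * norm y" for x y
 proof -
  have "\<bar>H x <.> y\<bar> <= norm (H x) * norm y" by (rule Cauchy_Schwarz_ineq2)
  also have "... <= C * norm x * norm y" using C(1) by (simp add: mult_right_mono)
  finally show ?thesis .
 qed
 define n a b where "n = norm N" and "a = norm w" and "b = norm g"
 have nn: "n >= 0" "a >= 0" "b > 0" "a <= b" using g by (auto simp: n_def a_def b_def)
 have kn: "\<bar>k\<bar> * n <= 2 * b"
 proof -
  have "k *\<^sub>R N = g - w" using g(1) by simp
  then have "\<bar>k\<bar> * n = norm (g - w)" unfolding n_def by (metis norm_scaleR)
  also have "... <= b + a" unfolding a_def b_def by (rule norm_triangle_ineq4)
  finally show ?thesis using nn by simp
 qed
 have NN: "N <.> N = n * n" "g <.> g = b * b" unfolding n_def b_def by (simp_all add: power2_norm_eq_inner flip: power2_eq_square)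
 have e: "(N <.> N) * (H g <.> g) - (g <.> g) * (H N <.> N)
  = (n * n) * (k * (H N <.> w) + k * (H w <.> N)) + (n * n) * (H w <.> w) - (2 * k * (N <.> w)) * (H N <.> N) - (w <.> w) * (H N <.> N)"
  unfolding NN(1)[symmetric] unfolding g(1)
  by (simp add: linear_add[OF lin] linear_scale[OF lin] inner_add_left inner_add_right inner_commute[of w N] algebra_simps)
 have t1: "k * (H N <.> w) <= C * (\<bar>k\<bar> * n) * a" "k * (H w <.> N) <= C * (\<bar>k\<bar> * n) * a"
 proof -
  have ab: "k * x <= \<bar>k\<bar> * \<bar>x\<bar>" for x by (metis abs_ge_self abs_mult)
  have "\<bar>k\<bar> * \<bar>H N <.> w\<bar> <= \<bar>k\<bar> * (C * n * a)" "\<bar>k\<bar> * \<bar>H w <.> N\<bar> <= \<bar>k\<bar> * (C * a * n)"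
  using bil[of N w] bil[of w N] unfolding n_def a_def by (intro mult_left_mono; simp)+
  then show "k * (H N <.> w) <= C * (\<bar>k\<bar> * n) * a" "k * (H w <.> N) <= C * (\<bar>k\<bar> * n) * a"
  using ab[of "H N <.> w"] ab[of "H w <.> N"] by (simp_all add: algebra_simps)
 qed
 have kb: "C * (\<bar>k\<bar> * n) * a <= C * (2 * b) * a" using kn C(2) nn by (intro mult_right_mono mult_left_mono) auto
 have t2: "H w <.> w <= C * a * a" using bil[of w w] by (simp add: a_def)
 have caa: "C * a * a <= C * b * a" using nn C(2) by (intro mult_right_mono mult_left_mono) auto
 have t3: "- ((2 * k * (N <.> w)) * (H N <.> N)) <= 2 * \<bar>k\<bar> * (n * a) * (C * n * n)"
 proof -
  have "\<bar>(2 * k * (N <.> w)) * (H N <.> N)\<bar> = 2 * \<bar>k\<bar> * \<bar>N <.> w\<bar> * \<bar>H N <.> N\<bar>" by (simp add: abs_mult)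
  also have "... <= 2 * \<bar>k\<bar> * (n * a) * (C * n * n)"
  using bil[of N N] Cauchy_Schwarz_ineq2[of N w] unfolding n_def a_def by (intro mult_mono mult_left_mono) auto
  finally show ?thesis by linarith
 qed
 have t3': "2 * \<bar>k\<bar> * (n * a) * (C * n * n) <= 2 * (2 * b) * a * (C * n * n)"
 proof -
  have "2 * \<bar>k\<bar> * (n * a) * (C * n * n) = 2 * (\<bar>k\<bar> * n) * a * (C * n * n)" by simp
  also have "... <= 2 * (2 * b) * a * (C * n * n)"
  using kn C(2) nn by (intro mult_right_mono mult_left_mono) auto
  finally show ?thesis .
 qed
 have t4: "- ((w <.> w) * (H N <.> N)) <= b * a * (C * n * n)"
 proof -
  have "- ((w <.> w) * (H N <.> N)) <= (w <.> w) * \<bar>H N <.> N\<bar>"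
  using mult_left_mono[of "- (H N <.> N)" "\<bar>H N <.> N\<bar>" "w <.> w"] by auto
  also have "... <= (a * a) * (C * n * n)"
  using bil[of N N] unfolding n_def a_def by (intro mult_mono) (auto simp: power2_norm_eq_inner simp flip: power2_eq_square)
  also have "... <= b * a * (C * n * n)" using nn C(2) by (intro mult_right_mono) auto
  finally show ?thesis .
 qed
 have "(N <.> N) * (H g <.> g) - (g <.> g) * (H N <.> N) <=
  (n * n) * (C * (2 * b) * a + C * (2 * b) * a) + (n * n) * (C * b * a) + 2 * (2 * b) * a * (C * n * n) + b * a * (C * n * n)"
 proof -
  have "(n * n) * (k * (H N <.> w) + k * (H w <.> N)) <= (n * n) * (C * (2 * b) * a + C * (2 * b) * a)"
  proof -
  have "k * (H N <.> w) + k * (H w <.> N) <= C * (2 * b) * a + C * (2 * b) * a" using t1 kb by linarith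
  then show ?thesis by (intro mult_left_mono) auto
  qed
  moreover have "(n * n) * (H w <.> w) <= (n * n) * (C * b * a)"
  using t2 caa by (intro mult_left_mono) auto
  ultimately show ?thesis unfolding e using t3 t3' t4 by linarith
 qed
 also have "... = (g <.> g) * (10 * C * (N <.> N) * (a / b))" unfolding NN using nn by (simp add: field_simps)
 finally have "((N <.> N) * (H g <.> g) - (g <.> g) * (H N <.> N)) / (g <.> g) <= 10 * C * (N <.> N) * (a / b)"
  using g(3) by (simp add: field_simps)
 then show ?thesis using g(3) unfolding a_def b_def by (simp add: diff_divide_distrib)
qed

text \<open>The barrier is a Gaussian in the two tangential coordinates, extended to space as
  constant along the normal of the frame.\<close>

lemma hopf_barrier_derivatives:
 fixes p e1 e2 :: "real^3" and a b al m :: real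
 defines "Q \<equiv> %x. ((x - p) <.> e1 - a)^2 + ((x - p) <.> e2 - b)^2"
 defines "V \<equiv> %x. ((x - p) <.> e1 - a) *\<^sub>R e1 + ((x - p) <.> e2 - b) *\<^sub>R e2"
 shows "((%x. exp (- al * Q x) - m) has_derivative (%v. ((-2 * al * exp (- al * Q x)) *\<^sub>R V x) <.> v)) (at x)"
  "((%x. (-2 * al * exp (- al * Q x)) *\<^sub>R V x) has_derivative
  (%v. exp (- al * Q x) *\<^sub>R ((4 * al^2) *\<^sub>R ((v <.> V x) *\<^sub>R V x) - (2 * al) *\<^sub>R ((v <.> e1) *\<^sub>R e1 + (v <.> e2) *\<^sub>R e2)))) (at x)"
proof -
 have dQ: "(Q has_derivative (%v. 2 * (V x <.> v))) (at x)" for x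
  unfolding Q_def V_def
  by (auto intro!: derivative_eq_intros simp: fun_eq_iff inner_add_left inner_commute algebra_simps)
 have dV: "(V has_derivative (%v. (v <.> e1) *\<^sub>R e1 + (v <.> e2) *\<^sub>R e2)) (at x)" for x
  unfolding V_def by (auto intro!: derivative_eq_intros)
 have dE: "((%x. exp (- al * Q x)) has_derivative (%v. (-2 * al * exp (- al * Q x)) * (V x <.> v))) (at x)" for x
  using dQ[of x] by (auto intro!: derivative_eq_intros simp: fun_eq_iff)
 show "((%x. exp (- al * Q x) - m) has_derivative (%v. ((-2 * al * exp (- al * Q x)) *\<^sub>R V x) <.> v)) (at x)"
  using has_derivative_diff[OF dE has_derivative_const] by simp
 have "((%x. (-2 * al * exp (- al * Q x)) *\<^sub>R V x) has_derivative
  (%v. (-2 * al * exp (- al * Q x)) *\<^sub>R ((v <.> e1) *\<^sub>R e1 + (v <.> e2) *\<^sub>R e2)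
  + (-2 * al * ((-2 * al * exp (- al * Q x)) * (V x <.> v))) *\<^sub>R V x)) (at x)"
  by (intro has_derivative_scaleR has_derivative_mult_right dE dV)
 then show "((%x. (-2 * al * exp (- al * Q x)) *\<^sub>R V x) has_derivative
  (%v. exp (- al * Q x) *\<^sub>R ((4 * al^2) *\<^sub>R ((v <.> V x) *\<^sub>R V x) - (2 * al) *\<^sub>R ((v <.> e1) *\<^sub>R e1 + (v <.> e2) *\<^sub>R e2)))) (at x)"
  by (rule has_derivative_eq_rhs) (auto simp: fun_eq_iff inner_commute power2_eq_square algebra_simps)
qed

text \<open>At an interior minimum of \<open>Ps - eps h\<close> on the first surface, where \<open>h\<close> is Hopf's barrier,
 the level-set equation for \<open>Ps\<close> contradicts the largeness of \<open>al\<close>.\<close>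

lemma hopf_no_interior_min:
 fixes a b :: real
 assumes fr: "tframe M p e1 e2 n u dl eta" "z \<in> ball 0 dl"
  and T: "open T" "graph_map p e1 e2 n u z \<in> T" "!!x. x \<in> T ==> (Ps has_derivative (%v. g x <.> v)) (at x)"
  and H: "(g has_derivative H) (at (graph_map p e1 e2 n u z))"
  and leveq: "(g (graph_map p e1 e2 n u z) <.> g (graph_map p e1 e2 n u z)) * (tr3 H + g (graph_map p e1 e2 n u z) <.> tau)
  = H (g (graph_map p e1 e2 n u z)) <.> g (graph_map p e1 e2 n u z)"
  and g1: "norm (g (graph_map p e1 e2 n u z)) >= 1"
  and C: "!!v. norm (H v) <= C * norm v" "C >= 0"
  and B: "1 + (D1 u z)^2 + (D2 u z)^2 <= B"
  and d: "d > 0" "d / 2 <= dist z (a, b)" "dist z (a, b) <= d"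
  and al: "al > 0" "al * d^2 > B * (20 * C * d + 4 + 2 * d)"
  and eps: "eps > 0" "2 * al * d * eps <= 1"
  and S: "open S" "z \<in> S" "!!y. y \<in> S ==>
  Ps (graph_map p e1 e2 n u z) - eps * (exp (- al * (dist z (a, b))^2) - m)
  <= Ps (graph_map p e1 e2 n u y) - eps * (exp (- al * (dist y (a, b))^2) - m)"
 shows False
proof -
 note t = tframeD[OF fr(1)]
 note o = orthonormal3_inner[OF t(1)]
 let ?X = "graph_map p e1 e2 n u"
 define Q where "Q = (%x. ((x - p) <.> e1 - a)^2 + ((x - p) <.> e2 - b)^2)"
 define V where "V = (%x. ((x - p) <.> e1 - a) *\<^sub>R e1 + ((x - p) <.> e2 - b) *\<^sub>R e2)"
 define E where "E = exp (- al * Q (?X z))"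
 define v where "v = V (?X z)"
 define N where "N = nrm e1 e2 n u z"
 define gx where "gx = g (?X z)"
 define gh where "gh = (%x. (-2 * al * exp (- al * Q x)) *\<^sub>R V x)"
 define Hh where "Hh = (%w. E *\<^sub>R ((4 * al^2) *\<^sub>R ((w <.> v) *\<^sub>R v) - (2 * al) *\<^sub>R ((w <.> e1) *\<^sub>R e1 + (w <.> e2) *\<^sub>R e2)))"
 have QX: "Q (?X y) = (dist y (a, b))^2" for y
 proof -
  have "(?X y - p) <.> e1 = fst y" "(?X y - p) <.> e2 = snd y"
  using proj_graph_map(1)[OF t(1), of p u y] unfolding proj_def by (metis fst_conv snd_conv)+
  then show ?thesis unfolding Q_def by (simp add: dist_prod_def dist_real_def)
 qed
 have Qx: "((x - p) <.> e1 - a)^2 + ((x - p) <.> e2 - b)^2 = Q x"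
  and Vx: "((x - p) <.> e1 - a) *\<^sub>R e1 + ((x - p) <.> e2 - b) *\<^sub>R e2 = V x" for x
  by (simp_all add: Q_def V_def)
 note hb = hopf_barrier_derivatives[of al p e1 a e2 b, unfolded Qx Vx]
 have dG: "((%x. Ps x - eps * (exp (- al * Q x) - m)) has_derivative (%w. (g x - eps *\<^sub>R gh x) <.> w)) (at x)" if "x \<in> T" for x
  using has_derivative_diff[OF T(3)[OF that] has_derivative_mult_right[OF hb(1)[of m x], of eps]]
  unfolding gh_def by (simp add: inner_diff_left inner_add_left mult.assoc)
 have dgh: "((%x. g x - eps *\<^sub>R gh x) has_derivative (%w. H w - eps *\<^sub>R Hh w)) (at (?X z))"
  using has_derivative_diff[OF H has_derivative_scaleR_right[OF hb(2)[of "?X z"], of eps]]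
  unfolding gh_def Hh_def E_def v_def by simp
 have S': "Ps (?X z) - eps * (exp (- al * Q (?X z)) - m) <= Ps (?X y) - eps * (exp (- al * Q (?X y)) - m)" if "y \<in> S" for y
  using S(3)[OF that] unfolding QX .
 note m = tframe_local_min[OF fr T(1,2) dG dgh S(1,2) S', folded N_def gx_def]
 have lin: "linear H" using H has_derivative_linear by blast
 define k where "k = (gx - eps *\<^sub>R gh (?X z)) <.> n"
 define w where "w = eps *\<^sub>R gh (?X z)"
 have m1: "gx - w = k *\<^sub>R N" using m(1) unfolding k_def w_def by blast
 have m2: "(H N - eps *\<^sub>R Hh N) <.> N <= (N <.> N) * (tr3 H - eps * tr3 Hh + (gx - w) <.> tau)"
  using m(2) unfolding w_def by (auto simp: tr3_diff tr3_scale)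
 define W where "W = N <.> N"
 have W: "W = 1 + (D1 u z)^2 + (D2 u z)^2" unfolding W_def N_def by (rule tframe_level_equation(2)[OF fr])
 have W1: "W >= 1" unfolding W by simp
 have Epos: "E > 0" by (simp add: E_def)
 define r where "r = dist z (a, b)"
 define x y where "x = (?X z - p) <.> e1 - a" and "y = (?X z - p) <.> e2 - b"
 have vxy: "v = x *\<^sub>R e1 + y *\<^sub>R e2" unfolding v_def V_def x_def y_def ..
 have rxy: "x^2 + y^2 = r^2" using QX[of z] unfolding Q_def x_def y_def r_def .
 have vv: "v <.> v = r^2" unfolding vxy rxy[symmetric] by (simp add: inner_add_left inner_add_right o power2_eq_square)
 then have nv: "norm v = r" by (metis zero_le_dist norm_eq_sqrt_inner r_def real_sqrt_unique)
 have nw: "norm w = eps * (2 * al * E * r)"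
  using eps al Epos nv unfolding w_def gh_def E_def[symmetric] v_def[symmetric] by simp
 have E1: "E <= 1" unfolding E_def QX using al(1) by simp
 have r: "d / 2 <= r" "r <= d" "r >= 0" using d by (auto simp: r_def)
 have nw1: "norm w <= 1"
 proof -
  have "norm w <= eps * (2 * al * 1 * d)" unfolding nw using eps al E1 r Epos by (intro mult_left_mono mult_mono) auto
  then show ?thesis using eps(2) by (simp add: algebra_simps)
 qed
 have ng: "norm gx >= 1" using g1 unfolding gx_def .
 have gx0: "gx ~= 0" using ng by auto
 have lhs: "(W * (H gx <.> gx)) / (gx <.> gx) - H N <.> N <= 10 * C * W * (norm w / norm gx)"
  unfolding W_def by (rule quadratic_form_difference_bound[OF lin C _ _ gx0, where k = k])
  (use m1 nw1 ng in "auto simp: algebra_simps")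
 also have "... <= 10 * C * W * norm w"
 proof -
  have "norm w / norm gx <= norm w / 1" using ng by (intro divide_left_mono) auto
  then show ?thesis using C(2) W1 by (intro mult_left_mono) auto
 qed
 also have "... <= 10 * C * W * (eps * (2 * al * E * d))"
  unfolding nw using C(2) W1 r al eps Epos by (intro mult_left_mono) auto
 finally have up: "(W * (H gx <.> gx)) / (gx <.> gx) - H N <.> N <= eps * E * al * (20 * C * d * W)" by (simp add: algebra_simps)
 have leq: "(W * (H gx <.> gx)) / (gx <.> gx) = W * (tr3 H + gx <.> tau)"
  using leveq gx0 unfolding gx_def[symmetric] by (metis inner_eq_zero_iff nonzero_mult_div_cancel_left times_divide_eq_right)
 have low: "eps * (W * (tr3 Hh + gh (?X z) <.> tau) - Hh N <.> N) <= (W * (H gx <.> gx)) / (gx <.> gx) - H N <.> N"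
  unfolding leq using m2 unfolding W_def[symmetric] w_def by (simp add: inner_diff_left algebra_simps)
 have trh: "tr3 Hh = E * (4 * al^2 * r^2 - 4 * al)"
  unfolding Hh_def tr3_scale tr3_diff tr3_add tr3_rank_one vv o by (simp add: algebra_simps)
 have ght: "gh (?X z) <.> tau >= - (2 * al * E * d)"
 proof -
  have "gh (?X z) <.> tau = - (2 * al * E * (v <.> tau))" unfolding gh_def E_def v_def by simp
  moreover have "v <.> tau <= d" using Cauchy_Schwarz_ineq2[of v tau] nv r by simp
  ultimately show ?thesis using al Epos by simp
 qed
 have vN: "(N <.> v)^2 <= (W - 1) * r^2"
 proof -
  have "N <.> v = - (x * D1 u z + y * D2 u z)" unfolding N_def nrm_def vxy
  by (simp add: inner_diff_left inner_add_right o algebra_simps)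
  then have "(N <.> v)^2 = (x * D1 u z + y * D2 u z)^2" by (simp only: power2_minus)
  also have "... <= (x^2 + y^2) * ((D1 u z)^2 + (D2 u z)^2)"
  using zero_le_power2[of "x * D2 u z - y * D1 u z"] by (simp add: power2_eq_square algebra_simps)
  also have "... = (W - 1) * r^2" unfolding W rxy by simp
  finally show ?thesis .
 qed
 have HhN: "Hh N <.> N <= E * (4 * al^2 * ((W - 1) * r^2))"
 proof -
  have "Hh N <.> N = E * (4 * al^2 * (N <.> v)^2 - 2 * al * ((N <.> e1)^2 + (N <.> e2)^2))"
  unfolding Hh_def by (simp add: inner_diff_left inner_add_left inner_commute[of v N] inner_commute[of e1 N] inner_commute[of e2 N] power2_eq_square)
  also have "... <= E * (4 * al^2 * (N <.> v)^2)" using Epos al by (intro mult_left_mono) auto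
  also have "... <= E * (4 * al^2 * ((W - 1) * r^2))" using Epos vN by (intro mult_left_mono) auto
  finally show ?thesis .
 qed
 \<comment> \<open>The trace brings \<open>4 * al^2 * r^2\<close> with weight \<open>W\<close>, the
   normal direction takes back at most \<open>W - 1\<close> of it. What remains is quadratic in
   \<open>al\<close>, while all errors are linear in \<open>al\<close>.\<close>
 have "E * (4 * al^2 * r^2 - 4 * al * W - 2 * al * d * W) <= W * (tr3 Hh + gh (?X z) <.> tau) - Hh N <.> N"
 proof -
  have "W * (gh (?X z) <.> tau) >= W * (- (2 * al * E * d))" using ght W1 by (intro mult_left_mono) auto
  then have "W * (tr3 Hh + gh (?X z) <.> tau) - Hh N <.> N >= W * (E * (4 * al^2 * r^2 - 4 * al)) + W * (- (2 * al * E * d)) - E * (4 * al^2 * ((W - 1) * r^2))"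
  using HhN unfolding trh by (simp add: distrib_left)
  then show ?thesis by (simp add: algebra_simps)
 qed
 from mult_left_mono[OF this, of eps] have "eps * (E * (4 * al^2 * r^2 - 4 * al * W - 2 * al * d * W)) <= eps * E * al * (20 * C * d * W)"
  using low up eps(1) by linarith
 then have "eps * E * al * (4 * al * r^2 - 4 * W - 2 * d * W) <= eps * E * al * (20 * C * d * W)"
  by (simp add: algebra_simps power2_eq_square)
 then have "4 * al * r^2 - 4 * W - 2 * d * W <= 20 * C * d * W"
  using eps(1) Epos al(1) by simp
 then have "4 * al * r^2 <= W * (20 * C * d + 4 + 2 * d)" by (simp add: algebra_simps)
 also have "... <= B * (20 * C * d + 4 + 2 * d)" using B C(2) d(1) unfolding W by (intro mult_right_mono) auto
 also have "... < al * d^2" by (rule al(2))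
 also have "... <= 4 * al * r^2"
 proof -
  have "(d / 2)^2 <= r^2" using r d(1) by (intro power_mono) auto
  then show ?thesis using al(1) by (simp add: power_divide mult_left_mono)
 qed
 finally show False by simp
qed

text \<open>Otherwise a ball around a nearby point with positive value touches the zero set at a
  point \<open>y1\<close>. On the annulus between this ball and half of it the barrier lies below
  \<open>ps\<close>, so \<open>ps\<close> has a nonzero inward slope at \<open>y1\<close>; but
  \<open>y1\<close> is an interior minimum of \<open>ps\<close>.\<close>

lemma hopf_translator:
 assumes fr: "tframe M p e1 e2 n u dl eta"
  and r: "0 < r" "r <= dl"
  and T: "open T" "!!y. y \<in> ball 0 r ==> graph_map p e1 e2 n u y \<in> T"
  "!!x. x \<in> T ==> (Ps has_derivative (%v. g x <.> v)) (at x)"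
  "!!x. x \<in> T ==> (g has_derivative H x) (at x)"
  "!!x. x \<in> T ==> (g x <.> g x) * (tr3 (H x) + g x <.> tau) = H x (g x) <.> g x"
  "!!x. x \<in> T ==> norm (g x) >= 1"
  "!!x v. x \<in> T ==> norm (H x v) <= C * norm v" "C >= 0"
  and B: "!!y. y \<in> ball 0 r ==> 1 + (D1 u y)^2 + (D2 u y)^2 <= B"
  and nonneg: "!!y. y \<in> ball 0 r ==> Ps (graph_map p e1 e2 n u y) >= 0"
  and zero: "Ps p = 0"
 shows "\<exists>r'>0. \<forall>y\<in>ball 0 r'. Ps (graph_map p e1 e2 n u y) = 0"
proof (rule ccontr)
 assume non: "\<not> ?thesis"
 note t = tframeD[OF fr]
 note o = orthonormal3_inner[OF t(1)]
 let ?X = "graph_map p e1 e2 n u"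
 define ps where "ps = (%y. Ps (?X y))"
 have "r / 4 > 0" using r by simp
 then obtain c where c: "c \<in> ball 0 (r / 4)" "ps c ~= 0" using non unfolding ps_def by blast
 have ps0: "ps 0 = 0" unfolding ps_def using zero t(5) by (simp add: graph_map_def zero_prod_def)
 have br: "ball 0 r \<subseteq> ball 0 dl" using r(2) by auto
 have dX: "(?X has_derivative (%h. fst h *\<^sub>R (e1 + D1 u y *\<^sub>R n) + snd h *\<^sub>R (e2 + D2 u y *\<^sub>R n))) (at y)" if "y \<in> ball 0 r" for y
  by (rule graph_map_has_derivative[OF smooth2_differentiable[OF t(4)]]) (use that r(2) in auto)
 have dps: "(ps has_derivative (%h. g (?X y) <.> (fst h *\<^sub>R (e1 + D1 u y *\<^sub>R n) + snd h *\<^sub>R (e2 + D2 u y *\<^sub>R n)))) (at y)"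
  if "y \<in> ball 0 r" for y
  unfolding ps_def using has_derivative_compose[OF dX[OF that] T(3)[OF T(2)[OF that]]] .
 have cont: "continuous_on (ball 0 r) ps"
  using dps by (meson continuous_at_imp_continuous_on has_derivative_continuous)
 have near: "dist y c <= norm c ==> y \<in> ball 0 r" for y
  using c(1) norm_triangle_ineq2[of y c] r(1) by (auto simp: dist_norm)
 \<comment> \<open>The origin lies in \<open>Z\<close>, so a zero nearest to \<open>c\<close>
   exists; since \<open>c\<close> is within \<open>r / 4\<close> of the origin the whole
   construction stays in the ball of radius \<open>r\<close>.\<close>
 define Z where "Z = {y \<in> cball c (norm c). ps y = 0}"
 have "continuous_on (cball c (norm c)) ps"
  by (rule continuous_on_subset[OF cont]) (use near in "auto simp: dist_commute")
 then have "closed Z" unfolding Z_def by (intro continuous_closed_preimage_constant) auto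
 moreover have "0 \<in> Z" unfolding Z_def using ps0 by (simp add: dist_norm)
 ultimately obtain y1 where y1: "y1 \<in> Z" "!!y. y \<in> Z ==> dist c y1 <= dist c y"
  using distance_attains_inf[of Z c] by blast
 define d where "d = dist y1 c"
 have psy1: "ps y1 = 0" and dc: "d <= norm c" using y1(1) unfolding Z_def d_def by (auto simp: dist_commute)
 have dpos: "d > 0" using c(2) psy1 unfolding d_def by auto
 have y1r: "y1 \<in> ball 0 r" using near dc unfolding d_def by blast
 have inr: "dist y c <= d ==> y \<in> ball 0 r" for y using near dc by (meson order_trans)
 have pos: "ps y > 0" if "dist y c < d" for y
 proof -
  have "y \<notin> Z" using y1(2)[of y] that unfolding d_def by (auto simp: dist_commute)
  moreover have "y \<in> cball c (norm c)" using that dc by (simp add: dist_commute)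
  ultimately have "ps y ~= 0" unfolding Z_def by blast
  moreover have "ps y >= 0" using nonneg inr[of y] that unfolding ps_def by simp
  ultimately show ?thesis by simp
 qed
 obtain ca cb where cab: "c = (ca, cb)" by fastforce
 define K where "K = \<bar>B\<bar> * (20 * C * d + 4 + 2 * d)"
 have K0: "K >= 0" unfolding K_def using T(8) dpos by simp
 define al where "al = (K + 1) / d^2"
 have alpos: "al > 0" unfolding al_def using K0 dpos by simp
 have al: "al * d^2 > B * (20 * C * d + 4 + 2 * d)"
 proof -
  have "B * (20 * C * d + 4 + 2 * d) <= K" unfolding K_def using T(8) dpos by (intro mult_right_mono) auto
  then show ?thesis unfolding al_def using dpos by simp
 qed
 define S where "S = sphere c (d / 2)"
 have "compact S" "S ~= {}" unfolding S_def using dpos by auto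
 moreover have "continuous_on S ps"
  by (rule continuous_on_subset[OF cont]) (use inr dpos in "auto simp: S_def dist_commute")
 ultimately obtain s where s: "s \<in> S" "!!y. y \<in> S ==> ps s <= ps y" using continuous_attains_inf by metis
 have spos: "ps s > 0" using pos[of s] s(1) dpos unfolding S_def by (simp add: dist_commute)
 define m where "m = exp (- al * d^2)"
 \<comment> \<open>The first bound puts the barrier below \<open>ps\<close> on the inner sphere, the
   second keeps the gradient of the barrier at most 1, hence at most that of the level
   function.\<close>
 define eps where "eps = min (ps s) (1 / (2 * al * d))"
 have eps: "eps > 0" "2 * al * d * eps <= 1" "eps <= ps s"
 proof -
  show "eps > 0" "eps <= ps s" unfolding eps_def using spos alpos dpos by auto
  have "2 * al * d * eps <= 2 * al * d * (1 / (2 * al * d))"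
  unfolding eps_def using alpos dpos by (intro mult_left_mono) auto
  then show "2 * al * d * eps <= 1" using alpos dpos by simp
 qed
 define h where "h = (%y. exp (- al * (dist y c)^2) - m)"
 define F where "F = (%y. ps y - eps * h y)"
 have conth: "continuous_on A h" for A unfolding h_def by (intro continuous_intros)
 define A where "A = {y. d / 2 <= dist y c & dist y c <= d}"
 have "A = cball c d - ball c (d / 2)" unfolding A_def by (auto simp: dist_commute)
 then have "compact A" by (simp add: compact_diff)
 moreover have "y1 \<in> A" unfolding A_def using d_def dpos by simp
 moreover have contA: "continuous_on A F"
  unfolding F_def by (intro continuous_intros conth continuous_on_subset[OF cont]) (use inr in "auto simp: A_def")
 ultimately obtain y0 where y0: "y0 \<in> A" "!!y. y \<in> A ==> F y0 <= F y" using continuous_attains_inf by (metis empty_iff)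
 have "F y0 >= 0"
 proof (rule ccontr)
  assume neg: "\<not> F y0 >= 0"
  have ne1: "dist y0 c ~= d / 2"
  proof
  assume "dist y0 c = d / 2"
  then have "ps y0 >= eps" using s(2)[of y0] eps(3) unfolding S_def by (simp add: dist_commute)
  moreover have "eps * h y0 <= eps * 1"
  proof (rule mult_left_mono)
  have "exp (- al * (dist y0 c)^2) <= 1" using alpos by simp
  then show "h y0 <= 1" unfolding h_def m_def using exp_gt_zero[of "- al * d^2"] by linarith
  qed (use eps(1) in auto)
  ultimately show False using neg unfolding F_def by simp
  qed
  have ne2: "dist y0 c ~= d"
  proof
  assume e: "dist y0 c = d"
  then have "h y0 = 0" unfolding h_def m_def by simp
  moreover have "ps y0 >= 0" using nonneg inr[of y0] e unfolding ps_def by simp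
  ultimately show False using neg unfolding F_def by simp
  qed
  define S' where "S' = {y. d / 2 < dist y c & dist y c < d}"
  have "S' = ball c d - cball c (d / 2)" unfolding S'_def by (auto simp: dist_commute)
  then have oS: "open S'" by (simp add: open_Diff)
  have yS: "y0 \<in> S'" using y0(1) ne1 ne2 unfolding A_def S'_def by auto
  have y0r: "y0 \<in> ball 0 r" using inr y0(1) unfolding A_def by blast
  have y0d: "y0 \<in> ball 0 dl" using y0r br by blast
  show False
  proof (rule hopf_no_interior_min[OF fr y0d T(1) T(2)[OF y0r] T(3) T(4)[OF T(2)[OF y0r]] T(5)[OF T(2)[OF y0r]]
  T(6)[OF T(2)[OF y0r]] T(7)[OF T(2)[OF y0r]] T(8) B[OF y0r] dpos _ _ alpos al eps(1,2) oS yS])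
  show "d / 2 <= dist y0 (ca, cb)" "dist y0 (ca, cb) <= d" using y0(1) unfolding A_def cab by auto
  show "Ps (?X y0) - eps * (exp (- al * (dist y0 (ca, cb))^2) - m) <= Ps (?X y) - eps * (exp (- al * (dist y (ca, cb))^2) - m)"
  if "y \<in> S'" for y
  using y0(2)[of y] that unfolding A_def S'_def F_def h_def ps_def cab by auto
  qed
 qed
 then have Fnn: "F y >= 0" if "y \<in> A" for y using y0(2)[OF that] by linarith
 define v where "v = c - y1"
 define f where "f = (%q::real. F (y1 + q *\<^sub>R v))"
 have dlin: "((%q. y1 + q *\<^sub>R v) has_derivative (%q. q *\<^sub>R v)) (at 0)" by (auto intro!: derivative_eq_intros)
 obtain L where L: "DERIV (%q. ps (y1 + q *\<^sub>R v)) 0 :> L"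
 proof -
  have "(ps has_derivative (%h. g (?X y1) <.> (fst h *\<^sub>R (e1 + D1 u y1 *\<^sub>R n) + snd h *\<^sub>R (e2 + D2 u y1 *\<^sub>R n)))) (at (y1 + 0 *\<^sub>R v))"
  using dps[OF y1r] by simp
  from has_derivative_compose[OF dlin this]
  have "EX L. ((%q. ps (y1 + q *\<^sub>R v)) has_derivative (%q. L * q)) (at 0)"
  by (intro exI[of _ "g (?X y1) <.> (fst v *\<^sub>R (e1 + D1 u y1 *\<^sub>R n) + snd v *\<^sub>R (e2 + D2 u y1 *\<^sub>R n))"])
  (simp add: inner_add_right algebra_simps)
  then show ?thesis using that unfolding has_field_derivative_def by (metis (no_types, lifting))
 qed
 have L0: "L = 0"
 proof -
  have "open ((%q::real. y1 + q *\<^sub>R v) -` ball 0 r)" by (intro open_vimage continuous_intros) auto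
  moreover have "0 \<in> (%q::real. y1 + q *\<^sub>R v) -` ball 0 r" using y1r by simp
  ultimately obtain e where e: "e > 0" "ball 0 e \<subseteq> (%q::real. y1 + q *\<^sub>R v) -` ball 0 r"
  using open_contains_ball by blast
  show ?thesis
  by (rule DERIV_local_min[OF L e(1)]) (use e(2) nonneg psy1 in "auto simp: ps_def subset_eq")
 qed
 have hv: "h (y1 + q *\<^sub>R v) = exp (- al * ((1 - q)^2 * d^2)) - m" for q
 proof -
  have "y1 + q *\<^sub>R v - c = (1 - q) *\<^sub>R (y1 - c)" unfolding v_def by (simp add: algebra_simps)
  then have "dist (y1 + q *\<^sub>R v) c = \<bar>1 - q\<bar> * d" unfolding d_def dist_norm by simp
  then show ?thesis unfolding h_def by (simp add: power_mult_distrib)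
 qed
 have dist_v: "dist (y1 + q *\<^sub>R v) c = \<bar>1 - q\<bar> * d" for q
 proof -
  have "y1 + q *\<^sub>R v - c = (1 - q) *\<^sub>R (y1 - c)" unfolding v_def by (simp add: algebra_simps)
  then show ?thesis unfolding d_def dist_norm by simp
 qed
 have "DERIV f 0 :> L - eps * (2 * al * d^2 * exp (- al * d^2))"
  unfolding f_def F_def hv
  by (rule DERIV_diff[OF L]) (auto intro!: derivative_eq_intros simp: power2_eq_square)
 moreover have "L - eps * (2 * al * d^2 * exp (- al * d^2)) < 0"
  unfolding L0 using eps(1) alpos dpos by simp
 ultimately obtain e where e: "e > 0" "!!q. 0 < q ==> q < e ==> f (0 + q) < f 0"
  using DERIV_neg_dec_right by blast
 define q where "q = min (e / 2) (1 / 2)"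
 have q: "0 < q" "q < e" "q <= 1 / 2" using e(1) by (auto simp: q_def)
 have "y1 + q *\<^sub>R v \<in> A"
 proof -
  have "d / 2 <= (1 - q) * d" "(1 - q) * d <= d" using q dpos by (simp_all add: field_simps)
  then show ?thesis unfolding A_def mem_Collect_eq dist_v using q by simp
 qed
 then have "f q >= 0" unfolding f_def by (rule Fnn)
 moreover have "f 0 = 0" unfolding f_def F_def hv m_def by (simp add: psy1)
 ultimately show False using e(2)[of q] q by simp
qed

lemma continuous_locally_bounded:
 fixes f :: "real \<times> real => real"
 assumes "continuous_on (ball 0 dl) f" "dl > 0"
 shows "\<exists>r>0. r <= dl & (\<forall>z\<in>ball 0 r. \<bar>f z\<bar> <= \<bar>f 0\<bar> + 1)"
proof -
 have "isCont f 0" using assms by (auto simp: continuous_on_eq_continuous_at)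
 then obtain d where d: "d > 0" "!!z. dist z 0 < d ==> dist (f z) (f 0) < 1"
  unfolding continuous_at_eps_delta by (metis zero_less_one)
 show ?thesis
 proof (intro exI[of _ "min d dl"] conjI ballI)
  fix z :: "real \<times> real" assume "z \<in> ball 0 (min d dl)"
  then have "\<bar>f z - f 0\<bar> < 1" using d(2)[of z] by (simp add: dist_real_def)
  then show "\<bar>f z\<bar> <= \<bar>f 0\<bar> + 1" by linarith
 qed (use d assms in auto)
qed

lemma hss_bound:
 assumes "norm e1 = 1" "norm e2 = 1"
 shows "norm (hss e1 e2 u z v) <= (\<bar>D1 (D1 u) z\<bar> + \<bar>D2 (D1 u) z\<bar> + \<bar>D1 (D2 u) z\<bar> + \<bar>D2 (D2 u) z\<bar>) * norm v"
proof -
 have v: "\<bar>v <.> e1\<bar> <= norm v" "\<bar>v <.> e2\<bar> <= norm v"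
  using Cauchy_Schwarz_ineq2[of v e1] Cauchy_Schwarz_ineq2[of v e2] assms by auto
 have *: "\<bar>(v <.> e1) * a + (v <.> e2) * b\<bar> <= (\<bar>a\<bar> + \<bar>b\<bar>) * norm v" for a b
 proof -
  have "\<bar>(v <.> e1) * a\<bar> <= norm v * \<bar>a\<bar>" "\<bar>(v <.> e2) * b\<bar> <= norm v * \<bar>b\<bar>"
  unfolding abs_mult using v by (auto intro: mult_right_mono)
  then show ?thesis by (simp add: algebra_simps)
 qed
 have "norm (hss e1 e2 u z v) <= norm (((v <.> e1) * D1 (D1 u) z + (v <.> e2) * D2 (D1 u) z) *\<^sub>R e1)
  + norm (((v <.> e1) * D1 (D2 u) z + (v <.> e2) * D2 (D2 u) z) *\<^sub>R e2)"
  unfolding hss_def norm_minus_cancel by (rule norm_triangle_ineq)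
 also have "... <= (\<bar>D1 (D1 u) z\<bar> + \<bar>D2 (D1 u) z\<bar>) * norm v + (\<bar>D1 (D2 u) z\<bar> + \<bar>D2 (D2 u) z\<bar>) * norm v"
  unfolding norm_scaleR assms using * by (intro add_mono) auto
 finally show ?thesis by (simp add: algebra_simps)
qed

lemma norm_tau [simp]: "norm tau = 1" and tau_tau [simp]: "tau <.> tau = 1"
 by (simp_all add: norm_axis_1 inner_axis_axis)

text \<open>The order of the two surfaces is expressed by disjointness of small downward translates,
  which makes sense for vertical tangent planes too. The level function of \<open>M2\<close> has no
  zero on the connected family of lowered points of \<open>M1\<close>, so its sign is constant;
  letting the shift tend to 0 gives a weak sign on \<open>M1\<close>, and Hopf's argument applies to
  the level function or to its negative.\<close>

lemma strong_maximum_principle: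
 assumes M1: "translator_patch M1 p" "p \<in> M1" and M2: "translator_patch M2 p" "p \<in> M2"
  and eps: "eps > 0" and rh: "rh > 0"
  and disj: "!!x s. x \<in> M1 ==> dist x p < rh ==> 0 < s ==> s < eps ==> x - s *\<^sub>R tau \<notin> M2"
 shows "\<exists>r>0. \<forall>x\<in>M1. dist x p < r --> x \<in> M2"
proof -
 obtain e1 e2 n u dl eta where fr: "tframe M1 p e1 e2 n u dl eta" using translator_patch_tframe[OF M1] .
 obtain f1 f2 m w dl' eta' where fr': "tframe M2 p f1 f2 m w dl' eta'" using translator_patch_tframe[OF M2] .
 note t = tframeD[OF fr] and t' = tframeD[OF fr']
 let ?X = "graph_map p e1 e2 n u"
 define Ps where "Ps = lev p f1 f2 m w"
 define g where "g = (%x. nrm f1 f2 m w (proj p f1 f2 x))"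
 define H where "H = (%x. hss f1 f2 w (proj p f1 f2 x))"
 have c: "continuous_on (ball 0 dl') (D1 (D1 w))" "continuous_on (ball 0 dl') (D2 (D1 w))"
  "continuous_on (ball 0 dl') (D1 (D2 w))" "continuous_on (ball 0 dl') (D2 (D2 w))"
  "continuous_on (ball 0 dl) (D1 u)" "continuous_on (ball 0 dl) (D2 u)"
  by (intro smooth2_continuous smooth2_D t(4) t'(4))+
 have d': "dl' > 0" "dl > 0" using t t' by auto
 obtain r1 where r1: "r1 > 0" "r1 <= dl'" "!!z. z \<in> ball 0 r1 ==> \<bar>D1 (D1 w) z\<bar> <= \<bar>D1 (D1 w) 0\<bar> + 1"
  using continuous_locally_bounded[OF c(1) d'(1)] by blast
 obtain r2 where r2: "r2 > 0" "r2 <= dl'" "!!z. z \<in> ball 0 r2 ==> \<bar>D2 (D1 w) z\<bar> <= \<bar>D2 (D1 w) 0\<bar> + 1"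
  using continuous_locally_bounded[OF c(2) d'(1)] by blast
 obtain r3 where r3: "r3 > 0" "r3 <= dl'" "!!z. z \<in> ball 0 r3 ==> \<bar>D1 (D2 w) z\<bar> <= \<bar>D1 (D2 w) 0\<bar> + 1"
  using continuous_locally_bounded[OF c(3) d'(1)] by blast
 obtain r4 where r4: "r4 > 0" "r4 <= dl'" "!!z. z \<in> ball 0 r4 ==> \<bar>D2 (D2 w) z\<bar> <= \<bar>D2 (D2 w) 0\<bar> + 1"
  using continuous_locally_bounded[OF c(4) d'(1)] by blast
 obtain r5 where r5: "r5 > 0" "r5 <= dl" "!!z. z \<in> ball 0 r5 ==> \<bar>D1 u z\<bar> <= \<bar>D1 u 0\<bar> + 1"
  using continuous_locally_bounded[OF c(5) d'(2)] by blast
 obtain r6 where r6: "r6 > 0" "r6 <= dl" "!!z. z \<in> ball 0 r6 ==> \<bar>D2 u z\<bar> <= \<bar>D2 u 0\<bar> + 1"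
  using continuous_locally_bounded[OF c(6) d'(2)] by blast
 define C where "C = (\<bar>D1 (D1 w) 0\<bar> + 1) + (\<bar>D2 (D1 w) 0\<bar> + 1) + (\<bar>D1 (D2 w) 0\<bar> + 1) + (\<bar>D2 (D2 w) 0\<bar> + 1)"
 define B where "B = 1 + (\<bar>D1 u 0\<bar> + 1)^2 + (\<bar>D2 u 0\<bar> + 1)^2"
 define k where "k = min (min r1 r2) (min r3 r4)"
 have k: "k > 0" "k <= dl'" using r1 r2 r3 r4 by (auto simp: k_def)
 define T where "T = ball p k"
 have T: "open T" by (simp add: T_def)
 have pk: "proj p f1 f2 x \<in> ball 0 k" if "x \<in> T" for x
  using norm_proj_le[OF t'(1), of p x] that by (simp add: T_def dist_norm norm_minus_commute)
 then have pr: "proj p f1 f2 x \<in> ball 0 dl'" if "x \<in> T" for x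
  using that k(2) by fastforce
 have dPs: "(Ps has_derivative (%v. g x <.> v)) (at x)" if "x \<in> T" for x
  unfolding Ps_def g_def by (rule lev_has_derivative[OF smooth2_differentiable[OF t'(4) pr[OF that]]])
 have dH: "(g has_derivative H x) (at x)" if "x \<in> T" for x
  unfolding g_def H_def by (intro nrm_has_derivative smooth2_differentiable[OF smooth2_D(1)[OF t'(4)]]
  smooth2_differentiable[OF smooth2_D(2)[OF t'(4)]] pr that)
 have leq: "(g x <.> g x) * (tr3 (H x) + g x <.> tau) = H x (g x) <.> g x" if "x \<in> T" for x
  unfolding g_def H_def by (rule tframe_level_equation(1)[OF fr' pr[OF that]])
 have g1: "norm (g x) >= 1" if "x \<in> T" for x
 proof -
  have "1 <= g x <.> g x" unfolding g_def tframe_level_equation(2)[OF fr' pr[OF that]] by simp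
  then show ?thesis by (simp add: norm_eq_sqrt_inner)
 qed
 have Cb: "norm (H x v) <= C * norm v" if "x \<in> T" for x v
 proof -
  let ?z = "proj p f1 f2 x"
  have "?z \<in> ball 0 r1" "?z \<in> ball 0 r2" "?z \<in> ball 0 r3" "?z \<in> ball 0 r4" using pk[OF that] by (auto simp: k_def)
  then have "\<bar>D1 (D1 w) ?z\<bar> + \<bar>D2 (D1 w) ?z\<bar> + \<bar>D1 (D2 w) ?z\<bar> + \<bar>D2 (D2 w) ?z\<bar> <= C"
  unfolding C_def using r1(3) r2(3) r3(3) r4(3) by (intro add_mono) auto
  then have "(\<bar>D1 (D1 w) ?z\<bar> + \<bar>D2 (D1 w) ?z\<bar> + \<bar>D1 (D2 w) ?z\<bar> + \<bar>D2 (D2 w) ?z\<bar>) * norm v <= C * norm v"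
  by (rule mult_right_mono) simp
  moreover have "norm f1 = 1" "norm f2 = 1" using t'(1) unfolding orthonormal3_def by auto
  ultimately show ?thesis unfolding H_def using hss_bound[of f1 f2 w ?z v] by linarith
 qed
 have C0: "C >= 0" unfolding C_def by simp
 have cX: "continuous_on (ball 0 dl) ?X" by (rule graph_map_continuous[OF smooth2_continuous[OF t(4)]])
 then have "isCont ?X 0" using d' by (simp add: continuous_on_eq_continuous_at)
 moreover have X0: "?X 0 = p" using t(5) by (simp add: graph_map_def zero_prod_def)
 moreover have "min (k / 2) rh > 0" using k rh by simp
 ultimately obtain r7 where r7: "r7 > 0" "!!z. dist z 0 < r7 ==> dist (?X z) p < min (k / 2) rh"
  unfolding continuous_at_eps_delta by metis
 define r where "r = min (min r5 r6) (min r7 eta)"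
 have r: "r > 0" "r <= r5" "r <= r6" "r <= r7" "r <= eta" "r <= dl" using r5 r6 r7 t(2,3) by (auto simp: r_def)
 have Bb: "1 + (D1 u y)^2 + (D2 u y)^2 <= B" if "y \<in> ball 0 r" for y
 proof -
  have "\<bar>D1 u y\<bar> <= \<bar>D1 u 0\<bar> + 1" "\<bar>D2 u y\<bar> <= \<bar>D2 u 0\<bar> + 1" using r5(3)[of y] r6(3)[of y] that r by auto
  note ab = this
  have "\<bar>D1 u y\<bar>\<^sup>2 <= (\<bar>D1 u 0\<bar> + 1)^2" "\<bar>D2 u y\<bar>\<^sup>2 <= (\<bar>D2 u 0\<bar> + 1)^2"
  by (rule power_mono[OF ab(1)], simp, rule power_mono[OF ab(2)], simp)
  then show ?thesis unfolding B_def by simp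
 qed
 have XT: "?X y \<in> T" if "y \<in> ball 0 r" for y using r7(2)[of y] that r k by (auto simp: T_def dist_commute)
 have XM: "?X y \<in> M1" if "y \<in> ball 0 r" for y using tframe_graph_in[OF fr] that r by auto
 have cPsi: "continuous_on T Ps" using dPs by (meson continuous_at_imp_continuous_on has_derivative_continuous)
 define eps' where "eps' = min eps (k / 2)"
 have e': "eps' > 0" using eps k by (simp add: eps'_def)
 \<comment> \<open>Parameters of the patch of \<open>M1\<close> together with the size of the
   downward shift.\<close>
 define P where "P = ball (0 :: real \<times> real) r \<times> {0<..<eps'}"
 define Ph where "Ph = (%(y, s). Ps (?X y - s *\<^sub>R tau))"
 have inT: "?X y - s *\<^sub>R tau \<in> T" if "y \<in> ball 0 r" "0 <= s" "s < k / 2" for y s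
 proof -
  have "dist (?X y - s *\<^sub>R tau) p <= dist (?X y) p + s"
  unfolding dist_norm using norm_triangle_ineq4[of "?X y - p" "s *\<^sub>R tau"] that(2) by (simp add: algebra_simps)
  also have "... < k" using r7(2)[of y] that r by auto
  finally show ?thesis by (simp add: T_def dist_commute)
 qed
 have nz: "Ph q ~= 0" if "q \<in> P" for q
 proof -
  obtain y s where q0: "q = (y, s)" by fastforce
  have q: "q = (y, s)" "y \<in> ball 0 r" "0 < s" "s < eps'" using that q0 unfolding P_def by auto
  have "?X y - s *\<^sub>R tau \<notin> M2"
  using disj[OF XM[OF q(2)]] r7(2)[of y] q r by (auto simp: eps'_def)
  moreover have "?X y - s *\<^sub>R tau \<in> ball p dl'"
  using inT[OF q(2), of s] q(3,4) k(2) unfolding eps'_def T_def by (auto intro: less_le_trans)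
  ultimately show ?thesis using t'(6) unfolding Ph_def q Ps_def by simp
 qed
 have conP: "connected P" unfolding P_def by (intro connected_Times convex_connected convex_ball) auto
 have cPhi: "continuous_on P Ph"
 proof -
  have "continuous_on P (%q. ?X (fst q) - snd q *\<^sub>R tau)"
  by (intro continuous_intros continuous_on_compose2[OF cX]) (use r(6) in "auto simp: P_def")
  then have "continuous_on P (%q. Ps (?X (fst q) - snd q *\<^sub>R tau))"
  by (rule continuous_on_compose2[OF cPsi]) (use inT in "auto simp: P_def eps'_def")
  then show ?thesis unfolding Ph_def by (simp add: case_prod_unfold)
 qed
 have lim: "((%s. Ph (y, s)) \<longlongrightarrow> Ps (?X y)) (at_right 0)" if "y \<in> ball 0 r" for y
 proof -
  have "isCont Ps (?X y - 0 *\<^sub>R tau)" using cPsi T XT[OF that] by (simp add: continuous_on_eq_continuous_at)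
  moreover have "isCont (%s. ?X y - s *\<^sub>R tau) 0" by (intro continuous_intros)
  ultimately have "isCont (%s. Ps (?X y - s *\<^sub>R tau)) 0" by (rule isCont_o2[rotated])
  then show ?thesis unfolding Ph_def isCont_def by (auto intro: filterlim_at_split[THEN iffD1, THEN conjunct2])
 qed
 have ev: "\<forall>\<^sub>F s in at_right 0. s \<in> {0<..<eps'}" using e' eventually_at_right_real by blast
 have "\<exists>r'>0. \<forall>y\<in>ball 0 r'. Ps (?X y) = 0"
 proof (cases "\<exists>q\<in>P. Ph q > 0")
  case True
  have allpos: "Ph q > 0" if "q \<in> P" for q
  proof (rule ccontr)
  assume "\<not> Ph q > 0"
  then have "0 \<in> Ph ` P"
  using connectedD_interval[OF connected_continuous_image[OF cPhi conP], of "Ph q" _ 0] True that by fastforce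
  then show False using nz by auto
  qed
  have nonneg: "Ps (?X y) >= 0" if "y \<in> ball 0 r" for y
  by (rule tendsto_lowerbound[OF lim[OF that]])
  (use ev in "auto elim!: eventually_mono intro!: less_imp_le allpos simp: P_def that[simplified]")
  show ?thesis
  by (rule hopf_translator[OF fr r(1,6) T XT dPs dH leq g1 Cb C0 Bb nonneg])
  (use t'(5) in "auto simp: Ps_def lev_def zero_prod_def")
 next
  case False
  then have allneg: "Ph q < 0" if "q \<in> P" for q using nz[OF that] that by force
  have nonneg: "- Ps (?X y) >= 0" if "y \<in> ball 0 r" for y
  proof -
  have "Ps (?X y) <= 0"
  by (rule tendsto_upperbound[OF lim[OF that]])
  (use ev in "auto elim!: eventually_mono intro!: less_imp_le allneg simp: P_def that[simplified]")
  then show ?thesis by simp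
  qed
  have d1: "((%x. - Ps x) has_derivative (%v. (- g x) <.> v)) (at x)" if "x \<in> T" for x
  using has_derivative_minus[OF dPs[OF that]] by simp
  have d2: "((%x. - g x) has_derivative (%v. - H x v)) (at x)" if "x \<in> T" for x
  by (rule has_derivative_minus[OF dH[OF that]])
  have leq': "((- g x) <.> (- g x)) * (tr3 (%v. - H x v) + (- g x) <.> tau) = (- H x (- g x)) <.> (- g x)" if "x \<in> T" for x
  proof -
  have "H x (- g x) = - H x (g x)" using has_derivative_linear[OF dH[OF that]] by (rule linear_neg)
  then show ?thesis using leq[OF that] tr3_minus[of "H x"] by (simp add: algebra_simps)
  qed
  have "\<exists>r'>0. \<forall>y\<in>ball 0 r'. - Ps (?X y) = 0"
  by (rule hopf_translator[OF fr r(1,6) T XT d1 d2 leq' _ _ C0 Bb nonneg])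
  (use t'(5) g1 Cb in "auto simp: Ps_def lev_def zero_prod_def")
  then show ?thesis by simp
 qed
 then obtain r' where r': "r' > 0" "!!y. y \<in> ball 0 r' ==> Ps (?X y) = 0" by blast
 define r'' where "r'' = min (min r' r) dl"
 have r'': "r'' > 0" using r' r d' by (simp add: r''_def)
 have "x \<in> M2" if x: "x \<in> M1" "dist x p < r''" for x
 proof -
  have xb: "x \<in> ball p dl" using x by (simp add: r''_def dist_commute)
  let ?y = "proj p e1 e2 x"
  have "norm ?y < r''" using norm_proj_le[OF t(1), of p x] x by (simp add: dist_norm)
  then have y: "?y \<in> ball 0 r'" "?y \<in> ball 0 r" by (auto simp: r''_def)
  have "?X ?y = x" using graph_map_proj[OF t(1)] t(6)[OF xb] x by blast
  moreover have "?X ?y \<in> ball p dl'" using XT[OF y(2)] k by (auto simp: T_def)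
  ultimately show ?thesis using r'(2)[OF y(1)] t'(6)[of x] unfolding Ps_def by simp
 qed
 then show ?thesis using r'' by blast
qed

text \<open>The frame is moved along and the graph function is unchanged.\<close>

lemma translator_patch_isometry:
 assumes L: "orthogonal_transformation L" "L tau = tau" and M: "translator_patch M p"
 shows "translator_patch ((%x. L x + c) ` M) (L p + c)"
proof -
 obtain e1 e2 n U u r where P: "orthonormal3 e1 e2 n" "open U" "smooth2 U u" "r > 0"
  "M \<inter> ball p r = graph_map p e1 e2 n u ` U \<inter> ball p r"
  "\<forall>z\<in>U. graph_mean_curv u z = graph_normal e1 e2 n u z <.> tau"
  using M unfolding translator_patch_def by blast
 have lin: "linear L" using L(1) orthogonal_transformation_linear by blast
 have inner: "L x <.> L y = x <.> y" for x y using L(1) unfolding orthogonal_transformation_def by blast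
 have on: "orthonormal3 (L e1) (L e2) (L n)"
  using P(1) unfolding orthonormal3_def by (simp add: inner orthogonal_transformation_norm[OF L(1)])
 have gm: "graph_map (L p + c) (L e1) (L e2) (L n) u z = L (graph_map p e1 e2 n u z) + c" for z
  unfolding graph_map_def by (cases z) (simp add: linear_add[OF lin] linear_scale[OF lin])
 have dist: "dist (L x + c) (L y + c) = dist x y" for x y
  unfolding dist_norm using orthogonal_transformation_norm[OF L(1), of "x - y"] by (simp add: linear_diff[OF lin])
 have inj: "L x + c = L y + c \<longleftrightarrow> x = y" for x y using dist[of x y] by (metis dist_eq_0_iff)
 have "(%x. L x + c) ` M \<inter> ball (L p + c) r = (%x. L x + c) ` (M \<inter> ball p r)"
  using dist by auto
 also have "... = (%x. L x + c) ` (graph_map p e1 e2 n u ` U \<inter> ball p r)" unfolding P(5) ..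
 also have "... = graph_map (L p + c) (L e1) (L e2) (L n) u ` U \<inter> ball (L p + c) r"
  using dist gm by auto
 finally have im: "(%x. L x + c) ` M \<inter> ball (L p + c) r = graph_map (L p + c) (L e1) (L e2) (L n) u ` U \<inter> ball (L p + c) r" .
 have "graph_normal (L e1) (L e2) (L n) u z = L (graph_normal e1 e2 n u z)" for z
  unfolding graph_normal_def by (simp add: linear_diff[OF lin] linear_scale[OF lin])
 then have "graph_normal (L e1) (L e2) (L n) u z <.> tau = graph_normal e1 e2 n u z <.> tau" for z
  by (metis L(2) inner)
 then show ?thesis unfolding translator_patch_def using on P im by metis
qed

section \<open>Barriers: confinement of \<open>M\<close> and the bound from below\<close>

text \<open>If the bound fails, compactness gives a minimum of \<open>G\<close> over time and
  surface, at a time later than \<open>a\<close>. Minimality in space yields the touching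
  inequality, so \<open>strict\<close> makes \<open>G\<close> increasing in time there, and a
  slightly earlier time has a smaller value.\<close>

lemma moving_barrier:
 assumes M: "!!p. p \<in> M ==> translator_patch M p" and ab: "a <= b"
  and cont: "continuous_on UNIV (%(t, y). G t y)"
  and comp: "compact {(t, y). a <= t & t <= b & y \<in> M & G t y <= c}"
  and init: "!!y. y \<in> M ==> G a y > c"
  and grad: "!!t y. ((G t) has_derivative (%v. g t y <.> v)) (at y)"
  and hess: "!!t y. ((g t) has_derivative H t y) (at y)"
  and time: "!!t y. DERIV (%t. G t y) t :> G' t y"
  and strict: "!!t y N. y \<in> M ==> N ~= 0 ==> H t y N <.> N <= (N <.> N) * (tr3 (H t y) + g t y <.> tau) ==> G' t y > 0"
  and t: "a <= t" "t <= b" and y: "y \<in> M"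
 shows "G t y > c"
proof (rule ccontr)
 assume neg: "\<not> G t y > c"
 define S where "S = {(t, y). a <= t & t <= b & y \<in> M & G t y <= c}"
 have "(t, y) \<in> S" using neg t y unfolding S_def by auto
 then have "S ~= {}" by blast
 moreover have "continuous_on S (%(t, y). G t y)" using cont continuous_on_subset by blast
 ultimately obtain q where q: "q \<in> S" "!!q'. q' \<in> S ==> (%(t, y). G t y) q <= (%(t, y). G t y) q'"
  using continuous_attains_inf[OF comp[folded S_def]] by metis
 obtain t0 y0 where q0: "q = (t0, y0)" by fastforce
 have 0: "a <= t0" "t0 <= b" "y0 \<in> M" "G t0 y0 <= c" using q(1) unfolding S_def q0 by auto
 have min: "G t0 y0 <= G t y" if "a <= t" "t <= b" "y \<in> M" for t y
 proof (cases "G t y <= c")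
  case True
  then show ?thesis using q(2)[of "(t, y)"] that unfolding S_def q0 by auto
 qed (use 0 in auto)
 have "t0 ~= a" using init[OF 0(3)] 0(4) by auto
 then have t0: "a < t0" using 0 by simp
 obtain N where N: "N ~= 0" "H t0 y0 N <.> N <= (N <.> N) * (tr3 (H t0 y0) + g t0 y0 <.> tau)"
  by (rule tframe_local_min_set[OF M[OF 0(3)] 0(3) open_UNIV UNIV_I grad hess]) (use min 0 in auto)
 have "G' t0 y0 > 0" by (rule strict[OF 0(3) N])
 then obtain d where d: "d > 0" "!!h. 0 < h ==> h < d ==> G (t0 - h) y0 < G t0 y0"
  using DERIV_pos_inc_left[OF time] by blast
 define h where "h = min (d / 2) (t0 - a)"
 have "0 < h" "h < d" "h <= t0 - a" using d t0 by (auto simp: h_def)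
 then show False using d(2)[of h] min[of "t0 - h" y0] 0 by auto
qed

lemma compact_subset_closed:
 fixes A :: "(real \<times> (real^3)) set"
 assumes "closed A" "A \<subseteq> {a..b} \<times> cball c r"
 shows "compact A"
proof -
 have "compact (({a..b} \<times> cball c r) \<inter> A)"
  by (intro compact_Int_closed compact_Times compact_Icc compact_cball assms(1))
 then show ?thesis using assms(2) by (simp add: Int_absorb1)
qed

definition hr :: "real^3 => real" where "hr x = (x $ 1)^2 + (x $ 2)^2"

lemma tau_nth [simp]: "tau $ 1 = 0" "tau $ 2 = 0" "tau $ 3 = 1"
 by (simp_all add: axis_def)

lemma inner3: "x <.> y = x $ 1 * y $ 1 + x $ 2 * y $ 2 + x $ 3 * y $ (3 :: 3)" for x y :: "real^3"
 unfolding inner_vec_def by (simp add: sum_3)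

lemma norm3: "(norm x)^2 = hr x + (x $ 3)^2" for x :: "real^3"
 unfolding power2_norm_eq_inner inner3 hr_def by (simp add: power2_eq_square)

lemma inner_tau [simp]: "x <.> tau = x $ 3"
 unfolding inner3 by simp

lemma vec3_eq: "x = y \<longleftrightarrow> x $ 1 = y $ 1 & x $ 2 = y $ 2 & x $ 3 = y $ (3::3)" for x y :: "real^3"
 unfolding vec_eq_iff forall_3 by blast

lemma hr_nonneg [simp]: "hr x >= 0" by (simp add: hr_def)

text \<open>The hypothesis at time \<open>- T\<close> with the rescaling undone: the origin of the
  rescaled picture is the point at height \<open>T\<close> on the axis, and its unit of length is
  \<open>sqrt T\<close>.\<close>

lemma convergesE:
 assumes "converges_to_cylinder M" "R > 0" "eps > 0"
 obtains T0 where "T0 > 0" "!!T. T >= T0 ==> EX w. smooth2 UNIV w & (ALL th z. w (th + 2 * pi, z) = w (th, z)) &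
  (ALL i j th z. i + j <= k & \<bar>z\<bar> <= R --> \<bar>(D1 ^^ i) ((D2 ^^ j) w) (th, z)\<bar> <= eps) &
  (ALL x. norm (x - T *\<^sub>R tau) < R * sqrt T -->
  (x \<in> M \<longleftrightarrow> (EX th. x = vector [sqrt T * (sqrt 2 + w (th, (x $ 3 - T) / sqrt T)) * cos th,
  sqrt T * (sqrt 2 + w (th, (x $ 3 - T) / sqrt T)) * sin th, x $ 3])))"
proof -
 have "\<forall>\<^sub>F t in at_bot. EX w. smooth2 UNIV w & (ALL th z. w (th + 2 * pi, z) = w (th, z)) &
  (ALL i j th z. i + j <= k & \<bar>z\<bar> <= R --> \<bar>(D1 ^^ i) ((D2 ^^ j) w) (th, z)\<bar> <= eps) &
  rescaled_flow M t \<inter> ball 0 R = cyl_map w ` UNIV \<inter> ball 0 R"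
  using assms unfolding converges_to_cylinder_def by blast
 then obtain N where N: "!!t. t <= N ==> EX w. smooth2 UNIV w & (ALL th z. w (th + 2 * pi, z) = w (th, z)) &
  (ALL i j th z. i + j <= k & \<bar>z\<bar> <= R --> \<bar>(D1 ^^ i) ((D2 ^^ j) w) (th, z)\<bar> <= eps) &
  rescaled_flow M t \<inter> ball 0 R = cyl_map w ` UNIV \<inter> ball 0 R"
  unfolding eventually_at_bot_linorder by blast
 show ?thesis
 proof (rule that[of "\<bar>N\<bar> + 1"])
  fix T assume T: "T >= \<bar>N\<bar> + 1"
  then have Tp: "T > 0" "- T <= N" by auto
  define s where "s = sqrt T"
  have s: "s > 0" using Tp by (simp add: s_def)
  obtain w where w: "smooth2 UNIV w" "ALL th z. w (th + 2 * pi, z) = w (th, z)"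
  "ALL i j th z. i + j <= k & \<bar>z\<bar> <= R --> \<bar>(D1 ^^ i) ((D2 ^^ j) w) (th, z)\<bar> <= eps"
  "rescaled_flow M (- T) \<inter> ball 0 R = cyl_map w ` UNIV \<inter> ball 0 R"
  using N[OF Tp(2)] by blast
  have "x \<in> M \<longleftrightarrow> (EX th. x = vector [s * (sqrt 2 + w (th, (x $ 3 - T) / s)) * cos th,
  s * (sqrt 2 + w (th, (x $ 3 - T) / s)) * sin th, x $ 3])" if x: "norm (x - T *\<^sub>R tau) < R * s" for x
  proof -
  define y where "y = (1 / s) *\<^sub>R (x - T *\<^sub>R tau)"
  have "norm y = norm (x - T *\<^sub>R tau) / s" unfolding y_def norm_scaleR using s by simp
  then have yb: "y \<in> ball 0 R" using x s by (simp add: pos_divide_less_eq)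
  have yn: "y $ 1 = x $ 1 / s" "y $ 2 = x $ 2 / s" "y $ 3 = (x $ 3 - T) / s"
  unfolding y_def by simp_all
  have "y \<in> rescaled_flow M (- T) \<longleftrightarrow> x \<in> M"
  proof
  assume "y \<in> rescaled_flow M (- T)"
  then obtain x' where "x' \<in> M" "y = (1 / s) *\<^sub>R (x' - T *\<^sub>R tau)"
  unfolding rescaled_flow_def s_def by auto
  then show "x \<in> M" using s unfolding y_def by simp
  next
  assume "x \<in> M"
  then show "y \<in> rescaled_flow M (- T)" unfolding rescaled_flow_def s_def y_def by auto
  qed
  then have "x \<in> M \<longleftrightarrow> y \<in> cyl_map w ` UNIV" using w(4) yb by blast
  also have "... \<longleftrightarrow> (EX th. y = vector [(sqrt 2 + w (th, y $ 3)) * cos th, (sqrt 2 + w (th, y $ 3)) * sin th, y $ 3])"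
  unfolding cyl_map_def by (force simp: image_iff)
  also have "... \<longleftrightarrow> (EX th. x = vector [s * (sqrt 2 + w (th, y $ 3)) * cos th, s * (sqrt 2 + w (th, y $ 3)) * sin th, x $ 3])"
  unfolding vec3_eq vector_3 yn(1,2) using s by (simp add: field_simps)
  finally show ?thesis unfolding yn(3) .
  qed
  then show "EX w. smooth2 UNIV w & (ALL th z. w (th + 2 * pi, z) = w (th, z)) &
  (ALL i j th z. i + j <= k & \<bar>z\<bar> <= R --> \<bar>(D1 ^^ i) ((D2 ^^ j) w) (th, z)\<bar> <= eps) &
  (ALL x. norm (x - T *\<^sub>R tau) < R * sqrt T -->
  (x \<in> M \<longleftrightarrow> (EX th. x = vector [sqrt T * (sqrt 2 + w (th, (x $ 3 - T) / sqrt T)) * cos th,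
  sqrt T * (sqrt 2 + w (th, (x $ 3 - T) / sqrt T)) * sin th, x $ 3])))"
  using w(1-3) unfolding s_def by blast
 qed simp
qed

lemma near_cylinder:
 assumes "converges_to_cylinder M" "R > 0" "eps > 0"
 shows "\<exists>T0>0. \<forall>T\<ge>T0. \<forall>x\<in>M. norm (x - T *\<^sub>R tau) < R * sqrt T --> \<bar>sqrt (hr x) - sqrt 2 * sqrt T\<bar> <= eps * sqrt T"
proof -
 obtain T0 where T0: "T0 > 0" "!!T. T >= T0 ==> EX w. smooth2 UNIV w & (ALL th z. w (th + 2 * pi, z) = w (th, z)) &
  (ALL i j th z. i + j <= 0 & \<bar>z\<bar> <= R --> \<bar>(D1 ^^ i) ((D2 ^^ j) w) (th, z)\<bar> <= eps) &
  (ALL x. norm (x - T *\<^sub>R tau) < R * sqrt T -->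
  (x \<in> M \<longleftrightarrow> (EX th. x = vector [sqrt T * (sqrt 2 + w (th, (x $ 3 - T) / sqrt T)) * cos th,
  sqrt T * (sqrt 2 + w (th, (x $ 3 - T) / sqrt T)) * sin th, x $ 3])))"
  by (rule convergesE[OF assms, of 0]) blast
 have "\<bar>sqrt (hr x) - sqrt 2 * sqrt T\<bar> <= eps * sqrt T" if T: "T >= T0" and x: "x \<in> M" "norm (x - T *\<^sub>R tau) < R * sqrt T" for T x
 proof -
  define s where "s = sqrt T"
  have s: "s > 0" using T T0 by (simp add: s_def)
  from T0(2)[OF T] obtain w where w1: "ALL i j th z. i + j <= 0 & \<bar>z\<bar> <= R --> \<bar>(D1 ^^ i) ((D2 ^^ j) w) (th, z)\<bar> <= eps"
  and w2: "ALL x. norm (x - T *\<^sub>R tau) < R * sqrt T -->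
  (x \<in> M \<longleftrightarrow> (EX th. x = vector [sqrt T * (sqrt 2 + w (th, (x $ 3 - T) / sqrt T)) * cos th,
  sqrt T * (sqrt 2 + w (th, (x $ 3 - T) / sqrt T)) * sin th, x $ 3]))"
  by (elim exE conjE) (rule that)
  obtain th where w: "x = vector [s * (sqrt 2 + w (th, (x $ 3 - T) / s)) * cos th,
  s * (sqrt 2 + w (th, (x $ 3 - T) / s)) * sin th, x $ 3]"
  using w2[rule_format, OF x(2)] x(1) unfolding s_def by blast
  have "\<bar>x $ 3 - T\<bar> <= norm (x - T *\<^sub>R tau)" using component_le_norm_cart[of "x - T *\<^sub>R tau" 3] by simp
  then have "\<bar>(x $ 3 - T) / s\<bar> <= R" using x(2) s unfolding s_def[symmetric] by (simp add: field_simps)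
  then have wb: "\<bar>w (th, (x $ 3 - T) / s)\<bar> <= eps" using w1[rule_format, of 0 0] by simp
  define r where "r = s * (sqrt 2 + w (th, (x $ 3 - T) / s))"
  have x12: "x $ 1 = r * cos th" "x $ 2 = r * sin th" using w unfolding r_def vec3_eq by simp_all
  have "hr x = r^2 * ((cos th)^2 + (sin th)^2)" unfolding hr_def x12 by (simp only: power_mult_distrib distrib_left)
  then have hr: "sqrt (hr x) = \<bar>r\<bar>" by simp
  have "\<bar>\<bar>r\<bar> - sqrt 2 * s\<bar> <= \<bar>r - sqrt 2 * s\<bar>" using abs_triangle_ineq3[of r "sqrt 2 * s"] s by simp
  also have "... = s * \<bar>w (th, (x $ 3 - T) / s)\<bar>" unfolding r_def using s by (simp add: algebra_simps abs_mult)
  also have "... <= s * eps" using wb s by (intro mult_left_mono) auto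
  finally show ?thesis unfolding hr s_def by (simp add: mult.commute)
 qed
 then show ?thesis using T0(1) by blast
qed

text \<open>A fixed ball for the flow is, seen from \<open>M\<close>, a ball sinking at unit speed.
  Spheres moving by mean curvature lose 4 in squared radius per unit time; losing 5 makes the
  barrier strict. The ball starts at height \<open>T\<close> away from the almost cylindrical part
  of \<open>M\<close>, and if \<open>x\<close> were too far from the axis it would still contain
  \<open>x\<close> on reaching the height of \<open>x\<close>.\<close>

lemma sphere_confinement:
 assumes M: "properly_embedded_translator M" "converges_to_cylinder M"
 shows "\<exists>r0>0. \<forall>x\<in>M. r0^2 <= hr x --> hr x < 100 * \<bar>x $ 3\<bar>"
proof -
 have cl: "closed M" and pt: "!!p. p \<in> M ==> translator_patch M p"
  using M(1) unfolding properly_embedded_translator_def by auto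
 obtain T0 where T0: "T0 > 0" "!!T x. T >= T0 ==> x \<in> M ==> norm (x - T *\<^sub>R tau) < 10 * sqrt T ==>
  \<bar>sqrt (hr x) - sqrt 2 * sqrt T\<bar> <= (1 / 50) * sqrt T"
  using near_cylinder[OF M(2), of 10 "1/50"] by auto
 have "hr x < 100 * \<bar>x $ 3\<bar>" if x: "x \<in> M" "(4 * sqrt T0)^2 <= hr x" for x
 proof (rule ccontr)
  assume "\<not> hr x < 100 * \<bar>x $ 3\<bar>"
  define r where "r = sqrt (hr x)"
  define z where "z = x $ 3"
  have r2: "r^2 = hr x" by (simp add: r_def)
  have z: "\<bar>z\<bar> <= r^2 / 100" using \<open>\<not> hr x < 100 * \<bar>x $ 3\<bar>\<close> unfolding r2 z_def by simp
  have r: "r >= 4 * sqrt T0" using x(2) T0(1) unfolding r2[symmetric] by (simp add: r_def real_le_rsqrt)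
  then have rp: "r > 0" using T0(1) by (smt (verit) real_sqrt_gt_zero)
  \<comment> \<open>With this choice the cylinder at height \<open>T\<close> has radius about
    \<open>sqrt 2 * r / 4\<close>, below \<open>19 / 50 * r\<close> including the error, and
    \<open>T\<close> dominates the height \<open>z\<close>, which is at most
    \<open>r^2 / 100\<close>.\<close>
  define T where "T = r^2 / 16"
  have T: "T >= T0"
  using power_mono[OF r, of 2] T0(1) unfolding T_def by (simp add: power_mult_distrib)
  have sT: "sqrt T = r / 4" unfolding T_def using rp by (simp add: real_sqrt_divide)
  define e where "e = (vector [x $ 1 / r, x $ 2 / r, 0] :: real^3)"
  have e: "e $ 1 = x $ 1 / r" "e $ 2 = x $ 2 / r" "e $ 3 = 0" unfolding e_def by simp_all
  have ne: "norm e = 1"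
  proof -
  have "(norm e)^2 = hr x / r^2" unfolding norm3 hr_def e by (simp add: power_divide add_divide_distrib)
  also have "... = 1" using rp r2[symmetric] by simp
  finally show ?thesis by (metis norm_ge_zero real_sqrt_one real_sqrt_unique)
  qed
  \<comment> \<open>The initial ball of radius \<open>r\<close> keeps horizontal distance at least
    \<open>2 / 5 * r\<close> from the axis, more than \<open>19 / 50 * r\<close>. At the end
    \<open>x\<close> is at distance \<open>2 / 5 * r\<close> from the centre, and
    \<open>(2 / 5)^2 + 5 * (1 / 16 + 1 / 100) < 1\<close> places it inside the shrunken
    ball.\<close>
  define c where "c = (7 / 5 * r) *\<^sub>R e"
  have nc: "norm c = 7 / 5 * r" unfolding c_def using ne rp by simp
  have ct: "c $ 3 = 0" unfolding c_def by (simp add: e)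
  define G where "G = (%t y. (y - c + t *\<^sub>R tau) <.> (y - c + t *\<^sub>R tau) + 5 * (t + T))"
  have "G (- z) x > r^2"
  proof (rule moving_barrier[OF pt, where G = G and t = "- z" and y = x and a = "- T" and b = "- z" and g = "%t y. 2 *\<^sub>R (y - c + t *\<^sub>R tau)"
  and H = "%t y v. 2 *\<^sub>R v" and G' = "%t y. 2 * ((y - c + t *\<^sub>R tau) <.> tau) + 5"])
  show "- T <= - z" using z rp unfolding T_def by (simp add: abs_le_iff field_simps)
  then show "- T <= - z" .
  show "- z <= - z" "x \<in> M" using x by auto
  show cG: "continuous_on UNIV (%(t, y). G t y)"
  unfolding G_def case_prod_unfold by (intro continuous_intros)
  show "compact {(t, y). - T <= t & t <= - z & y \<in> M & G t y <= r^2}" (is "compact ?S")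
  proof -
  have "?S = ({- T..- z} \<times> M) \<inter> {q. (%(t, y). G t y) q <= r^2}" by auto
  moreover have "closed {q. (%(t, y). G t y) q <= r^2}"
  using cG by (intro closed_Collect_le) auto
  ultimately have "closed ?S" using cl by (auto intro!: closed_Int closed_Times)
  moreover have "?S \<subseteq> {- T..- z} \<times> cball 0 (r + norm c + (T + \<bar>z\<bar>))"
  proof
  fix q assume "q \<in> ?S"
  then obtain t y where q: "q = (t, y)" "- T <= t" "t <= - z" "G t y <= r^2" by auto
  have "(norm (y - c + t *\<^sub>R tau))^2 <= r^2" using q unfolding G_def power2_norm_eq_inner by simp
  then have "norm (y - c + t *\<^sub>R tau) <= r" using rp by (simp add: power2_le_iff_abs_le)
  moreover have "norm y <= norm (y - c + t *\<^sub>R tau) + norm c + norm (t *\<^sub>R tau)"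
  using norm_triangle_ineq4[of "(y - c + t *\<^sub>R tau) + c" "t *\<^sub>R tau"] norm_triangle_ineq[of "y - c + t *\<^sub>R tau" c] by simp
  moreover have "norm (t *\<^sub>R tau) <= T + \<bar>z\<bar>" using q T T0(1) by (auto simp: abs_le_iff)
  ultimately show "q \<in> {- T..- z} \<times> cball 0 (r + norm c + (T + \<bar>z\<bar>))" using q by auto
  qed
  ultimately show ?thesis
  by (rule compact_subset_closed[OF _ _])
  qed
  show "r^2 < G (- T) y" if y: "y \<in> M" for y
  proof (rule ccontr)
  assume "\<not> r^2 < G (- T) y"
  then have "(norm (y - c - T *\<^sub>R tau))^2 <= r^2" unfolding G_def power2_norm_eq_inner by simp
  then have n: "norm (y - c - T *\<^sub>R tau) <= r" using rp by (simp add: power2_le_iff_abs_le)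
  have "norm (y - T *\<^sub>R tau) <= norm (y - c - T *\<^sub>R tau) + norm c"
  using norm_triangle_ineq[of "y - c - T *\<^sub>R tau" c] by (simp add: algebra_simps)
  also have "... < 10 * sqrt T" using n rp unfolding nc sT by simp
  finally have "\<bar>sqrt (hr y) - sqrt 2 * sqrt T\<bar> <= (1 / 50) * sqrt T" by (rule T0(2)[OF T y])
  then have "sqrt (hr y) <= sqrt 2 * (r / 4) + (1 / 50) * (r / 4)" unfolding sT by linarith
  also have "sqrt 2 * (r / 4) <= (3 / 2) * (r / 4)"
  proof (rule mult_right_mono)
  show "sqrt 2 <= 3 / 2" by (rule real_le_lsqrt) (auto simp: power2_eq_square)
  qed (use rp in auto)
  finally have hy: "sqrt (hr y) <= 19 / 50 * r" using rp by (simp add: algebra_simps)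
  have "e <.> y <= sqrt (hr y)"
  proof -
  have "e <.> y = e <.> vector [y $ 1, y $ 2, 0]" unfolding inner3 e by simp
  also have "... <= norm e * norm (vector [y $ 1, y $ 2, 0] :: real^3)" by (rule norm_cauchy_schwarz)
  also have "norm (vector [y $ 1, y $ 2, 0] :: real^3) = sqrt (hr y)"
  using norm3[of "vector [y $ 1, y $ 2, 0]"] by (simp add: hr_def real_sqrt_unique)
  finally show ?thesis by (simp add: ne)
  qed
  moreover have "e <.> (c + T *\<^sub>R tau - y) <= r"
  proof -
  have "e <.> (c + T *\<^sub>R tau - y) <= norm e * norm (c + T *\<^sub>R tau - y)" by (rule norm_cauchy_schwarz)
  also have "norm (c + T *\<^sub>R tau - y) = norm (y - c - T *\<^sub>R tau)"
  by (metis diff_diff_eq norm_minus_commute)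
  finally show ?thesis using n ne by simp
  qed
  moreover have "e <.> (c + T *\<^sub>R tau - y) = 7 / 5 * r - e <.> y"
  proof -
  have "e <.> e = 1" using ne by (simp add: norm_eq_1)
  then show ?thesis unfolding c_def by (simp add: inner_diff_right inner_add_right e)
  qed
  ultimately show False using hy rp by linarith
  qed
  show "(G t has_derivative (%v. 2 *\<^sub>R (y - c + t *\<^sub>R tau) <.> v)) (at y)" for t y
  unfolding G_def by (auto intro!: derivative_eq_intros simp: fun_eq_iff inner_commute algebra_simps inner_add_left inner_diff_left simp del: inner_tau)
  show "((%y. 2 *\<^sub>R (y - c + t *\<^sub>R tau)) has_derivative (%v. 2 *\<^sub>R v)) (at y)" for t y
  by (auto intro!: derivative_eq_intros)
  show "DERIV (%t. G t y) t :> 2 * ((y - c + t *\<^sub>R tau) <.> tau) + 5" for t y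
  proof -
  define v where "v = y - c"
  have v3: "v <.> tau = v $ 3" "tau <.> v = v $ 3" by (simp_all add: inner_commute[of tau])
  have "G t y = v <.> v + 2 * t * (v $ 3) + t^2 + 5 * (t + T)" for t
  unfolding G_def v_def[symmetric]
  by (simp add: inner_add_left inner_add_right v3 power2_eq_square algebra_simps)
  then show ?thesis unfolding v_def[symmetric]
  by (auto intro!: derivative_eq_intros simp: inner_add_left)
  qed
  show "0 < 2 * ((y - c + t *\<^sub>R tau) <.> tau) + 5"
  if N: "N ~= 0" "2 *\<^sub>R N <.> N <= (N <.> N) * (tr3 (%v. 2 *\<^sub>R v) + 2 *\<^sub>R (y - c + t *\<^sub>R tau) <.> tau)" for t y and N :: "real^3"
  proof -
  have "N <.> N > 0" using N(1) by simp
  then have "2 <= 6 + 2 * ((y - c + t *\<^sub>R tau) <.> tau)"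
  using N(2) unfolding tr3_scale tr3_id by (simp add: mult.commute[of 2] del: inner_tau)
  then show ?thesis by linarith
  qed
  qed
  moreover have "G (- z) x <= r^2"
  proof -
  have "x - c + (- z) *\<^sub>R tau = (- 2 / 5 * r) *\<^sub>R e"
  unfolding vec3_eq c_def using rp by (simp add: e z_def field_simps)
  then have "(x - c + (- z) *\<^sub>R tau) <.> (x - c + (- z) *\<^sub>R tau) = (2 / 5 * r)^2 * (e <.> e)"
  by (simp add: power2_eq_square)
  moreover have "e <.> e = 1" using ne by (simp add: norm_eq_1)
  ultimately have "G (- z) x = (2 / 5 * r)^2 + 5 * (T - z)" unfolding G_def by simp
  also have "... <= (2 / 5 * r)^2 + 5 * (r^2 / 16 + r^2 / 100)" using z unfolding T_def by simp
  also have "... <= r^2" by (simp add: power2_eq_square)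
  finally show ?thesis .
  qed
  ultimately show False by simp
 qed
 moreover have "4 * sqrt T0 > 0" using T0(1) by simp
 ultimately show ?thesis by blast
qed

text \<open>The barrier encloses \<open>M\<close> in a hyperboloid of one sheet whose waist sits at
  height \<open>- t\<close> and has squared radius \<open>A - t / 2\<close>. The waist closes at
  \<open>t = 2 * A\<close>, so no point of \<open>M\<close> lies much below height
  \<open>- 2 * A\<close>.\<close>

lemma bounded_below:
 assumes M: "properly_embedded_translator M" "converges_to_cylinder M"
 shows "\<exists>K>0. \<forall>x\<in>M. x $ 3 >= - K"
proof -
 have cl: "closed M" and pt: "!!p. p \<in> M ==> translator_patch M p"
  using M(1) unfolding properly_embedded_translator_def by auto
 obtain r0 where r0: "r0 > 0" "!!x. x \<in> M ==> r0^2 <= hr x ==> hr x < 100 * \<bar>x $ 3\<bar>"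
  using sphere_confinement[OF M] by blast
 have hb: "hr x <= r0^2 + 100 * \<bar>x $ 3\<bar>" if "x \<in> M" for x
  using r0(2)[OF that] by (cases "r0^2 <= hr x") (auto intro: order_trans less_imp_le)
 \<comment> \<open>Chosen so that confinement gives the inclusion at time 0:
   \<open>100 * z <= z^2 / 2 + 5000\<close>.\<close>
 define A where "A = r0^2 + 5000 + 1"
 have A: "A > 0" unfolding A_def using zero_le_power2[of r0] by linarith
 define G where "G = (%t (y :: real^3). (y $ 3 + t)^2 / 2 - hr y - t / 2)"
 have lower: "x $ 3 >= - (2 * A + 1)" if x: "x \<in> M" for x
 proof (rule ccontr)
  assume neg: "\<not> x $ 3 >= - (2 * A + 1)"
  define t1 where "t1 = - (x $ 3)"
  have t1: "t1 > 2 * A + 1" "t1 > 0" using neg A unfolding t1_def by auto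
  have "G t1 x > - A"
  proof (rule moving_barrier[OF pt, where G = G and t = t1 and y = x and a = 0 and b = t1 and g = "%t y. (y $ 3 + t) *\<^sub>R tau - 2 *\<^sub>R (y - (y $ 3) *\<^sub>R tau)"
  and H = "%t y v. (v $ 3) *\<^sub>R tau - 2 *\<^sub>R (v - (v $ 3) *\<^sub>R tau)" and G' = "%t y. (y $ 3 + t) - 1 / 2"])
  show "0 <= t1" "0 <= t1" "t1 <= t1" "x \<in> M" using t1 x by auto
  show cG: "continuous_on UNIV (%(t, y). G t y)"
  unfolding G_def hr_def case_prod_unfold by (intro continuous_intros) auto
  show "compact {(t, y). 0 <= t & t <= t1 & y \<in> M & G t y <= - A}" (is "compact ?S")
  proof -
  have "?S = ({0..t1} \<times> M) \<inter> {q. (%(t, y). G t y) q <= - A}" by auto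
  moreover have "closed {q. (%(t, y). G t y) q <= - A}"
  using cG by (intro closed_Collect_le) auto
  ultimately have "closed ?S" using cl by (auto intro!: closed_Int closed_Times)
  moreover have "?S \<subseteq> {0..t1} \<times> cball 0 (r0^2 + 100 * (400 + 4 * t1 + 4 * r0^2) + (400 + 4 * t1 + 4 * r0^2) + 1)"
  proof
  fix q assume "q \<in> ?S"
  then obtain t y where q: "q = (t, y)" "0 <= t" "t <= t1" "y \<in> M" "G t y <= - A" by auto
  define z where "z = \<bar>y $ 3\<bar>"
  have h: "hr y <= r0^2 + 100 * z" using hb[OF q(4)] unfolding z_def .
  \<comment> \<open>On \<open>M\<close> the squared horizontal distance grows at most linearly in
    the height, whereas the barrier is quadratic in it; this bounds the region where the barrier
    could be crossed.\<close>
  have zb: "z <= 400 + 4 * t1 + 4 * r0^2"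
  proof (rule ccontr)
  assume big: "\<not> z <= 400 + 4 * t1 + 4 * r0^2"
  have r0n: "r0^2 >= 0" by simp
  have zz: "z > 400" "t1 <= z / 4" "r0^2 <= z / 4" using big t1 r0n by linarith+
  have zt: "z - t1 <= \<bar>y $ 3 + t\<bar>" using q unfolding z_def by linarith
  have "(z - t1)^2 <= \<bar>y $ 3 + t\<bar>\<^sup>2" by (rule power_mono[OF zt]) (use zz in linarith)
  then have "(z - t1)^2 / 2 <= hr y + t / 2 - A" using q(5) unfolding G_def by simp
  also have "... <= r0^2 + 100 * z + t1 / 2" using h q A by linarith
  also have "... <= 101 * z" using zz by linarith
  finally have "(z - t1)^2 <= 202 * z" by simp
  moreover have "300 * ((3/4) * z) <= (z - t1) * (z - t1)"
  by (rule mult_mono) (use zz in linarith)+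
  ultimately show False using zz(1) by (simp add: power2_eq_square)
  qed
  have "norm y <= sqrt (hr y) + z"
  proof -
  have "norm y = sqrt (hr y + (y $ 3)^2)" using norm3[of y] by (metis norm_ge_zero real_sqrt_unique)
  also have "... <= sqrt (hr y) + sqrt ((y $ 3)^2)" by (rule sqrt_add_le_add_sqrt) auto
  finally show ?thesis unfolding z_def by simp
  qed
  moreover have "sqrt (hr y) <= hr y + 1"
  proof -
  have "hr y <= (hr y + 1)^2" by (simp add: power2_eq_square algebra_simps)
  then show ?thesis by (intro real_le_lsqrt) auto
  qed
  ultimately have "norm y <= r0^2 + 100 * (400 + 4 * t1 + 4 * r0^2) + (400 + 4 * t1 + 4 * r0^2) + 1"
  proof -
  have "100 * z <= 100 * (400 + 4 * t1 + 4 * r0^2)" by (intro mult_left_mono zb) simp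
  then have "(r0^2 + 100 * z + 1) + z <= r0^2 + 100 * (400 + 4 * t1 + 4 * r0^2) + 1 + (400 + 4 * t1 + 4 * r0^2)"
  by (intro add_mono zb order_refl)
  moreover have "norm y <= (r0^2 + 100 * z + 1) + z"
  using h \<open>norm y <= sqrt (hr y) + z\<close> \<open>sqrt (hr y) <= hr y + 1\<close> by linarith
  ultimately show ?thesis by (simp only: add_ac)
  qed
  then show "q \<in> {0..t1} \<times> cball 0 (r0^2 + 100 * (400 + 4 * t1 + 4 * r0^2) + (400 + 4 * t1 + 4 * r0^2) + 1)"
  using q by auto
  qed
  ultimately show ?thesis
  by (rule compact_subset_closed[OF _ _])
  qed
  show "- A < G 0 y" if y: "y \<in> M" for y
  proof -
  have "hr y <= r0^2 + 100 * \<bar>y $ 3\<bar>" by (rule hb[OF y])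
  moreover have "100 * \<bar>y $ 3\<bar> <= (y $ 3)^2 / 2 + 5000"
  using zero_le_power2[of "\<bar>y $ 3\<bar> - 100"] by (simp add: power2_diff)
  ultimately show ?thesis unfolding G_def A_def by simp
  qed
  have lin3: "((%y::real^3. y $ i) has_derivative (%v. v $ i)) (at y)" for i y
  by (rule bounded_linear.has_derivative[OF bounded_linear_vec_nth has_derivative_ident])
  show "(G t has_derivative (%v. ((y $ 3 + t) *\<^sub>R tau - 2 *\<^sub>R (y - (y $ 3) *\<^sub>R tau)) <.> v)) (at y)" for t y
  unfolding G_def hr_def
  by (auto intro!: derivative_eq_intros lin3 simp: fun_eq_iff inner3 algebra_simps)
  show "((%y. (y $ 3 + t) *\<^sub>R tau - 2 *\<^sub>R (y - (y $ 3) *\<^sub>R tau)) has_derivative (%v. (v $ 3) *\<^sub>R tau - 2 *\<^sub>R (v - (v $ 3) *\<^sub>R tau))) (at y)" for t y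
  by (auto intro!: derivative_eq_intros lin3)
  show "DERIV (%t. G t y) t :> (y $ 3 + t) - 1 / 2" for t y
  unfolding G_def by (auto intro!: derivative_eq_intros)
  show "0 < (y $ 3 + t) - 1 / 2"
  if N: "N ~= 0" "((N $ 3) *\<^sub>R tau - 2 *\<^sub>R (N - (N $ 3) *\<^sub>R tau)) <.> N <=
  (N <.> N) * (tr3 (%v. (v $ 3) *\<^sub>R tau - 2 *\<^sub>R (v - (v $ 3) *\<^sub>R tau)) + ((y $ 3 + t) *\<^sub>R tau - 2 *\<^sub>R (y - (y $ 3) *\<^sub>R tau)) <.> tau)"
  for t y and N :: "real^3"
  proof -
  have rk: "tr3 (%v. (v $ 3) *\<^sub>R tau) = 1" using tr3_rank_one[of tau tau] by simp
  have tr: "tr3 (%v. (v $ 3) *\<^sub>R tau - 2 *\<^sub>R (v - (v $ 3) *\<^sub>R tau)) = - 3"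
  unfolding tr3_diff tr3_scale rk tr3_id by simp
  have "((N $ 3) *\<^sub>R tau - 2 *\<^sub>R (N - (N $ 3) *\<^sub>R tau)) <.> N = 3 * (N $ 3)^2 - 2 * (N <.> N)"
  unfolding inner3 by (simp add: power2_eq_square algebra_simps)
  then have "3 * (N $ 3)^2 - 2 * (N <.> N) <= (N <.> N) * (- 3 + (y $ 3 + t))"
  using N(2) unfolding tr by simp
  then have "- 2 * (N <.> N) <= (N <.> N) * (- 3 + (y $ 3 + t))"
  using zero_le_power2[of "N $ 3"] by linarith
  then have "0 <= (N <.> N) * (y $ 3 + t - 1)" by (simp add: algebra_simps)
  moreover have "N <.> N > 0" using N(1) by simp
  ultimately have "0 <= y $ 3 + t - 1" by (simp add: zero_le_mult_iff)
  then show ?thesis by linarith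
  qed
  qed
  moreover have "G t1 x = - hr x - t1 / 2" unfolding G_def t1_def by simp
  ultimately have "t1 / 2 < A" using hr_nonneg[of x] by linarith
  then show False using t1 by simp
 qed
 then show ?thesis using A by (intro exI[of _ "2 * A + 1"]) auto
qed

section \<open>Symbol classes at the end\<close>

definition bigOz :: "real => (real \<times> real => real) => bool" where
 "bigOz a f \<longleftrightarrow> (EX C. \<forall>\<^sub>F z in at_top. ALL th. \<bar>f (th, z)\<bar> <= C * z powr a)"

lemma bigOzI: "(\<forall>\<^sub>F z in at_top. ALL th. \<bar>f (th, z)\<bar> <= C * z powr a) ==> bigOz a f"
 unfolding bigOz_def by blast

lemma bigOzE:
 assumes "bigOz a f"
 obtains C where "C > 0" "\<forall>\<^sub>F z in at_top. ALL th. \<bar>f (th, z)\<bar> <= C * z powr a"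
proof -
 obtain C where C: "\<forall>\<^sub>F z in at_top. ALL th. \<bar>f (th, z)\<bar> <= C * z powr a" using assms unfolding bigOz_def by blast
 have "\<forall>\<^sub>F z in at_top. ALL th. \<bar>f (th, z)\<bar> <= (\<bar>C\<bar> + 1) * z powr a"
  using C
 proof (rule eventually_mono)
  fix z :: real assume h: "ALL th. \<bar>f (th, z)\<bar> <= C * z powr a"
  have "C * z powr a <= (\<bar>C\<bar> + 1) * z powr a" by (intro mult_right_mono) auto
  then show "ALL th. \<bar>f (th, z)\<bar> <= (\<bar>C\<bar> + 1) * z powr a" using h by (meson order_trans)
 qed
 then show ?thesis using that[of "\<bar>C\<bar> + 1"] by simp
qed

lemma bigOz_mono:
 assumes "bigOz a f" "a <= b"
 shows "bigOz b f"
proof -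
 obtain C where C: "C > 0" "\<forall>\<^sub>F z in at_top. ALL th. \<bar>f (th, z)\<bar> <= C * z powr a" using assms(1) by (rule bigOzE)
 show ?thesis
 proof (rule bigOzI)
  show "\<forall>\<^sub>F z in at_top. ALL th. \<bar>f (th, z)\<bar> <= C * z powr b"
  using C(2) eventually_ge_at_top[of 1]
  proof eventually_elim
  case (elim z)
  have "C * z powr a <= C * z powr b" using C(1) elim(2) assms(2) by (intro mult_left_mono powr_mono) auto
  then show ?case using elim(1) by (meson order_trans)
  qed
 qed
qed

lemma bigOz_add:
 assumes "bigOz a f" "bigOz a g"
 shows "bigOz a (%p. f p + g p)"
proof -
 obtain C where C: "C > 0" "\<forall>\<^sub>F z in at_top. ALL th. \<bar>f (th, z)\<bar> <= C * z powr a" using assms(1) by (rule bigOzE)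
 obtain D where D: "D > 0" "\<forall>\<^sub>F z in at_top. ALL th. \<bar>g (th, z)\<bar> <= D * z powr a" using assms(2) by (rule bigOzE)
 show ?thesis
 proof (rule bigOzI)
  show "\<forall>\<^sub>F z in at_top. ALL th. \<bar>f (th, z) + g (th, z)\<bar> <= (C + D) * z powr a"
  using C(2) D(2)
  by eventually_elim (auto simp: distrib_right intro!: order_trans[OF abs_triangle_ineq] add_mono)
 qed
qed

lemma bigOz_mult:
 assumes "bigOz a f" "bigOz b g"
 shows "bigOz (a + b) (%p. f p * g p)"
proof -
 obtain C where C: "C > 0" "\<forall>\<^sub>F z in at_top. ALL th. \<bar>f (th, z)\<bar> <= C * z powr a" using assms(1) by (rule bigOzE)
 obtain D where D: "D > 0" "\<forall>\<^sub>F z in at_top. ALL th. \<bar>g (th, z)\<bar> <= D * z powr b" using assms(2) by (rule bigOzE)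
 show ?thesis
 proof (rule bigOzI)
  show "\<forall>\<^sub>F z in at_top. ALL th. \<bar>f (th, z) * g (th, z)\<bar> <= (C * D) * z powr (a + b)"
  using C(2) D(2) eventually_gt_at_top[of 0]
  proof eventually_elim
  case (elim z)
  show ?case
  proof
  fix th
  have "\<bar>f (th, z)\<bar> * \<bar>g (th, z)\<bar> <= (C * z powr a) * (D * z powr b)"
  using elim C(1) by (intro mult_mono) auto
  then show "\<bar>f (th, z) * g (th, z)\<bar> <= (C * D) * z powr (a + b)"
  by (simp add: abs_mult powr_add algebra_simps)
  qed
  qed
 qed
qed

lemma bigOz_cong:
 assumes "!!th z. z0 < z ==> f (th, z) = g (th, z)" "bigOz a f"
 shows "bigOz a g"
proof -
 obtain C where C: "\<forall>\<^sub>F z in at_top. ALL th. \<bar>f (th, z)\<bar> <= C * z powr a" using assms(2) unfolding bigOz_def by blast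
 have "\<forall>\<^sub>F z in at_top. ALL th. \<bar>g (th, z)\<bar> <= C * z powr a"
  using C eventually_gt_at_top[of z0] by eventually_elim (use assms(1) in auto)
 then show ?thesis by (rule bigOzI)
qed

lemma bigOz_const: "bigOz 0 (%p. c)"
 by (rule bigOzI[of _ "\<bar>c\<bar>"], rule eventually_mono[OF eventually_gt_at_top[of 0]]) auto

text \<open>The weight loses \<open>1/2\<close> for each derivative in \<open>z\<close>: this is the parabolic scaling in which
 the convergence hypothesis is formulated.\<close>

fun SymK :: "nat => real => (real \<times> real => real) => bool" where
 "SymK 0 a f = bigOz a f"
| "SymK (Suc k) a f = (bigOz a f & SymK k a (D1 f) & SymK k (a - 1 / 2) (D2 f))"

abbreviation half :: "real => (real \<times> real) set" where "half z0 \<equiv> {p. z0 < snd p}"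

lemma open_half: "open (half z0)"
 by (intro open_Collect_less continuous_intros)

lemma SymK_SucD: "SymK (Suc k) a f ==> SymK k a f"
proof (induction k arbitrary: a f)
 case (Suc k)
 then show ?case by (metis SymK.simps(2))
qed simp

lemma SymK_mono: "SymK k a f ==> a <= b ==> SymK k b f"
 by (induction k arbitrary: a b f) (auto intro: bigOz_mono)

lemma SymK_cong:
 assumes "!!p. p \<in> half z0 ==> f p = g p" "SymK k a f"
 shows "SymK k a g"
 using assms
proof (induction k arbitrary: a f g)
 case 0
 then show ?case using bigOz_cong[of z0 f g] by auto
next
 case (Suc k)
 have 1: "D1 f p = D1 g p" "D2 f p = D2 g p" if "p \<in> half z0" for p
  using D_cong_open[OF open_half that Suc.prems(1)] by auto
 have "bigOz a g" using Suc.prems bigOz_cong[of z0 f g] by auto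
 moreover have "SymK k a (D1 g)" by (rule Suc.IH[OF 1(1)]) (use Suc.prems in auto)
 moreover have "SymK k (a - 1 / 2) (D2 g)" by (rule Suc.IH[OF 1(2)]) (use Suc.prems in auto)
 ultimately show ?case by simp
qed

lemma SymK_add:
 assumes "smooth2 (half z0) f" "smooth2 (half z0) g" "SymK k a f" "SymK k a g"
 shows "SymK k a (%p. f p + g p)"
 using assms
proof (induction k arbitrary: a f g)
 case 0
 then show ?case by (simp add: bigOz_add)
next
 case (Suc k)
 note d = smooth2_differentiable[OF Suc.prems(1)] smooth2_differentiable[OF Suc.prems(2)]
 have "SymK k a (D1 (%p. f p + g p))"
  by (rule SymK_cong[of z0 "%p. D1 f p + D1 g p"])
  (use d Suc.prems smooth2_D Suc.IH in "auto simp: D_add")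
 moreover have "SymK k (a - 1 / 2) (D2 (%p. f p + g p))"
  by (rule SymK_cong[of z0 "%p. D2 f p + D2 g p"])
  (use d Suc.prems smooth2_D Suc.IH in "auto simp: D_add")
 ultimately show ?case using Suc.prems by (simp add: bigOz_add)
qed

lemma SymK_mult:
 assumes "smooth2 (half z0) f" "smooth2 (half z0) g" "SymK k a f" "SymK k b g"
 shows "SymK k (a + b) (%p. f p * g p)"
 using assms
proof (induction k arbitrary: a b f g)
 case 0
 then show ?case by (simp add: bigOz_mult)
next
 case (Suc k)
 note d = smooth2_differentiable[OF Suc.prems(1)] smooth2_differentiable[OF Suc.prems(2)]
 note s = Suc.prems(1,2) smooth2_D[OF Suc.prems(1)] smooth2_D[OF Suc.prems(2)]
 note o = open_half[of z0]
 note k = SymK_SucD[OF Suc.prems(3)] SymK_SucD[OF Suc.prems(4)]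
 have "SymK k (a + b) (%p. D1 f p * g p)" "SymK k (a + b) (%p. f p * D1 g p)"
  using Suc.IH[OF s(3,2), of a b] Suc.IH[OF s(1,5), of a b] k Suc.prems(3,4) by auto
 then have "SymK k (a + b) (%p. D1 f p * g p + f p * D1 g p)"
  by (intro SymK_add[of z0] smooth2_mult o s)
 then have 1: "SymK k (a + b) (D1 (%p. f p * g p))"
  by (rule SymK_cong[of z0, rotated]) (use d in "auto simp: D_mult")
 have "SymK k (a - 1/2 + b) (%p. D2 f p * g p)" "SymK k (a + (b - 1/2)) (%p. f p * D2 g p)"
  using Suc.IH[OF s(4,2), of "a - 1/2" b] Suc.IH[OF s(1,6), of a "b - 1/2"] k Suc.prems(3,4) by auto
 then have "SymK k (a + b - 1/2) (%p. D2 f p * g p + f p * D2 g p)"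
  by (intro SymK_add[of z0] smooth2_mult o s) (simp_all add: algebra_simps)
 then have 2: "SymK k (a + b - 1/2) (D2 (%p. f p * g p))"
  by (rule SymK_cong[of z0, rotated]) (use d in "auto simp: D_mult")
 show ?case using 1 2 Suc.prems by (simp add: bigOz_mult)
qed

definition Sym :: "real => real => (real \<times> real => real) => bool" where
 "Sym z0 a f \<longleftrightarrow> smooth2 (half z0) f & (ALL k. SymK k a f)"

lemma Sym_smooth: "Sym z0 a f ==> smooth2 (half z0) f"
 and Sym_bigOz: "Sym z0 a f ==> bigOz a f"
 unfolding Sym_def by (auto dest: spec[of _ 0])

lemma Sym_D1: "Sym z0 a f ==> Sym z0 a (D1 f)"
 and Sym_D2: "Sym z0 a f ==> Sym z0 (a - 1 / 2) (D2 f)"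
 unfolding Sym_def by (metis SymK.simps(2) smooth2_D)+

lemma Sym_mono: "Sym z0 a f ==> a <= b ==> Sym z0 b f"
 unfolding Sym_def using SymK_mono by blast

lemma Sym_cong: "(!!p. p \<in> half z0 ==> f p = g p) ==> Sym z0 a f ==> Sym z0 a g"
 unfolding Sym_def using SymK_cong[of z0 f g] smooth2_cong[OF open_half, of z0 f g] by blast

lemma Sym_add: "Sym z0 a f ==> Sym z0 a g ==> Sym z0 a (%p. f p + g p)"
 unfolding Sym_def using SymK_add smooth2_add[OF open_half] by blast

lemma Sym_mult: "Sym z0 a f ==> Sym z0 b g ==> Sym z0 (a + b) (%p. f p * g p)"
 unfolding Sym_def using SymK_mult smooth2_mult[OF open_half] by blast

lemma Sym_mult': "Sym z0 a f ==> Sym z0 b g ==> a + b <= c ==> Sym z0 c (%p. f p * g p)"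
 using Sym_mult Sym_mono by blast

lemma SymK_const: "SymK k 0 (%p. c)"
proof -
 have "SymK k a (%p. 0)" for a
  by (induction k arbitrary: a) (auto intro!: bigOzI[of _ 0])
 then show ?thesis by (cases k) (auto simp: bigOz_const)
qed

lemma Sym_const: "0 <= a ==> Sym z0 a (%p. c)"
 unfolding Sym_def using SymK_const SymK_mono by (metis smooth2_const)

lemma Sym_cmult: "Sym z0 a f ==> Sym z0 a (%p. c * f p)"
 using Sym_mult[OF Sym_const[of 0 z0 c], of a f] by simp

lemma Sym_uminus: "Sym z0 a f ==> Sym z0 a (%p. - f p)"
 using Sym_cmult[of z0 a f "-1"] by simp

lemma Sym_diff: "Sym z0 a f ==> Sym z0 a g ==> Sym z0 a (%p. f p - g p)"
 using Sym_add[of z0 a f "%p. - g p"] Sym_uminus[of z0 a g] by simp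

text \<open>The derivatives of the inverse are products of the inverse squared with derivatives of
  \<open>f\<close>, so the orders match by induction once \<open>f\<close> is bounded below by its
  own order.\<close>

lemma Sym_inverse:
 assumes f: "Sym z0 a f" and nz: "!!p. p \<in> half z0 ==> f p ~= 0"
  and c: "c > 0" "\<forall>\<^sub>F z in at_top. ALL th. c * z powr a <= \<bar>f (th, z)\<bar>"
 shows "Sym z0 (- a) (%p. inverse (f p))"
proof -
 note sf = Sym_smooth[OF f]
 have si: "smooth2 (half z0) (%p. inverse (f p))" by (rule smooth2_inverse[OF open_half sf nz])
 have O: "bigOz (- a) (%p. inverse (f p))"
 proof (rule bigOzI)
  show "\<forall>\<^sub>F z in at_top. ALL th. \<bar>inverse (f (th, z))\<bar> <= inverse c * z powr (- a)"
  using c(2) eventually_gt_at_top[of 0]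
  proof eventually_elim
  case (elim z)
  show ?case
  proof
  fix th
  have "inverse \<bar>f (th, z)\<bar> <= inverse (c * z powr a)" using elim c(1) by (intro le_imp_inverse_le) auto
  then show "\<bar>inverse (f (th, z))\<bar> <= inverse c * z powr (- a)"
  by (simp add: powr_minus abs_inverse)
  qed
  qed
 qed
 have "SymK k (- a) (%p. inverse (f p))" for k
 proof (induction k)
  case 0
  show ?case using O by simp
 next
  case (Suc k)
  note d = smooth2_differentiable[OF sf]
  have i2: "SymK k (- a + - a) (%p. inverse (f p) * inverse (f p))"
  by (rule SymK_mult[OF si si Suc.IH Suc.IH])
  have si2: "smooth2 (half z0) (%p. inverse (f p) * inverse (f p))" by (rule smooth2_mult[OF open_half si si])
  note D1f = Sym_uminus[OF Sym_D1[OF f]] and D2f = Sym_uminus[OF Sym_D2[OF f]]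
  have "SymK k (a + (- a + - a)) (%p. - D1 f p * (inverse (f p) * inverse (f p)))"
  by (rule SymK_mult[OF Sym_smooth[OF D1f] si2 _ i2]) (use D1f in "auto simp: Sym_def")
  then have s1: "SymK k (- a) (%p. - D1 f p * (inverse (f p) * inverse (f p)))" by simp
  have 1: "SymK k (- a) (D1 (%p. inverse (f p)))"
  proof (rule SymK_cong[OF _ s1])
  fix p assume "p \<in> half z0"
  then show "- D1 f p * (inverse (f p) * inverse (f p)) = D1 (%p. inverse (f p)) p"
  using D_inverse(2)[OF d nz] by simp
  qed
  have "SymK k (a - 1/2 + (- a + - a)) (%p. - D2 f p * (inverse (f p) * inverse (f p)))"
  by (rule SymK_mult[OF Sym_smooth[OF D2f] si2 _ i2]) (use D2f in "auto simp: Sym_def")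
  then have s2: "SymK k (- a - 1/2) (%p. - D2 f p * (inverse (f p) * inverse (f p)))" by simp
  have 2: "SymK k (- a - 1/2) (D2 (%p. inverse (f p)))"
  proof (rule SymK_cong[OF _ s2])
  fix p assume "p \<in> half z0"
  then show "- D2 f p * (inverse (f p) * inverse (f p)) = D2 (%p. inverse (f p)) p"
  using D_inverse(3)[OF d nz] by simp
  qed
  show ?case using O 1 2 by simp
 qed
 then show ?thesis unfolding Sym_def using si by simp
qed

section \<open>Charts from the convergence hypothesis and the polar radius\<close>

lemma iterD_cong:
 assumes "open U" "!!p. p \<in> U ==> f p = g p" "p \<in> U"
 shows "(D1 ^^ i) ((D2 ^^ j) f) p = (D1 ^^ i) ((D2 ^^ j) g) p"
proof -
 have 1: "(D2 ^^ j) f p = (D2 ^^ j) g p" if "p \<in> U" for p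
  using that
 proof (induction j arbitrary: p)
  case (Suc j)
  then show ?case using D_cong_open(2)[OF assms(1) Suc.prems Suc.IH] by simp
 qed (simp add: assms(2))
 have "(D1 ^^ i) ((D2 ^^ j) f) p = (D1 ^^ i) ((D2 ^^ j) g) p" if "p \<in> U" for p
  using that
 proof (induction i arbitrary: p)
  case (Suc i)
  then show ?case using D_cong_open(1)[OF assms(1) Suc.prems Suc.IH] by simp
 qed (simp add: 1)
 then show ?thesis using assms(3) by blast
qed

lemma smooth2_iter1: "smooth2 U f ==> smooth2 U ((D1 ^^ i) f)"
 and smooth2_iter2: "smooth2 U f ==> smooth2 U ((D2 ^^ j) f)"
 by (induction i, auto intro: smooth2_D) (induction j, auto intro: smooth2_D)

lemma D1_iter2_commute:
 assumes "open U" "smooth2 U f" "p \<in> U"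
 shows "D1 ((D2 ^^ j) f) p = (D2 ^^ j) (D1 f) p"
 using assms(3)
proof (induction j arbitrary: p)
 case 0
 then show ?case by simp
next
 case (Suc j)
 have "D1 (D2 ((D2 ^^ j) f)) p = D2 (D1 ((D2 ^^ j) f)) p"
  by (rule smooth2_commute[OF assms(1) smooth2_iter2[OF assms(2)] Suc.prems])
 also have "... = D2 ((D2 ^^ j) (D1 f)) p"
  by (rule D_cong_open(2)[OF assms(1) Suc.prems Suc.IH])
 finally show ?case by simp
qed

text \<open>The weight counts \<open>z\<close>-derivatives regardless of their position, and the
  derivatives commute, so it is enough to test them with all \<open>D1\<close> outermost.\<close>

lemma SymK_iterI:
 assumes "smooth2 (half z0) f" "!!i j. i + j <= k ==> bigOz (a - real j / 2) ((D1 ^^ i) ((D2 ^^ j) f))"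
 shows "SymK k a f"
 using assms
proof (induction k arbitrary: a f)
 case 0
 then show ?case using 0(2)[of 0 0] by simp
next
 case (Suc k)
 have "bigOz a f" using Suc.prems(2)[of 0 0] by simp
 moreover have "SymK k a (D1 f)"
 proof (rule Suc.IH[OF smooth2_D(1)[OF Suc.prems(1)]])
  fix i j assume "i + j <= k"
  then have "bigOz (a - real j / 2) ((D1 ^^ Suc i) ((D2 ^^ j) f))" using Suc.prems(2)[of "Suc i" j] by simp
  moreover have "(D1 ^^ Suc i) ((D2 ^^ j) f) p = (D1 ^^ i) ((D2 ^^ j) (D1 f)) p" if p: "p \<in> half z0" for p
  proof -
  have "(D1 ^^ Suc i) ((D2 ^^ j) f) p = (D1 ^^ i) ((D2 ^^ 0) (D1 ((D2 ^^ j) f))) p"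
  by (simp add: funpow_swap1)
  also have "... = (D1 ^^ i) ((D2 ^^ 0) ((D2 ^^ j) (D1 f))) p"
  by (rule iterD_cong[OF open_half _ p]) (rule D1_iter2_commute[OF open_half Suc.prems(1)])
  finally show ?thesis by simp
  qed
  ultimately show "bigOz (a - real j / 2) ((D1 ^^ i) ((D2 ^^ j) (D1 f)))"
  using bigOz_cong[of z0 "(D1 ^^ Suc i) ((D2 ^^ j) f)"] by auto
 qed
 moreover have "SymK k (a - 1 / 2) (D2 f)"
 proof (rule Suc.IH[OF smooth2_D(2)[OF Suc.prems(1)]])
  fix i j assume "i + j <= k"
  then have "bigOz (a - real (Suc j) / 2) ((D1 ^^ i) ((D2 ^^ Suc j) f))" using Suc.prems(2)[of i "Suc j"] by simp
  moreover have "(D2 ^^ Suc j) f = (D2 ^^ j) (D2 f)" by (simp add: funpow_swap1)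
  moreover have "a - real (Suc j) / 2 = a - 1 / 2 - real j / 2" by (simp add: field_simps)
  ultimately show "bigOz (a - 1 / 2 - real j / 2) ((D1 ^^ i) ((D2 ^^ j) (D2 f)))" by metis
 qed
 ultimately show ?case by simp
qed

lemma iterD_scaled:
 assumes "smooth2 UNIV f" "s ~= 0"
 shows "(D1 ^^ i) ((D2 ^^ j) (%(th, z). c * f (th, (z - h) / s))) =
  (%(th, z). (c * (1 / s) ^ j) * (D1 ^^ i) ((D2 ^^ j) f) (th, (z - h) / s))"
proof -
 have d2: "D2 (%(th, z). c * g (th, (z - h) / s)) = (%(th, z). (c * (1 / s)) * D2 g (th, (z - h) / s))"
  if g: "smooth2 UNIV g" for g c
 proof (rule ext, clarify)
  fix th z
  have "DERIV (%y. g (th, y)) ((z - h) / s) :> D2 g (th, (z - h) / s)"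
  by (rule DERIV_D2[OF smooth2_differentiable[OF g]]) simp
  moreover have "DERIV (%z. (z - h) / s) z :> 1 / s" using assms(2) by (auto intro!: derivative_eq_intros)
  ultimately have "DERIV (%z. c * g (th, (z - h) / s)) z :> c * (D2 g (th, (z - h) / s) * (1 / s))"
  by (intro DERIV_cmult DERIV_chain2)
  then show "D2 (%(th, z). c * g (th, (z - h) / s)) (th, z) = c * (1 / s) * D2 g (th, (z - h) / s)"
  unfolding D2_def by (simp add: DERIV_imp_deriv)
 qed
 have d1: "D1 (%(th, z). c * g (th, (z - h) / s)) = (%(th, z). c * D1 g (th, (z - h) / s))"
  if g: "smooth2 UNIV g" for g c
 proof (rule ext, clarify)
  fix th z
  have "DERIV (%y. g (y, (z - h) / s)) th :> D1 g (th, (z - h) / s)"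
  by (rule DERIV_D1[OF smooth2_differentiable[OF g]]) simp
  then have "DERIV (%y. c * g (y, (z - h) / s)) th :> c * D1 g (th, (z - h) / s)"
  by (rule DERIV_cmult)
  then show "D1 (%(th, z). c * g (th, (z - h) / s)) (th, z) = c * D1 g (th, (z - h) / s)"
  unfolding D1_def by (simp add: DERIV_imp_deriv)
 qed
 have 2: "(D2 ^^ j) (%(th, z). c * f (th, (z - h) / s)) = (%(th, z). (c * (1 / s) ^ j) * (D2 ^^ j) f (th, (z - h) / s))"
 proof (induction j)
  case (Suc j)
  then show ?case using d2[OF smooth2_iter2[OF assms(1)], of "c * (1 / s) ^ j" j] by (simp add: mult.assoc mult.commute)
 qed simp
 show ?thesis
 proof (induction i)
  case 0
  then show ?case using 2 by simp
 next
  case (Suc i)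
  then show ?case using d1[OF smooth2_iter1[OF smooth2_iter2[OF assms(1)]], of "c * (1 / s) ^ j" i j] by simp
 qed
qed

lemma smooth2_add_const_D:
 assumes "smooth2 UNIV w"
 shows "D1 (%p. c + w p) = D1 w" "D2 (%p. c + w p) = D2 w"
 using D_add(2,3)[OF _ smooth2_differentiable[OF assms UNIV_I], of "%p. c"] by auto

lemma iterD_add_const:
 assumes "smooth2 UNIV w" "i + j > 0"
 shows "(D1 ^^ i) ((D2 ^^ j) (%p. c + w p)) = (D1 ^^ i) ((D2 ^^ j) w)"
proof (cases j)
 case 0
 then obtain i' where "i = Suc i'" using assms(2) by (cases i) auto
 then show ?thesis using 0 smooth2_add_const_D(1)[OF assms(1)] by (simp add: funpow_swap1)
next
 case (Suc j')
 then show ?thesis using smooth2_add_const_D(2)[OF assms(1)] by (simp add: funpow_swap1)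
qed

text \<open>What the hypothesis gives at height \<open>h\<close>, with the rescaling undone and with
  the ball replaced by a full horizontal slab.\<close>

definition chart_at :: "(real^3) set => nat => real => real => (real \<times> real => real) => bool" where
 "chart_at M k eps h w \<longleftrightarrow> smooth2 UNIV w & (ALL th z. w (th + 2 * pi, z) = w (th, z)) &
  (ALL i j th z. i + j <= k & \<bar>z\<bar> <= 1 --> \<bar>(D1 ^^ i) ((D2 ^^ j) w) (th, z)\<bar> <= eps) &
  (ALL x. \<bar>x $ 3 - h\<bar> <= sqrt h -->
  (x \<in> M \<longleftrightarrow> (EX th. x = vector [sqrt h * (sqrt 2 + w (th, (x $ 3 - h) / sqrt h)) * cos th,
  sqrt h * (sqrt 2 + w (th, (x $ 3 - h) / sqrt h)) * sin th, x $ 3])))"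

lemma sqrt2_bounds: "sqrt 2 < 3 / 2" "1 < sqrt 2"
proof -
 show "sqrt 2 < 3 / 2" by (rule real_less_lsqrt) (auto simp: power2_eq_square)
qed simp

text \<open>Convergence describes \<open>M\<close> only in balls. Confinement by spheres excludes
  further points of \<open>M\<close> in the slab, so that a ball of radius
  \<open>12 * sqrt h\<close> sees all of them.\<close>

lemma ex_chart:
 assumes M: "properly_embedded_translator M" "converges_to_cylinder M" and eps: "0 < eps" "eps <= 1 / 10"
 shows "\<exists>h0\<ge>1. \<forall>h\<ge>h0. EX w. chart_at M k eps h w"
proof -
 obtain r0 where r0: "r0 > 0" "!!x. x \<in> M ==> r0^2 <= hr x ==> hr x < 100 * \<bar>x $ 3\<bar>"
  using sphere_confinement[OF M] by blast
 obtain T0 where T0: "T0 > 0" "!!T. T >= T0 ==> EX w. smooth2 UNIV w & (ALL th z. w (th + 2 * pi, z) = w (th, z)) &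
  (ALL i j th z. i + j <= k & \<bar>z\<bar> <= 12 --> \<bar>(D1 ^^ i) ((D2 ^^ j) w) (th, z)\<bar> <= eps) &
  (ALL x. norm (x - T *\<^sub>R tau) < 12 * sqrt T -->
  (x \<in> M \<longleftrightarrow> (EX th. x = vector [sqrt T * (sqrt 2 + w (th, (x $ 3 - T) / sqrt T)) * cos th,
  sqrt T * (sqrt 2 + w (th, (x $ 3 - T) / sqrt T)) * sin th, x $ 3])))"
  using convergesE[OF M(2) _ eps(1), of 12 k] by auto
 define h0 where "h0 = max (max T0 100) (r0^2)"
 have "EX w. chart_at M k eps h w" if h: "h >= h0" for h
 proof -
  have hb: "h >= T0" "h >= 100" "h >= r0^2" using h by (auto simp: h0_def)
  define s where "s = sqrt h"
  have s: "s >= 10" "s * s = h" using hb(2) by (auto simp: s_def real_le_rsqrt power2_eq_square)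
  from T0(2)[OF hb(1)] obtain w where w: "smooth2 UNIV w" "ALL th z. w (th + 2 * pi, z) = w (th, z)"
  and w1: "ALL i j th z. i + j <= k & \<bar>z\<bar> <= 12 --> \<bar>(D1 ^^ i) ((D2 ^^ j) w) (th, z)\<bar> <= eps"
  and w2: "ALL x. norm (x - h *\<^sub>R tau) < 12 * sqrt h -->
  (x \<in> M \<longleftrightarrow> (EX th. x = vector [sqrt h * (sqrt 2 + w (th, (x $ 3 - h) / sqrt h)) * cos th,
  sqrt h * (sqrt 2 + w (th, (x $ 3 - h) / sqrt h)) * sin th, x $ 3]))"
  by (elim exE conjE) (rule that)
  \<comment> \<open>\<open>121 + 1 < 144\<close>; the bound \<open>121 * h\<close> is met by the
    points of \<open>M\<close> because \<open>100 * (h + sqrt h)\<close> is at most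
    \<open>110 * h\<close>, and by the chart points because their radius is at most
    \<open>2 * sqrt h\<close>.\<close>
  have near: "norm (x - h *\<^sub>R tau) < 12 * sqrt h" if "\<bar>x $ 3 - h\<bar> <= s" "hr x <= 121 * h" for x
  proof -
  have "(norm (x - h *\<^sub>R tau))^2 = hr x + (x $ 3 - h)^2" unfolding norm3 by (simp add: hr_def)
  also have "... <= 121 * h + s^2" using that abs_le_square_iff[of "x $ 3 - h" s] s by (intro add_mono) auto
  also have "... < (12 * s)^2" using s hb(2) by (simp add: power2_eq_square)
  finally show ?thesis unfolding s_def[symmetric] by (rule power2_less_imp_less) (use s in simp)
  qed
  have "chart_at M k eps h w"
  unfolding chart_at_def
  proof (intro conjI allI impI)
  fix i j th z assume "i + j <= k & \<bar>z\<bar> <= (1::real)"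
  then show "\<bar>(D1 ^^ i) ((D2 ^^ j) w) (th, z)\<bar> <= eps" using w1 by auto
  next
  fix x :: "real^3" assume x: "\<bar>x $ 3 - h\<bar> <= sqrt h"
  let ?R = "EX th. x = vector [sqrt h * (sqrt 2 + w (th, (x $ 3 - h) / sqrt h)) * cos th,
  sqrt h * (sqrt 2 + w (th, (x $ 3 - h) / sqrt h)) * sin th, x $ 3]"
  show "x \<in> M \<longleftrightarrow> ?R"
  proof
  assume xM: "x \<in> M"
  have "hr x <= 121 * h"
  proof (cases "r0^2 <= hr x")
  case True
  have "hr x < 100 * \<bar>x $ 3\<bar>" by (rule r0(2)[OF xM True])
  also have "\<bar>x $ 3\<bar> <= h + s" using x hb unfolding s_def by linarith
  also have "s <= h / 10" using mult_right_mono[of 10 s s] s by simp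
  finally show ?thesis using hb by simp
  qed (use hb in auto)
  then show ?R using w2[rule_format, OF near] x xM unfolding s_def by blast
  next
  assume R: ?R
  then obtain th where thx: "x = vector [s * (sqrt 2 + w (th, (x $ 3 - h) / s)) * cos th,
  s * (sqrt 2 + w (th, (x $ 3 - h) / s)) * sin th, x $ 3]" unfolding s_def by blast
  define W where "W = sqrt 2 + w (th, (x $ 3 - h) / s)"
  have "\<bar>(x $ 3 - h) / s\<bar> <= 12" using x s unfolding s_def[symmetric] by (simp add: field_simps)
  then have "\<bar>w (th, (x $ 3 - h) / s)\<bar> <= eps" using w1[rule_format, of 0 0] by simp
  then have "\<bar>w (th, (x $ 3 - h) / s)\<bar> <= 1 / 10" using eps(2) by linarith
  then have W: "\<bar>W\<bar> <= 2" unfolding W_def using sqrt2_bounds by linarith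
  have x12: "x $ 1 = s * W * cos th" "x $ 2 = s * W * sin th" using thx unfolding vec3_eq W_def by simp_all
  have "hr x = (s * W)^2 * ((cos th)^2 + (sin th)^2)" unfolding hr_def x12 by (simp only: power_mult_distrib distrib_left)
  also have "... = h * W^2" using s by (simp add: power_mult_distrib power2_eq_square)
  also have "... <= h * 4" using W abs_le_square_iff[of W 2] hb by (intro mult_left_mono) auto
  finally have "hr x <= 121 * h" using hb by simp
  then show "x \<in> M" using w2[rule_format, OF near] x R unfolding s_def by blast
  qed
  qed (use w in auto)
  then show ?thesis by blast
 qed
 moreover have "h0 >= 1" by (simp add: h0_def)
 ultimately show ?thesis by blast
qed

lemma sqrt_scaling:
 assumes "z > 0"
 shows "sqrt z * (1 / sqrt z) ^ j = z powr (1 / 2 - real j / 2)"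
proof -
 have "1 / sqrt z = z powr (- 1 / 2)" using assms by (simp add: powr_minus_divide powr_half_sqrt)
 then have "(1 / sqrt z) ^ j = z powr (- real j / 2)" using assms by (simp add: powr_power)
 moreover have "sqrt z = z powr (1 / 2)" using assms by (simp add: powr_half_sqrt)
 ultimately show ?thesis using assms by (simp add: powr_add[symmetric])
qed

lemma periodic_int:
 assumes "!!th. f (th + 2 * pi) = f th"
 shows "f (th + 2 * pi * real_of_int n) = f th"
proof -
 have nat: "f (th + 2 * pi * real m) = f th" for m th
 proof (induction m)
  case (Suc m)
  have "f (th + 2 * pi * real (Suc m)) = f ((th + 2 * pi * real m) + 2 * pi)" by (simp add: algebra_simps)
  then show ?case using assms Suc by simp
 qed simp
 show ?thesis
 proof (cases "n >= 0")
  case True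
  then show ?thesis using nat[of th "nat n"] by simp
 next
  case False
  then show ?thesis using nat[of "th + 2 * pi * real_of_int n" "nat (- n)"] by simp
 qed
qed

lemma polar_unique:
 assumes "r > 0" "r' > 0" "r * cos a = r' * cos b" "r * sin a = r' * sin b"
 shows "r = r'" "\<exists>n::int. a = b + 2 * pi * n"
proof -
 have "r^2 * ((cos a)^2 + (sin a)^2) = r'^2 * ((cos b)^2 + (sin b)^2)"
  unfolding distrib_left power_mult_distrib[symmetric] assms(3,4) ..
 then have "r^2 = r'^2" by simp
 then show e: "r = r'" using assms(1,2) by (simp add: power2_eq_iff)
 then have "cos a = cos b" "sin a = sin b" using assms by auto
 then show "\<exists>n::int. a = b + 2 * pi * n" using sin_cos_eq_iff by metis
qed

lemma chart_polar:
 assumes c: "chart_at M k eps h w" and eps: "eps <= 1 / 10" and h: "h >= 1" and z: "\<bar>z - h\<bar> <= sqrt h"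
 shows "r > 0 ==> vector [r * cos th, r * sin th, z] \<in> M \<longleftrightarrow> r = sqrt h * (sqrt 2 + w (th, (z - h) / sqrt h))"
  and "\<bar>w (th, (z - h) / sqrt h)\<bar> <= eps" and "sqrt h * (sqrt 2 + w (th, (z - h) / sqrt h)) > 0"
  and "x \<in> M ==> x $ 3 = z ==> \<exists>r>0. EX th. x = vector [r * cos th, r * sin th, z]"
proof -
 have s: "sqrt h > 0" using h by simp
 have "\<bar>(z - h) / sqrt h\<bar> <= 1" using z s by (simp add: field_simps)
 then have wb: "\<bar>w (th, (z - h) / sqrt h)\<bar> <= eps" for th
  using c unfolding chart_at_def by (metis add_0 le0 funpow_0)
 then show "\<bar>w (th, (z - h) / sqrt h)\<bar> <= eps" by blast
 have pos: "sqrt h * (sqrt 2 + w (th, (z - h) / sqrt h)) > 0" for th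
  using wb[of th] eps s sqrt2_bounds by (intro mult_pos_pos) linarith+
 then show "sqrt h * (sqrt 2 + w (th, (z - h) / sqrt h)) > 0" by blast
 have per: "w (a + 2 * pi, y) = w (a, y)" for a y using c unfolding chart_at_def by blast
 have iff: "x \<in> M \<longleftrightarrow> (EX th. x = vector [sqrt h * (sqrt 2 + w (th, (z - h) / sqrt h)) * cos th,
  sqrt h * (sqrt 2 + w (th, (z - h) / sqrt h)) * sin th, z])" if "x $ 3 = z" for x
 proof -
  have "ALL x. \<bar>x $ 3 - h\<bar> <= sqrt h -->
  (x \<in> M \<longleftrightarrow> (EX th. x = vector [sqrt h * (sqrt 2 + w (th, (x $ 3 - h) / sqrt h)) * cos th,
  sqrt h * (sqrt 2 + w (th, (x $ 3 - h) / sqrt h)) * sin th, x $ 3]))"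
  using c unfolding chart_at_def by (elim conjE)
  from this[rule_format, of x] show ?thesis using z that by simp
 qed
 show "x \<in> M ==> x $ 3 = z ==> \<exists>r>0. EX th. x = vector [r * cos th, r * sin th, z]"
  using iff[of x] pos by blast
 assume r: "r > 0"
 show "vector [r * cos th, r * sin th, z] \<in> M \<longleftrightarrow> r = sqrt h * (sqrt 2 + w (th, (z - h) / sqrt h))"
 proof
  assume "vector [r * cos th, r * sin th, z] \<in> M"
  then obtain ph where "(vector [r * cos th, r * sin th, z] :: real^3) =
  vector [sqrt h * (sqrt 2 + w (ph, (z - h) / sqrt h)) * cos ph, sqrt h * (sqrt 2 + w (ph, (z - h) / sqrt h)) * sin ph, z]"
  using iff[of "vector [r * cos th, r * sin th, z]"] by auto
  then have e: "r * cos th = sqrt h * (sqrt 2 + w (ph, (z - h) / sqrt h)) * cos ph"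
  "r * sin th = sqrt h * (sqrt 2 + w (ph, (z - h) / sqrt h)) * sin ph" unfolding vec3_eq by simp_all
  obtain n :: int where n: "th = ph + 2 * pi * n" using polar_unique(2)[OF r pos e] by blast
  have "w (th, (z - h) / sqrt h) = w (ph, (z - h) / sqrt h)"
  unfolding n by (rule periodic_int[of "%th. w (th, (z - h) / sqrt h)"]) (rule per)
  then show "r = sqrt h * (sqrt 2 + w (th, (z - h) / sqrt h))" using polar_unique(1)[OF r pos e] by simp
 next
  assume "r = sqrt h * (sqrt 2 + w (th, (z - h) / sqrt h))"
  then show "vector [r * cos th, r * sin th, z] \<in> M" using iff[of "vector [r * cos th, r * sin th, z]"] by auto
 qed
qed

text \<open>Chosen without reference to a chart, so that the charts at different heights agree on
  overlaps automatically.\<close>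

definition rho :: "(real^3) set => real \<times> real => real" where
 "rho M = (%(th, z). THE r. r > 0 & vector [r * cos th, r * sin th, z] \<in> M)"

lemma rho_chart:
 assumes c: "chart_at M k eps h w" and eps: "eps <= 1 / 10" and h: "h >= 1" and z: "\<bar>z - h\<bar> <= sqrt h"
 shows "rho M (th, z) = sqrt h * (sqrt 2 + w (th, (z - h) / sqrt h))"
 unfolding rho_def case_prod_conv
 by (rule the_equality) (use chart_polar(1,3)[OF assms] in auto)

lemma rho_chart_D:
 assumes c: "chart_at M k eps h w" and eps: "eps <= 1 / 10" and h: "h >= 1"
 shows "EX V. open V & (ALL th. (th, h) \<in> V) & smooth2 V (rho M)"
  "(D1 ^^ i) ((D2 ^^ j) (rho M)) (th, h) = (sqrt h * (1 / sqrt h) ^ j) * (D1 ^^ i) ((D2 ^^ j) (%p. sqrt 2 + w p)) (th, 0)"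
proof -
 have s: "sqrt h > 0" using h by simp
 define f where "f = (%p. sqrt 2 + w p)"
 have sw: "smooth2 UNIV w" using c unfolding chart_at_def by blast
 then have sf: "smooth2 UNIV f" unfolding f_def by (intro smooth2_add smooth2_const open_UNIV)
 define V where "V = {p :: real \<times> real. \<bar>snd p - h\<bar> < sqrt h}"
 have oV: "open V" unfolding V_def by (intro open_Collect_less continuous_intros)
 define g where "g = (%(th, z). sqrt h * f (th, (z - h) / sqrt h))"
 have eq: "g p = rho M p" if "p \<in> V" for p
  using rho_chart[OF assms, of "snd p" "fst p"] that unfolding V_def g_def f_def by (cases p) auto
 have mem: "(th, h) \<in> V" for th unfolding V_def using s by simp
 have "smooth2 V (%p. sqrt h * f (fst p, (snd p - h) * (1 / sqrt h)))"
  by (intro smooth2_mult oV smooth2_const smooth2_compose[OF oV smooth2_fst _ sf] smooth2_diff smooth2_snd) auto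
 then have "smooth2 V g" unfolding g_def by (simp add: case_prod_unfold)
 then have "smooth2 V (rho M)" by (rule smooth2_cong[OF oV eq, rotated])
 then show "EX V. open V & (ALL th. (th, h) \<in> V) & smooth2 V (rho M)" using oV mem by blast
 have "(D1 ^^ i) ((D2 ^^ j) (rho M)) (th, h) = (D1 ^^ i) ((D2 ^^ j) g) (th, h)"
  by (rule iterD_cong[OF oV eq[symmetric] mem])
 also have "... = (sqrt h * (1 / sqrt h) ^ j) * (D1 ^^ i) ((D2 ^^ j) f) (th, 0)"
  unfolding g_def using iterD_scaled[OF sf, of "sqrt h" i j "sqrt h" h] s by simp
 finally show "(D1 ^^ i) ((D2 ^^ j) (rho M)) (th, h) = (sqrt h * (1 / sqrt h) ^ j) * (D1 ^^ i) ((D2 ^^ j) (%p. sqrt 2 + w p)) (th, 0)"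
  unfolding f_def .
qed

text \<open>At each height the derivatives of \<open>rho M\<close> are read off in the middle of the
  chart centred at that height. Undoing the scaling multiplies a derivative with \<open>j\<close>
  factors in \<open>z\<close> by \<open>sqrt z * (1 / sqrt z)^j\<close>, which is exactly the weight
  of the symbol class of order \<open>1 / 2\<close>.\<close>

lemma end_structure:
 assumes M: "properly_embedded_translator M" "converges_to_cylinder M"
 obtains z0 where "z0 >= 1" "Sym z0 (1 / 2) (rho M)"
  "!!th z. z > z0 ==> rho M (th, z) > 0"
  "!!th z r. z > z0 ==> r > 0 ==> vector [r * cos th, r * sin th, z] \<in> M \<longleftrightarrow> r = rho M (th, z)"
  "!!x. x \<in> M ==> x $ 3 > z0 ==> EX th. x = vector [rho M (th, x $ 3) * cos th, rho M (th, x $ 3) * sin th, x $ 3]"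
  "!!eps. eps > 0 ==> \<forall>\<^sub>F z in at_top. ALL th. \<bar>rho M (th, z) - sqrt 2 * sqrt z\<bar> <= eps * sqrt z &
  \<bar>D1 (rho M) (th, z)\<bar> <= eps * sqrt z & \<bar>D1 (D1 (rho M)) (th, z)\<bar> <= eps * sqrt z"
proof -
 have e10: "(0::real) < 1 / 10" "(1/10::real) <= 1/10" by auto
 obtain h0 where h0: "h0 >= 1" "!!h. h >= h0 ==> EX w. chart_at M 0 (1 / 10) h w"
  using ex_chart[OF M e10, of 0] by blast
 have self: "\<bar>h - h\<bar> <= sqrt h" if "h >= 1" for h :: real using that by simp
 have smooth: "smooth2 (half h0) (rho M)"
 proof (rule smooth2_local)
  fix p :: "real \<times> real" assume p: "p \<in> half h0"
  then obtain w where w: "chart_at M 0 (1 / 10) (snd p) w" using h0(2)[of "snd p"] by auto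
  then show "EX V. open V & p \<in> V & smooth2 V (rho M)"
  using rho_chart_D(1)[OF w e10(2)] p h0(1) by (metis mem_Collect_eq order.strict_trans1 less_imp_le prod.collapse)
 qed
 have small: "\<forall>\<^sub>F z in at_top. ALL i j th. i + j <= k & i + j > 0 -->
  \<bar>(D1 ^^ i) ((D2 ^^ j) (rho M)) (th, z)\<bar> <= eps * (sqrt z * (1 / sqrt z) ^ j)"
  and small0: "\<forall>\<^sub>F z in at_top. ALL th. \<bar>rho M (th, z) - sqrt 2 * sqrt z\<bar> <= eps * sqrt z"
  if e: "eps > 0" for eps k
 proof -
  define eps' where "eps' = min eps (1 / 10)"
  have e': "eps' > 0" "eps' <= 1 / 10" "eps' <= eps" using e by (auto simp: eps'_def)
  obtain h1 where h1: "h1 >= 1" "!!h. h >= h1 ==> EX w. chart_at M k eps' h w"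
  using ex_chart[OF M e'(1,2), of k] by blast
  have A: "\<bar>(D1 ^^ i) ((D2 ^^ j) (rho M)) (th, z)\<bar> <= eps * (sqrt z * (1 / sqrt z) ^ j)"
  if z: "z >= h1" and ij: "i + j <= k" "i + j > 0" for z i j th
  proof -
  have z1: "z >= 1" using z h1 by simp
  obtain w where w: "chart_at M k eps' z w" using h1(2)[OF z] by blast
  have sw: "smooth2 UNIV w" using w unfolding chart_at_def by blast
  have "\<bar>(D1 ^^ i) ((D2 ^^ j) w) (th, 0)\<bar> <= eps'" using w ij(1) unfolding chart_at_def by simp
  then have "\<bar>(D1 ^^ i) ((D2 ^^ j) w) (th, 0)\<bar> <= eps" using e' by simp
  moreover have "sqrt z * (1 / sqrt z) ^ j >= 0" using z1 by simp
  ultimately have "(sqrt z * (1 / sqrt z) ^ j) * \<bar>(D1 ^^ i) ((D2 ^^ j) w) (th, 0)\<bar> <= (sqrt z * (1 / sqrt z) ^ j) * eps"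
  by (intro mult_left_mono)
  then show ?thesis
  unfolding rho_chart_D(2)[OF w e'(2) z1] iterD_add_const[OF sw ij(2)]
  using z1 by (simp add: abs_mult mult.commute)
  qed
  have B: "\<bar>rho M (th, z) - sqrt 2 * sqrt z\<bar> <= eps * sqrt z" if z: "z >= h1" for z th
  proof -
  have z1: "z >= 1" using z h1 by simp
  obtain w where w: "chart_at M k eps' z w" using h1(2)[OF z] by blast
  have "\<bar>w (th, 0)\<bar> <= eps'" using chart_polar(2)[OF w e'(2) z1 self[OF z1], of th] by simp
  then have "sqrt z * \<bar>w (th, 0)\<bar> <= sqrt z * eps" using e' z1 by (intro mult_left_mono) auto
  then show ?thesis using rho_chart[OF w e'(2) z1 self[OF z1], of th] z1 by (simp add: algebra_simps abs_mult)
  qed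
  show "\<forall>\<^sub>F z in at_top. ALL i j th. i + j <= k & i + j > 0 -->
  \<bar>(D1 ^^ i) ((D2 ^^ j) (rho M)) (th, z)\<bar> <= eps * (sqrt z * (1 / sqrt z) ^ j)"
  using eventually_ge_at_top[of h1] by (rule eventually_mono) (use A in blast)
  show "\<forall>\<^sub>F z in at_top. ALL th. \<bar>rho M (th, z) - sqrt 2 * sqrt z\<bar> <= eps * sqrt z"
  using eventually_ge_at_top[of h1] by (rule eventually_mono) (use B in blast)
 qed
 have "Sym h0 (1 / 2) (rho M)"
  unfolding Sym_def
 proof (intro conjI allI smooth SymK_iterI[OF smooth])
  fix k i j :: nat
  show "bigOz (1 / 2 - real j / 2) ((D1 ^^ i) ((D2 ^^ j) (rho M)))"
  proof (cases "i + j > 0")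
  case True
  show ?thesis
  by (rule bigOzI[of _ 1], rule eventually_mono[OF eventually_conj[OF small[of 1 "i + j"] eventually_gt_at_top[of 0]]])
  (use True in "auto simp: sqrt_scaling")
  next
  case False
  show ?thesis
  proof (rule bigOzI[of _ 3], rule eventually_mono[OF eventually_conj[OF small0[of 1] eventually_gt_at_top[of 0]]])
  fix z :: real assume z: "(ALL th. \<bar>rho M (th, z) - sqrt 2 * sqrt z\<bar> <= 1 * sqrt z) & 0 < z"
  have "sqrt 2 * sqrt z <= 2 * sqrt z" using sqrt2_bounds z by (intro mult_right_mono) auto
  then have "\<bar>rho M (th, z)\<bar> <= 3 * sqrt z" for th
  using z[THEN conjunct1, rule_format, of th] z by (smt (verit) mult_nonneg_nonneg real_sqrt_ge_zero)
  then show "ALL th. \<bar>(D1 ^^ i) ((D2 ^^ j) (rho M)) (th, z)\<bar> <= 3 * z powr (1 / 2 - real j / 2)"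
  using False z by (simp add: powr_half_sqrt)
  qed simp
  qed
 qed
 moreover have pos: "rho M (th, z) > 0" if z: "z > h0" for th z
 proof -
  obtain w where w: "chart_at M 0 (1 / 10) z w" using h0(2)[of z] z by auto
  have z1: "z >= 1" using z h0 by simp
  show ?thesis using chart_polar(3)[OF w e10(2) z1 self[OF z1]] rho_chart[OF w e10(2) z1 self[OF z1]] by metis
 qed
 moreover have iff: "vector [r * cos th, r * sin th, z] \<in> M \<longleftrightarrow> r = rho M (th, z)" if z: "z > h0" and r: "r > 0" for th z r
 proof -
  obtain w where w: "chart_at M 0 (1 / 10) z w" using h0(2)[of z] z by auto
  have z1: "z >= 1" using z h0 by simp
  show ?thesis using chart_polar(1)[OF w e10(2) z1 self[OF z1] r] rho_chart[OF w e10(2) z1 self[OF z1]] by metis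
 qed
 moreover have "EX th. x = vector [rho M (th, x $ 3) * cos th, rho M (th, x $ 3) * sin th, x $ 3]" if x: "x \<in> M" and z: "x $ 3 > h0" for x
 proof -
  obtain w where w: "chart_at M 0 (1 / 10) (x $ 3) w" using h0(2)[of "x $ 3"] z by auto
  have z1: "x $ 3 >= 1" using z h0 by simp
  obtain r th where r: "r > 0" "x = vector [r * cos th, r * sin th, x $ 3]"
  using chart_polar(4)[OF w e10(2) z1 self[OF z1] x] by blast
  then have "r = rho M (th, x $ 3)" using iff[OF z r(1)] x by metis
  then show ?thesis using r(2) by metis
 qed
 moreover have "\<forall>\<^sub>F z in at_top. ALL th. \<bar>rho M (th, z) - sqrt 2 * sqrt z\<bar> <= eps * sqrt z &
  \<bar>D1 (rho M) (th, z)\<bar> <= eps * sqrt z & \<bar>D1 (D1 (rho M)) (th, z)\<bar> <= eps * sqrt z" if e: "eps > 0" for eps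
  using small[OF e, of 2] small0[OF e]
 proof eventually_elim
  case (elim z)
  show ?case
  using elim(1)[rule_format, of 1 0] elim(1)[rule_format, of 2 0] elim(2) by (simp add: numeral_2_eq_2)
 qed
 ultimately show ?thesis using that[of h0] h0(1) by blast
qed

section \<open>The equation in polar form and the order of its error\<close>

lemma has_derivative_er:
 "((%p :: real \<times> real. (vector [cos (fst p), sin (fst p), 0] :: real^3)) has_derivative
  (%h. fst h *\<^sub>R vector [- sin (fst p), cos (fst p), 0])) (at p)"
 "((%p :: real \<times> real. (vector [- sin (fst p), cos (fst p), 0] :: real^3)) has_derivative
  (%h. fst h *\<^sub>R (- vector [cos (fst p), sin (fst p), 0]))) (at p)"
proof -
 have v: "(vector [a, b, 0] :: real^3) = a *\<^sub>R axis 1 1 + b *\<^sub>R axis 2 1" for a b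
  unfolding vec3_eq by (simp add: axis_def)
 show "((%p :: real \<times> real. (vector [cos (fst p), sin (fst p), 0] :: real^3)) has_derivative
  (%h. fst h *\<^sub>R vector [- sin (fst p), cos (fst p), 0])) (at p)"
  unfolding v by (auto intro!: derivative_eq_intros simp: fun_eq_iff algebra_simps)
 show "((%p :: real \<times> real. (vector [- sin (fst p), cos (fst p), 0] :: real^3)) has_derivative
  (%h. fst h *\<^sub>R (- vector [cos (fst p), sin (fst p), 0]))) (at p)"
  unfolding v by (auto intro!: derivative_eq_intros simp: fun_eq_iff algebra_simps)
qed

text \<open>The immersion equation for \<open>rh\<close> times the radial unit vector plus
  \<open>z\<close> times \<open>tau\<close>. The frame \<open>er\<close>, \<open>et\<close> turns
  with the angle, which produces the lower-order terms of \<open>X11\<close> and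
  \<open>X12\<close>.\<close>

lemma translator_polar_equation:
 fixes rh :: "real \<times> real => real"
 assumes M: "!!x. x \<in> M ==> translator_patch M x"
  and S: "open S" "p \<in> S" "smooth2 S rh" "rh p > 0"
  and inM: "!!th z. (th, z) \<in> S ==> vector [rh (th, z) * cos th, rh (th, z) * sin th, z] \<in> M"
 shows "(1 + (D2 rh p)^2) * (rh p * D1 (D1 rh) p - (rh p)^2 - 2 * (D1 rh p)^2)
  - 2 * D1 rh p * D2 rh p * (rh p * D1 (D2 rh) p - D1 rh p * D2 rh p)
  + ((D1 rh p)^2 + (rh p)^2) * rh p * D2 (D2 rh) p
  = - ((D1 rh p)^2 + (rh p)^2 + (rh p)^2 * (D2 rh p)^2) * rh p * D2 rh p"
proof -
 define er where "er = (%p :: real \<times> real. (vector [cos (fst p), sin (fst p), 0] :: real^3))"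
 define et where "et = (%p :: real \<times> real. (vector [- sin (fst p), cos (fst p), 0] :: real^3))"
 have der: "(er has_derivative (%h. fst h *\<^sub>R et p)) (at p)" and det: "(et has_derivative (%h. fst h *\<^sub>R (- er p))) (at p)" for p
  using has_derivative_er[of p] unfolding er_def et_def by auto
 have erx: "er p $ 1 = cos (fst p)" "er p $ 2 = sin (fst p)" "er p $ 3 = 0"
  and etx: "et p $ 1 = - sin (fst p)" "et p $ 2 = cos (fst p)" "et p $ 3 = 0" for p
  unfolding er_def et_def by simp_all
 have o: "er p <.> er p = 1" "et p <.> et p = 1" "er p <.> et p = 0" "et p <.> er p = 0"
  "er p <.> tau = 0" "et p <.> tau = 0" "tau <.> er p = 0" "tau <.> et p = 0" for p
  unfolding inner3 erx etx by (simp_all add: algebra_simps flip: power2_eq_square)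
 define X where "X = (%p. rh p *\<^sub>R er p + snd p *\<^sub>R tau)"
 define X1 where "X1 = (%p. D1 rh p *\<^sub>R er p + rh p *\<^sub>R et p)"
 define X2 where "X2 = (%p. D2 rh p *\<^sub>R er p + tau)"
 define X11 where "X11 = (D1 (D1 rh) p - rh p) *\<^sub>R er p + (2 * D1 rh p) *\<^sub>R et p"
 define X12 where "X12 = D1 (D2 rh) p *\<^sub>R er p + D2 rh p *\<^sub>R et p"
 define X22 where "X22 = D2 (D2 rh) p *\<^sub>R er p"
 define N where "N = rh p *\<^sub>R er p - D1 rh p *\<^sub>R et p - (rh p * D2 rh p) *\<^sub>R tau"
 have d: "(rh has_derivative (%h. fst h * D1 rh q + snd h * D2 rh q)) (at q)"
  "(D1 rh has_derivative (%h. fst h * D1 (D1 rh) q + snd h * D1 (D2 rh) q)) (at q)"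
  "(D2 rh has_derivative (%h. fst h * D1 (D2 rh) q + snd h * D2 (D2 rh) q)) (at q)" if "q \<in> S" for q
  using has_derivative_D[OF smooth2_differentiable[OF S(3) that]]
  has_derivative_D[OF smooth2_differentiable[OF smooth2_D(1)[OF S(3)] that]]
  has_derivative_D[OF smooth2_differentiable[OF smooth2_D(2)[OF S(3)] that]]
  smooth2_commute[OF S(1,3) that] by simp_all
 have dX: "(X has_derivative (%h. fst h *\<^sub>R X1 q + snd h *\<^sub>R X2 q)) (at q)" if "q \<in> S" for q
  unfolding X_def X1_def X2_def
  by (rule has_derivative_eq_rhs[OF has_derivative_add[OF has_derivative_scaleR[OF d(1)[OF that] der]
  has_derivative_scaleR_left[OF has_derivative_snd[OF has_derivative_ident]]]])
  (auto simp: fun_eq_iff algebra_simps)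
 have dX1: "(X1 has_derivative (%h. fst h *\<^sub>R X11 + snd h *\<^sub>R X12)) (at p)"
  unfolding X1_def X11_def X12_def
  by (rule has_derivative_eq_rhs[OF has_derivative_add[OF has_derivative_scaleR[OF d(2)[OF S(2)] der]
  has_derivative_scaleR[OF d(1)[OF S(2)] det]]])
  (auto simp: fun_eq_iff vec3_eq erx etx algebra_simps)
 have dX2: "(X2 has_derivative (%h. fst h *\<^sub>R X12 + snd h *\<^sub>R X22)) (at p)"
  unfolding X2_def X12_def X22_def
  by (rule has_derivative_eq_rhs[OF has_derivative_add[OF has_derivative_scaleR[OF d(3)[OF S(2)] der]
  has_derivative_const]])
  (auto simp: fun_eq_iff algebra_simps)
 have XM: "X q \<in> M" if "q \<in> S" for q
 proof -
  have "X q = vector [rh q * cos (fst q), rh q * sin (fst q), snd q]"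
  unfolding X_def vec3_eq by (simp add: erx)
  then show ?thesis using inM[of "fst q" "snd q"] that by simp
 qed
 have N1: "N <.> X1 p = 0" "N <.> X2 p = 0"
  unfolding N_def X1_def X2_def by (simp_all add: inner_diff_left inner_add_right o del: inner_tau)
 have g11: "X1 p <.> X1 p = (D1 rh p)^2 + (rh p)^2" and g12: "X1 p <.> X2 p = D1 rh p * D2 rh p"
  and g22: "X2 p <.> X2 p = 1 + (D2 rh p)^2"
  unfolding X1_def X2_def by (simp_all add: inner_add_left inner_add_right o power2_eq_square del: inner_tau)
 have D: "(X1 p <.> X1 p) * (X2 p <.> X2 p) - (X1 p <.> X2 p)^2 = (D1 rh p)^2 + (rh p)^2 + (rh p)^2 * (D2 rh p)^2"
  unfolding g11 g12 g22 by (simp add: power2_eq_square algebra_simps)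
 have D0: "(X1 p <.> X1 p) * (X2 p <.> X2 p) - (X1 p <.> X2 p)^2 > 0"
 proof -
  have "(rh p)^2 > 0" using S(4) by simp
  moreover have "(D1 rh p)^2 >= 0" "(rh p)^2 * (D2 rh p)^2 >= 0" by simp_all
  ultimately show ?thesis unfolding D by linarith
 qed
 have "N <.> ((X2 p <.> X2 p) *\<^sub>R X11 - (2 * (X1 p <.> X2 p)) *\<^sub>R X12 + (X1 p <.> X1 p) *\<^sub>R X22)
  = ((X1 p <.> X1 p) * (X2 p <.> X2 p) - (X1 p <.> X2 p)^2) * (N <.> tau)"
  by (rule translator_immersion_equation[OF M[OF XM[OF S(2)]] S(1,2) dX XM dX1 dX2 N1 D0])
 moreover have "N <.> X11 = rh p * (D1 (D1 rh) p - rh p) - 2 * (D1 rh p)^2"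
  "N <.> X12 = rh p * D1 (D2 rh) p - D1 rh p * D2 rh p" "N <.> X22 = rh p * D2 (D2 rh) p"
  unfolding N_def X11_def X12_def X22_def
  by (simp_all add: inner_diff_left inner_add_right o power2_eq_square algebra_simps del: inner_tau)
 moreover have "N <.> tau = - rh p * D2 rh p"
  unfolding N_def by (simp add: inner_diff_left o del: inner_tau)
 ultimately show ?thesis
  unfolding D g11 g12 g22 by (simp add: inner_diff_right inner_add_right power2_eq_square algebra_simps)
qed

locale polar_end =
 fixes rh :: "real \<times> real => real" and z0 :: real
 assumes z0: "z0 >= 1" and sym: "Sym z0 (1 / 2) rh" and pos: "!!p. p \<in> half z0 ==> rh p > 0"
  and per: "!!th z. rh (th + 2 * pi, z) = rh (th, z)"
  and small: "!!eps. eps > 0 ==> \<forall>\<^sub>F z in at_top. ALL th. \<bar>rh (th, z) - sqrt 2 * sqrt z\<bar> <= eps * sqrt z &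
  \<bar>D1 rh (th, z)\<bar> <= eps * sqrt z & \<bar>D1 (D1 rh) (th, z)\<bar> <= eps * sqrt z"
  and pde: "!!p. p \<in> half z0 ==> (1 + (D2 rh p)^2) * (rh p * D1 (D1 rh) p - (rh p)^2 - 2 * (D1 rh p)^2)
  - 2 * D1 rh p * D2 rh p * (rh p * D1 (D2 rh) p - D1 rh p * D2 rh p)
  + ((D1 rh p)^2 + (rh p)^2) * rh p * D2 (D2 rh) p
  = - ((D1 rh p)^2 + (rh p)^2 + (rh p)^2 * (D2 rh p)^2) * rh p * D2 rh p"
begin

text \<open>\<open>m\<close> is the angular logarithmic derivative of the radius, \<open>F\<close>
  is the angular derivative of \<open>arctan m\<close>, and \<open>bz\<close> is the
  \<open>z\<close>-derivative of half the squared radius. So \<open>E\<close> is the defect of the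
  leading equation. Since \<open>F\<close> is an exact derivative it disappears from means over the
  circle.\<close>

definition m where "m p = D1 rh p * inverse (rh p)"
definition A where "A p = 1 + m p * m p"
definition F where "F p = D1 m p * inverse (A p)"
definition bz where "bz p = rh p * D2 rh p"
definition E where "E p = bz p - 1 + F p"

lemma rho_lower: "\<forall>\<^sub>F z in at_top. ALL th. sqrt z <= rh (th, z)"
proof -
 have "\<forall>\<^sub>F z in at_top. ALL th. \<bar>rh (th, z) - sqrt 2 * sqrt z\<bar> <= 1 / 10 * sqrt z &
  \<bar>D1 rh (th, z)\<bar> <= 1 / 10 * sqrt z & \<bar>D1 (D1 rh) (th, z)\<bar> <= 1 / 10 * sqrt z"
  by (rule small) simp
 then show ?thesis using eventually_gt_at_top[of 0]
 proof eventually_elim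
 case (elim z)
 show ?case
 proof
  fix th
  have "(7 / 5) * sqrt z <= sqrt 2 * sqrt z"
  by (intro mult_right_mono real_le_rsqrt) (use elim in "auto simp: power2_eq_square")
  moreover have "\<bar>rh (th, z) - sqrt 2 * sqrt z\<bar> <= 1 / 10 * sqrt z" using elim by blast
  moreover have "sqrt z >= 0" using elim by simp
  ultimately show "sqrt z <= rh (th, z)" by linarith
 qed
 qed
qed

lemma Sym_inv_rho: "Sym z0 (- (1 / 2)) (%p. inverse (rh p))"
proof (rule Sym_inverse[OF sym, of 1])
 show "\<forall>\<^sub>F z in at_top. ALL th. 1 * z powr (1 / 2) <= \<bar>rh (th, z)\<bar>"
  using rho_lower eventually_gt_at_top[of 0]
  by eventually_elim (auto simp: powr_half_sqrt intro: order_trans abs_ge_self)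
qed (use pos in "auto simp: less_imp_neq[symmetric]")

lemma Sym_m: "Sym z0 0 m"
 unfolding m_def[abs_def] using Sym_mult'[OF Sym_D1[OF sym] Sym_inv_rho, of 0] by simp

lemma A_ge1: "A p >= 1" by (simp add: A_def)

lemma Sym_A: "Sym z0 0 A"
 unfolding A_def[abs_def] using Sym_add[OF Sym_const[of 0] Sym_mult'[OF Sym_m Sym_m, of 0], of 1] by simp

lemma Sym_inverse_ge1:
 assumes "Sym z0 0 f" "!!p. f p >= 1"
 shows "Sym z0 0 (%p. inverse (f p))"
proof -
 have "Sym z0 (- 0) (%p. inverse (f p))"
 proof (rule Sym_inverse[OF assms(1), of 1])
  show "f p ~= 0" for p using assms(2)[of p] by auto
  show "\<forall>\<^sub>F z in at_top. ALL th. 1 * z powr 0 <= \<bar>f (th, z)\<bar>"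
  using eventually_gt_at_top[of 0] by (rule eventually_mono) (simp, metis assms(2) abs_ge_self order_trans)
 qed simp
 then show ?thesis by simp
qed

lemma Sym_F: "Sym z0 0 F"
 unfolding F_def[abs_def] using Sym_mult'[OF Sym_D1[OF Sym_m] Sym_inverse_ge1[OF Sym_A A_ge1], of 0] by simp

lemma D_m:
 assumes "p \<in> half z0"
 shows "D1 m p = D1 (D1 rh) p * inverse (rh p) - D1 rh p * D1 rh p * (inverse (rh p) * inverse (rh p))"
  "D2 m p = D1 (D2 rh) p * inverse (rh p) - D1 rh p * D2 rh p * (inverse (rh p) * inverse (rh p))"
proof -
 note d = smooth2_differentiable[OF Sym_smooth[OF sym] assms]
  smooth2_differentiable[OF smooth2_D(1)[OF Sym_smooth[OF sym]] assms]
 have nz: "rh p ~= 0" using pos[OF assms] by simp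
 note i = D_inverse[OF d(1) nz]
 show "D1 m p = D1 (D1 rh) p * inverse (rh p) - D1 rh p * D1 rh p * (inverse (rh p) * inverse (rh p))"
  unfolding m_def[abs_def] D_mult(2)[OF d(2) i(1)] i(2) by simp
 show "D2 m p = D1 (D2 rh) p * inverse (rh p) - D1 rh p * D2 rh p * (inverse (rh p) * inverse (rh p))"
  unfolding m_def[abs_def] D_mult(3)[OF d(2) i(1)] i(3)
  using smooth2_commute[OF open_half Sym_smooth[OF sym] assms] by simp
qed

lemma polar_equation:
 assumes "p \<in> half z0"
 shows "bz p * (A p + D2 rh p * D2 rh p) = (1 + D2 rh p * D2 rh p) * (A p - D1 m p)
  + 2 * (m p * D2 rh p * (rh p * D2 m p)) - A p * (rh p * D2 (D2 rh) p)"
proof -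
 define r where "r = rh p"
 have r: "r > 0" using pos[OF assms] by (simp add: r_def)
 have m: "m p = D1 rh p / r" "D1 m p = (r * D1 (D1 rh) p - D1 rh p * D1 rh p) / (r * r)"
  "D2 m p = (r * D1 (D2 rh) p - D1 rh p * D2 rh p) / (r * r)"
  unfolding D_m[OF assms] r_def[symmetric] using r by (simp_all add: m_def r_def[symmetric] field_simps)
 show ?thesis
  using pde[OF assms] r unfolding A_def bz_def m r_def[symmetric]
  by (simp add: field_simps power2_eq_square) algebra?
qed

lemma Sym_half_cong: "(!!p. p \<in> half z0 ==> f p = g p) ==> Sym z0 a f ==> Sym z0 a g"
 by (rule Sym_cong)

text \<open>The first use of the equation improves \<open>bz\<close> from order \<open>1/2\<close> to order \<open>0\<close>; each further use
 gains because \<open>z\<close>-derivatives are expressed through \<open>th\<close>-derivatives.\<close>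

lemma Sym_bz: "Sym z0 0 bz"
proof -
 define G where "G = (%p. A p + D2 rh p * D2 rh p)"
 define R where "R = (%p. (1 + D2 rh p * D2 rh p) * (A p - D1 m p)
  + 2 * (m p * D2 rh p * (rh p * D2 m p)) - A p * (rh p * D2 (D2 rh) p))"
 note r2 = Sym_D2[OF sym] and r22 = Sym_D2[OF Sym_D2[OF sym]] and m2 = Sym_D2[OF Sym_m] and m1 = Sym_D1[OF Sym_m]
 have q: "Sym z0 0 (%p. D2 rh p * D2 rh p)" by (rule Sym_mult'[OF r2 r2]) simp
 have G: "Sym z0 0 G" unfolding G_def by (rule Sym_add[OF Sym_A q])
 have G1: "G p >= 1" for p
  using A_ge1[of p] zero_le_square[of "D2 rh p"] unfolding G_def by linarith
 have "Sym z0 0 (%p. (1 + D2 rh p * D2 rh p) * (A p - D1 m p))"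
  by (rule Sym_mult'[OF Sym_add[OF Sym_const[of 0] q] Sym_diff[OF Sym_A m1]]) simp_all
 moreover have "Sym z0 0 (%p. 2 * (m p * D2 rh p * (rh p * D2 m p)))"
  by (rule Sym_cmult, rule Sym_mult'[OF Sym_mult[OF Sym_m r2] Sym_mult[OF sym m2]]) simp
 moreover have "Sym z0 0 (%p. A p * (rh p * D2 (D2 rh) p))"
  by (rule Sym_mult'[OF Sym_A Sym_mult[OF sym r22]]) simp
 ultimately have R: "Sym z0 0 R" unfolding R_def by (intro Sym_diff Sym_add)
 have "Sym z0 0 (%p. R p * inverse (G p))"
  by (rule Sym_mult'[OF R Sym_inverse_ge1[OF G G1]]) simp
 moreover have "R p * inverse (G p) = bz p" if "p \<in> half z0" for p
 proof -
  have "bz p * G p = R p" unfolding G_def R_def by (rule polar_equation[OF that])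
  then show ?thesis using G1[of p] by (simp add: field_simps)
 qed
 ultimately show ?thesis by (rule Sym_half_cong[rotated])
qed

lemma Sym_D2_rho: "Sym z0 (- (1 / 2)) (D2 rh)"
proof (rule Sym_half_cong)
 show "Sym z0 (- (1 / 2)) (%p. bz p * inverse (rh p))" by (rule Sym_mult'[OF Sym_bz Sym_inv_rho]) simp
 show "bz p * inverse (rh p) = D2 rh p" if "p \<in> half z0" for p
  using pos[OF that] unfolding bz_def by simp
qed

lemma Sym_D2_m: "Sym z0 (- 1) (D2 m)"
proof (rule Sym_half_cong)
 note i = Sym_inv_rho and r2 = Sym_D2_rho
 show "Sym z0 (- 1) (%p. D1 (D2 rh) p * inverse (rh p) - D1 rh p * D2 rh p * (inverse (rh p) * inverse (rh p)))"
  by (rule Sym_diff[OF Sym_mult'[OF Sym_D1[OF r2] i] Sym_mult'[OF Sym_mult[OF Sym_D1[OF sym] r2] Sym_mult[OF i i]]]) simp_all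
qed (use D_m in auto)

text \<open>Solving the polar equation for \<open>bz\<close>: every term that remains contains two
  derivatives in \<open>z\<close>, and this makes \<open>E\<close> small.\<close>

lemma E_formula:
 assumes "p \<in> half z0"
 shows "E p = (D2 rh p * D2 rh p * (A p - D1 m p) + 2 * (m p * D2 rh p * (rh p * D2 m p))
  - D2 rh p * D2 rh p * bz p) * inverse (A p) - rh p * D2 (D2 rh) p"
proof -
 have "A p > 0" using A_ge1[of p] by linarith
 then show ?thesis using polar_equation[OF assms] unfolding E_def F_def by (simp add: field_simps)
qed

lemma Sym_E_aux: "Sym z0 (- 1) (%p. (D2 rh p * D2 rh p * (A p - D1 m p) + 2 * (m p * D2 rh p * (rh p * D2 m p))
  - D2 rh p * D2 rh p * bz p) * inverse (A p))"
proof (rule Sym_mult'[OF _ Sym_inverse_ge1[OF Sym_A A_ge1]])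
 note r2 = Sym_D2_rho
 have q: "Sym z0 (- 1) (%p. D2 rh p * D2 rh p)" by (rule Sym_mult'[OF r2 r2]) simp
 have "Sym z0 (- 1) (%p. D2 rh p * D2 rh p * (A p - D1 m p))"
  by (rule Sym_mult'[OF q Sym_diff[OF Sym_A Sym_D1[OF Sym_m]]]) simp
 moreover have "Sym z0 (- 1) (%p. 2 * (m p * D2 rh p * (rh p * D2 m p)))"
  by (rule Sym_cmult, rule Sym_mult'[OF Sym_mult[OF Sym_m r2] Sym_mult[OF sym Sym_D2_m]]) simp
 moreover have "Sym z0 (- 1) (%p. D2 rh p * D2 rh p * bz p)"
  by (rule Sym_mult'[OF q Sym_bz]) simp
 ultimately show "Sym z0 (- 1) (%p. D2 rh p * D2 rh p * (A p - D1 m p) + 2 * (m p * D2 rh p * (rh p * D2 m p))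
  - D2 rh p * D2 rh p * bz p)" by (intro Sym_diff Sym_add)
qed simp

lemma Sym_E_half: "Sym z0 (- (1 / 2)) E"
proof (rule Sym_half_cong)
 have "Sym z0 (- (1 / 2)) (%p. rh p * D2 (D2 rh) p)"
  by (rule Sym_mult'[OF sym Sym_D2[OF Sym_D2_rho]]) simp
 then show "Sym z0 (- (1 / 2)) (%p. (D2 rh p * D2 rh p * (A p - D1 m p) + 2 * (m p * D2 rh p * (rh p * D2 m p))
  - D2 rh p * D2 rh p * bz p) * inverse (A p) - rh p * D2 (D2 rh) p)"
  by (intro Sym_diff Sym_mono[OF Sym_E_aux]) simp_all
qed (use E_formula in auto)

lemma Sym_D2_F: "Sym z0 (- 1) (D2 F)"
proof (rule Sym_half_cong)
 note sm = Sym_smooth[OF Sym_m]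
 have "Sym z0 (- 1) (D1 (D2 m))" by (rule Sym_D1[OF Sym_D2_m])
 then have "Sym z0 (- 1) (D2 (D1 m))"
  by (rule Sym_half_cong[rotated]) (rule smooth2_commute[OF open_half sm])
 note x = this
 note iA = Sym_inverse_ge1[OF Sym_A A_ge1]
 have y: "Sym z0 (- 1) (%p. D2 m p * m p)" by (rule Sym_mult'[OF Sym_D2_m Sym_m]) simp
 show "Sym z0 (- 1) (%p. D2 (D1 m) p * inverse (A p) - 2 * ((D2 m p * m p) * (D1 m p * (inverse (A p) * inverse (A p)))))"
  by (rule Sym_diff[OF Sym_mult'[OF x iA] Sym_cmult[OF Sym_mult'[OF y Sym_mult[OF Sym_D1[OF Sym_m] Sym_mult[OF iA iA]]]]]) simp_all
 show "D2 (D1 m) p * inverse (A p) - 2 * ((D2 m p * m p) * (D1 m p * (inverse (A p) * inverse (A p)))) = D2 F p"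
  if p: "p \<in> half z0" for p
 proof -
  note d = smooth2_differentiable[OF sm p]
  note d1 = smooth2_differentiable[OF smooth2_D(1)[OF sm] p]
  have c: "(%p. 1) differentiable (at p)" by simp
  note dm = D_mult[OF d d]
  have dA: "A differentiable (at p)" "D2 A p = 2 * (D2 m p * m p)"
  unfolding A_def[abs_def] using D_add[OF c dm(1)] dm(3) by simp_all
  have nz: "A p ~= 0" using A_ge1[of p] by auto
  note i = D_inverse[OF dA(1) nz]
  show ?thesis unfolding F_def[abs_def] D_mult(3)[OF d1 i(1)] i(3) dA(2) by simp
 qed
qed

text \<open>In \<open>E_formula\<close> only the product of \<open>rh\<close> with its second
  \<open>z\<close>-derivative still has order \<open>- 1 / 2\<close>. By
  \<open>bz = 1 - F + E\<close> the derivative \<open>D2 bz\<close> is \<open>D2 E - D2 F\<close>,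
  of order \<open>- 1\<close> by the weaker bound on \<open>E\<close>; subtracting the square of
  \<open>D2 rh\<close> recovers that product with the better order.\<close>

lemma Sym_E: "Sym z0 (- 1) E"
proof (rule Sym_half_cong)
 have bze: "bz = (%p. 1 - F p + E p)" unfolding E_def by simp
 note sF = Sym_smooth[OF Sym_F] and sE = Sym_smooth[OF Sym_E_half]
 have "Sym z0 (- 1) (%p. D2 E p - D2 F p)"
  by (rule Sym_diff[OF Sym_mono[OF Sym_D2[OF Sym_E_half]] Sym_D2_F]) simp
 moreover have "D2 E p - D2 F p = D2 bz p" if p: "p \<in> half z0" for p
 proof -
  note dF = smooth2_differentiable[OF sF p] and dE = smooth2_differentiable[OF sE p]
  have c: "(%p. -1 :: real) differentiable (at p)" by simp
  note mF = D_mult[OF c dF]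
  note a = D_add[OF dE mF(1)]
  have c1: "(%p. 1 :: real) differentiable (at p)" by simp
  have "bz = (%p. 1 + (E p + (-1) * F p))" unfolding bze by (simp add: fun_eq_iff)
  then show ?thesis using D_add(3)[OF c1 a(1)] a(3) mF(3) by simp
 qed
 ultimately have Dbz: "Sym z0 (- 1) (D2 bz)" by (rule Sym_half_cong[rotated])
 have q: "Sym z0 (- 1) (%p. D2 rh p * D2 rh p)" by (rule Sym_mult'[OF Sym_D2_rho Sym_D2_rho]) simp
 have "Sym z0 (- 1) (%p. D2 bz p - D2 rh p * D2 rh p)" by (rule Sym_diff[OF Dbz q])
 moreover have "D2 bz p - D2 rh p * D2 rh p = rh p * D2 (D2 rh) p" if p: "p \<in> half z0" for p
  unfolding bz_def[abs_def]
  using D_mult(3)[OF smooth2_differentiable[OF Sym_smooth[OF sym] p] smooth2_differentiable[OF smooth2_D(2)[OF Sym_smooth[OF sym]] p]]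
  by simp
 ultimately have "Sym z0 (- 1) (%p. rh p * D2 (D2 rh) p)" by (rule Sym_half_cong[rotated])
 then show "Sym z0 (- 1) (%p. (D2 rh p * D2 rh p * (A p - D1 m p) + 2 * (m p * D2 rh p * (rh p * D2 m p))
  - D2 rh p * D2 rh p * bz p) * inverse (A p) - rh p * D2 (D2 rh) p)"
  by (rule Sym_diff[OF Sym_E_aux])
qed (use E_formula in auto)

end

section \<open>Integrals over the circle and the spectral gap\<close>

abbreviation circ :: "(real => real) => real" where "circ f \<equiv> integral {0..2 * pi} f"

lemma circ_ftc:
 assumes "!!x. DERIV f x :> f' x"
 shows "circ f' = f (2 * pi) - f 0" "f' integrable_on {0..2 * pi}"
proof -
 have "(f' has_integral (f (2 * pi) - f 0)) {0..2 * pi}"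
  by (rule fundamental_theorem_of_calculus)
  (auto intro!: has_vector_derivative_at_within assms[unfolded has_real_derivative_iff_has_vector_derivative])
 then show "circ f' = f (2 * pi) - f 0" "f' integrable_on {0..2 * pi}" by (auto simp: integral_unique)
qed

lemma circ_integrable: "continuous_on UNIV f ==> f integrable_on {0..2 * pi :: real}" for f :: "real => real"
 by (rule integrable_continuous_real) (rule continuous_on_subset, auto)

lemma circ_add: "continuous_on UNIV f ==> continuous_on UNIV g ==> circ (%x. f x + g x) = circ f + circ g"
 and circ_diff: "continuous_on UNIV f ==> continuous_on UNIV g ==> circ (%x. f x - g x) = circ f - circ g"
 by (intro Henstock_Kurzweil_Integration.integral_add Henstock_Kurzweil_Integration.integral_diff circ_integrable; assumption)+

lemma circ_mono: "continuous_on UNIV f ==> continuous_on UNIV g ==> (!!x. f x <= g x) ==> circ f <= circ g"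
 by (intro integral_le circ_integrable) auto

lemma circ_nonneg: "continuous_on UNIV f ==> (!!x. f x >= 0) ==> circ f >= 0"
 by (intro Henstock_Kurzweil_Integration.integral_nonneg circ_integrable) auto

lemma circ_const: "circ (%x. c) = 2 * pi * c"
 by simp

lemma circ_abs: "continuous_on UNIV f ==> \<bar>circ f\<bar> <= circ (%x. \<bar>f x\<bar>)"
 using integral_norm_bound_integral[of f "{0..2*pi}" "%x. \<bar>f x\<bar>"]
 by (auto intro!: circ_integrable continuous_intros)

lemma circ_bound: "continuous_on UNIV f ==> (!!x. \<bar>f x\<bar> <= B) ==> \<bar>circ f\<bar> <= 2 * pi * B"
 using order_trans[OF circ_abs circ_mono[of "%x. \<bar>f x\<bar>" "%x. B"]] by (auto intro!: continuous_intros)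

lemma circ_by_parts:
 assumes f: "!!x. DERIV f x :> f' x" and g: "!!x. DERIV g x :> g' x"
  and c: "continuous_on UNIV f'" "continuous_on UNIV g'"
  and p: "f (2 * pi) = f 0" "g (2 * pi) = g 0"
 shows "circ (%x. f' x * g x) = - circ (%x. f x * g' x)"
proof -
 have cf: "continuous_on UNIV f" and cg: "continuous_on UNIV g"
  using f g by (meson DERIV_isCont continuous_at_imp_continuous_on)+
 have "circ (%x. f' x * g x + f x * g' x) = f (2 * pi) * g (2 * pi) - f 0 * g 0"
  by (rule circ_ftc(1)) (use f g in "auto intro!: derivative_eq_intros")
 then have "circ (%x. f' x * g x + f x * g' x) = 0" using p by simp
 moreover have "circ (%x. f' x * g x + f x * g' x) = circ (%x. f' x * g x) + circ (%x. f x * g' x)"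
  by (intro circ_add continuous_intros c cf cg)
 ultimately show ?thesis by simp
qed

lemma circ_by_cos:
 assumes f: "!!x. DERIV f x :> f' x" and c: "continuous_on UNIV f'" and p: "f (2 * pi) = f 0"
 shows "circ (%x. f' x * cos x) = circ (%x. f x * sin x)"
proof -
 have "circ (%x. f' x * cos x) = - circ (%x. f x * (%x. - sin x) x)"
 proof (rule circ_by_parts)
  show "DERIV f x :> f' x" for x by (rule f)
  show "DERIV cos x :> - sin x" for x :: real by (rule DERIV_cos)
  show "continuous_on UNIV f'" by (rule c)
  show "continuous_on UNIV (%x::real. - sin x)" by (intro continuous_intros)
  show "f (2 * pi) = f 0" by (rule p)
  show "cos (2 * pi) = cos (0::real)" by simp
 qed
 then show ?thesis by simp
qed
lemma circ_by_sin:
 assumes f: "!!x. DERIV f x :> f' x" and c: "continuous_on UNIV f'" and p: "f (2 * pi) = f 0"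
 shows "circ (%x. f' x * sin x) = - circ (%x. f x * cos x)"
proof (rule circ_by_parts)
  show "DERIV f x :> f' x" for x by (rule f)
  show "DERIV sin x :> cos x" for x :: real by (rule DERIV_sin)
  show "continuous_on UNIV f'" by (rule c)
  show "continuous_on UNIV (%x::real. cos x)" by (intro continuous_intros)
  show "f (2 * pi) = f 0" by (rule p)
  show "sin (2 * pi) = sin (0::real)" by simp
qed

lemma circ_Cauchy_Schwarz:
 assumes c: "continuous_on UNIV f" "continuous_on UNIV g"
 shows "(circ (%x. f x * g x))^2 <= circ (%x. (f x)^2) * circ (%x. (g x)^2)"
proof -
 define a b d where "a = circ (%x. (f x)^2)" and "b = circ (%x. f x * g x)" and "d = circ (%x. (g x)^2)"
 have q: "0 <= s^2 * a - 2 * s * t * b + t^2 * d" for s t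
 proof -
  have "0 <= circ (%x. (s * f x - t * g x)^2)" by (intro circ_nonneg continuous_intros c) auto
  also have "(%x. (s * f x - t * g x)^2) = (%x. s^2 * (f x)^2 - (2 * s * t) * (f x * g x) + t^2 * (g x)^2)"
  by (auto simp: power2_eq_square algebra_simps)
  also have "circ ... = circ (%x. s^2 * (f x)^2) - circ (%x. (2 * s * t) * (f x * g x)) + circ (%x. t^2 * (g x)^2)"
  by (subst circ_add, (intro continuous_intros c)+, subst circ_diff, (intro continuous_intros c)+, rule refl)
  also have "... = s^2 * a - 2 * s * t * b + t^2 * d" unfolding a_def b_def d_def by simp
  finally show ?thesis .
 qed
 have d0: "d >= 0" unfolding d_def by (intro circ_nonneg continuous_intros c) auto
 have "b^2 <= a * d"
 proof (cases "d = 0")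
  case True
  have "b = 0"
  proof (rule ccontr)
  assume "b ~= 0"
  \<comment> \<open>With \<open>d = 0\<close> this choice makes the quadratic form equal to
    \<open>- 1\<close>.\<close>
  then show False using q[of 1 "(a + 1) / (2 * b)"] True by (simp add: field_simps)
  qed
  then show ?thesis using True by simp
 next
  case False
  have "0 <= d^2 * a - 2 * d * b * b + b^2 * d" by (rule q)
  also have "... = d * (a * d - b^2)" by (simp add: power2_eq_square algebra_simps)
  finally show ?thesis using False d0 by (simp add: zero_le_mult_iff)
 qed
 then show ?thesis unfolding a_def b_def d_def .
qed

text \<open>For a primitive \<open>G\<close> the shifted integral is
  \<open>G (s + 2 * pi) - G s\<close>, whose derivative in \<open>s\<close> vanishes by
  periodicity.\<close>

lemma circ_shift:
 assumes c: "continuous_on UNIV f" and p: "!!x. f (x + 2 * pi) = f x"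
 shows "circ (%x. f (x + a)) = circ f"
proof -
 define B where "B = \<bar>a\<bar> + 2 * pi + 1"
 have "continuous_on {- B..B} f" using c continuous_on_subset by blast
 then obtain G where G: "!!x. x \<in> {- B..B} ==> (G has_vector_derivative f x) (at x within {- B..B})"
  using antiderivative_continuous by blast
 have dG: "DERIV G x :> f x" if "- B < x" "x < B" for x
  using G[of x] that by (simp add: has_real_derivative_iff_has_vector_derivative at_within_Icc_at)
 have int: "circ (%x. f (x + s)) = G (s + 2 * pi) - G s" if s: "\<bar>s\<bar> <= \<bar>a\<bar>" for s
 proof -
  have "((%x. f (x + s)) has_integral (G (2 * pi + s) - G (0 + s))) {0..2 * pi}"
  proof (rule fundamental_theorem_of_calculus)
  fix x :: real assume x: "x \<in> {0..2 * pi}"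
  have "DERIV G (x + s) :> f (x + s)" by (rule dG) (use x s in "auto simp: B_def")
  then have "DERIV (%x. G (x + s)) x :> f (x + s)" by (simp add: DERIV_shift)
  then show "((%x. G (x + s)) has_vector_derivative f (x + s)) (at x within {0..2 * pi})"
  by (auto intro: has_vector_derivative_at_within simp: has_real_derivative_iff_has_vector_derivative)
  qed simp
  then show ?thesis by (simp add: integral_unique add.commute)
 qed
 have "G (s + 2 * pi) - G s = G (0 + 2 * pi) - G 0" if "\<bar>s\<bar> <= \<bar>a\<bar>" for s
 proof -
  have d: "DERIV (%s. G (s + 2 * pi) - G s) x :> 0" if "\<bar>x\<bar> <= \<bar>a\<bar>" for x
  proof -
  have xa: "x <= \<bar>a\<bar>" "- \<bar>a\<bar> <= x" using that by linarith+
  have "- B < x + 2 * pi" "x + 2 * pi < B" "- B < x" "x < B" unfolding B_def using xa pi_gt_zero by linarith+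
  note bd = this
  have "DERIV G (x + 2 * pi) :> f (x + 2 * pi)" by (rule dG[OF bd(1,2)])
  then have "DERIV (%s. G (s + 2 * pi)) x :> f (x + 2 * pi)" by (simp add: DERIV_shift)
  moreover have "DERIV G x :> f x" by (rule dG[OF bd(3,4)])
  ultimately have "DERIV (%s. G (s + 2 * pi) - G s) x :> f (x + 2 * pi) - f x" by (rule DERIV_diff)
  then show ?thesis by (simp add: p)
  qed
  show ?thesis
  proof (cases "s = 0")
  case False
  show ?thesis
  proof (cases "s > 0")
  case True
  have "\<exists>z>0. z < s & (G (s + 2 * pi) - G s) - (G (0 + 2 * pi) - G 0) = (s - 0) * 0"
  by (rule MVT2[OF True]) (use d that in auto)
  then show ?thesis by auto
  next
  case neg: False
  then have "s < 0" using False by simp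
  then have "\<exists>z>s. z < 0 & (G (0 + 2 * pi) - G 0) - (G (s + 2 * pi) - G s) = (0 - s) * 0"
  by (rule MVT2) (use d that in auto)
  then show ?thesis by auto
  qed
  qed simp
 qed
 from this[of a] show ?thesis using int[of a] int[of 0] by simp
qed

text \<open>On one period this is the sum over \<open>k >= 2\<close> of
  \<open>- cos (k * t) / (pi * k^2)\<close> in closed form. By Parseval its squared norm is
  \<open>1 / pi\<close> times the sum of \<open>1 / k^4\<close> over \<open>k >= 2\<close>, which
  explains the value \<open>pi^3 / 90 - 1 / pi\<close> found below by an explicit primitive.\<close>

definition kap :: "real => real" where
 "kap t = - ((t - pi)^2 - pi^2 / 3) / (4 * pi) + cos t / pi"

lemma circ_kap_square: "circ (%t. (kap t)^2) = pi ^ 3 / 90 - 1 / pi"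
proof -
 define G where "G = (%t. ((t - pi) ^ 5 / 5 - 2 * pi^2 * (t - pi) ^ 3 / 9 + pi ^ 4 * (t - pi) / 9) / (16 * pi^2)
  - ((t - pi)^2 * sin t + 2 * (t - pi) * cos t - 2 * sin t - pi^2 / 3 * sin t) / (2 * pi^2)
  + (t / 2 + sin t * cos t / 2) / pi^2)"
 have dG: "DERIV G t :> (kap t)^2" for t
 proof -
  define s where "s = t - pi"
  have "DERIV G t :> ((s ^ 4 - 2 * pi^2 * s^2 / 3 + pi ^ 4 / 9)) / (16 * pi^2)
  - (s^2 * cos t - pi^2 / 3 * cos t) / (2 * pi^2) + (1 / 2 + (cos t * cos t - sin t * sin t) / 2) / pi^2"
  unfolding G_def s_def
  by (auto intro!: derivative_eq_intros simp: power2_eq_square divide_simps) (auto simp: algebra_simps power2_eq_square power4_eq_xxxx numeral_eq_Suc)?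
  moreover have "((s ^ 4 - 2 * pi^2 * s^2 / 3 + pi ^ 4 / 9)) / (16 * pi^2)
  - (s^2 * cos t - pi^2 / 3 * cos t) / (2 * pi^2) + (1 / 2 + (cos t * cos t - sin t * sin t) / 2) / pi^2 = (kap t)^2"
  proof -
  have ss: "sin t * sin t = 1 - cos t * cos t" using sin_cos_squared_add[of t] by (simp add: power2_eq_square)
  show ?thesis unfolding kap_def s_def[symmetric] ss
  by (simp add: divide_simps power2_eq_square power4_eq_xxxx) (simp add: algebra_simps)
  qed
  ultimately show ?thesis by simp
 qed
 have "circ (%t. (kap t)^2) = G (2 * pi) - G 0" by (rule circ_ftc(1)[OF dG])
 also have "... = pi ^ 3 / 90 - 1 / pi"
  unfolding G_def by (simp add: divide_simps power2_eq_square power3_eq_cube power4_eq_xxxx numeral_eq_Suc)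
 finally show ?thesis .
qed

text \<open>The left side, about 0.165, is the factor by which the kernel bounds the squared norm of
  \<open>h\<close> by that of \<open>h''\<close>; \<open>(5 / 12)^2\<close> is about 0.174.\<close>

lemma pi_pow4_bound: "2 * (pi ^ 4 / 90 - 1) <= (5 / 12)^2"
proof -
 have "pi ^ 4 <= (3.1416 :: real) ^ 4" using pi_approx(2) by (intro power_mono) auto
 then show ?thesis by (simp add: power4_eq_xxxx power2_eq_square)
qed

text \<open>The Green function of \<open>d^2/dth^2\<close> on the circle, with its first harmonic removed, represents \<open>h\<close> by
 \<open>h''\<close>; the constant \<open>5/12\<close> is not optimal, but only a spectral gap above \<open>2\<close> is needed.\<close>

lemma kap_representation:
 assumes d: "!!x. DERIV h x :> h' x" "!!x. DERIV h' x :> h'' x" and c: "continuous_on UNIV h''"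
  and p: "h (2 * pi) = h 0" "h' (2 * pi) = h' 0"
  and o: "circ h = 0" "circ (%x. h x * cos x) = 0"
 shows "h 0 = circ (%x. kap x * h'' x)"
proof -
 define k' where "k' = (%t. - (t - pi) / (2 * pi) - sin t / pi)"
 define k'' where "k'' = (%t. - 1 / (2 * pi) - cos t / pi)"
 have dk: "DERIV kap t :> k' t" "DERIV k' t :> k'' t" for t
  unfolding kap_def[abs_def] k'_def k''_def
  by (auto intro!: derivative_eq_intros simp: divide_simps) (auto simp: algebra_simps)?
 have ch: "continuous_on UNIV h" and ck: "continuous_on UNIV kap"
  using d(1) dk(1) by (auto intro!: continuous_at_imp_continuous_on DERIV_isCont)
 have ck'': "continuous_on UNIV k''" unfolding k''_def by (intro continuous_intros) auto
 have "circ (%x. kap x * h'' x - k'' x * h x) = (kap (2 * pi) * h' (2 * pi) - k' (2 * pi) * h (2 * pi)) - (kap 0 * h' 0 - k' 0 * h 0)"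
  by (rule circ_ftc(1)[where f = "%x. kap x * h' x - k' x * h x"])
  (auto intro!: derivative_eq_intros d dk)
 also have "... = h 0"
  unfolding p by (simp add: kap_def k'_def power2_eq_square)
 finally have "circ (%x. kap x * h'' x - k'' x * h x) = h 0" .
 moreover have "circ (%x. kap x * h'' x - k'' x * h x) = circ (%x. kap x * h'' x) - circ (%x. k'' x * h x)"
  by (intro circ_diff continuous_intros c ch ck ck'')
 moreover have "circ (%x. k'' x * h x) = 0"
 proof -
  have "(%x. k'' x * h x) = (%x. (- 1 / (2 * pi)) * h x - (1 / pi) * (h x * cos x))"
  unfolding k''_def by (auto simp: algebra_simps)
  then have "circ (%x. k'' x * h x) = circ (%x. (- 1 / (2 * pi)) * h x) - circ (%x. (1 / pi) * (h x * cos x))"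
  by (simp only:) (intro circ_diff continuous_intros ch)
  also have "... = (- 1 / (2 * pi)) * circ h - (1 / pi) * circ (%x. h x * cos x)"
  by (simp only: integral_mult_right)
  finally show ?thesis using o by simp
 qed
 ultimately show ?thesis by simp
qed

text \<open>The representation at 0, applied to all translates of \<open>h\<close>, bounds
  \<open>h\<close> pointwise and hence in norm by \<open>h''\<close>. Then the squared norm of
  \<open>h'\<close> is minus the product of \<open>h\<close> and \<open>h''\<close>, and
  Cauchy-Schwarz finishes. Orthogonality to both \<open>cos\<close> and \<open>sin\<close> is what
  survives translation.\<close>

lemma circle_poincare2:
 assumes d: "!!x. DERIV h x :> h' x" "!!x. DERIV h' x :> h'' x" and c: "continuous_on UNIV h''"
  and p: "!!x. h (x + 2 * pi) = h x" "!!x. h' (x + 2 * pi) = h' x" "!!x. h'' (x + 2 * pi) = h'' x"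
  and o: "circ h = 0" "circ (%x. h x * cos x) = 0" "circ (%x. h x * sin x) = 0"
 shows "circ (%x. (h' x)^2) <= (5 / 12) * circ (%x. (h'' x)^2)"
proof -
 have ch: "continuous_on UNIV h" and ch': "continuous_on UNIV h'"
  using d by (auto intro!: continuous_at_imp_continuous_on DERIV_isCont)
 define J where "J = circ (%x. (h'' x)^2)"
 have J0: "J >= 0" unfolding J_def by (intro circ_nonneg continuous_intros c) auto
 have pt: "(h a)^2 <= (pi ^ 3 / 90 - 1 / pi) * J" for a
 proof -
  have sh: "circ (%x. h (x + a)) = 0" using circ_shift[OF ch p(1), of a] o(1) by simp
  have cs: "continuous_on UNIV (%x. h (x + a))" by (rule continuous_on_compose2[OF ch]) (auto intro!: continuous_intros)
  have c1: "circ (%x. h (x + a) * cos (x + a)) = 0"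
  using circ_shift[of "%x. h x * cos x" a] p(1) o(2) by (simp add: continuous_on_mult ch continuous_on_cos)
  have s1: "circ (%x. h (x + a) * sin (x + a)) = 0"
  using circ_shift[of "%x. h x * sin x" a] p(1) o(3) by (simp add: continuous_on_mult ch continuous_on_sin)
  have "(%x. h (x + a) * cos x) = (%x. cos a * (h (x + a) * cos (x + a)) + sin a * (h (x + a) * sin (x + a)))"
  proof
  fix x
  have "cos x = cos ((x + a) - a)" by simp
  also have "... = cos (x + a) * cos a + sin (x + a) * sin a" by (rule cos_diff)
  finally show "h (x + a) * cos x = cos a * (h (x + a) * cos (x + a)) + sin a * (h (x + a) * sin (x + a))"
  by (simp add: algebra_simps)
  qed
  then have "circ (%x. h (x + a) * cos x) = circ (%x. cos a * (h (x + a) * cos (x + a))) + circ (%x. sin a * (h (x + a) * sin (x + a)))"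
  by (simp only:) (intro circ_add continuous_intros cs)
  then have oc: "circ (%x. h (x + a) * cos x) = 0" using c1 s1 by simp
  have cs'': "continuous_on UNIV (%x. h'' (x + a))" by (rule continuous_on_compose2[OF c]) (auto intro!: continuous_intros)
  have "h (0 + a) = circ (%x. kap x * h'' (x + a))"
  proof (rule kap_representation[OF _ _ cs'' _ _ sh oc])
  show "DERIV (%x. h (x + a)) x :> h' (x + a)" "DERIV (%x. h' (x + a)) x :> h'' (x + a)" for x
  using d(1)[of "x + a"] d(2)[of "x + a"] by (simp_all add: DERIV_shift)
  show "h (2 * pi + a) = h (0 + a)" "h' (2 * pi + a) = h' (0 + a)" using p(1)[of a] p(2)[of a] by (simp_all add: add.commute)
  qed
  then have "(h a)^2 = (circ (%x. kap x * h'' (x + a)))^2" by simp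
  also have "... <= circ (%x. (kap x)^2) * circ (%x. (h'' (x + a))^2)"
  by (rule circ_Cauchy_Schwarz[OF _ cs'']) (unfold kap_def, intro continuous_intros, auto)
  also have "circ (%x. (h'' (x + a))^2) = J"
  unfolding J_def by (rule circ_shift[of "%x. (h'' x)^2"]) (auto intro!: continuous_intros c simp: p)
  finally show ?thesis unfolding circ_kap_square .
 qed
 define I where "I = circ (%x. (h x)^2)"
 have "I <= circ (%x. (pi ^ 3 / 90 - 1 / pi) * J)"
  unfolding I_def by (rule circ_mono) (auto intro!: continuous_intros ch pt)
 also have "... = 2 * (pi ^ 4 / 90 - 1) * J"
  unfolding circ_const by (simp add: field_simps power4_eq_xxxx power3_eq_cube)
 also have "... <= (5 / 12)^2 * J" using pi_pow4_bound J0 by (intro mult_right_mono)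
 finally have I: "I <= (5 / 12)^2 * J" .
 have "circ (%x. (h' x)^2) = circ (%x. h' x * h' x)" by (simp add: power2_eq_square)
 also have "... = - circ (%x. h x * h'' x)"
  by (rule circ_by_parts[OF d(1,2) ch' c]) (use p(1)[of 0] p(2)[of 0] in auto)
 finally have e: "circ (%x. (h' x)^2) = - circ (%x. h x * h'' x)" .
 have "(circ (%x. (h' x)^2))^2 <= I * J"
  unfolding e power2_minus I_def J_def by (rule circ_Cauchy_Schwarz[OF ch c])
 also have "... <= (5 / 12)^2 * J * J" using I J0 by (intro mult_right_mono)
 also have "... = ((5 / 12) * J)^2" by (simp add: power2_eq_square)
 finally show ?thesis unfolding J_def[symmetric] by (rule power2_le_imp_le) (use J0 in simp)
qed

lemma circ_trig: "circ cos = 0" "circ sin = 0" "circ (%x. cos x * cos x) = pi" "circ (%x. sin x * sin x) = pi" "circ (%x. sin x * cos x) = 0"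
proof -
 show "circ cos = 0" using circ_ftc(1)[of sin cos] by (simp add: DERIV_sin)
 have "circ sin = (- cos (2 * pi)) - (- cos 0)" by (rule circ_ftc(1)) (auto intro!: derivative_eq_intros)
 then show "circ sin = 0" by simp
 have "circ (%x. cos x * cos x) = ((2 * pi) / 2 + sin (2 * pi) * cos (2 * pi) / 2) - (0 / 2 + sin 0 * cos 0 / 2)"
 proof (rule circ_ftc(1))
  fix x :: real
  have ss: "sin x * sin x = 1 - cos x * cos x" using sin_cos_squared_add[of x] by (simp add: power2_eq_square)
  show "DERIV (%x. x / 2 + sin x * cos x / 2) x :> cos x * cos x"
  by (auto intro!: derivative_eq_intros simp: ss field_simps)
 qed
 then show "circ (%x. cos x * cos x) = pi" by simp
 have "circ (%x. sin x * sin x) = ((2 * pi) / 2 - sin (2 * pi) * cos (2 * pi) / 2) - (0 / 2 - sin 0 * cos 0 / 2)"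
 proof (rule circ_ftc(1))
  fix x :: real
  have ss: "cos x * cos x = 1 - sin x * sin x" using sin_cos_squared_add[of x] by (simp add: power2_eq_square)
  show "DERIV (%x. x / 2 - sin x * cos x / 2) x :> sin x * sin x"
  by (auto intro!: derivative_eq_intros simp: ss field_simps)
 qed
 then show "circ (%x. sin x * sin x) = pi" by simp
 have "circ (%x. sin x * cos x) = (sin (2 * pi))^2 / 2 - (sin 0)^2 / 2"
  by (rule circ_ftc(1)) (auto intro!: derivative_eq_intros)
 then show "circ (%x. sin x * cos x) = 0" by simp
qed

text \<open>The first harmonic is the only one below the gap.\<close>

lemma circle_poincare_gap:
 assumes d: "!!x. DERIV b x :> q x" "!!x. DERIV q x :> q' x" and c: "continuous_on UNIV q'"
  and p: "!!x. b (x + 2 * pi) = b x" "!!x. q (x + 2 * pi) = q x" "!!x. q' (x + 2 * pi) = q' x"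
 defines "A1 \<equiv> circ (%x. q x * cos x)" and "A2 \<equiv> circ (%x. q x * sin x)"
 defines "g \<equiv> (%x. q x - (A1 * cos x + A2 * sin x) / pi)"
 shows "circ (%x. (g x)^2) = circ (%x. (q x)^2) - (A1^2 + A2^2) / pi"
  "circ (%x. (q x)^2) >= (A1^2 + A2^2) / pi"
  "circ (%x. (q' x)^2) >= (12 / 5) * circ (%x. (q x)^2) - (7 / 5) * ((A1^2 + A2^2) / pi)"
proof -
 have cb: "continuous_on UNIV b" and cq: "continuous_on UNIV q"
  using d by (auto intro!: continuous_at_imp_continuous_on DERIV_isCont)
 note ci = continuous_intros cb cq c
 have pw: "b (2 * pi) = b 0" "q (2 * pi) = q 0" using p(1)[of 0] p(2)[of 0] by auto
 have sc: "circ (%x. cos x * sin x) = 0" using circ_trig(5) by (simp add: mult.commute)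
 have square: "circ (%x. (f x - (al * cos x + be * sin x))^2) = circ (%x. (f x)^2)
  - 2 * (al * circ (%x. f x * cos x) + be * circ (%x. f x * sin x)) + pi * (al^2 + be^2)"
  if cf: "continuous_on UNIV f" for f al be
 proof -
  have e1: "(%x. (f x - (al * cos x + be * sin x))^2) = (%x. (f x)^2 - 2 * (al * (f x * cos x) + be * (f x * sin x))
  + (al^2 * (cos x * cos x) + be^2 * (sin x * sin x) + (2 * al * be) * (sin x * cos x)))"
  by (auto simp: power2_eq_square algebra_simps)
  have e2: "circ (%x. (f x - (al * cos x + be * sin x))^2) = circ (%x. (f x)^2) - 2 * (al * circ (%x. f x * cos x) + be * circ (%x. f x * sin x))
  + (al^2 * circ (%x. cos x * cos x) + be^2 * circ (%x. sin x * sin x) + (2 * al * be) * circ (%x. sin x * cos x))"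
  proof -
  have i1: "continuous_on UNIV (%x. (f x)^2)" "continuous_on UNIV (%x. al * (f x * cos x))"
  "continuous_on UNIV (%x. be * (f x * sin x))" "continuous_on UNIV (%x. al^2 * (cos x * cos x))"
  "continuous_on UNIV (%x. be^2 * (sin x * sin x))" "continuous_on UNIV (%x. (2 * al * be) * (sin x * cos x))"
  by (intro continuous_intros cf)+
  have i2: "continuous_on UNIV (%x. al * (f x * cos x) + be * (f x * sin x))"
  "continuous_on UNIV (%x. al^2 * (cos x * cos x) + be^2 * (sin x * sin x))"
  "continuous_on UNIV (%x. 2 * (al * (f x * cos x) + be * (f x * sin x)))"
  "continuous_on UNIV (%x. (f x)^2 - 2 * (al * (f x * cos x) + be * (f x * sin x)))"
  "continuous_on UNIV (%x. al^2 * (cos x * cos x) + be^2 * (sin x * sin x) + (2 * al * be) * (sin x * cos x))"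
  by (intro continuous_intros cf)+
  show ?thesis
  unfolding e1 using i1 i2
  by (simp only: circ_add circ_diff integral_mult_right)
  qed
  show ?thesis unfolding e2 circ_trig
  by (simp only: distrib_left mult.commute add_ac mult_zero_right mult_zero_left add_0_left add_0_right)
 qed
 have alg: "X - 2 * ((al / pi) * al + (be / pi) * be) + pi * ((al / pi)^2 + (be / pi)^2) = X - (al^2 + be^2) / pi" for X al be
  by (simp add: field_simps power2_eq_square)
 have A: "A1 = circ (%x. b x * sin x)" "A2 = - circ (%x. b x * cos x)"
  unfolding A1_def A2_def by (rule circ_by_cos[OF d(1) cq pw(1)], rule circ_by_sin[OF d(1) cq pw(1)])
 have ge: "g = (%x. q x - ((A1 / pi) * cos x + (A2 / pi) * sin x))" unfolding g_def by (auto simp: field_simps)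
 show g2: "circ (%x. (g x)^2) = circ (%x. (q x)^2) - (A1^2 + A2^2) / pi"
  unfolding ge square[OF cq] A1_def[symmetric] A2_def[symmetric] by (rule alg)
 have "circ (%x. (g x)^2) >= 0" unfolding ge by (intro circ_nonneg ci) auto
 then show "circ (%x. (q x)^2) >= (A1^2 + A2^2) / pi" unfolding g2 by simp
 \<comment> \<open>\<open>b\<close> without its mean and its first harmonic; its derivative is
   \<open>g\<close>, and the coefficients come from those of \<open>q\<close> by integration by
   parts.\<close>
 define h where "h = (%x. b x - circ b / (2 * pi) - ((- A2 / pi) * cos x + (A1 / pi) * sin x))"
 define g' where "g' = (%x. q' x - ((A2 / pi) * cos x + (- A1 / pi) * sin x))"
 have dh: "DERIV h x :> g x" "DERIV g x :> g' x" for x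
  unfolding h_def ge g'_def by (auto intro!: derivative_eq_intros d simp: algebra_simps)
 have g'2: "circ (%x. (g' x)^2) = circ (%x. (q' x)^2) - (A1^2 + A2^2) / pi"
 proof -
  have e1: "circ (%x. q' x * cos x) = A2" unfolding A2_def by (rule circ_by_cos[OF d(2) c pw(2)])
  have e2: "circ (%x. q' x * sin x) = - A1" unfolding A1_def by (rule circ_by_sin[OF d(2) c pw(2)])
  show ?thesis unfolding g'_def square[OF c] e1 e2 using alg[of _ A2 "- A1"] by (simp only: power2_minus add.commute)
 qed
 have "circ (%x. (g x)^2) <= (5 / 12) * circ (%x. (g' x)^2)"
 proof (rule circle_poincare2[OF dh])
  show "continuous_on UNIV g'" unfolding g'_def by (intro ci)
  show "h (x + 2 * pi) = h x" "g (x + 2 * pi) = g x" "g' (x + 2 * pi) = g' x" for x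
  unfolding h_def g_def g'_def by (simp_all add: p)
  have "circ h = (circ b - circ (%x. circ b / (2 * pi))) - circ (%x. (- A2 / pi) * cos x + (A1 / pi) * sin x)"
  proof -
  have "continuous_on UNIV (%x. b x - circ b / (2 * pi))" "continuous_on UNIV (%x. (- A2 / pi) * cos x + (A1 / pi) * sin x)"
  by (intro ci)+
  then show ?thesis unfolding h_def by (simp only: circ_diff cb continuous_on_const)
  qed
  also have "circ (%x. (- A2 / pi) * cos x + (A1 / pi) * sin x) = (- A2 / pi) * circ cos + (A1 / pi) * circ sin"
  proof -
  have "continuous_on UNIV (%x. (- A2 / pi) * cos x)" "continuous_on UNIV (%x. (A1 / pi) * sin x)" by (intro continuous_intros)+
  then show ?thesis by (simp only: circ_add integral_mult_right)
  qed
  finally show "circ h = 0" unfolding circ_trig circ_const by simp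
  have hc: "circ (%x. h x * f x) = circ (%x. b x * f x) - (circ b / (2 * pi)) * circ f
  - ((- A2 / pi) * circ (%x. cos x * f x) + (A1 / pi) * circ (%x. sin x * f x))" if cf: "continuous_on UNIV f" for f
  proof -
  have e1: "(%x. h x * f x) = (%x. b x * f x - (circ b / (2 * pi)) * f x
  - ((- A2 / pi) * (cos x * f x) + (A1 / pi) * (sin x * f x)))"
  unfolding h_def by (auto simp: algebra_simps)
  show ?thesis
  proof -
  have "continuous_on UNIV (%x. b x * f x)" "continuous_on UNIV (%x. (circ b / (2 * pi)) * f x)"
  "continuous_on UNIV (%x. b x * f x - (circ b / (2 * pi)) * f x)"
  "continuous_on UNIV (%x. (- A2 / pi) * (cos x * f x))" "continuous_on UNIV (%x. (A1 / pi) * (sin x * f x))"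
  "continuous_on UNIV (%x. (- A2 / pi) * (cos x * f x) + (A1 / pi) * (sin x * f x))"
  by (intro continuous_intros cb cf)+
  then show ?thesis unfolding e1 by (simp only: circ_add circ_diff integral_mult_right)
  qed
  qed
  show "circ (%x. h x * cos x) = 0"
  unfolding hc[OF continuous_on_cos[OF continuous_on_id]] circ_trig using A(2) by simp
  show "circ (%x. h x * sin x) = 0"
  unfolding hc[OF continuous_on_sin[OF continuous_on_id]] circ_trig sc using A(1) by simp
 qed
 then show "circ (%x. (q' x)^2) >= (12 / 5) * circ (%x. (q x)^2) - (7 / 5) * ((A1^2 + A2^2) / pi)"
 proof -
  define K where "K = (A1^2 + A2^2) / pi"
  assume "circ (%x. (g x)^2) <= (5 / 12) * circ (%x. (g' x)^2)"
  then have "circ (%x. (q x)^2) - K <= (5 / 12) * (circ (%x. (q' x)^2) - K)" unfolding g2 g'2 K_def .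
  moreover have "x - k <= 5 / 12 * (y - k) ==> 12 / 5 * x - 7 / 5 * k <= y" for x y k :: real
  by (simp add: field_simps)
  ultimately show ?thesis unfolding K_def by blast
 qed
qed

text \<open>A function of mean zero is bounded by its oscillation, hence by the integral of the
  absolute value of its derivative; Cauchy-Schwarz bounds the square of that integral.\<close>

lemma circle_sup_bound:
 assumes d: "!!x. DERIV f x :> f' x" and c: "continuous_on UNIV f'"
  and p: "!!x. f (x + 2 * pi) = f x" and o: "circ f = 0"
 shows "(f a)^2 <= 2 * pi * circ (%x. (f' x)^2)"
proof -
 have cf: "continuous_on UNIV f" using d by (auto intro!: continuous_at_imp_continuous_on DERIV_isCont)
 define V where "V = circ (%x. \<bar>f' x\<bar>)"
 have seg: "\<bar>f y - f x\<bar> <= V" if "0 <= x" "x <= y" "y <= 2 * pi" for x y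
 proof -
  have i: "(f' has_integral (f y - f x)) {x..y}"
  by (rule fundamental_theorem_of_calculus)
  (auto intro!: has_vector_derivative_at_within d[unfolded has_real_derivative_iff_has_vector_derivative] that)
  have ca: "continuous_on UNIV (%x. \<bar>f' x\<bar>)" using c by (intro continuous_intros)
  have "\<bar>f y - f x\<bar> = \<bar>integral {x..y} f'\<bar>" using i by (simp add: integral_unique)
  also have "... <= integral {x..y} (%x. \<bar>f' x\<bar>)"
  proof -
  have "f' integrable_on {x..y}" using i by blast
  moreover have "(%x. \<bar>f' x\<bar>) integrable_on {x..y}"
  by (rule integrable_continuous_real[OF continuous_on_subset[OF ca]]) simp
  ultimately show ?thesis using integral_norm_bound_integral[of f' "{x..y}" "%x. \<bar>f' x\<bar>"] by simp
  qed
  also have "... <= V" unfolding V_def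
  by (rule integral_subset_le) (use that in "auto intro!: integrable_continuous_real continuous_on_subset[OF ca]")
  finally show ?thesis .
 qed
 have key: "\<bar>f y\<bar> <= V" if y: "0 <= y" "y <= 2 * pi" for y
 proof -
  have osc: "\<bar>f y - f x\<bar> <= V" if "x \<in> {0..2 * pi}" for x
  using seg[of x y] seg[of y x] that y by (cases "x <= y") auto
  have "2 * pi * f y = circ (%x. f y - f x)"
  by (subst circ_diff, (intro continuous_intros cf)+) (simp add: o)
  also have "\<bar>circ (%x. f y - f x)\<bar> <= V * (2 * pi - 0)"
  proof -
  have "norm (circ (%x. f y - f x)) <= V * (2 * pi - 0)"
  by (rule integral_bound) (use osc in "auto intro!: continuous_intros continuous_on_subset[OF cf]")
  then show ?thesis by simp
  qed
  finally have "2 * pi * \<bar>f y\<bar> <= 2 * pi * V" by (simp add: abs_mult mult.commute)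
  then show ?thesis by simp
 qed
 have "circ (%x. (f' x)^2) >= 0" by (intro circ_nonneg continuous_intros c) auto
 have "V^2 = (circ (%x. \<bar>f' x\<bar> * 1))^2" unfolding V_def by simp
 also have "... <= circ (%x. \<bar>f' x\<bar>\<^sup>2) * circ (%x. 1^2)" by (rule circ_Cauchy_Schwarz) (intro continuous_intros c)+
 finally have V2: "V^2 <= 2 * pi * circ (%x. (f' x)^2)" by (simp add: mult.commute)
 have "\<bar>f (0 + a)\<bar> <= V"
 proof -
  define n where "n = \<lfloor>a / (2 * pi)\<rfloor>"
  define y where "y = a - 2 * pi * n"
  have "of_int n <= a / (2 * pi)" "a / (2 * pi) < of_int n + 1" unfolding n_def by linarith+
  then have y: "0 <= y" "y <= 2 * pi" unfolding y_def by (simp_all add: field_simps)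
  have nat: "f (x + 2 * pi * real k) = f x" for x k
  proof (induction k)
  case (Suc k)
  have "f (x + 2 * pi * real (Suc k)) = f ((x + 2 * pi * real k) + 2 * pi)" by (simp add: algebra_simps)
  then show ?case using p Suc by simp
  qed simp
  have "f a = f y"
  proof (cases "n >= 0")
  case True
  then show ?thesis using nat[of y "nat n"] unfolding y_def by simp
  next
  case False
  then show ?thesis using nat[of a "nat (- n)"] unfolding y_def by simp
  qed
  then show ?thesis using key[OF y] by simp
 qed
 then have "(f a)^2 <= V^2" by (simp add: abs_le_square_iff[symmetric])
 then show ?thesis using V2 by linarith
qed

text \<open>Moving \<open>j\<close> derivatives from one factor to the other gives
  \<open>J j^2 <= J 0 * J (2 * j)\<close>. Used at 1, 2 and 4 this leaves only a small power of the
  top norm, so a crude bound on eight derivatives costs little.\<close>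

lemma circle_interpolation:
 fixes f :: "nat => real => real"
 assumes d: "!!i x. DERIV (f i) x :> f (Suc i) x" and p: "!!i x. f i (x + 2 * pi) = f i x"
 defines "J \<equiv> %i. circ (%x. (f i x)^2)"
 shows "J 1 ^ 8 <= J 0 ^ 7 * J 8" "J 2 ^ 4 <= J 0 ^ 3 * J 8"
proof -
 have c: "continuous_on UNIV (f i)" for i using d by (auto intro!: continuous_at_imp_continuous_on DERIV_isCont)
 have J0: "J i >= 0" for i unfolding J_def by (intro circ_nonneg continuous_intros c) auto
 have w: "f i (2 * pi) = f i 0" for i using p[of i 0] by simp
 have parts: "circ (%x. f (Suc i) x * f j x) = - circ (%x. f i x * f (Suc j) x)" for i j
  by (rule circ_by_parts[OF d d c c w w])
 have "\<bar>circ (%x. f (i + j) x * f k x)\<bar> = \<bar>circ (%x. f i x * f (j + k) x)\<bar>" for i j k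
 proof (induction j arbitrary: k)
  case (Suc j)
  have "\<bar>circ (%x. f (i + Suc j) x * f k x)\<bar> = \<bar>circ (%x. f (i + j) x * f (Suc k) x)\<bar>"
  using parts[of "i + j" k] by simp
  then show ?case using Suc[of "Suc k"] by simp
 qed simp
 note key = this
 have sw: "J j = \<bar>circ (%x. f 0 x * f (j + j) x)\<bar>" for j
 proof -
  have "J j = \<bar>J j\<bar>" using J0[of j] by simp
  also have "... = \<bar>circ (%x. f (0 + j) x * f j x)\<bar>" unfolding J_def power2_eq_square add_0_left ..
  also have "... = \<bar>circ (%x. f 0 x * f (j + j) x)\<bar>" by (rule key)
  finally show ?thesis .
 qed
 have conv: "(J j)^2 <= J 0 * J (j + j)" for j
  unfolding sw[of j] power2_abs unfolding J_def by (rule circ_Cauchy_Schwarz[OF c c])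
 have 1: "(J 1)^2 <= J 0 * J 2" "(J 2)^2 <= J 0 * J 4" "(J 4)^2 <= J 0 * J 8"
  using conv[of 1] conv[of 2] conv[of 4] unfolding one_add_one by simp_all
 have "J 2 ^ 4 = ((J 2)^2)^2" by simp
 also have "... <= (J 0 * J 4)^2" using 1(2) by (rule power_mono) simp
 also have "... = (J 0)^2 * (J 4)^2" by (simp add: power_mult_distrib)
 also have "... <= (J 0)^2 * (J 0 * J 8)" using 1(3) by (intro mult_left_mono) auto
 finally show 2: "J 2 ^ 4 <= J 0 ^ 3 * J 8" by (simp add: power2_eq_square power3_eq_cube)
 have "J 1 ^ 8 = ((J 1)^2) ^ 4" by simp
 also have "... <= (J 0 * J 2) ^ 4" using 1(1) by (rule power_mono) simp
 also have "... = J 0 ^ 4 * J 2 ^ 4" by (simp add: power_mult_distrib)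
 also have "... <= J 0 ^ 4 * (J 0 ^ 3 * J 8)" using 2 J0 by (intro mult_left_mono) auto
 finally show "J 1 ^ 8 <= J 0 ^ 7 * J 8" by (simp add: numeral_eq_Suc mult.assoc)
qed

section \<open>Evolution in \<open>z\<close> of the Fourier modes\<close>

lemma periodic_D:
 assumes "!!th z. g (th + 2 * pi, z) = g (th, z)"
 shows "D1 g (th + 2 * pi, z) = D1 g (th, z)" "D2 g (th + 2 * pi, z) = D2 g (th, z)"
proof -
 have "deriv (%s. g (s, z)) (th + 2 * pi) = deriv (%s. g (s + 2 * pi, z)) th"
  unfolding deriv_def using DERIV_shift[of "%s. g (s, z)" _ th "2 * pi"] by simp
 then show "D1 g (th + 2 * pi, z) = D1 g (th, z)" unfolding D1_def assms by simp
 have "(%s. g (th + 2 * pi, s)) = (%s. g (th, s))" using assms by blast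
 then show "D2 g (th + 2 * pi, z) = D2 g (th, z)" unfolding D2_def by simp
qed

lemma half_slice:
 assumes "smooth2 (half z0) g" "z > z0"
 shows "DERIV (%th. g (th, z)) th :> D1 g (th, z)" "continuous_on UNIV (%th. g (th, z))"
proof -
 show d: "DERIV (%th. g (th, z)) th :> D1 g (th, z)" for th
  by (rule DERIV_D1[OF smooth2_differentiable[OF assms(1)]]) (use assms(2) in simp)
 show "continuous_on UNIV (%th. g (th, z))"
  by (rule DERIV_continuous_on[where D = "%th. D1 g (th, z)"]) (use d in "auto intro: has_field_derivative_at_within")
qed

lemma circ_leibniz:
 assumes g: "smooth2 (half z0) g" and z: "z > z0" and c: "continuous_on UNIV c"
 shows "DERIV (%z. circ (%th. g (th, z) * c th)) z :> circ (%th. D2 g (th, z) * c th)"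
proof -
 have "((%z. integral (cbox 0 (2 * pi)) (%th. g (th, z) * c th)) has_field_derivative
  integral (cbox 0 (2 * pi)) (%th. D2 g (th, z) * c th)) (at z within {z0<..})"
 proof (rule leibniz_rule_field_derivative)
  fix y th :: real assume y: "y \<in> {z0<..}"
  have "DERIV (%y. g (th, y)) y :> D2 g (th, y)"
  by (rule DERIV_D2[OF smooth2_differentiable[OF g]]) (use y in simp)
  then show "((%y. g (th, y) * c th) has_field_derivative D2 g (th, y) * c th) (at y within {z0<..})"
  by (rule has_field_derivative_at_within[OF DERIV_cmult_right])
 next
  fix y assume y: "y \<in> {z0<..}"
  show "(%th. g (th, y) * c th) integrable_on cbox 0 (2 * pi)"
  by (rule integrable_continuous[OF continuous_on_subset[OF continuous_on_mult[OF half_slice(2)[OF g] c]]])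
  (use y in auto)
 next
  have "continuous_on ({z0<..} \<times> cbox 0 (2 * pi)) (%q. D2 g (snd q, fst q))"
  by (rule continuous_on_compose2[OF smooth2_continuous[OF smooth2_D(2)[OF g]]])
  (auto intro!: continuous_intros)
  moreover have "continuous_on ({z0<..} \<times> cbox 0 (2 * pi)) (%q. c (snd q))"
  by (rule continuous_on_compose2[OF c]) (auto intro!: continuous_intros)
  ultimately show "continuous_on ({z0<..} \<times> cbox 0 (2 * pi)) (%(y, th). D2 g (th, y) * c th)"
  unfolding case_prod_unfold by (rule continuous_on_mult)
 qed (use z in auto)
 moreover have "at z within {z0<..} = at z" by (rule at_within_open) (use z in auto)
 ultimately show ?thesis by simp
qed

lemma arctan_cubic_bound: "\<bar>arctan x - x\<bar> <= \<bar>x\<bar> ^ 3" for x :: real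
proof -
 have p: "x - x ^ 3 <= arctan x & arctan x <= x" if "x >= 0" for x :: real
 proof
  have "0 - arctan 0 <= x - arctan x"
  proof (rule DERIV_nonneg_imp_nondecreasing[OF that])
  fix y :: real
  have "DERIV (%x. x - arctan x) y :> 1 - inverse (1 + y^2)" by (auto intro!: derivative_eq_intros)
  moreover have "inverse (1 + y^2) <= 1" by (simp add: inverse_le_1_iff)
  ultimately show "EX d. DERIV (%x. x - arctan x) y :> d & 0 <= d" by (intro exI conjI) auto
  qed
  then show "arctan x <= x" by simp
  have "arctan 0 - (0 - 0 ^ 3) <= arctan x - (x - x ^ 3)"
  proof (rule DERIV_nonneg_imp_nondecreasing[OF that])
  fix y :: real
  have "DERIV (%x. arctan x - (x - x ^ 3)) y :> inverse (1 + y^2) - (1 - 3 * y^2)"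
  by (auto intro!: derivative_eq_intros)
  moreover have "(1 - 3 * y^2) * (1 + y^2) <= 1" by (simp add: algebra_simps)
  then have "1 - 3 * y^2 <= inverse (1 + y^2)"
  by (simp add: inverse_eq_divide pos_le_divide_eq add_pos_nonneg)
  ultimately show "EX d. DERIV (%x. arctan x - (x - x ^ 3)) y :> d & 0 <= d" by (intro exI conjI) auto
  qed
  then show "x - x ^ 3 <= arctan x" by simp
 qed
 show ?thesis
 proof (cases "x >= 0")
  case True
  then show ?thesis using p[OF True] by simp
 next
  case False
  then have "\<bar>arctan (- x) - (- x)\<bar> <= \<bar>- x\<bar> ^ 3" using p[of "- x"] by simp
  then show ?thesis by (simp add: arctan_minus)
 qed
qed

text \<open>With \<open>r\<close> the angular derivative of \<open>q\<close>, the numbers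
  \<open>s\<close> and \<open>t\<close> are \<open>m\<close> and its angular derivative expressed by
  \<open>b\<close>, \<open>q\<close>, \<open>r\<close>. The errors come from replacing
  \<open>b\<close> by \<open>z\<close>, from the quadratic term of \<open>t\<close>, and from the
  cubic nonlinearity of \<open>arctan\<close>.\<close>

lemma slope_bounds:
 fixes b q r z be :: real
 assumes z: "z > 0" and b: "z / 2 <= b" "\<bar>b - z\<bar> <= be" and q: "\<bar>q\<bar> <= z"
 defines "s \<equiv> q / (2 * b)" and "t \<equiv> r / (2 * b) - q^2 / (2 * b^2)"
 shows "\<bar>arctan s - q / (2 * z)\<bar> <= \<bar>q\<bar> * be / z^2 + \<bar>q\<bar> ^ 3 / z ^ 3"
  "\<bar>t * inverse (1 + s * s) - r / (2 * z)\<bar> <= \<bar>r\<bar> * be / z^2 + 4 * q^2 / z^2 + q^2 * \<bar>r\<bar> / z ^ 3"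
proof -
 have bp: "b > 0" using z b by linarith
 have i: "1 / (2 * b) <= 1 / z" using z b bp by (simp add: field_simps)
 have ab: "\<bar>x / (2 * b)\<bar> <= \<bar>x\<bar> / z" for x
 proof -
  have "\<bar>x / (2 * b)\<bar> = \<bar>x\<bar> * (1 / (2 * b))" using bp by simp
  also have "... <= \<bar>x\<bar> * (1 / z)" using i by (intro mult_left_mono) auto
  finally show ?thesis by simp
 qed
 have s1: "\<bar>s\<bar> <= \<bar>q\<bar> / z" unfolding s_def by (rule ab)
 have lin: "\<bar>x / (2 * b) - x / (2 * z)\<bar> <= \<bar>x\<bar> * be / z^2" for x
 proof -
  have "x / (2 * b) - x / (2 * z) = (x * (z - b)) / (2 * b) * (1 / z)" using bp z by (simp add: field_simps)
  then have "\<bar>x / (2 * b) - x / (2 * z)\<bar> = \<bar>(x * (z - b)) / (2 * b)\<bar> * (1 / z)" using z by (simp add: abs_mult)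
  also have "... <= (\<bar>x * (z - b)\<bar> / z) * (1 / z)" using ab[of "x * (z - b)"] z by (intro mult_right_mono) auto
  also have "... = \<bar>x\<bar> * \<bar>b - z\<bar> / z^2" by (simp add: abs_mult abs_minus_commute power2_eq_square)
  also have "... <= \<bar>x\<bar> * be / z^2" using b(2) by (intro divide_right_mono mult_left_mono) auto
  finally show ?thesis .
 qed
 have "\<bar>arctan s - s\<bar> <= \<bar>s\<bar> ^ 3" by (rule arctan_cubic_bound)
 also have "... <= (\<bar>q\<bar> / z) ^ 3" using s1 by (intro power_mono) auto
 finally have "\<bar>arctan s - s\<bar> <= \<bar>q\<bar> ^ 3 / z ^ 3" by (simp add: power_divide)
 then show "\<bar>arctan s - q / (2 * z)\<bar> <= \<bar>q\<bar> * be / z^2 + \<bar>q\<bar> ^ 3 / z ^ 3"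
  using lin[of q] unfolding s_def by linarith
 have ss: "s * s <= q^2 / z^2"
  using power_mono[OF s1, of 2] by (simp add: power2_eq_square power_divide)
 have ss1: "s * s <= 1"
 proof -
  have "q^2 <= z^2" using q z by (simp add: abs_le_square_iff[symmetric])
  then have "q^2 / z^2 <= 1" using z by (simp add: divide_le_eq_1)
  then show ?thesis using ss by linarith
 qed
 have qb: "q^2 / (2 * b^2) <= 2 * q^2 / z^2"
 proof -
  have "(z / 2)^2 <= b^2" using b z by (intro power_mono) auto
  then have "q^2 / (2 * b^2) <= q^2 / (2 * (z / 2)^2)" using z bp by (intro divide_left_mono) auto
  then show ?thesis by (simp add: power_divide)
 qed
 have qb0: "0 <= q^2 / (2 * b^2)" by simp
 have tb: "\<bar>t\<bar> <= \<bar>r\<bar> / z + q^2 / (2 * b^2)" unfolding t_def using ab[of r] qb0 by linarith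
 have p1: "1 + s * s > 0" by (simp add: add_pos_nonneg)
 then have "inverse (1 + s * s) + s * s * inverse (1 + s * s) = 1"
  using right_inverse[of "1 + s * s"] by (simp add: distrib_right)
 then have "t * inverse (1 + s * s) + t * (s * s) * inverse (1 + s * s) = t"
  by (metis distrib_left mult.assoc mult.right_neutral)
 then have "t * inverse (1 + s * s) - t = - (t * (s * s) * inverse (1 + s * s))" by linarith
 then have "\<bar>t * inverse (1 + s * s) - t\<bar> = \<bar>t\<bar> * (s * s) * inverse (1 + s * s)"
  using p1 by (simp add: abs_mult)
 also have "... <= \<bar>t\<bar> * (s * s) * 1" by (intro mult_left_mono) (auto simp: inverse_le_1_iff)
 also have "... <= (\<bar>r\<bar> / z + q^2 / (2 * b^2)) * (s * s)" using tb by (simp add: mult_right_mono)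
 also have "... = (\<bar>r\<bar> / z) * (s * s) + q^2 / (2 * b^2) * (s * s)" by (rule distrib_right)
 also have "... <= (\<bar>r\<bar> / z) * (q^2 / z^2) + q^2 / (2 * b^2) * 1"
  using ss ss1 z by (intro add_mono mult_left_mono) auto
 also have "(\<bar>r\<bar> / z) * (q^2 / z^2) = q^2 * \<bar>r\<bar> / z ^ 3" by (simp add: power2_eq_square power3_eq_cube mult.commute mult.left_commute)
 finally have "\<bar>t * inverse (1 + s * s) - t\<bar> <= q^2 * \<bar>r\<bar> / z ^ 3 + 2 * q^2 / z^2" using qb by linarith
 moreover have "\<bar>t - r / (2 * z)\<bar> <= \<bar>r\<bar> * be / z^2 + 2 * q^2 / z^2"
  using lin[of r] qb qb0 unfolding t_def by linarith
 ultimately show "\<bar>t * inverse (1 + s * s) - r / (2 * z)\<bar> <= \<bar>r\<bar> * be / z^2 + 4 * q^2 / z^2 + q^2 * \<bar>r\<bar> / z ^ 3"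
  by linarith
qed

context polar_end
begin

definition b where "b p = rh p * rh p / 2"
definition q where "q p = rh p * D1 rh p"
definition X where "X z = circ (%th. (q (th, z))^2)"
definition Pz where "Pz z = circ (%th. (D1 q (th, z))^2)"
definition A1 where "A1 z = circ (%th. q (th, z) * cos th)"
definition A2 where "A2 z = circ (%th. q (th, z) * sin th)"
text \<open>The squared norm of the first-harmonic part of \<open>q\<close>, to be compared with the
  full squared norm \<open>X\<close>.\<close>

definition X1 where "X1 z = ((A1 z)^2 + (A2 z)^2) / pi"

lemma smooth_rho: "smooth2 (half z0) rh" by (rule Sym_smooth[OF sym])

lemma Sym_q: "Sym z0 1 q"
 unfolding q_def[abs_def] by (rule Sym_mult'[OF sym Sym_D1[OF sym]]) simp

lemma smooth_q: "smooth2 (half z0) q" by (rule Sym_smooth[OF Sym_q])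

lemma smooth_b: "smooth2 (half z0) b"
proof -
 have "smooth2 (half z0) (%p. (1 / 2) * (rh p * rh p))"
  by (intro smooth2_mult open_half smooth_rho smooth2_const)
 then show ?thesis unfolding b_def[abs_def] by simp
qed

lemma D_b:
 assumes p: "p \<in> half z0"
 shows "D1 b p = q p" "D2 b p = bz p"
proof -
 note d = smooth2_differentiable[OF smooth_rho p]
 note m = D_mult[OF d d]
 have c: "(%p. 1 / 2) differentiable (at p)" by simp
 have be: "b = (%p. 1 / 2 * (rh p * rh p))" unfolding b_def[abs_def] by auto
 show "D1 b p = q p" "D2 b p = bz p"
  unfolding be D_mult(2,3)[OF c m(1)] m(2,3) q_def bz_def by simp_all
qed

lemma D2_q:
 assumes p: "p \<in> half z0"
 shows "D2 q p = D1 E p - D1 F p"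
proof -
 have "D2 q p = D2 (D1 b) p" by (rule D_cong_open(2)[OF open_half p]) (use D_b in auto)
 also have "... = D1 (D2 b) p" using smooth2_commute[OF open_half smooth_b p] by simp
 also have "... = D1 (%p. (1 + E p) + (- 1) * F p) p"
  by (rule D_cong_open(1)[OF open_half p]) (use D_b in "auto simp: E_def")
 also have "... = D1 E p - D1 F p"
 proof -
  note dE = smooth2_differentiable[OF Sym_smooth[OF Sym_E] p] and dF = smooth2_differentiable[OF Sym_smooth[OF Sym_F] p]
  have c: "(%p. 1 :: real) differentiable (at p)" "(%p. - 1 :: real) differentiable (at p)" by auto
  note a = D_add[OF c(1) dE] and mm = D_mult[OF c(2) dF]
  show ?thesis unfolding D_add(2)[OF a(1) mm(1)] a(2) mm(2) by simp
 qed
 finally show ?thesis .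
qed

lemma per_D1_rho: "D1 rh (th + 2 * pi, z) = D1 rh (th, z)" and per_D2_rho: "D2 rh (th + 2 * pi, z) = D2 rh (th, z)"
 using periodic_D[of rh] per by auto

lemma per_q: "q (th + 2 * pi, z) = q (th, z)" and per_b: "b (th + 2 * pi, z) = b (th, z)"
 and per_m: "m (th + 2 * pi, z) = m (th, z)"
 unfolding q_def b_def m_def by (simp_all add: per per_D1_rho)

lemma per_F: "F (th + 2 * pi, z) = F (th, z)"
 unfolding F_def A_def by (simp add: per_m periodic_D(1)[of m, OF per_m])

lemma per_E: "E (th + 2 * pi, z) = E (th, z)"
 unfolding E_def bz_def by (simp add: per_F per per_D2_rho)

lemma DERIV_Theta:
 assumes "z > z0"
 shows "DERIV (%th. arctan (m (th, z))) th :> F (th, z)"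
proof -
 have "DERIV (%th. m (th, z)) th :> D1 m (th, z)" by (rule half_slice(1)[OF Sym_smooth[OF Sym_m] assms])
 then show ?thesis unfolding F_def A_def
  by (auto intro!: derivative_eq_intros simp: power2_eq_square mult.commute)
qed

text \<open>After integration by parts the main term pairs \<open>F\<close>, which is close to
  \<open>D1 q / (2 * z)\<close>, with \<open>D1 q\<close>, and is about \<open>Pz z / z\<close>. The
  positive sign is that of a backward heat equation: the energy is forced to grow.\<close>

lemma DERIV_X:
 assumes z: "z > z0"
 shows "DERIV X z :> 2 * circ (%th. D1 q (th, z) * F (th, z)) + 2 * circ (%th. q (th, z) * D1 E (th, z))"
proof -
 have sqq: "smooth2 (half z0) (%p. q p * q p)" by (intro smooth2_mult open_half smooth_q)
 have c1: "continuous_on UNIV (%th :: real. 1 :: real)" by simp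
 note L = circ_leibniz[OF sqq z c1]
 have cF: "continuous_on UNIV (%th. F (th, z))" "continuous_on UNIV (%th. D1 F (th, z))"
  "continuous_on UNIV (%th. D1 E (th, z))" "continuous_on UNIV (%th. q (th, z))" "continuous_on UNIV (%th. D1 q (th, z))"
  using half_slice(2)[OF Sym_smooth[OF Sym_F] z] half_slice(2)[OF Sym_smooth[OF Sym_D1[OF Sym_F]] z]
  half_slice(2)[OF Sym_smooth[OF Sym_D1[OF Sym_E]] z] half_slice(2)[OF smooth_q z] half_slice(2)[OF smooth2_D(1)[OF smooth_q] z] by auto
 have "D2 (%p. q p * q p) (th, z) * 1 = 2 * (q (th, z) * D1 E (th, z)) - 2 * (D1 F (th, z) * q (th, z))" for th
 proof -
  have p: "(th, z) \<in> half z0" using z by simp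
  show ?thesis unfolding D_mult(3)[OF smooth2_differentiable[OF smooth_q p] smooth2_differentiable[OF smooth_q p]] D2_q[OF p]
  by (simp add: algebra_simps)
 qed
 then have e: "circ (%th. D2 (%p. q p * q p) (th, z) * 1) = circ (%th. 2 * (q (th, z) * D1 E (th, z)) - 2 * (D1 F (th, z) * q (th, z)))"
  by (simp only:)
 have "circ (%th. 2 * (q (th, z) * D1 E (th, z)) - 2 * (D1 F (th, z) * q (th, z)))
  = circ (%th. 2 * (q (th, z) * D1 E (th, z))) - circ (%th. 2 * (D1 F (th, z) * q (th, z)))"
  by (rule circ_diff) (intro continuous_intros cF)+
 also have "... = 2 * circ (%th. q (th, z) * D1 E (th, z)) - 2 * circ (%th. D1 F (th, z) * q (th, z))"
  by (simp only: integral_mult_right)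
 also have "circ (%th. D1 F (th, z) * q (th, z)) = - circ (%th. F (th, z) * D1 q (th, z))"
  using circ_by_parts[OF half_slice(1)[OF Sym_smooth[OF Sym_F] z] half_slice(1)[OF smooth_q z] cF(2,5)]
  per_F[of 0 z] per_q[of 0 z] by simp
 finally have e2: "circ (%th. D2 (%p. q p * q p) (th, z) * 1) =
  2 * circ (%th. D1 q (th, z) * F (th, z)) + 2 * circ (%th. q (th, z) * D1 E (th, z))"
  unfolding e by (simp only: mult.commute[of "F _"])
 have "X = (%z. circ (%th. (q (th, z) * q (th, z)) * 1))" unfolding X_def[abs_def] by (simp add: power2_eq_square)
 then show ?thesis using L unfolding e2 by simp
qed

lemma circ_bz_trig:
 assumes z: "z > z0"
 shows "circ (%th. D2 q (th, z) * cos th) = circ (%th. arctan (m (th, z)) * cos th) + circ (%th. E (th, z) * sin th)"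
  "circ (%th. D2 q (th, z) * sin th) = circ (%th. arctan (m (th, z)) * sin th) - circ (%th. E (th, z) * cos th)"
proof -
 have cF: "continuous_on UNIV (%th. F (th, z))" and cE: "continuous_on UNIV (%th. E (th, z))"
  and cF1: "continuous_on UNIV (%th. D1 F (th, z))" and cE1: "continuous_on UNIV (%th. D1 E (th, z))"
  using half_slice(2)[OF Sym_smooth[OF Sym_F] z] half_slice(2)[OF Sym_smooth[OF Sym_E] z]
  half_slice(2)[OF Sym_smooth[OF Sym_D1[OF Sym_F]] z] half_slice(2)[OF Sym_smooth[OF Sym_D1[OF Sym_E]] z] by auto
 have e: "D2 q (th, z) = D1 E (th, z) - D1 F (th, z)" for th using D2_q[of "(th, z)"] z by simp
 have wF: "F (2 * pi, z) = F (0, z)" and wE: "E (2 * pi, z) = E (0, z)" and wT: "arctan (m (2 * pi, z)) = arctan (m (0, z))"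
  using per_F[of 0 z] per_E[of 0 z] per_m[of 0 z] by auto
 note dE = half_slice(1)[OF Sym_smooth[OF Sym_E] z] and dF = half_slice(1)[OF Sym_smooth[OF Sym_F] z]
 have i: "continuous_on UNIV (%th. D1 E (th, z) * cos th)" "continuous_on UNIV (%th. D1 F (th, z) * cos th)"
  "continuous_on UNIV (%th. D1 E (th, z) * sin th)" "continuous_on UNIV (%th. D1 F (th, z) * sin th)"
  by (intro continuous_intros cE1 cF1)+
 show "circ (%th. D2 q (th, z) * cos th) = circ (%th. arctan (m (th, z)) * cos th) + circ (%th. E (th, z) * sin th)"
  unfolding e left_diff_distrib circ_diff[OF i(1,2)]
  circ_by_cos[where f = "%th. E (th, z)", OF dE cE1 wE] circ_by_cos[where f = "%th. F (th, z)", OF dF cF1 wF]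
  circ_by_sin[where f = "%th. arctan (m (th, z))", OF DERIV_Theta[OF z] cF wT] by (simp only: diff_minus_eq_add add.commute)
 show "circ (%th. D2 q (th, z) * sin th) = circ (%th. arctan (m (th, z)) * sin th) - circ (%th. E (th, z) * cos th)"
  unfolding e left_diff_distrib circ_diff[OF i(3,4)]
  circ_by_sin[where f = "%th. E (th, z)", OF dE cE1 wE] circ_by_sin[where f = "%th. F (th, z)", OF dF cF1 wF]
  circ_by_cos[where f = "%th. arctan (m (th, z))", OF DERIV_Theta[OF z] cF wT] by (simp only: diff_minus_eq_add add.commute uminus_add_conv_diff)
qed

lemma DERIV_A:
 assumes z: "z > z0"
 shows "DERIV A1 z :> circ (%th. arctan (m (th, z)) * cos th) + circ (%th. E (th, z) * sin th)"
  "DERIV A2 z :> circ (%th. arctan (m (th, z)) * sin th) - circ (%th. E (th, z) * cos th)"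
 unfolding A1_def[abs_def] A2_def[abs_def] circ_bz_trig[OF z, symmetric]
 by (rule circ_leibniz[OF smooth_q z]; intro continuous_intros)+

text \<open>\<open>F\<close> integrates to zero around the circle, so the mean of \<open>b\<close>
  follows \<open>z\<close> up to the integral of \<open>E\<close>.\<close>

lemma DERIV_mean:
 assumes z: "z > z0"
 shows "DERIV (%z. circ (%th. b (th, z))) z :> 2 * pi + circ (%th. E (th, z))"
proof -
 have c1: "continuous_on UNIV (%th :: real. 1 :: real)" by simp
 note L = circ_leibniz[OF smooth_b z c1]
 have cF: "continuous_on UNIV (%th. F (th, z))" and cE: "continuous_on UNIV (%th. E (th, z))"
  using half_slice(2)[OF Sym_smooth[OF Sym_F] z] half_slice(2)[OF Sym_smooth[OF Sym_E] z] by auto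
 have e: "D2 b (th, z) * 1 = (1 + E (th, z)) - F (th, z)" for th
  using D_b(2)[of "(th, z)"] z unfolding E_def by simp
 have "circ (%th. (1 + E (th, z)) - F (th, z)) = circ (%th. 1 + E (th, z)) - circ (%th. F (th, z))"
  by (rule circ_diff) (intro continuous_intros cE cF)+
 also have "circ (%th. 1 + E (th, z)) = circ (%th. 1) + circ (%th. E (th, z))"
  by (rule circ_add) (intro continuous_intros cE)+
 also have "circ (%th. F (th, z)) = 0"
  using circ_ftc(1)[OF DERIV_Theta[OF z]] per_m[of 0 z] by simp
 finally show ?thesis using L unfolding e by simp
qed

lemma gap:
 assumes z: "z > z0"
 shows "circ (%th. (q (th, z) - (A1 z * cos th + A2 z * sin th) / pi)^2) = X z - X1 z"
  "X1 z <= X z" "Pz z >= (12 / 5) * X z - (7 / 5) * X1 z"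
proof -
 have d: "DERIV (%th. b (th, z)) th :> q (th, z)" for th
  using half_slice(1)[OF smooth_b z, of th] D_b(1)[of "(th, z)"] z by simp
 note g = circle_poincare_gap[where b = "%th. b (th, z)" and q = "%th. q (th, z)" and q' = "%th. D1 q (th, z)",
  OF d half_slice(1)[OF smooth_q z] half_slice(2)[OF smooth2_D(1)[OF smooth_q] z] per_b per_q periodic_D(1)[of q, OF per_q],
  folded A1_def A2_def X_def Pz_def, folded X1_def]
 show "circ (%th. (q (th, z) - (A1 z * cos th + A2 z * sin th) / pi)^2) = X z - X1 z" "X1 z <= X z" "Pz z >= (12 / 5) * X z - (7 / 5) * X1 z"
  by (rule g)+
qed

end

lemma powr_growth:
 fixes f f' :: "real => real"
 assumes z1: "z1 > 0" and d: "!!z. z >= z1 ==> DERIV f z :> f' z"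
  and le: "!!z. z >= z1 ==> a * f z <= z * f' z" and xy: "z1 <= x" "x <= y"
 shows "f x * x powr (- a) <= f y * y powr (- a)"
proof (rule DERIV_nonneg_imp_nondecreasing[OF xy(2)])
 fix z assume "x <= z" "z <= y"
 then have z: "z >= z1" "z > 0" using xy z1 by auto
 have "DERIV (%z. f z * z powr (- a)) z :> f' z * z powr (- a) + (- a * z powr (- a - 1)) * f z"
  by (rule DERIV_mult[OF d[OF z(1)] has_real_derivative_powr[OF z(2)]])
 moreover have "f' z * z powr (- a) + (- a * z powr (- a - 1)) * f z = z powr (- a - 1) * (z * f' z - a * f z)"
 proof -
  have "z powr (- a) = z powr (- a - 1) * z" using powr_add[of z "- a - 1" 1] z by simp
  then show ?thesis by (simp add: algebra_simps)
 qed
 ultimately show "EX d. DERIV (%z. f z * z powr (- a)) z :> d & 0 <= d"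
  using le[OF z(1)] by (intro exI conjI) (assumption, simp)
qed

text \<open>This is how the backward equation is exploited: a positive value would be amplified at
  least like \<open>z powr a\<close>, which exceeds the permitted \<open>z powr c\<close>.\<close>

lemma subcritical_growth:
 fixes f f' :: "real => real"
 assumes z1: "z1 > 0" and d: "!!z. z >= z1 ==> DERIV f z :> f' z"
  and le: "!!z. z >= z1 ==> a * f z <= z * f' z"
  and up: "!!z. z >= z1 ==> f z <= C * z powr c" and ca: "c < a" and x: "x >= z1"
 shows "f x <= 0"
proof (rule ccontr)
 assume "\<not> f x <= 0"
 then have k: "f x * x powr (- a) > 0" using z1 x by simp
 have "((%y. C * y powr (c - a)) \<longlongrightarrow> C * 0) at_top"
  by (intro tendsto_intros tendsto_neg_powr filterlim_ident) (use ca in simp)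
 then have "\<forall>\<^sub>F y in at_top. C * y powr (c - a) < f x * x powr (- a)"
  using order_tendstoD(2) k by fastforce
 then have "\<forall>\<^sub>F y in at_top. C * y powr (c - a) < f x * x powr (- a) & x <= y"
  using eventually_ge_at_top[of x] by (rule eventually_conj)
 then obtain y where y: "C * y powr (c - a) < f x * x powr (- a)" "x <= y"
  using eventually_happens'[OF trivial_limit_at_top_linorder] by blast
 have "f x * x powr (- a) <= f y * y powr (- a)" by (rule powr_growth[OF z1 d le x y(2)])
 also have "... <= (C * y powr c) * y powr (- a)" using up[of y] y(2) x by (intro mult_right_mono) auto
 also have "... = C * y powr (c - a)" using powr_add[of y c "- a"] by simp
 finally show False using y(1) by linarith
qed

context polar_end
begin

definition dX where "dX z = 2 * circ (%th. D1 q (th, z) * F (th, z)) + 2 * circ (%th. q (th, z) * D1 E (th, z))"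
definition dA1 where "dA1 z = circ (%th. arctan (m (th, z)) * cos th) + circ (%th. E (th, z) * sin th)"
definition dA2 where "dA2 z = circ (%th. arctan (m (th, z)) * sin th) - circ (%th. E (th, z) * cos th)"
definition dX1 where "dX1 z = 2 * (A1 z * dA1 z + A2 z * dA2 z) / pi"

lemma DERIV_X1: "z > z0 ==> DERIV X1 z :> dX1 z"
 unfolding X1_def[abs_def] dX1_def dA1_def dA2_def
 by (auto intro!: derivative_eq_intros DERIV_A simp: field_simps)

lemma slice_continuous:
 assumes z: "z > z0"
 shows "continuous_on UNIV (%th. q (th, z))" "continuous_on UNIV (%th. D1 q (th, z))" "continuous_on UNIV (%th. F (th, z))"
  "continuous_on UNIV (%th. E (th, z))" "continuous_on UNIV (%th. D1 E (th, z))" "continuous_on UNIV (%th. arctan (m (th, z)))"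
  "continuous_on UNIV (%th. b (th, z))"
 using half_slice(2)[OF smooth_q z] half_slice(2)[OF smooth2_D(1)[OF smooth_q] z] half_slice(2)[OF Sym_smooth[OF Sym_F] z]
  half_slice(2)[OF Sym_smooth[OF Sym_E] z] half_slice(2)[OF Sym_smooth[OF Sym_D1[OF Sym_E]] z] half_slice(2)[OF smooth_b z]
  continuous_on_arctan[OF half_slice(2)[OF Sym_smooth[OF Sym_m] z]] by auto

text \<open>\<open>k\<close> is any pointwise majorant of the error, so the same lemma serves the
  relative errors of the first pass and the power errors of the second.\<close>

lemma X_growth:
 assumes z: "z > z0" "z > 0" and ck: "continuous_on UNIV k"
  and k: "!!th. - (2 * D1 q (th, z) * (F (th, z) - D1 q (th, z) / (2 * z)) + 2 * q (th, z) * D1 E (th, z)) <= k th"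
 shows "Pz z / z - circ k <= dX z"
proof -
 note c = slice_continuous[OF z(1)]
 have "Pz z / z - circ k = circ (%th. (1 / z) * (D1 q (th, z))^2) - circ k"
  unfolding Pz_def by (simp only: integral_mult_right) simp
 also have "... = circ (%th. (1 / z) * (D1 q (th, z))^2 - k th)"
  by (rule circ_diff[symmetric]) (intro continuous_intros c ck)+
 also have "... <= circ (%th. 2 * (D1 q (th, z) * F (th, z)) + 2 * (q (th, z) * D1 E (th, z)))"
 proof (rule circ_mono)
  fix th
  have "D1 q (th, z) * (F (th, z) - D1 q (th, z) / (2 * z)) = D1 q (th, z) * F (th, z) - (1 / z) * (D1 q (th, z))^2 / 2"
  using z by (simp add: field_simps power2_eq_square)
  then show "(1 / z) * (D1 q (th, z))^2 - k th <= 2 * (D1 q (th, z) * F (th, z)) + 2 * (q (th, z) * D1 E (th, z))"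
  using k[of th] by (simp add: mult.assoc)
 qed (intro continuous_intros c ck)+
 also have "... = circ (%th. 2 * (D1 q (th, z) * F (th, z))) + circ (%th. 2 * (q (th, z) * D1 E (th, z)))"
  by (rule circ_add) (intro continuous_intros c)+
 also have "... = dX z" unfolding dX_def by (simp only: integral_mult_right)
 finally show ?thesis .
qed

lemma A_growth_aux:
 assumes z: "z > z0" "z > 0" and ck: "continuous_on UNIV k"
  and k: "!!th. \<bar>arctan (m (th, z)) - q (th, z) / (2 * z)\<bar> <= k th" and e: "!!th. \<bar>E (th, z)\<bar> <= e"
  and c: "continuous_on UNIV c" "continuous_on UNIV s" and c1: "!!th. \<bar>c th\<bar> <= 1" "!!th. \<bar>s th\<bar> <= 1"
 shows "\<bar>circ (%th. arctan (m (th, z)) * c th) + circ (%th. E (th, z) * s th) - circ (%th. q (th, z) * c th) / (2 * z)\<bar>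
  <= circ k + 2 * pi * e"
proof -
 note cs = slice_continuous[OF z(1)]
 let ?f = "%th. (arctan (m (th, z)) - q (th, z) / (2 * z)) * c th"
 have cf: "continuous_on UNIV ?f" by (intro continuous_intros cs c) (use z in auto)
 have "circ ?f = circ (%th. arctan (m (th, z)) * c th - (1 / (2 * z)) * (q (th, z) * c th))"
  by (simp add: left_diff_distrib)
 also have "... = circ (%th. arctan (m (th, z)) * c th) - circ (%th. (1 / (2 * z)) * (q (th, z) * c th))"
  by (rule circ_diff) (intro continuous_intros cs c)+
 also have "circ (%th. (1 / (2 * z)) * (q (th, z) * c th)) = circ (%th. q (th, z) * c th) / (2 * z)"
  by (simp only: integral_mult_right) simp
 finally have e1: "circ ?f = circ (%th. arctan (m (th, z)) * c th) - circ (%th. q (th, z) * c th) / (2 * z)" .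
 have "\<bar>circ ?f\<bar> <= circ (%th. \<bar>?f th\<bar>)" by (rule circ_abs[OF cf])
 also have "... <= circ k"
 proof (rule circ_mono[OF _ ck])
  fix th
  have "\<bar>?f th\<bar> <= k th * 1" unfolding abs_mult by (rule mult_mono) (use k[of th] c1[of th] in auto)
  then show "\<bar>?f th\<bar> <= k th" by simp
 qed (intro continuous_intros cf)
 finally have f: "\<bar>circ ?f\<bar> <= circ k" .
 have "\<bar>E (th, z) * s th\<bar> <= e" for th
  using mult_mono[OF e[of th] c1(2)[of th]] e[of th] by (simp add: abs_mult)
 then have "\<bar>circ (%th. E (th, z) * s th)\<bar> <= 2 * pi * e" by (intro circ_bound continuous_intros cs c)
 then show ?thesis using f unfolding e1 by linarith
qed

text \<open>The main part \<open>A / (2 * z)\<close> makes both coefficients grow like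
  \<open>sqrt z\<close>, that is \<open>X1\<close> like \<open>z\<close>; dividing by the radius
  then leaves a bounded first harmonic.\<close>

lemma A_growth:
 assumes z: "z > z0" "z > 0" and ck: "continuous_on UNIV k"
  and k: "!!th. \<bar>arctan (m (th, z)) - q (th, z) / (2 * z)\<bar> <= k th" and e: "!!th. \<bar>E (th, z)\<bar> <= e"
 shows "\<bar>dA1 z - A1 z / (2 * z)\<bar> <= circ k + 2 * pi * e" "\<bar>dA2 z - A2 z / (2 * z)\<bar> <= circ k + 2 * pi * e"
proof -
 have cc: "continuous_on UNIV (cos :: real => real)" "continuous_on UNIV (sin :: real => real)" "continuous_on UNIV (%x :: real. - cos x)"
  by (intro continuous_intros)+
 show "\<bar>dA1 z - A1 z / (2 * z)\<bar> <= circ k + 2 * pi * e"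
  unfolding dA1_def A1_def by (rule A_growth_aux[OF z ck k e cc(1,2)]) auto
 have n: "circ (%th. E (th, z) * (- cos th)) = - circ (%th. E (th, z) * cos th)"
  by (simp only: mult_minus_right Henstock_Kurzweil_Integration.integral_neg)
 have "\<bar>circ (%th. arctan (m (th, z)) * sin th) + circ (%th. E (th, z) * (- cos th)) - circ (%th. q (th, z) * sin th) / (2 * z)\<bar>
  <= circ k + 2 * pi * e"
  by (rule A_growth_aux[OF z ck k e cc(2,3)]) auto
 then show "\<bar>dA2 z - A2 z / (2 * z)\<bar> <= circ k + 2 * pi * e" unfolding dA2_def A2_def n by simp
qed

lemma slope_estimates:
 assumes z: "z > z0" "z > 0" and bb: "z / 2 <= b (th, z)" "\<bar>b (th, z) - z\<bar> <= be" and qz: "\<bar>q (th, z)\<bar> <= z"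
 shows "\<bar>arctan (m (th, z)) - q (th, z) / (2 * z)\<bar> <= \<bar>q (th, z)\<bar> * be / z^2 + \<bar>q (th, z)\<bar> ^ 3 / z ^ 3"
  "\<bar>F (th, z) - D1 q (th, z) / (2 * z)\<bar> <=
  \<bar>D1 q (th, z)\<bar> * be / z^2 + 4 * (q (th, z))^2 / z^2 + (q (th, z))^2 * \<bar>D1 q (th, z)\<bar> / z ^ 3"
proof -
 have p: "(th, z) \<in> half z0" using z by simp
 have r0: "rh (th, z) > 0" by (rule pos[OF p])
 have me: "m (th, z) = q (th, z) / (2 * b (th, z))"
  unfolding m_def q_def b_def using r0 by (simp add: field_simps)
 note d = smooth2_differentiable[OF smooth_rho p] and d1 = smooth2_differentiable[OF smooth2_D(1)[OF smooth_rho] p]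
 have "D1 m (th, z) = D1 q (th, z) / (2 * b (th, z)) - (q (th, z))^2 / (2 * (b (th, z))^2)"
  unfolding D_m(1)[OF p] q_def[abs_def] D_mult(2)[OF d d1] b_def using r0
  by (simp add: field_simps power2_eq_square)
 then have Fe: "F (th, z) = (D1 q (th, z) / (2 * b (th, z)) - (q (th, z))^2 / (2 * (b (th, z))^2)) *
  inverse (1 + (q (th, z) / (2 * b (th, z))) * (q (th, z) / (2 * b (th, z))))"
  unfolding F_def A_def me by simp
 show "\<bar>arctan (m (th, z)) - q (th, z) / (2 * z)\<bar> <= \<bar>q (th, z)\<bar> * be / z^2 + \<bar>q (th, z)\<bar> ^ 3 / z ^ 3"
  unfolding me by (rule slope_bounds(1)[OF z(2) bb qz])
 show "\<bar>F (th, z) - D1 q (th, z) / (2 * z)\<bar> <=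
  \<bar>D1 q (th, z)\<bar> * be / z^2 + 4 * (q (th, z))^2 / z^2 + (q (th, z))^2 * \<bar>D1 q (th, z)\<bar> / z ^ 3"
  unfolding Fe by (rule slope_bounds(2)[OF z(2) bb qz])
qed

lemma b_small:
 assumes "eps > 0" "eps <= 1"
 shows "\<forall>\<^sub>F z in at_top. ALL th. \<bar>b (th, z) - z\<bar> <= eps * z & \<bar>q (th, z)\<bar> <= eps * z & \<bar>D1 q (th, z)\<bar> <= eps * z"
proof -
 \<comment> \<open>\<open>b - z\<close> is half the product of the difference and the sum of the
   radius and \<open>sqrt 2 * s\<close>; the sum is at most \<open>7 / 2 * s\<close>, so a quarter
   of \<open>eps\<close> suffices.\<close>
 have "eps / 4 > 0" using assms by simp
 from small[OF this] show ?thesis using eventually_gt_at_top[of "max 1 z0"]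
 proof eventually_elim
  case (elim z)
  show ?case
  proof
  fix th
  have p: "(th, z) \<in> half z0" and z: "z > 0" using elim by auto
  define s r r1 r2 where "s = sqrt z" and "r = rh (th, z)" and "r1 = D1 rh (th, z)" and "r2 = D1 (D1 rh) (th, z)"
  have zz: "z = s * s" and s0: "s > 0" unfolding s_def using z by auto
  have h: "\<bar>r - sqrt 2 * s\<bar> <= eps / 4 * s" "\<bar>r1\<bar> <= eps / 4 * s" "\<bar>r2\<bar> <= eps / 4 * s"
  unfolding r_def r1_def r2_def s_def using elim by auto
  have s2: "sqrt 2 <= (3 / 2 :: real)" by (rule real_le_lsqrt) (auto simp: power2_eq_square)
  have e1: "eps * s <= s" using assms s0 by simp
  have s3: "sqrt 2 * s <= 3 / 2 * s" using s2 s0 by (intro mult_right_mono) auto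
  have q0: "0 <= sqrt 2 * s" and es: "0 <= eps * s" using s0 assms by auto
  have rle: "\<bar>r\<bar> <= 2 * s" and sle: "\<bar>r + sqrt 2 * s\<bar> <= 2 * s + 3 / 2 * s" and r1: "\<bar>r1\<bar> <= s"
  using h(1,2) s3 e1 s0 q0 es by linarith+
  have "\<bar>(r - sqrt 2 * s) * (r + sqrt 2 * s)\<bar> <= (eps / 4 * s) * (2 * s + 3 / 2 * s)"
  unfolding abs_mult using h(1) sle es by (intro mult_mono) auto
  moreover have "(r - sqrt 2 * s) * (r + sqrt 2 * s) = r * r - 2 * z"
  unfolding zz by (simp add: algebra_simps)
  moreover have "(eps / 4 * s) * (2 * s + 3 / 2 * s) = 7 / 8 * (eps * z)" unfolding zz by (simp add: algebra_simps)
  moreover have ez: "eps * z >= 0" using assms z by simp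
  ultimately have 1: "\<bar>b (th, z) - z\<bar> <= eps * z" unfolding b_def r_def[symmetric] by linarith
  have "\<bar>r * r1\<bar> <= (2 * s) * (eps / 4 * s)" unfolding abs_mult by (intro mult_mono rle h) (use s0 in auto)
  also have "... = eps * z / 2" unfolding zz by simp
  finally have 2: "\<bar>r * r1\<bar> <= eps * z / 2" .
  have "\<bar>r * r2\<bar> <= (2 * s) * (eps / 4 * s)" unfolding abs_mult by (intro mult_mono rle h) (use s0 in auto)
  also have "... = eps * z / 2" unfolding zz by simp
  finally have 3: "\<bar>r * r2\<bar> <= eps * z / 2" .
  have "\<bar>r1 * r1\<bar> <= s * (eps / 4 * s)" unfolding abs_mult using s0 by (intro mult_mono h r1) auto
  also have "... = eps * z / 4" unfolding zz by simp
  finally have 4: "\<bar>r1 * r1\<bar> <= eps * z / 4" .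
  note d = smooth2_differentiable[OF smooth_rho p] and d1 = smooth2_differentiable[OF smooth2_D(1)[OF smooth_rho] p]
  have "D1 q (th, z) = r1 * r1 + r * r2"
  unfolding q_def[abs_def] D_mult(2)[OF d d1] r_def r1_def r2_def by simp
  then have 5: "\<bar>D1 q (th, z)\<bar> <= eps * z" using 3 4 ez by linarith
  show "\<bar>b (th, z) - z\<bar> <= eps * z & \<bar>q (th, z)\<bar> <= eps * z & \<bar>D1 q (th, z)\<bar> <= eps * z"
  using 1 2 5 ez unfolding q_def r_def r1_def by auto
  qed
 qed
qed

lemma E_small:
 obtains C where "C > 0" "\<forall>\<^sub>F z in at_top. ALL th. \<bar>E (th, z)\<bar> <= C / z & \<bar>D1 E (th, z)\<bar> <= C / z"
proof -
 obtain C1 C2 where 1: "\<forall>\<^sub>F z in at_top. ALL th. \<bar>E (th, z)\<bar> <= C1 * z powr (- 1)"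
  and 2: "\<forall>\<^sub>F z in at_top. ALL th. \<bar>D1 E (th, z)\<bar> <= C2 * z powr (- 1)"
  using Sym_bigOz[OF Sym_E] Sym_bigOz[OF Sym_D1[OF Sym_E]] unfolding bigOz_def by auto
 show ?thesis
 proof (rule that)
  show "max 1 (max C1 C2) > 0" by simp
  show "\<forall>\<^sub>F z in at_top. ALL th. \<bar>E (th, z)\<bar> <= max 1 (max C1 C2) / z & \<bar>D1 E (th, z)\<bar> <= max 1 (max C1 C2) / z"
  using 1 2 eventually_gt_at_top[of 0]
  proof eventually_elim
  case (elim z)
  have "C1 * z powr (- 1) <= max 1 (max C1 C2) / z" "C2 * z powr (- 1) <= max 1 (max C1 C2) / z"
  using elim(3) by (auto simp: powr_minus divide_inverse intro!: mult_right_mono)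
  then show ?case using elim(1,2) by (meson order_trans)
  qed
 qed
qed

end

section \<open>First pass: the growth of \<open>q\<close> from relatively small errors\<close>

lemma weighted_am_gm: "mu > 0 ==> 2 * x * y <= mu * x^2 + y^2 / mu" for x y mu :: real
proof -
 assume m: "mu > 0"
 have "0 <= (mu * x - y)^2 / mu" using m by simp
 also have "... = mu * x^2 + y^2 / mu - 2 * x * y" using m by (simp add: power2_eq_square field_simps)
 finally show ?thesis by simp
qed

context polar_end
begin

lemma phase_one_start:
 obtains z1 C where "z1 >= 1" "z1 > z0" "C > 0"
  "!!z th. z >= z1 ==> \<bar>b (th, z) - z\<bar> <= z / 1000 & \<bar>q (th, z)\<bar> <= z / 1000 & \<bar>D1 q (th, z)\<bar> <= z / 1000"
  "!!z th. z >= z1 ==> \<bar>E (th, z)\<bar> <= C / z & \<bar>D1 E (th, z)\<bar> <= C / z"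
proof -
 obtain C where C: "C > 0" "\<forall>\<^sub>F z in at_top. ALL th. \<bar>E (th, z)\<bar> <= C / z & \<bar>D1 E (th, z)\<bar> <= C / z" by (rule E_small)
 have "\<forall>\<^sub>F z in at_top. z > max 1 z0 & (ALL th. \<bar>b (th, z) - z\<bar> <= 1 / 1000 * z & \<bar>q (th, z)\<bar> <= 1 / 1000 * z & \<bar>D1 q (th, z)\<bar> <= 1 / 1000 * z)
  & (ALL th. \<bar>E (th, z)\<bar> <= C / z & \<bar>D1 E (th, z)\<bar> <= C / z)"
  by (intro eventually_conj b_small C(2) eventually_gt_at_top) auto
 then obtain z1 where z1: "\<forall>z\<ge>z1. z > max 1 z0 & (ALL th. \<bar>b (th, z) - z\<bar> <= 1 / 1000 * z & \<bar>q (th, z)\<bar> <= 1 / 1000 * z & \<bar>D1 q (th, z)\<bar> <= 1 / 1000 * z)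
  & (ALL th. \<bar>E (th, z)\<bar> <= C / z & \<bar>D1 E (th, z)\<bar> <= C / z)"
  unfolding eventually_at_top_linorder by blast
 show ?thesis
  by (rule that[of z1 C]) (use z1 C(1) in auto)
qed

lemma phase_one_slopes:
 assumes z: "z >= 1" "z > z0"
  and s: "\<bar>b (th, z) - z\<bar> <= z / 1000 & \<bar>q (th, z)\<bar> <= z / 1000 & \<bar>D1 q (th, z)\<bar> <= z / 1000"
 shows "\<bar>arctan (m (th, z)) - q (th, z) / (2 * z)\<bar> <= (1 / (500 * z)) * \<bar>q (th, z)\<bar>"
  "\<bar>F (th, z) - D1 q (th, z) / (2 * z)\<bar> <= (\<bar>D1 q (th, z)\<bar> / 500 + \<bar>q (th, z)\<bar> / 250) / z"
proof -
 let ?q = "\<bar>q (th, z)\<bar>" and ?r = "\<bar>D1 q (th, z)\<bar>"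
 have zp: "z > 0" using z by linarith
 have bb: "z / 2 <= b (th, z)" "\<bar>b (th, z) - z\<bar> <= z / 1000" "\<bar>q (th, z)\<bar> <= z" using s zp by linarith+
 have qz: "?q / z <= 1 / 1000" using s zp by (simp add: field_simps)
 have q2: "(?q / z)^2 <= 1 / 1000 * (?q / z)" unfolding power2_eq_square using qz zp by (intro mult_right_mono) auto
 have q3: "(?q / z)^2 <= 1 / 1000"
 proof -
  have "?q / z >= 0" using zp by simp
  then show ?thesis using q2 qz by linarith
 qed
 have "\<bar>arctan (m (th, z)) - q (th, z) / (2 * z)\<bar> <= ?q * (z / 1000) / z^2 + ?q ^ 3 / z ^ 3"
  by (rule slope_estimates(1)[OF z(2) zp bb])
 also have "... = ?q / z / 1000 + (?q / z)^2 * (?q / z)"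
  using zp by (simp add: power2_eq_square power3_eq_cube)
 also have "... <= ?q / z / 1000 + 1 / 1000 * (?q / z)"
  by (intro add_left_mono mult_right_mono q3) (use zp in auto)
 finally show "\<bar>arctan (m (th, z)) - q (th, z) / (2 * z)\<bar> <= (1 / (500 * z)) * ?q" by simp
 have "\<bar>F (th, z) - D1 q (th, z) / (2 * z)\<bar> <= ?r * (z / 1000) / z^2 + 4 * (q (th, z))^2 / z^2 + (q (th, z))^2 * ?r / z ^ 3"
  by (rule slope_estimates(2)[OF z(2) zp bb])
 also have "... = ?r / z / 1000 + 4 * (?q / z)^2 + (?q / z)^2 * (?r / z)"
  using zp by (simp add: power2_eq_square power3_eq_cube power_divide)
 also have "... <= ?r / z / 1000 + 4 * (1 / 1000 * (?q / z)) + 1 / 1000 * (?r / z)"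
  by (intro add_mono mult_right_mono mult_left_mono q2 q3) (use zp in auto)
 finally show "\<bar>F (th, z) - D1 q (th, z) / (2 * z)\<bar> <= (?r / 500 + ?q / 250) / z"
  by (simp add: add_divide_distrib)
qed

lemma X_nonneg: "z > z0 ==> X z >= 0" and X1_nonneg: "X1 z >= 0"
 unfolding X_def X1_def by (auto intro!: circ_nonneg continuous_intros slice_continuous)

lemma circ_abs_q:
 assumes "z > z0"
 shows "(circ (%th. \<bar>q (th, z)\<bar>))^2 <= 2 * pi * X z"
 using circ_Cauchy_Schwarz[of "%th. \<bar>q (th, z)\<bar>" "%th. 1"] slice_continuous(1)[OF assms]
 by (simp add: X_def mult.commute continuous_on_rabs)

text \<open>All nonlinear errors are at most small fixed fractions of \<open>Pz\<close> and
  \<open>X\<close>. The defect \<open>E\<close> gives products linear in \<open>q\<close>, which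
  weighted AM-GM splits into a fraction of \<open>X\<close> and a constant multiple of
  \<open>C^2\<close>.\<close>

lemma phase_one_X:
 assumes z: "z >= 1" "z > z0" and C: "C > 0"
  and s: "!!th. \<bar>b (th, z) - z\<bar> <= z / 1000 & \<bar>q (th, z)\<bar> <= z / 1000 & \<bar>D1 q (th, z)\<bar> <= z / 1000"
  and e: "!!th. \<bar>E (th, z)\<bar> <= C / z & \<bar>D1 E (th, z)\<bar> <= C / z"
 shows "237 / 100 * X z - 7 / 5 * X1 z - 2000 * pi * C^2 <= z * dX z"
  "\<bar>z * dX1 z - X1 z\<bar> <= 3 / 250 * X z + 4000 * pi * C^2"
proof -
 have zp: "z > 0" using z by linarith
 note c = slice_continuous[OF z(2)]
 define k where "k = (%th. (1 / z) * (1 / 125 * (D1 q (th, z))^2 + 1 / 200 * (q (th, z))^2 + 1000 * C^2))"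
 have ck: "continuous_on UNIV k" unfolding k_def by (intro continuous_intros c)
 have "- (2 * D1 q (th, z) * (F (th, z) - D1 q (th, z) / (2 * z)) + 2 * q (th, z) * D1 E (th, z)) <= k th" for th
 proof -
  let ?q = "\<bar>q (th, z)\<bar>" and ?r = "\<bar>D1 q (th, z)\<bar>"
  have 1: "\<bar>D1 q (th, z) * (F (th, z) - D1 q (th, z) / (2 * z))\<bar> <= ?r * ((?r / 500 + ?q / 250) / z)"
  unfolding abs_mult by (intro mult_left_mono phase_one_slopes z s) simp
  have 2: "\<bar>q (th, z) * D1 E (th, z)\<bar> <= ?q * (C / z)"
  unfolding abs_mult using e[of th] by (intro mult_left_mono) auto
  have 3: "2 * ?q * C <= 1 / 1000 * ?q^2 + C^2 / (1 / 1000)" by (rule weighted_am_gm) simp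
  have 4: "2 * ?r * ?q <= 1 * ?r^2 + ?q^2 / 1" by (rule weighted_am_gm) simp
  have "- (2 * D1 q (th, z) * (F (th, z) - D1 q (th, z) / (2 * z)) + 2 * q (th, z) * D1 E (th, z))
  <= 2 * (?r * ((?r / 500 + ?q / 250) / z)) + 2 * (?q * (C / z))" using 1 2 by linarith
  also have "... = (1 / z) * (?r^2 / 250 + (2 * ?r * ?q) / 250 + 2 * ?q * C)"
  using zp by (simp add: field_simps power2_eq_square)
  also have "... <= (1 / z) * (1 / 125 * ?r^2 + 1 / 200 * ?q^2 + 1000 * C^2)"
  proof (rule mult_left_mono)
  have gen: "R / 250 + x / 250 + y <= 1 / 125 * R + 1 / 200 * Q + 1000 * P"
  if "y <= 1 / 1000 * Q + P / (1 / 1000)" "x <= 1 * R + Q / 1" "0 <= Q" for R Q x y P :: real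
  using that by simp
  show "?r^2 / 250 + (2 * ?r * ?q) / 250 + 2 * ?q * C <= 1 / 125 * ?r^2 + 1 / 200 * ?q^2 + 1000 * C^2"
  by (rule gen[OF 3 4]) simp
  qed (use zp in simp)
  finally show ?thesis unfolding k_def by simp
 qed
 from X_growth[OF z(2) zp ck this] have g: "Pz z / z - circ k <= dX z" .
 have "circ k = (1 / z) * circ (%th. 1 / 125 * (D1 q (th, z))^2 + 1 / 200 * (q (th, z))^2 + 1000 * C^2)"
  unfolding k_def by (simp only: integral_mult_right)
 also have "circ (%th. 1 / 125 * (D1 q (th, z))^2 + 1 / 200 * (q (th, z))^2 + 1000 * C^2) =
  circ (%th. 1 / 125 * (D1 q (th, z))^2 + 1 / 200 * (q (th, z))^2) + circ (%th. 1000 * C^2)"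
  by (rule circ_add) (intro continuous_intros c)+
 also have "circ (%th. 1 / 125 * (D1 q (th, z))^2 + 1 / 200 * (q (th, z))^2) =
  circ (%th. 1 / 125 * (D1 q (th, z))^2) + circ (%th. 1 / 200 * (q (th, z))^2)"
  by (rule circ_add) (intro continuous_intros c)+
 also have "circ (%th. 1 / 125 * (D1 q (th, z))^2) = 1 / 125 * Pz z" unfolding Pz_def by (simp only: integral_mult_right)
 also have "circ (%th. 1 / 200 * (q (th, z))^2) = 1 / 200 * X z" unfolding X_def by (simp only: integral_mult_right)
 also have "circ (%th. 1000 * C^2) = 2000 * pi * C^2" by simp
 finally have k: "circ k = (1 / z) * (1 / 125 * Pz z + 1 / 200 * X z + 2000 * pi * C^2)" .
 have "z * (Pz z / z - circ k) <= z * dX z" using g zp by simp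
 moreover have "z * (Pz z / z - circ k) = Pz z - (1 / 125 * Pz z + 1 / 200 * X z + 2000 * pi * C^2)"
  unfolding k using zp by (simp add: right_diff_distrib)
 \<comment> \<open>The gap with coefficient \<open>124 / 125\<close> on \<open>Pz\<close>, minus
   \<open>1 / 200\<close>: \<open>124 / 125 * 12 / 5 - 1 / 200 > 237 / 100\<close>.\<close>
 ultimately show "237 / 100 * X z - 7 / 5 * X1 z - 2000 * pi * C^2 <= z * dX z"
  using gap(3)[OF z(2)] X_nonneg[OF z(2)] X1_nonneg[of z] by linarith
 define I where "I = circ (%th. \<bar>q (th, z)\<bar>)"
 have I2: "I^2 <= 2 * pi * X z" unfolding I_def by (rule circ_abs_q[OF z(2)])
 have ck2: "continuous_on UNIV (%th. (1 / (500 * z)) * \<bar>q (th, z)\<bar>)" by (intro continuous_intros c)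
 have eb: "\<bar>E (th, z)\<bar> <= C / z" for th using e by blast
 define B where "B = I / 500 + 2 * pi * C"
 have Be: "circ (%th. (1 / (500 * z)) * \<bar>q (th, z)\<bar>) + 2 * pi * (C / z) = B / z"
  unfolding B_def I_def using zp by (simp only: integral_mult_right) (simp add: field_simps)
 note ag = A_growth[OF z(2) zp ck2 phase_one_slopes(1)[OF z s] eb, unfolded Be]
 define R1 where "R1 = dA1 z - A1 z / (2 * z)"
 define R2 where "R2 = dA2 z - A2 z / (2 * z)"
 have R: "\<bar>z * R1\<bar> <= B" "\<bar>z * R2\<bar> <= B"
  using ag zp unfolding R1_def[symmetric] R2_def[symmetric] by (auto simp: abs_mult field_simps)
 have dx: "z * dX1 z - X1 z = (2 * A1 z * (z * R1) + 2 * A2 z * (z * R2)) / pi"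
  unfolding dX1_def X1_def R1_def R2_def using zp by (simp add: field_simps power2_eq_square)
 have am: "\<bar>2 * a * r\<bar> <= a^2 / 250 + 250 * B^2" if "\<bar>r\<bar> <= B" for a r :: real
 proof -
  have "2 * \<bar>a\<bar> * \<bar>r\<bar> <= (1 / 250) * \<bar>a\<bar>\<^sup>2 + \<bar>r\<bar>\<^sup>2 / (1 / 250)" by (rule weighted_am_gm) simp
  moreover have "\<bar>r\<bar>\<^sup>2 <= B^2" using that by (intro power_mono) auto
  ultimately show ?thesis by (simp add: abs_mult)
 qed
 have Y: "\<bar>2 * A1 z * (z * R1) + 2 * A2 z * (z * R2)\<bar> <= ((A1 z)^2 + (A2 z)^2) / 250 + 500 * B^2"
  using am[OF R(1), of "A1 z"] am[OF R(2), of "A2 z"] by (simp add: add_divide_distrib)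
 have 1: "\<bar>z * dX1 z - X1 z\<bar> <= X1 z / 250 + 500 * B^2 / pi"
 proof -
  have "\<bar>z * dX1 z - X1 z\<bar> = \<bar>2 * A1 z * (z * R1) + 2 * A2 z * (z * R2)\<bar> / pi" unfolding dx by simp
  also have "... <= (((A1 z)^2 + (A2 z)^2) / 250 + 500 * B^2) / pi"
  using Y by (intro divide_right_mono) auto
  also have "... = X1 z / 250 + 500 * B^2 / pi" unfolding X1_def by (simp add: add_divide_distrib)
  finally show ?thesis .
 qed
 have "B^2 <= 2 * (I / 500)^2 + 2 * (2 * pi * C)^2"
 proof -
  have "0 <= (I / 500 - 2 * pi * C)^2" by simp
  then show ?thesis unfolding B_def power2_sum power2_diff by linarith
 qed
 also have "... <= 2 * (2 * pi * X z / 250000) + 8 * pi * pi * C^2"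
  using I2 by (simp add: power_divide power2_eq_square)
 finally have "500 * B^2 / pi <= 500 * (2 * (2 * pi * X z / 250000) + 8 * pi * pi * C^2) / pi"
  by (intro divide_right_mono mult_left_mono) auto
 also have "... = X z / 125 + 4000 * pi * C^2" by (simp add: field_simps)
 finally show "\<bar>z * dX1 z - X1 z\<bar> <= 3 / 250 * X z + 4000 * pi * C^2"
  using 1 gap(2)[OF z(2)] by linarith
qed

text \<open>First the higher modes are dominated: \<open>X - 6 / 5 * X1 - K\<close> would grow at a
  rate above 2, against the bound \<open>z^2\<close>. So \<open>X\<close> is bounded by
  \<open>X1\<close>, whose own rate is then at most slightly above 1.\<close>

lemma X_bound: obtains C z1 where "z1 >= 1" "z1 > z0" "!!z. z >= z1 ==> X z <= C * z powr (51 / 50)"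
proof -
 obtain z1 C where z1: "z1 >= 1" "z1 > z0" "C > 0"
  and s: "!!z th. z >= z1 ==> \<bar>b (th, z) - z\<bar> <= z / 1000 & \<bar>q (th, z)\<bar> <= z / 1000 & \<bar>D1 q (th, z)\<bar> <= z / 1000"
  and e: "!!z th. z >= z1 ==> \<bar>E (th, z)\<bar> <= C / z & \<bar>D1 E (th, z)\<bar> <= C / z"
  by (rule phase_one_start) blast
 have p: "z >= 1" "z > z0" if "z >= z1" for z using that z1 by auto
 have g: "237 / 100 * X z - 7 / 5 * X1 z - 2000 * pi * C^2 <= z * dX z"
  "\<bar>z * dX1 z - X1 z\<bar> <= 3 / 250 * X z + 4000 * pi * C^2" if "z >= z1" for z
  using phase_one_X[OF p[OF that] z1(3)] s[OF that] e[OF that] by blast+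
 define P where "P = pi * C^2"
 have P0: "P >= 0" unfolding P_def by simp
 define K where "K = 6 * (2000 * P + 6 / 5 * (4000 * P))"
 have z10: "z1 > 0" using z1 by linarith
 \<comment> \<open>The weights are matched so that the \<open>X1\<close> terms cancel,
   \<open>7 / 5 + 6 / 5 = 13 / 6 * 6 / 5\<close>, while \<open>237 / 100 - 6 / 5 * 3 / 250\<close>
   still exceeds \<open>13 / 6\<close>.\<close>
 have W: "X z - 6 / 5 * X1 z - K <= 0" if z: "z >= z1" for z
 proof (rule subcritical_growth[OF z10 _ _ _ _ z, where a = "13 / 6" and c = 2 and C = "2 * pi"])
  fix z assume z: "z >= z1"
  have "DERIV X z :> dX z" unfolding dX_def by (rule DERIV_X[OF p(2)[OF z]])
  then show "DERIV (%z. X z - 6 / 5 * X1 z - K) z :> dX z - 6 / 5 * dX1 z"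
  using DERIV_X1[OF p(2)[OF z]] by (auto intro!: derivative_eq_intros)
  show "13 / 6 * (X z - 6 / 5 * X1 z - K) <= z * (dX z - 6 / 5 * dX1 z)"
  proof -
  have "z * (dX z - 6 / 5 * dX1 z) = z * dX z - 6 / 5 * (z * dX1 z)" by (simp add: algebra_simps)
  moreover have "237 / 100 * X z - 7 / 5 * X1 z - 2000 * P <= z * dX z" "\<bar>z * dX1 z - X1 z\<bar> <= 3 / 250 * X z + 4000 * P"
  using g[OF z] unfolding P_def by (simp_all add: mult.assoc)
  ultimately show ?thesis
  using X_nonneg[OF p(2)[OF z]] X1_nonneg[of z] P0 unfolding K_def by (simp add: abs_le_iff right_diff_distrib distrib_left)
  qed
  have "X z <= 2 * pi * z^2"
  proof -
  have "\<bar>X z\<bar> <= 2 * pi * z^2" unfolding X_def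
  proof (rule circ_bound)
  fix th
  have "\<bar>q (th, z)\<bar> <= \<bar>z\<bar>" using s[OF z, of th] p[OF z] by linarith
  then show "\<bar>(q (th, z))^2\<bar> <= z^2" by (simp add: abs_le_square_iff)
  qed (intro continuous_intros slice_continuous p[OF z])
  then show ?thesis by simp
  qed
  moreover have "z powr 2 = z^2" using p[OF z] by simp
  moreover have "K >= 0" unfolding K_def using P0 by simp
  ultimately show "X z - 6 / 5 * X1 z - K <= 2 * pi * z powr 2" using X1_nonneg[of z] by simp
 qed simp
 \<comment> \<open>Absorbs the constants into the difference between the rate \<open>51 / 50\<close>
   and the rate \<open>1 + 3 / 250 * 6 / 5\<close> obtained from the bound on
   \<open>X\<close>.\<close>
 define L where "L = 50 * (3 / 250 * K + 4000 * P)"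
 have L0: "L >= 0" "K >= 0" unfolding L_def K_def using P0 by simp_all
 have X1b: "(X1 z + L) * z powr (- (51 / 50)) <= (X1 z1 + L) * z1 powr (- (51 / 50))" if z: "z >= z1" for z
 proof -
  have *: "- (X1 z1 + L) * z1 powr (- (51 / 50)) <= - (X1 z + L) * z powr (- (51 / 50))"
  proof (rule powr_growth[OF z10 _ _ order.refl z])
  fix z assume z: "z >= z1"
  show "DERIV (%z. - (X1 z + L)) z :> - dX1 z"
  using DERIV_X1[OF p(2)[OF z]] by (auto intro!: derivative_eq_intros)
  have "z * dX1 z <= X1 z + (3 / 250 * X z + 4000 * P)"
  using g(2)[OF z] unfolding P_def by (simp add: abs_le_iff mult.assoc)
  then show "51 / 50 * - (X1 z + L) <= z * - dX1 z"
  using W[OF z] X1_nonneg[of z] P0 L0 unfolding L_def by simp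
  qed
  show ?thesis using * unfolding mult_minus_left neg_le_iff_le .
 qed
 define Q where "Q = 6 / 5 * ((X1 z1 + L) * z1 powr (- (51 / 50))) + K"
 show ?thesis
 proof (rule that[of z1 Q, OF z1(1,2)])
  fix z assume z: "z >= z1"
  have zp: "z powr (51 / 50) >= 1" using p[OF z] by (simp add: ge_one_powr_ge_zero)
  have zi: "z powr (- (51 / 50)) * z powr (51 / 50) = 1" using p[OF z] by (simp flip: powr_add)
  have "(X1 z + L) * z powr (- (51 / 50)) * z powr (51 / 50) <= ((X1 z1 + L) * z1 powr (- (51 / 50))) * z powr (51 / 50)"
  by (rule mult_right_mono[OF X1b[OF z]]) simp
  then have "X1 z + L <= ((X1 z1 + L) * z1 powr (- (51 / 50))) * z powr (51 / 50)" unfolding mult.assoc zi by simp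
  then have "X z <= 6 / 5 * (((X1 z1 + L) * z1 powr (- (51 / 50))) * z powr (51 / 50)) + K * 1"
  using W[OF z] L0 by linarith
  also have "... <= 6 / 5 * (((X1 z1 + L) * z1 powr (- (51 / 50))) * z powr (51 / 50)) + K * z powr (51 / 50)"
  using zp L0 by (intro add_left_mono mult_left_mono) auto
  also have "... = Q * z powr (51 / 50)" unfolding Q_def by (simp add: algebra_simps)
  finally show "X z <= Q * z powr (51 / 50)" .
 qed
qed

end

section \<open>Interpolation and second pass: limits of the first harmonic\<close>

lemma powr_integrate:
 fixes f f' :: "real => real"
 assumes z1: "z1 > 0" and d: "!!z. z >= z1 ==> DERIV f z :> f' z"
  and le: "!!z. z >= z1 ==> \<bar>f' z\<bar> <= k * z powr (c - 1)" and c: "c ~= 0" and xy: "z1 <= x" "x <= y"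
 shows "\<bar>f y - f x\<bar> <= (k / c) * (y powr c - x powr c)"
proof -
 have g: "g x - (k / c) * x powr c >= g y - (k / c) * y powr c"
  if dg: "!!z. z >= z1 ==> DERIV g z :> g' z" and lg: "!!z. z >= z1 ==> g' z <= k * z powr (c - 1)" for g g' :: "real => real"
 proof (rule DERIV_nonpos_imp_nonincreasing[OF xy(2)])
  fix z assume "x <= z" "z <= y"
  then have z: "z >= z1" "z > 0" using xy z1 by auto
  have "DERIV (%z. g z - (k / c) * z powr c) z :> g' z - (k / c) * (c * z powr (c - 1))"
  by (intro DERIV_diff dg z DERIV_cmult has_real_derivative_powr)
  then show "EX d. DERIV (%z. g z - (k / c) * z powr c) z :> d & d <= 0"
  using lg[OF z(1)] c by (intro exI conjI) (assumption, simp)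
 qed
 have "f x - (k / c) * x powr c >= f y - (k / c) * y powr c"
  by (rule g[OF d]) (use le in "auto simp: abs_le_iff")
 moreover have "- f x - (k / c) * x powr c >= - f y - (k / c) * y powr c"
  by (rule g[where g' = "%z. - f' z"]) (use le d in "auto simp: abs_le_iff intro!: derivative_eq_intros")
 ultimately show ?thesis by (simp add: abs_le_iff right_diff_distrib)
qed

lemma powr_tendsto_zero: "c < 0 ==> ((%x :: real. k * x powr c) \<longlongrightarrow> 0) at_top" for k :: real
 using tendsto_mult[OF tendsto_const[of k] tendsto_neg_powr[OF _ filterlim_ident]] by simp

lemma powr_derivative_convergent:
 fixes f f' :: "real => real"
 assumes z1: "z1 > 0" and d: "!!z. z >= z1 ==> DERIV f z :> f' z"
  and le: "!!z. z >= z1 ==> \<bar>f' z\<bar> <= k * z powr (c - 1)" and c: "c < 0" and k: "k >= 0"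
 obtains L where "(f \<longlongrightarrow> L) at_top"
proof -
 have b: "\<bar>f y - f x\<bar> <= (k / - c) * x powr c" if "z1 <= x" "x <= y" for x y
 proof -
  have "\<bar>f y - f x\<bar> <= (k / c) * (y powr c - x powr c)" by (rule powr_integrate[OF z1 d le _ that]) (use c in auto)
  also have "... = (k / - c) * x powr c - (k / - c) * y powr c" by (simp add: right_diff_distrib)
  also have "... <= (k / - c) * x powr c" using k c by (simp add: divide_nonneg_neg)
  finally show ?thesis .
 qed
 note t0 = powr_tendsto_zero[OF c, of "k / - c"]
 have "Cauchy (%n. f (real n))"
 proof (rule metric_CauchyI)
  fix e :: real assume "e > 0"
  then have "\<forall>\<^sub>F x in at_top. (k / - c) * x powr c < e / 2 & x >= z1"
  by (intro eventually_conj order_tendstoD(2)[OF t0] eventually_ge_at_top) auto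
  then obtain x where x: "(k / - c) * x powr c < e / 2" "x >= z1"
  using eventually_happens'[OF trivial_limit_at_top_linorder] by blast
  obtain N where N: "real N >= x" using real_arch_simple by blast
  show "EX M. \<forall>m\<ge>M. \<forall>n\<ge>M. dist (f (real m)) (f (real n)) < e"
  proof (intro exI allI impI)
  fix m n assume "N <= m" "N <= n"
  then have "x <= real m" "x <= real n" using N by auto
  then show "dist (f (real m)) (f (real n)) < e" using b[OF x(2), of "real m"] b[OF x(2), of "real n"] x(1)
  unfolding dist_real_def by linarith
  qed
 qed
 then obtain L where L: "(%n. f (real n)) \<longlonglongrightarrow> L" using Cauchy_convergent_iff convergent_def by blast
 have bl: "\<bar>L - f x\<bar> <= (k / - c) * x powr c" if x: "x >= z1" for x
 proof (rule tendsto_upperbound)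
  show "(%n. \<bar>f (real n) - f x\<bar>) \<longlonglongrightarrow> \<bar>L - f x\<bar>" by (intro tendsto_intros L)
  obtain N where N: "real N >= x" using real_arch_simple by blast
  show "\<forall>\<^sub>F n in sequentially. \<bar>f (real n) - f x\<bar> <= (k / - c) * x powr c"
  using eventually_ge_at_top[of N] by eventually_elim (use N b[OF x] in auto)
 qed simp
 have "((%x. f x - L) \<longlongrightarrow> 0) at_top"
 proof (rule Lim_null_comparison[OF _ t0])
  show "\<forall>\<^sub>F x in at_top. norm (f x - L) <= (k / - c) * x powr c"
  using eventually_ge_at_top[of z1] by eventually_elim (use bl in "auto simp: abs_minus_commute")
 qed
 then have "(f \<longlongrightarrow> L) at_top" by (rule LIM_zero_cancel)
 then show ?thesis by (rule that)
qed

lemma bigOz_powr: "bigOz a (%p. snd p powr a)"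
 by (rule bigOzI[of _ 1]) simp

lemma bigOz_dom:
 assumes "bigOz a g" "\<forall>\<^sub>F z in at_top. ALL th. \<bar>f (th, z)\<bar> <= g (th, z)"
 shows "bigOz a f"
proof -
 obtain C where C: "\<forall>\<^sub>F z in at_top. ALL th. \<bar>g (th, z)\<bar> <= C * z powr a" using assms(1) unfolding bigOz_def by blast
 show ?thesis
  by (rule bigOzI[of _ C], use C assms(2) in eventually_elim) (meson abs_ge_self order_trans)
qed

lemma bigOz_abs: "bigOz a f ==> bigOz a (%p. \<bar>f p\<bar>)"
 unfolding bigOz_def by simp

lemma bigOz_cmult: "bigOz a f ==> bigOz a (%p. c * f p)"
proof -
 assume "bigOz a f"
 then obtain C where C: "\<forall>\<^sub>F z in at_top. ALL th. \<bar>f (th, z)\<bar> <= C * z powr a" unfolding bigOz_def by blast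
 show ?thesis
  by (rule bigOzI[of _ "\<bar>c\<bar> * C"], use C in eventually_elim) (auto simp: abs_mult mult.assoc intro!: mult_left_mono)
qed

lemma bigOz_mult': "bigOz a f ==> bigOz b g ==> a + b <= c ==> bigOz c (%p. f p * g p)"
 using bigOz_mult bigOz_mono by blast

lemma bigOz_power: "bigOz a f ==> bigOz (real n * a) (%p. f p ^ n)"
proof (induction n)
 case 0
 show ?case by (rule bigOzI[of _ 1]) (use eventually_gt_at_top[of 0] in "auto elim: eventually_mono")
next
 case (Suc n)
 then show ?case using bigOz_mult[of a f "real n * a" "%p. f p ^ n"] by (simp add: algebra_simps)
qed

lemma bigOz_root:
 assumes "bigOz a (%p. \<bar>f p\<bar> ^ n)" "n > 0"
 shows "bigOz (a / n) f"
proof -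
 obtain C where C: "C > 0" "\<forall>\<^sub>F z in at_top. ALL th. \<bar>\<bar>f (th, z)\<bar> ^ n\<bar> <= C * z powr a" using assms(1) by (rule bigOzE)
 show ?thesis
 proof (rule bigOzI[of _ "C powr (1 / n)"], use C(2) eventually_gt_at_top[of 0] in eventually_elim, rule allI)
  fix z th assume h: "ALL th. \<bar>\<bar>f (th, z)\<bar> ^ n\<bar> <= C * z powr a" "0 < z"
  have "\<bar>f (th, z)\<bar> = (\<bar>f (th, z)\<bar> ^ n) powr (1 / n)"
  proof (cases "f (th, z) = 0")
  case False
  then show ?thesis using assms(2) by (simp add: powr_powr flip: powr_realpow)
  qed (use assms(2) in simp)
  also have "... <= (C * z powr a) powr (1 / n)" using h(1) by (intro powr_mono2) auto
  also have "... = C powr (1 / n) * z powr (a / n)" using C(1) h(2) by (simp add: powr_mult powr_powr)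
  finally show "\<bar>f (th, z)\<bar> <= C powr (1 / n) * z powr (a / n)" .
 qed
qed

text \<open>A quantity of size \<open>z\<close> together with its derivatives gains from an \<open>L^2\<close> bound by interpolation.\<close>

lemma bigOz_interpolation:
 fixes f :: "nat => real \<times> real => real"
 assumes d: "!!i th z. z > z0 ==> DERIV (%th. f i (th, z)) th :> f (Suc i) (th, z)"
  and p: "!!i th z. z > z0 ==> f i (th + 2 * pi, z) = f i (th, z)"
  and o: "!!z. z > z0 ==> circ (%th. f 0 (th, z)) = 0"
  and b8: "bigOz 1 (f 8)" and b0: "bigOz a (%p. circ (%th. (f 0 (th, snd p))^2))"
 shows "bigOz ((7 * a + 2) / 16) (f 0)" "bigOz ((3 * a + 2) / 8) (f 1)"
proof -
 define J where "J i z = circ (%th. (f i (th, z))^2)" for i z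
 have c: "continuous_on UNIV (%th. f i (th, z))" if "z > z0" for i z
  using d[OF that] by (auto intro!: continuous_at_imp_continuous_on DERIV_isCont)
 have J0: "J i z >= 0" if "z > z0" for i z unfolding J_def by (intro circ_nonneg continuous_intros c that) auto
 obtain C where C: "C > 0" "\<forall>\<^sub>F z in at_top. ALL th. \<bar>f 8 (th, z)\<bar> <= C * z powr 1" using b8 by (rule bigOzE)
 have B8: "bigOz 2 (%p. J 8 (snd p))"
 proof (rule bigOzI[of _ "2 * pi * C^2"], use C(2) eventually_gt_at_top[of "max 1 z0"] in eventually_elim, rule allI)
  fix z th assume h: "ALL th. \<bar>f 8 (th, z)\<bar> <= C * z powr 1" "max 1 z0 < z"
  have "\<bar>J 8 z\<bar> <= 2 * pi * (C * z)^2" unfolding J_def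
  proof (rule circ_bound)
  show "\<bar>(f 8 (th, z))^2\<bar> <= (C * z)^2" for th
  using power_mono[of "\<bar>f 8 (th, z)\<bar>" "C * z" 2] h by simp
  qed (intro continuous_intros c, use h in simp)
  then show "\<bar>J 8 (snd (th, z))\<bar> <= 2 * pi * C^2 * z powr 2" using h by (simp add: power_mult_distrib)
 qed
 have B0: "bigOz a (%p. J 0 (snd p))" using b0 unfolding J_def .
 have ip: "J 1 z ^ 8 <= J 0 z ^ 7 * J 8 z" "J 2 z ^ 4 <= J 0 z ^ 3 * J 8 z" if "z > z0" for z
  unfolding J_def by (rule circle_interpolation[where f = "%i th. f i (th, z)"]; use d[OF that] p[OF that] in blast)+
 have s0: "\<bar>f 0 (th, z)\<bar> ^ 2 <= 2 * pi * J 1 z" if z: "z > z0" for th z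
  using circle_sup_bound[where f = "%th. f 0 (th, z)", OF d[OF z] c[OF z] p[OF z] o[OF z]] unfolding J_def by simp
 have s1: "\<bar>f 1 (th, z)\<bar> ^ 2 <= 2 * pi * J 2 z" if z: "z > z0" for th z
 proof -
  have o1: "circ (%th. f (Suc 0) (th, z)) = 0" using circ_ftc(1)[OF d[OF z]] p[OF z, of 0 0] by simp
  show ?thesis
  using circle_sup_bound[where f = "%th. f (Suc 0) (th, z)", OF d[OF z] c[OF z] p[OF z] o1] unfolding J_def
  by (simp add: numeral_2_eq_2)
 qed
 have "bigOz (7 * a + 2) (%p. \<bar>f 0 p\<bar> ^ 16)"
 proof (rule bigOz_dom)
  show "bigOz (7 * a + 2) (%p. (2 * pi) ^ 8 * (J 0 (snd p) ^ 7 * J 8 (snd p)))"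
  using bigOz_cmult[OF bigOz_mult[OF bigOz_power[OF B0, of 7] B8]] by simp
  show "\<forall>\<^sub>F z in at_top. ALL th. \<bar>\<bar>f 0 (th, z)\<bar> ^ 16\<bar> <= (2 * pi) ^ 8 * (J 0 (snd (th, z)) ^ 7 * J 8 (snd (th, z)))"
  proof (use eventually_gt_at_top[of z0] in eventually_elim, rule allI)
  fix z th assume z: "z0 < z"
  have "\<bar>f 0 (th, z)\<bar> ^ 16 = (\<bar>f 0 (th, z)\<bar> ^ 2) ^ 8" by (simp flip: power_mult)
  also have "... <= (2 * pi * J 1 z) ^ 8" by (intro power_mono s0 z) auto
  also have "... <= (2 * pi) ^ 8 * (J 0 z ^ 7 * J 8 z)" unfolding power_mult_distrib[of "2 * pi"]
  by (intro mult_left_mono ip z) auto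
  finally show "\<bar>\<bar>f 0 (th, z)\<bar> ^ 16\<bar> <= (2 * pi) ^ 8 * (J 0 (snd (th, z)) ^ 7 * J 8 (snd (th, z)))" by simp
  qed
 qed
 then show "bigOz ((7 * a + 2) / 16) (f 0)" using bigOz_root[of _ "f 0" 16] by simp
 have "bigOz (3 * a + 2) (%p. \<bar>f 1 p\<bar> ^ 8)"
 proof (rule bigOz_dom)
  show "bigOz (3 * a + 2) (%p. (2 * pi) ^ 4 * (J 0 (snd p) ^ 3 * J 8 (snd p)))"
  using bigOz_cmult[OF bigOz_mult[OF bigOz_power[OF B0, of 3] B8]] by simp
  show "\<forall>\<^sub>F z in at_top. ALL th. \<bar>\<bar>f 1 (th, z)\<bar> ^ 8\<bar> <= (2 * pi) ^ 4 * (J 0 (snd (th, z)) ^ 3 * J 8 (snd (th, z)))"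
  proof (use eventually_gt_at_top[of z0] in eventually_elim, rule allI)
  fix z th assume z: "z0 < z"
  have "\<bar>f 1 (th, z)\<bar> ^ 8 = (\<bar>f 1 (th, z)\<bar> ^ 2) ^ 4" by (simp flip: power_mult)
  also have "... <= (2 * pi * J 2 z) ^ 4" by (intro power_mono s1 z) auto
  also have "... <= (2 * pi) ^ 4 * (J 0 z ^ 3 * J 8 z)" unfolding power_mult_distrib[of "2 * pi"]
  by (intro mult_left_mono ip z) auto
  finally show "\<bar>\<bar>f 1 (th, z)\<bar> ^ 8\<bar> <= (2 * pi) ^ 4 * (J 0 (snd (th, z)) ^ 3 * J 8 (snd (th, z)))" by simp
  qed
 qed
 then show "bigOz ((3 * a + 2) / 8) (f 1)" using bigOz_root[of _ "f 1" 8] by simp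
qed

context polar_end
begin

lemma iter_q:
 shows "Sym z0 1 ((D1 ^^ i) q)" "(D1 ^^ i) q (th + 2 * pi, z) = (D1 ^^ i) q (th, z)"
  "z > z0 ==> DERIV (%th. (D1 ^^ i) q (th, z)) th :> (D1 ^^ Suc i) q (th, z)"
proof -
 show s: "Sym z0 1 ((D1 ^^ i) q)" by (induction i) (auto intro: Sym_q Sym_D1)
 show "(D1 ^^ i) q (th + 2 * pi, z) = (D1 ^^ i) q (th, z)"
 proof (induction i arbitrary: th z)
  case (Suc i)
  then show ?case using periodic_D(1)[of "(D1 ^^ i) q"] by simp
 qed (simp add: per_q)
 show "z > z0 ==> DERIV (%th. (D1 ^^ i) q (th, z)) th :> (D1 ^^ Suc i) q (th, z)"
  using half_slice(1)[OF Sym_smooth[OF s]] by simp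
qed

lemma b_slice: "z > z0 ==> DERIV (%th. b (th, z)) th :> q (th, z)"
 using half_slice(1)[OF smooth_b] D_b(1) by simp

lemma circ_q: "z > z0 ==> circ (%th. q (th, z)) = 0"
 using circ_ftc(1)[OF b_slice] per_b[of 0 z] by simp

lemma bigOz_X: "bigOz (51 / 50) (%p. X (snd p))"
proof -
 obtain C z1 where C: "z1 >= 1" "z1 > z0" "!!z. z >= z1 ==> X z <= C * z powr (51 / 50)" using X_bound by metis
 show ?thesis
  by (rule bigOzI[of _ C], use eventually_ge_at_top[of z1] in eventually_elim) (use C X_nonneg in auto)
qed

lemma bigOz_q: "bigOz (23 / 40) q" and bigOz_D1_q: "bigOz (16 / 25) (D1 q)"
proof -
 have "bigOz (51 / 50) (%p. circ (%th. ((D1 ^^ 0) q (th, snd p))^2))" using bigOz_X unfolding X_def by simp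
 from bigOz_interpolation[where f = "%i. (D1 ^^ i) q", OF iter_q(3,2) _ Sym_bigOz[OF iter_q(1)] this]
 have "bigOz ((7 * (51 / 50) + 2) / 16) ((D1 ^^ 0) q)" "bigOz ((3 * (51 / 50) + 2) / 8) ((D1 ^^ 1) q)"
  using circ_q by auto
 \<comment> \<open>Interpolation with \<open>a = 51 / 50\<close> gives 0.57125 and 0.6325, rounded
   up to \<open>23 / 40\<close> and \<open>16 / 25\<close>.\<close>
 then show "bigOz (23 / 40) q" "bigOz (16 / 25) (D1 q)" by (auto elim: bigOz_mono)
qed

text \<open>The oscillation of \<open>b\<close> is bounded by the norm of \<open>q\<close>, its
  angular derivative, hence by the square root of \<open>X\<close>; the mean differs from
  \<open>z\<close> by an integral of \<open>E\<close>, for which any small power is a generous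
  bound.\<close>

lemma bigOz_b: "bigOz (51 / 100) (%p. b p - snd p)"
proof -
 define mu where "mu = (%z. circ (%th. b (th, z)) / (2 * pi))"
 have "bigOz (51 / 100) (%p. b p - mu (snd p))"
 proof -
  have "bigOz (51 / 50) (%p. \<bar>b p - mu (snd p)\<bar> ^ 2)"
  proof (rule bigOz_dom[OF bigOz_cmult[OF bigOz_X, of "2 * pi"]], use eventually_gt_at_top[of z0] in eventually_elim, rule allI)
  fix z th assume z: "z0 < z"
  have o: "circ (%th. b (th, z) - mu z) = 0"
  unfolding circ_diff[OF slice_continuous(7)[OF z] continuous_on_const] mu_def by simp
  have "(b (th, z) - mu z)^2 <= 2 * pi * circ (%th. (q (th, z))^2)"
  by (rule circle_sup_bound[where f = "%th. b (th, z) - mu z", OF _ slice_continuous(1)[OF z] _ o])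
  (auto simp: per_b intro!: derivative_eq_intros b_slice z)
  then show "\<bar>\<bar>b (th, z) - mu (snd (th, z))\<bar> ^ 2\<bar> <= 2 * pi * X (snd (th, z))" by (simp add: X_def)
  qed
  then show ?thesis using bigOz_root[of "51 / 50" "%p. b p - mu (snd p)" 2] by simp
 qed
 moreover have "bigOz (51 / 100) (%p. mu (snd p) - snd p)"
 proof -
  obtain C where C: "C > 0" "\<forall>\<^sub>F z in at_top. ALL th. \<bar>E (th, z)\<bar> <= C / z & \<bar>D1 E (th, z)\<bar> <= C / z" by (rule E_small)
  have "\<forall>\<^sub>F z in at_top. z > max 1 z0 & (ALL th. \<bar>E (th, z)\<bar> <= C / z & \<bar>D1 E (th, z)\<bar> <= C / z)"
  by (intro eventually_conj C(2) eventually_gt_at_top)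
  then obtain z1 where z1: "!!z. z >= z1 ==> z > max 1 z0 & (ALL th. \<bar>E (th, z)\<bar> <= C / z & \<bar>D1 E (th, z)\<bar> <= C / z)"
  unfolding eventually_at_top_linorder by blast
  have z10: "z1 > 0" using z1[of z1] by simp
  have d: "DERIV (%z. mu z - z) z :> circ (%th. E (th, z)) / (2 * pi)" if "z >= z1" for z
  proof -
  have "DERIV (%z. circ (%th. b (th, z)) / (2 * pi) - z) z :> (2 * pi + circ (%th. E (th, z))) / (2 * pi) - 1"
  by (intro DERIV_diff DERIV_cdivide DERIV_mean DERIV_ident) (use z1[OF that] in auto)
  then show ?thesis unfolding mu_def by (simp add: add_divide_distrib)
  qed
  have le: "\<bar>circ (%th. E (th, z)) / (2 * pi)\<bar> <= C * z powr (1 / 2 - 1)" if "z >= z1" for z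
  proof -
  have z: "z > 1" "z > z0" using z1[OF that] by auto
  have "\<bar>circ (%th. E (th, z))\<bar> <= 2 * pi * (C / z)"
  by (rule circ_bound[OF slice_continuous(4)[OF z(2)]]) (use z1[OF that] in auto)
  then have "\<bar>circ (%th. E (th, z)) / (2 * pi)\<bar> <= C * z powr (- 1)"
  using z by (simp add: powr_minus field_simps)
  also have "... <= C * z powr (1 / 2 - 1)" using C(1) z by (intro mult_left_mono powr_mono) auto
  finally show ?thesis .
  qed
  have "bigOz (1 / 2) (%p. mu (snd p) - snd p)"
  proof (rule bigOzI[of _ "\<bar>mu z1 - z1\<bar> + 2 * C"], use eventually_ge_at_top[of z1] in eventually_elim, rule allI)
  fix z th assume z: "z1 <= z"
  have "\<bar>(mu z - z) - (mu z1 - z1)\<bar> <= (C / (1 / 2)) * (z powr (1 / 2) - z1 powr (1 / 2))"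
  by (rule powr_integrate[OF z10 d le _ order.refl z]) auto
  also have "... <= 2 * C * z powr (1 / 2)" using C(1) by (simp add: right_diff_distrib)
  finally have "\<bar>mu z - z\<bar> <= \<bar>mu z1 - z1\<bar> * 1 + 2 * C * z powr (1 / 2)"
  using abs_triangle_ineq[of "mu z - z - (mu z1 - z1)" "mu z1 - z1"] by simp
  also have "... <= \<bar>mu z1 - z1\<bar> * z powr (1 / 2) + 2 * C * z powr (1 / 2)"
  using z1[OF z] by (intro add_right_mono mult_left_mono ge_one_powr_ge_zero) auto
  finally show "\<bar>mu (snd (th, z)) - snd (th, z)\<bar> <= (\<bar>mu z1 - z1\<bar> + 2 * C) * z powr (1 / 2)" by (simp add: distrib_right)
  qed
  then show ?thesis by (rule bigOz_mono) simp
 qed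
 ultimately have "bigOz (51 / 100) (%p. (b p - mu (snd p)) + (mu (snd p) - snd p))" by (rule bigOz_add)
 then show ?thesis by simp
qed

text \<open>The critical exponents in \<open>slope_estimates\<close> are those of \<open>F\<close>:
  \<open>16 / 25 + 51 / 100 - 2\<close> and \<open>2 * 23 / 40 - 2\<close>, both equal to
  \<open>- 17 / 20\<close>.\<close>

lemma slopes_bigOz:
 "bigOz (- (17 / 20)) (%p. arctan (m p) - q p / (2 * snd p))"
 "bigOz (- (17 / 20)) (%p. F p - D1 q p / (2 * snd p))"
proof -
 obtain C where C: "C > 0" "\<forall>\<^sub>F z in at_top. ALL th. \<bar>b (th, z) - snd (th, z)\<bar> <= C * z powr (51 / 100)"
  using bigOz_b by (rule bigOzE)
 note aq = bigOz_abs[OF bigOz_q] and ar = bigOz_abs[OF bigOz_D1_q] and bp = bigOz_powr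
 have q2: "bigOz (23 / 20) (%p. q p * q p)" using bigOz_mult[OF bigOz_q bigOz_q] by simp
 define B where "B = (%p :: real \<times> real. C * snd p powr (51 / 100))"
 have B: "bigOz (51 / 100) B" unfolding B_def by (intro bigOz_cmult bp)
 have ev: "\<forall>\<^sub>F z in at_top. ALL th. z > z0 & z > 0 & z / 2 <= b (th, z) & \<bar>b (th, z) - z\<bar> <= B (th, z) & \<bar>q (th, z)\<bar> <= z"
 proof -
  have h: "(1 / 2 :: real) > 0" "(1 / 2 :: real) <= 1" by auto
  show ?thesis using C(2) b_small[OF h] eventually_gt_at_top[of "max 0 z0"]
  proof eventually_elim
  case (elim z)
  show ?case
  proof
  fix th
  have "\<bar>b (th, z) - z\<bar> <= 1 / 2 * z" "\<bar>q (th, z)\<bar> <= 1 / 2 * z" "\<bar>b (th, z) - z\<bar> <= C * z powr (51 / 100)"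
  using elim(1,2) by auto
  moreover from this have "z / 2 <= b (th, z)" by linarith
  ultimately show "z > z0 & z > 0 & z / 2 <= b (th, z) & \<bar>b (th, z) - z\<bar> <= B (th, z) & \<bar>q (th, z)\<bar> <= z"
  using elim(3) unfolding B_def by auto
  qed
  qed
 qed
 have pw: "x / z^2 = x * z powr (- 2)" "x / z ^ 3 = x * z powr (- 3)" if "z > 0" for x z :: real
  using that by (simp_all add: powr_minus field_simps)
 show "bigOz (- (17 / 20)) (%p. arctan (m p) - q p / (2 * snd p))"
 proof (rule bigOz_dom)
  show "bigOz (- (17 / 20)) (%p. \<bar>q p\<bar> * B p * snd p powr (- 2) + \<bar>q p\<bar> * (q p * q p) * snd p powr (- 3))"
  by (intro bigOz_add bigOz_mult'[OF bigOz_mult[OF aq B] bp] bigOz_mult'[OF bigOz_mult[OF aq q2] bp]) auto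
  show "\<forall>\<^sub>F z in at_top. ALL th. \<bar>arctan (m (th, z)) - q (th, z) / (2 * snd (th, z))\<bar> <=
  \<bar>q (th, z)\<bar> * B (th, z) * snd (th, z) powr (- 2) + \<bar>q (th, z)\<bar> * (q (th, z) * q (th, z)) * snd (th, z) powr (- 3)"
  proof (use ev in eventually_elim, rule allI)
  fix z th assume "ALL th. z > z0 & z > 0 & z / 2 <= b (th, z) & \<bar>b (th, z) - z\<bar> <= B (th, z) & \<bar>q (th, z)\<bar> <= z"
  then have h: "z > z0" "z > 0" "z / 2 <= b (th, z)" "\<bar>b (th, z) - z\<bar> <= B (th, z)" "\<bar>q (th, z)\<bar> <= z" by auto
  have "\<bar>q (th, z)\<bar> ^ 3 = \<bar>q (th, z)\<bar> * (q (th, z) * q (th, z))" by (simp add: power3_eq_cube mult.assoc)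
  then show "\<bar>arctan (m (th, z)) - q (th, z) / (2 * snd (th, z))\<bar> <=
  \<bar>q (th, z)\<bar> * B (th, z) * snd (th, z) powr (- 2) + \<bar>q (th, z)\<bar> * (q (th, z) * q (th, z)) * snd (th, z) powr (- 3)"
  using slope_estimates(1)[OF h] unfolding pw[OF h(2)] by simp
  qed
 qed
 show "bigOz (- (17 / 20)) (%p. F p - D1 q p / (2 * snd p))"
 proof (rule bigOz_dom)
  show "bigOz (- (17 / 20)) (%p. \<bar>D1 q p\<bar> * B p * snd p powr (- 2) + 4 * (q p * q p) * snd p powr (- 2) +
  (q p * q p) * \<bar>D1 q p\<bar> * snd p powr (- 3))"
  by (intro bigOz_add bigOz_mult'[OF bigOz_mult[OF ar B] bp] bigOz_mult'[OF bigOz_cmult[OF q2] bp] bigOz_mult'[OF bigOz_mult[OF q2 ar] bp]) auto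
  show "\<forall>\<^sub>F z in at_top. ALL th. \<bar>F (th, z) - D1 q (th, z) / (2 * snd (th, z))\<bar> <=
  \<bar>D1 q (th, z)\<bar> * B (th, z) * snd (th, z) powr (- 2) + 4 * (q (th, z) * q (th, z)) * snd (th, z) powr (- 2) +
  (q (th, z) * q (th, z)) * \<bar>D1 q (th, z)\<bar> * snd (th, z) powr (- 3)"
  proof (use ev in eventually_elim, rule allI)
  fix z th assume "ALL th. z > z0 & z > 0 & z / 2 <= b (th, z) & \<bar>b (th, z) - z\<bar> <= B (th, z) & \<bar>q (th, z)\<bar> <= z"
  then have h: "z > z0" "z > 0" "z / 2 <= b (th, z)" "\<bar>b (th, z) - z\<bar> <= B (th, z)" "\<bar>q (th, z)\<bar> <= z" by auto
  show "\<bar>F (th, z) - D1 q (th, z) / (2 * snd (th, z))\<bar> <=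
  \<bar>D1 q (th, z)\<bar> * B (th, z) * snd (th, z) powr (- 2) + 4 * (q (th, z) * q (th, z)) * snd (th, z) powr (- 2) +
  (q (th, z) * q (th, z)) * \<bar>D1 q (th, z)\<bar> * snd (th, z) powr (- 3)"
  using slope_estimates(2)[OF h] unfolding pw[OF h(2)] by (simp add: power2_eq_square)
  qed
 qed
qed

lemma phase_two_start:
 obtains z1 C where "z1 >= 1" "z1 > z0" "C > 0"
  "!!z th. z >= z1 ==> \<bar>arctan (m (th, z)) - q (th, z) / (2 * z)\<bar> <= C * z powr (- (17 / 20))"
  "!!z th. z >= z1 ==> \<bar>2 * D1 q (th, z) * (F (th, z) - D1 q (th, z) / (2 * z)) + 2 * q (th, z) * D1 E (th, z)\<bar> <= C * z powr (- (1 / 5))"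
  "!!z th. z >= z1 ==> \<bar>E (th, z)\<bar> <= C * z powr (- (17 / 20))"
proof -
 \<comment> \<open>\<open>16 / 25 - 17 / 20\<close> and \<open>23 / 40 - 1\<close> are both below
   \<open>- 1 / 5\<close>.\<close>
 have b2: "bigOz (- (1 / 5)) (%p. 2 * D1 q p * (F p - D1 q p / (2 * snd p)) + 2 * q p * D1 E p)"
  by (intro bigOz_add bigOz_mult'[OF bigOz_cmult[OF bigOz_D1_q] slopes_bigOz(2)]
  bigOz_mult'[OF bigOz_cmult[OF bigOz_q] Sym_bigOz[OF Sym_D1[OF Sym_E]]]) auto
 have b3: "bigOz (- (17 / 20)) E" by (rule bigOz_mono[OF Sym_bigOz[OF Sym_E]]) simp
 obtain C1 where 1: "C1 > 0" "\<forall>\<^sub>F z in at_top. ALL th. \<bar>arctan (m (th, z)) - q (th, z) / (2 * snd (th, z))\<bar> <= C1 * z powr (- (17 / 20))"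
  using slopes_bigOz(1) by (rule bigOzE)
 obtain C2 where 2: "C2 > 0" "\<forall>\<^sub>F z in at_top. ALL th. \<bar>2 * D1 q (th, z) * (F (th, z) - D1 q (th, z) / (2 * snd (th, z))) + 2 * q (th, z) * D1 E (th, z)\<bar> <= C2 * z powr (- (1 / 5))"
  using b2 by (rule bigOzE)
 obtain C3 where 3: "C3 > 0" "\<forall>\<^sub>F z in at_top. ALL th. \<bar>E (th, z)\<bar> <= C3 * z powr (- (17 / 20))"
  using b3 by (rule bigOzE)
 have "\<forall>\<^sub>F z in at_top. z > max 1 z0 & (ALL th. \<bar>arctan (m (th, z)) - q (th, z) / (2 * z)\<bar> <= C1 * z powr (- (17 / 20))) &
  (ALL th. \<bar>2 * D1 q (th, z) * (F (th, z) - D1 q (th, z) / (2 * z)) + 2 * q (th, z) * D1 E (th, z)\<bar> <= C2 * z powr (- (1 / 5))) &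
  (ALL th. \<bar>E (th, z)\<bar> <= C3 * z powr (- (17 / 20)))"
  using 1(2) 2(2) 3(2) eventually_gt_at_top[of "max 1 z0"] by eventually_elim simp
 then obtain z1 where z1: "!!z. z >= z1 ==> z > max 1 z0 & (ALL th. \<bar>arctan (m (th, z)) - q (th, z) / (2 * z)\<bar> <= C1 * z powr (- (17 / 20))) &
  (ALL th. \<bar>2 * D1 q (th, z) * (F (th, z) - D1 q (th, z) / (2 * z)) + 2 * q (th, z) * D1 E (th, z)\<bar> <= C2 * z powr (- (1 / 5))) &
  (ALL th. \<bar>E (th, z)\<bar> <= C3 * z powr (- (17 / 20)))"
  unfolding eventually_at_top_linorder by blast
 define C where "C = max C1 (max C2 C3)"
 have up: "x <= C * z powr a" if "x <= D * z powr a" "D <= C" for x D z a :: real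
  using that by (meson mult_right_mono order_trans powr_ge_zero)
 show ?thesis
 proof (rule that[of z1 C])
  show "z1 >= 1" "z1 > z0" "C > 0" using z1[of z1] 1(1) unfolding C_def by auto
  fix z th assume z: "z >= z1"
  show "\<bar>arctan (m (th, z)) - q (th, z) / (2 * z)\<bar> <= C * z powr (- (17 / 20))"
  by (rule up[of _ C1]) (use z1[OF z] in "auto simp: C_def")
  show "\<bar>2 * D1 q (th, z) * (F (th, z) - D1 q (th, z) / (2 * z)) + 2 * q (th, z) * D1 E (th, z)\<bar> <= C * z powr (- (1 / 5))"
  by (rule up[of _ C2]) (use z1[OF z] in "auto simp: C_def")
  show "\<bar>E (th, z)\<bar> <= C * z powr (- (17 / 20))"
  by (rule up[of _ C3]) (use z1[OF z] in "auto simp: C_def")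
 qed
qed

end

context polar_end
begin

text \<open>With power errors the coefficients divided by \<open>sqrt z\<close> have an integrable
  derivative and converge. The part of \<open>q\<close> beyond the first harmonic must grow at rate
  \<open>12 / 5\<close> unless it is of the size of the error, and the first pass forbids that
  growth.\<close>

lemma phase_two:
 obtains al1 al2 where "((%z. A1 z / sqrt z) \<longlongrightarrow> al1) at_top" "((%z. A2 z / sqrt z) \<longlongrightarrow> al2) at_top"
  "bigOz (4 / 5) (%p. X (snd p) - X1 (snd p))"
proof -
 obtain z1 C where z1: "z1 >= 1" "z1 > z0" "C > 0"
  and T: "!!z th. z >= z1 ==> \<bar>arctan (m (th, z)) - q (th, z) / (2 * z)\<bar> <= C * z powr (- (17 / 20))"
  and R: "!!z th. z >= z1 ==> \<bar>2 * D1 q (th, z) * (F (th, z) - D1 q (th, z) / (2 * z)) + 2 * q (th, z) * D1 E (th, z)\<bar> <= C * z powr (- (1 / 5))"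
  and e: "!!z th. z >= z1 ==> \<bar>E (th, z)\<bar> <= C * z powr (- (17 / 20))"
  by (rule phase_two_start) blast
 have p: "z > 0" "z > z0" "z >= 1" if "z >= z1" for z using that z1 by auto
 have z10: "z1 > 0" using z1 by simp
 define K where "K = 4 * pi * C"
 have K0: "K >= 0" unfolding K_def using z1 by simp
 have ag: "\<bar>dA1 z - A1 z / (2 * z)\<bar> <= K * z powr (- (17 / 20))" "\<bar>dA2 z - A2 z / (2 * z)\<bar> <= K * z powr (- (17 / 20))"
  if z: "z >= z1" for z
 proof -
  have "circ (%th. C * z powr (- (17 / 20))) + 2 * pi * (C * z powr (- (17 / 20))) = K * z powr (- (17 / 20))"
  unfolding K_def by simp
  note A_growth[OF p(2,1)[OF z] continuous_on_const T[OF z] e[OF z], unfolded this]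
  then show "\<bar>dA1 z - A1 z / (2 * z)\<bar> <= K * z powr (- (17 / 20))" "\<bar>dA2 z - A2 z / (2 * z)\<bar> <= K * z powr (- (17 / 20))"
  by blast+
 qed
 \<comment> \<open>The factor \<open>z powr (- (1 / 2))\<close> removes the main part
   \<open>a / (2 * z)\<close>, leaving a derivative of order
   \<open>- 17 / 20 - 1 / 2 = - 7 / 20 - 1\<close>.\<close>
 have lim: "EX al. ((%z. a z / sqrt z) \<longlongrightarrow> al) at_top"
  if d: "!!z. z >= z1 ==> DERIV a z :> a' z" and g: "!!z. z >= z1 ==> \<bar>a' z - a z / (2 * z)\<bar> <= K * z powr (- (17 / 20))" for a a'
 proof -
  have dd: "DERIV (%z. a z * z powr (- (1 / 2))) z :> (a' z - a z / (2 * z)) * z powr (- (1 / 2))" if z: "z >= z1" for z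
  proof -
  have "DERIV (%z. a z * z powr (- (1 / 2))) z :> a' z * z powr (- (1 / 2)) + (- (1 / 2) * z powr (- (1 / 2) - 1)) * a z"
  by (intro DERIV_mult d z has_real_derivative_powr p)
  moreover have "z powr (- (1 / 2) - 1) = z powr (- (1 / 2)) / z" using powr_diff[of z "- (1 / 2)" 1] p[OF z] by simp
  ultimately show ?thesis by (simp add: algebra_simps)
  qed
  have gg: "\<bar>(a' z - a z / (2 * z)) * z powr (- (1 / 2))\<bar> <= K * z powr (- (7 / 20) - 1)" if z: "z >= z1" for z
  proof -
  have "\<bar>(a' z - a z / (2 * z)) * z powr (- (1 / 2))\<bar> <= (K * z powr (- (17 / 20))) * z powr (- (1 / 2))"
  unfolding abs_mult using K0 by (intro mult_mono g z) auto
  then show ?thesis by (simp add: mult.assoc flip: powr_add)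
  qed
  obtain L where L: "((%z. a z * z powr (- (1 / 2))) \<longlongrightarrow> L) at_top"
  by (rule powr_derivative_convergent[OF z10 dd gg _ K0]) (assumption | simp)+
  have ev: "\<forall>\<^sub>F z in at_top. a z * z powr (- (1 / 2)) = a z / sqrt z"
  using eventually_gt_at_top[of 0]
  proof eventually_elim
  case (elim z)
  have "z powr (- (1 / 2)) = inverse (sqrt z)" using elim by (simp only: powr_minus powr_half_sqrt)
  then show ?case by (simp only: divide_inverse)
  qed
  show ?thesis by (rule exI, rule iffD1[OF tendsto_cong[OF ev] L])
 qed
 have dA: "DERIV A1 z :> dA1 z" "DERIV A2 z :> dA2 z" if "z >= z1" for z
  using DERIV_A[OF p(2)[OF that]] unfolding dA1_def dA2_def by auto
 obtain al1 al2 where al: "((%z. A1 z / sqrt z) \<longlongrightarrow> al1) at_top" "((%z. A2 z / sqrt z) \<longlongrightarrow> al2) at_top"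
  using lim[OF dA(1) ag(1)] lim[OF dA(2) ag(2)] by blast
 have "\<forall>\<^sub>F z in at_top. \<bar>A1 z / sqrt z\<bar> < \<bar>al1\<bar> + 1 & \<bar>A2 z / sqrt z\<bar> < \<bar>al2\<bar> + 1 & z >= z1"
  by (intro eventually_conj order_tendstoD(2)[OF tendsto_rabs[OF al(1)]] order_tendstoD(2)[OF tendsto_rabs[OF al(2)]] eventually_ge_at_top) auto
 then obtain z2 where z2: "!!z. z >= z2 ==> \<bar>A1 z / sqrt z\<bar> < \<bar>al1\<bar> + 1 & \<bar>A2 z / sqrt z\<bar> < \<bar>al2\<bar> + 1 & z >= z1"
  unfolding eventually_at_top_linorder by blast
 define B where "B = \<bar>al1\<bar> + \<bar>al2\<bar> + 1"
 have B0: "B > 0" unfolding B_def by simp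
 have Ab: "\<bar>A1 z\<bar> <= B * sqrt z" "\<bar>A2 z\<bar> <= B * sqrt z" if z: "z >= z2" for z
 proof -
  have zp: "z > 0" using z2[OF z] p by blast
  then have "\<bar>A1 z\<bar> < (\<bar>al1\<bar> + 1) * sqrt z" "\<bar>A2 z\<bar> < (\<bar>al2\<bar> + 1) * sqrt z"
  using z2[OF z] by (auto simp: abs_divide field_simps)
  moreover have "(\<bar>al1\<bar> + 1) * sqrt z <= B * sqrt z" "(\<bar>al2\<bar> + 1) * sqrt z <= B * sqrt z"
  unfolding B_def using zp by (intro mult_right_mono; simp)+
  ultimately show "\<bar>A1 z\<bar> <= B * sqrt z" "\<bar>A2 z\<bar> <= B * sqrt z" by linarith+
 qed
 define L where "L = 2 * pi * C + 4 * B * K"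
 have L0: "L >= 0" unfolding L_def using z1 B0 K0 by simp
 \<comment> \<open>Subtracting the growth of \<open>X1\<close>, whose rate is 1, turns
   \<open>12 / 5 * X - 7 / 5 * X1\<close> into a multiple of \<open>X - X1\<close>. The error is
   \<open>z\<close> times \<open>z powr (- (1 / 5))\<close>.\<close>
 have Vg: "(12 / 5) * (X z - X1 z) - L * z powr (4 / 5) <= z * (dX z - dX1 z)" if z: "z >= z2" for z
 proof -
  have zz: "z >= z1" using z2[OF z] by simp
  note pz = p[OF zz]
  have "Pz z / z - circ (%th. C * z powr (- (1 / 5))) <= dX z"
  by (rule X_growth[OF pz(2,1) continuous_on_const]) (use R[OF zz] in "auto simp: abs_le_iff")
  then have "z * (Pz z / z - 2 * pi * (C * z powr (- (1 / 5)))) <= z * dX z" using pz by (simp add: mult_ac)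
  moreover have "z * z powr (- (1 / 5)) = z powr (4 / 5)" using powr_add[of z 1 "- (1 / 5)"] pz by simp
  then have "z * (Pz z / z - 2 * pi * (C * z powr (- (1 / 5)))) = Pz z - 2 * pi * C * z powr (4 / 5)"
  using pz by (simp add: right_diff_distrib mult.left_commute mult.assoc)
  ultimately have 1: "Pz z - 2 * pi * C * z powr (4 / 5) <= z * dX z" by simp
  have t: "\<bar>A * (z * R)\<bar> <= B * K * z powr (4 / 5)" if A: "\<bar>A\<bar> <= B * sqrt z" and R: "\<bar>R\<bar> <= K * z powr (- (17 / 20))" for A R
  proof -
  have "\<bar>A * (z * R)\<bar> <= (B * sqrt z) * (z * (K * z powr (- (17 / 20))))"
  unfolding abs_mult using A R pz B0 by (intro mult_mono) auto
  also have "... = B * K * (z powr (1 / 2) * (z powr 1 * z powr (- (17 / 20))))" using pz by (simp add: powr_half_sqrt)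
  also have "z powr (1 / 2) * (z powr 1 * z powr (- (17 / 20))) = z powr (13 / 20)" unfolding powr_add[symmetric] by simp
  also have "B * K * z powr (13 / 20) <= B * K * z powr (4 / 5)" using pz B0 K0 by (intro mult_left_mono powr_mono) auto
  finally show ?thesis .
  qed
  define R1 where "R1 = dA1 z - A1 z / (2 * z)"
  define R2 where "R2 = dA2 z - A2 z / (2 * z)"
  have "z * dX1 z - X1 z = (2 * (A1 z * (z * R1)) + 2 * (A2 z * (z * R2))) / pi"
  unfolding dX1_def X1_def R1_def R2_def using pz by (simp add: field_simps power2_eq_square)
  also have "... <= 4 * (B * K * z powr (4 / 5)) / pi"
  using t[OF Ab(1)[OF z] ag(1)[OF zz]] t[OF Ab(2)[OF z] ag(2)[OF zz]] unfolding R1_def R2_def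
  by (intro divide_right_mono) (auto simp: abs_le_iff)
  also have "... <= 4 * (B * K * z powr (4 / 5)) / 1"
  using B0 K0 pi_ge_two by (intro divide_left_mono) auto
  finally have 2: "z * dX1 z - X1 z <= 4 * B * K * z powr (4 / 5)" by simp
  have gen: "12 / 5 * (x - y) - w <= d" if "w = u + v" "d = d1 - d2" "P - u <= d1" "d2 - y <= v" "12 / 5 * x - 7 / 5 * y <= P"
  for x y w d u v d1 d2 P :: real using that by (simp add: field_simps)
  have Le: "L * z powr (4 / 5) = 2 * pi * C * z powr (4 / 5) + 4 * B * K * z powr (4 / 5)"
  unfolding L_def by (rule distrib_right)
  show ?thesis by (rule gen[OF Le right_diff_distrib 1 2 gap(3)[OF pz(2)]])
 qed
 obtain CX zX where CX: "zX >= 1" "zX > z0" "!!z. z >= zX ==> X z <= CX * z powr (51 / 50)" using X_bound by metis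
 define z3 where "z3 = max z2 zX"
 have z3: "z3 > 0" using CX(1) unfolding z3_def by simp
 have V: "X z - X1 z - L * z powr (4 / 5) <= 0" if z: "z >= z3" for z
 proof (rule subcritical_growth[OF z3 _ _ _ _ z, where a = "12 / 5" and c = "51 / 50" and C = CX])
  fix z assume z: "z >= z3"
  have z': "z >= z2" "z >= zX" "z >= z1" using z z2[of z] unfolding z3_def by auto
  note pz = p[OF z'(3)]
  have "DERIV X z :> dX z" unfolding dX_def by (rule DERIV_X[OF pz(2)])
  then show "DERIV (%z. X z - X1 z - L * z powr (4 / 5)) z :> dX z - dX1 z - L * (4 / 5 * z powr (4 / 5 - 1))"
  by (intro DERIV_diff DERIV_X1 DERIV_cmult has_real_derivative_powr pz)
  have "z * z powr (4 / 5 - 1) = z powr (4 / 5)" using powr_add[of z 1 "4 / 5 - 1"] pz by simp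
  then have "z * (dX z - dX1 z - L * (4 / 5 * z powr (4 / 5 - 1))) = z * (dX z - dX1 z) - 4 / 5 * (L * z powr (4 / 5))"
  by (simp add: right_diff_distrib mult.left_commute)
  moreover have "0 <= L * z powr (4 / 5)" using L0 by simp
  moreover have gen: "12 / 5 * (v - w) <= d" if "d = d1 - 4 / 5 * w" "0 <= w" "12 / 5 * v - w <= d1" for v w d d1 :: real
  using that by simp
  ultimately show "12 / 5 * (X z - X1 z - L * z powr (4 / 5)) <= z * (dX z - dX1 z - L * (4 / 5 * z powr (4 / 5 - 1)))"
  by (intro gen[OF _ _ Vg[OF z'(1)]])
  show "X z - X1 z - L * z powr (4 / 5) <= CX * z powr (51 / 50)"
  using CX(3)[OF z'(2)] X1_nonneg[of z] \<open>0 <= L * z powr (4 / 5)\<close> by simp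
 qed simp
 have "bigOz (4 / 5) (%p. X (snd p) - X1 (snd p))"
 proof (rule bigOzI[of _ L], use eventually_ge_at_top[of z3] in eventually_elim, rule allI)
  fix z th assume z: "z3 <= z"
  have "z > z0" using z CX(2) unfolding z3_def by simp
  then show "\<bar>X (snd (th, z)) - X1 (snd (th, z))\<bar> <= L * z powr (4 / 5)" using V[OF z] gap(2)[of z] by simp
 qed
 then show ?thesis by (rule that[OF al])
qed

text \<open>The angular derivative of the radius is \<open>q / rh\<close>. The first harmonic of
  \<open>q\<close> over \<open>rh\<close> converges, and what is left decays; the limit is the
  angular derivative of \<open>a1 * cos th + a2 * sin th\<close>, the effect of centring the
  cross-sections at \<open>(a1, a2)\<close>.\<close>

lemma linear_asymptotics:
 obtains a1 a2 where
  "!!eps. eps > 0 ==> \<forall>\<^sub>F z in at_top. ALL th. \<bar>D1 rh (th, z) - (a2 * cos th - a1 * sin th)\<bar> <= eps"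
proof -
 obtain al1 al2 where al: "((%z. A1 z / sqrt z) \<longlongrightarrow> al1) at_top" "((%z. A2 z / sqrt z) \<longlongrightarrow> al2) at_top"
  and V: "bigOz (4 / 5) (%p. X (snd p) - X1 (snd p))" by (rule phase_two)
 \<comment> \<open>The derivatives of \<open>cos\<close> and \<open>sin\<close> as quarter-turn
   shifts, so that \<open>g i\<close> below is the \<open>i\<close>-th angular derivative of the
   remainder.\<close>
 define cs where "cs = (%i th. cos (th + real i * (pi / 2)))"
 define sn where "sn = (%i th. sin (th + real i * (pi / 2)))"
 have trig: "DERIV (cs i) th :> cs (Suc i) th" "DERIV (sn i) th :> sn (Suc i) th" "cs i (th + 2 * pi) = cs i th" "sn i (th + 2 * pi) = sn i th"
  for i th
 proof -
  have h: "th + (1 + real i) * (pi / 2) = (th + real i * (pi / 2)) + pi / 2" "th + 2 * pi + real i * (pi / 2) = th + real i * (pi / 2) + 2 * pi"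
  by (simp_all add: algebra_simps)
  show "DERIV (cs i) th :> cs (Suc i) th" "DERIV (sn i) th :> sn (Suc i) th" "cs i (th + 2 * pi) = cs i th" "sn i (th + 2 * pi) = sn i th"
  unfolding cs_def sn_def of_nat_Suc h by (auto intro!: derivative_eq_intros simp: sin_add cos_add)
 qed
 have tr1: "\<bar>cs i th\<bar> <= 1" "\<bar>sn i th\<bar> <= 1" for i th unfolding cs_def sn_def by simp_all
 define g where "g = (%i p. (D1 ^^ i) q p - (A1 (snd p) / pi * cs i (fst p) + A2 (snd p) / pi * sn i (fst p)))"
 have gd: "DERIV (%th. g i (th, z)) th :> g (Suc i) (th, z)" if "z > z0" for i th z
  unfolding g_def fst_conv snd_conv by (intro DERIV_diff DERIV_add iter_q(3)[OF that] DERIV_cmult trig)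
 have gp: "g i (th + 2 * pi, z) = g i (th, z)" for i th z
  unfolding g_def fst_conv snd_conv by (simp only: iter_q(2) trig)
 have cst: "cs 0 = cos" "sn 0 = sin" unfolding cs_def sn_def by auto
 have g0: "g 0 (th, z) = q (th, z) - (A1 z * cos th + A2 z * sin th) / pi" for th z
  unfolding g_def fst_conv snd_conv cst by (simp add: add_divide_distrib)
 have go: "circ (%th. g 0 (th, z)) = 0" if z: "z > z0" for z
 proof -
  have "circ (%th. g 0 (th, z)) = circ (%th. q (th, z)) - circ (%th. A1 z / pi * cos th + A2 z / pi * sin th)"
  unfolding g_def fst_conv snd_conv cst funpow_0
  by (rule circ_diff) (intro continuous_intros slice_continuous[OF z])+
  also have "circ (%th. A1 z / pi * cos th + A2 z / pi * sin th) = circ (%th. A1 z / pi * cos th) + circ (%th. A2 z / pi * sin th)"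
  by (rule circ_add) (intro continuous_intros)+
  also have "... = A1 z / pi * circ cos + A2 z / pi * circ sin" by (simp only: integral_mult_right)
  finally show ?thesis using circ_q[OF z] circ_trig by simp
 qed
 have Ab: "bigOz (1 / 2) (%p. a (snd p) / pi)" if "((%z. a z / sqrt z) \<longlongrightarrow> al) at_top" for a al
 proof -
  have ev: "\<forall>\<^sub>F z in at_top. \<bar>a z / sqrt z\<bar> < \<bar>al\<bar> + 1"
  by (rule order_tendstoD(2)[OF tendsto_rabs[OF that]]) simp
  show ?thesis
 proof (rule bigOzI[of _ "\<bar>al\<bar> + 1"], use ev eventually_gt_at_top[of 0] in eventually_elim, rule allI)
  fix z th :: real assume h: "\<bar>a z / sqrt z\<bar> < \<bar>al\<bar> + 1" "0 < z"
  then have "\<bar>a z\<bar> < (\<bar>al\<bar> + 1) * sqrt z" by (simp add: abs_divide field_simps)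
  moreover have "\<bar>a z / pi\<bar> <= \<bar>a z\<bar>"
  using pi_ge_two divide_left_mono[of 1 pi "\<bar>a z\<bar>"] by simp
  ultimately show "\<bar>a (snd (th, z)) / pi\<bar> <= (\<bar>al\<bar> + 1) * z powr (1 / 2)" using h(2) by (simp add: powr_half_sqrt)
 qed
 qed
 have tb: "bigOz 0 (%p. cs 8 (fst p))" "bigOz 0 (%p. sn 8 (fst p))"
  by (rule bigOzI[of _ 1], use eventually_gt_at_top[of 0] in eventually_elim, use tr1 in simp)+
 have g8: "bigOz 1 (g 8)"
 proof -
  have "bigOz 1 (%p. (D1 ^^ 8) q p + (- 1) * (A1 (snd p) / pi * cs 8 (fst p) + A2 (snd p) / pi * sn 8 (fst p)))"
  by (intro bigOz_add Sym_bigOz[OF iter_q(1)] bigOz_cmult bigOz_mult'[OF Ab[OF al(1)] tb(1)] bigOz_mult'[OF Ab[OF al(2)] tb(2)]) auto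
  moreover have "g 8 = (%p. (D1 ^^ 8) q p + (- 1) * (A1 (snd p) / pi * cs 8 (fst p) + A2 (snd p) / pi * sn 8 (fst p)))"
  unfolding g_def by (auto simp: fun_eq_iff)
  ultimately show ?thesis by simp
 qed
 have gb: "bigOz (4 / 5) (%p. circ (%th. (g 0 (th, snd p))^2))"
  by (rule bigOz_cong[OF _ V, of z0]) (use gap(1) in "simp add: g0")
 have "bigOz ((7 * (4 / 5) + 2) / 16) (g 0)"
  by (rule bigOz_interpolation(1)[where f = g, OF gd gp go g8 gb])
 \<comment> \<open>The remainder has order \<open>(7 * 4 / 5 + 2) / 16 = 19 / 40\<close>, just below
   the order \<open>1 / 2\<close> of the radius.\<close>
 from bigOz_mult[OF this Sym_bigOz[OF Sym_inv_rho]]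
 have small_rem: "bigOz (- (1 / 40)) (%p. g 0 p * inverse (rh p))" by simp
 show ?thesis
 proof (rule that[where ?a1.0 = "- (al2 / (pi * sqrt 2))" and ?a2.0 = "al1 / (pi * sqrt 2)"])
  fix eps :: real assume eps: "eps > 0"
  define eta where "eta = eps / (3 + \<bar>al1\<bar> + \<bar>al2\<bar>)"
  have eta: "eta > 0" unfolding eta_def using eps by (simp add: add_pos_nonneg)
  obtain C where C: "\<forall>\<^sub>F z in at_top. ALL th. \<bar>g 0 (th, z) * inverse (rh (th, z))\<bar> <= C * z powr (- (1 / 40))"
  using small_rem unfolding bigOz_def by blast
  have C0: "\<forall>\<^sub>F z in at_top. C * z powr (- (1 / 40)) < eta"
  by (rule order_tendstoD(2)[OF powr_tendsto_zero]) (use eta in auto)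
  have alm: "\<forall>\<^sub>F z in at_top. \<bar>a z / sqrt z - al\<bar> < eta" if "((%z. a z / sqrt z) \<longlongrightarrow> al) at_top" for a al
  using tendstoD[OF that eta] by (simp add: dist_real_def)
  show "\<forall>\<^sub>F z in at_top. ALL th. \<bar>D1 rh (th, z) - (al1 / (pi * sqrt 2) * cos th - - (al2 / (pi * sqrt 2)) * sin th)\<bar> <= eps"
  using C C0 alm[OF al(1)] alm[OF al(2)] small[OF eta] rho_lower eventually_gt_at_top[of "max 1 z0"]
  proof eventually_elim
  case (elim z)
  show ?case
  proof
  fix th
  have z: "z > 0" "z > z0" using elim by auto
  define s where "s = sqrt z"
  have s: "s > 0" unfolding s_def using z by simp
  define r where "r = rh (th, z)"
  have rs: "r >= s" unfolding r_def s_def using elim by blast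
  then have r0: "r > 0" using s by simp
  have D: "D1 rh (th, z) = g 0 (th, z) * inverse r + (A1 z * cos th + A2 z * sin th) / (pi * r)"
  unfolding g0 q_def r_def[symmetric] using r0 by (simp add: field_simps)
  have t: "\<bar>a / (pi * r) - al / (pi * sqrt 2)\<bar> <= eta * (1 + \<bar>al\<bar>)" if a: "\<bar>a / s - al\<bar> < eta" for a al
  proof -
  have "a / (pi * r) - al / (pi * sqrt 2) = ((a / s - al) * (s / r) + al * (sqrt 2 * s - r) / (sqrt 2 * r)) / pi"
  using r0 s by (simp add: field_simps)
  moreover have "\<bar>(a / s - al) * (s / r)\<bar> <= eta * 1"
  unfolding abs_mult using a rs r0 s by (intro mult_mono) auto
  moreover have "\<bar>al * (sqrt 2 * s - r) / (sqrt 2 * r)\<bar> <= \<bar>al\<bar> * eta"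
  proof -
  have "\<bar>sqrt 2 * s - r\<bar> <= eta * s" using elim(5) unfolding s_def r_def by (simp add: abs_minus_commute)
  also have "... <= eta * (sqrt 2 * r)"
  proof (rule mult_left_mono)
  have "1 * r <= sqrt 2 * r" using r0 by (intro mult_right_mono) auto
  then show "s <= sqrt 2 * r" using rs by linarith
  qed (use eta in simp)
  finally have "\<bar>sqrt 2 * s - r\<bar> / (sqrt 2 * r) <= eta" using r0 by (simp add: field_simps)
  then have "\<bar>al\<bar> * (\<bar>sqrt 2 * s - r\<bar> / (sqrt 2 * r)) <= \<bar>al\<bar> * eta" by (rule mult_left_mono) simp
  then show ?thesis using r0 by (simp add: abs_mult)
  qed
  ultimately have "a / (pi * r) - al / (pi * sqrt 2) = ((a / s - al) * (s / r) + al * (sqrt 2 * s - r) / (sqrt 2 * r)) / pi"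
  "\<bar>(a / s - al) * (s / r) + al * (sqrt 2 * s - r) / (sqrt 2 * r)\<bar> <= eta + \<bar>al\<bar> * eta"
  by linarith+
  then have "\<bar>a / (pi * r) - al / (pi * sqrt 2)\<bar> <= (eta + \<bar>al\<bar> * eta) / pi"
  by (simp add: divide_right_mono)
  also have "... <= (eta + \<bar>al\<bar> * eta) / 1" using eta pi_ge_two by (intro divide_left_mono) auto
  finally show ?thesis by (simp add: algebra_simps)
  qed
  define X1' where "X1' = A1 z / (pi * r) - al1 / (pi * sqrt 2)"
  define X2' where "X2' = A2 z / (pi * r) - al2 / (pi * sqrt 2)"
  have b: "\<bar>X1'\<bar> <= eta * (1 + \<bar>al1\<bar>)" "\<bar>X2'\<bar> <= eta * (1 + \<bar>al2\<bar>)"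
  unfolding X1'_def X2'_def using t elim(3,4) unfolding s_def by blast+
  have "D1 rh (th, z) - (al1 / (pi * sqrt 2) * cos th - - (al2 / (pi * sqrt 2)) * sin th) =
  g 0 (th, z) * inverse r + (X1' * cos th + X2' * sin th)"
  unfolding D X1'_def X2'_def by (simp add: add_divide_distrib left_diff_distrib)
  moreover have "\<bar>X1' * cos th\<bar> <= \<bar>X1'\<bar> * 1" "\<bar>X2' * sin th\<bar> <= \<bar>X2'\<bar> * 1"
  unfolding abs_mult by (intro mult_left_mono; simp)+
  moreover have "\<bar>g 0 (th, z) * inverse r\<bar> <= eta" using elim(1,2) unfolding r_def by (meson less_imp_le order_trans)
  moreover have "eta + eta * (1 + \<bar>al1\<bar>) + eta * (1 + \<bar>al2\<bar>) = eps"
  proof -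
  have "eta * (3 + \<bar>al1\<bar> + \<bar>al2\<bar>) = eps" unfolding eta_def by (simp add: add_pos_nonneg)
  then show ?thesis by (simp add: algebra_simps)
  qed
  ultimately show "\<bar>D1 rh (th, z) - (al1 / (pi * sqrt 2) * cos th - - (al2 / (pi * sqrt 2)) * sin th)\<bar> <= eps"
  using b by linarith
  qed
  qed
 qed
qed

text \<open>\<open>bz = 1 - F + E\<close> with \<open>F\<close> and \<open>E\<close> tending to 0.
  Monotonicity of the radius in the height is what keeps vertical double points low.\<close>

lemma D2_rho_pos: "\<forall>\<^sub>F z in at_top. ALL th. D2 rh (th, z) > 0"
proof -
 obtain C where C: "C > 0" "\<forall>\<^sub>F z in at_top. ALL th. \<bar>E (th, z)\<bar> <= C / z & \<bar>D1 E (th, z)\<bar> <= C / z" by (rule E_small)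
 obtain C' where C': "\<forall>\<^sub>F z in at_top. ALL th. \<bar>F (th, z) - D1 q (th, z) / (2 * snd (th, z))\<bar> <= C' * z powr (- (17 / 20))"
  using slopes_bigOz(2) unfolding bigOz_def by blast
 have C0: "\<forall>\<^sub>F z in at_top. C' * z powr (- (17 / 20)) < 1 / 4"
  by (rule order_tendstoD(2)[OF powr_tendsto_zero]) auto
 have q: "(1 / 4 :: real) > 0" "(1 / 4 :: real) <= 1" by auto
 show ?thesis
  using C(2) C' C0 b_small[OF q] eventually_gt_at_top[of "max (4 * C) (max 1 z0)"]
 proof eventually_elim
  case (elim z)
  show ?case
  proof
  fix th
  have z: "z > 0" "z > z0" "4 * C < z" using elim by auto
  have "C / z < 1 / 4" using z by (simp add: field_simps)
  moreover have "\<bar>E (th, z)\<bar> <= C / z" "\<bar>F (th, z) - D1 q (th, z) / (2 * z)\<bar> <= C' * z powr (- (17 / 20))"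
  using elim(1,2) by auto
  moreover have "\<bar>D1 q (th, z) / (2 * z)\<bar> <= 1 / 8" using elim(4) z by (auto simp: field_simps abs_divide)
  ultimately have "bz (th, z) > 0" using elim(3) unfolding E_def by linarith
  then show "D2 rh (th, z) > 0" unfolding bz_def using pos[of "(th, z)"] z by (simp add: zero_less_mult_iff)
  qed
 qed
qed

end

section \<open>Vertical translates: \<open>M\<close> as an entire graph\<close>

text \<open>What the comparison arguments use of the asymptotic analysis: \<open>rh'\<close> stands
  for the angular derivative of the radius and \<open>(a1, a2)\<close> for the centre of the
  cross-sections.\<close>

locale translator_end =
 fixes M :: "(real^3) set" and rh rh' :: "real \<times> real => real" and z1 a1 a2 K r0 :: real
 assumes patch: "!!x. x \<in> M ==> translator_patch M x" and clM: "closed M" and conM: "connected M"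
  and z1: "z1 >= 1" and r0: "r0 > 0"
  and rho_bounds: "!!th z. z > z1 ==> sqrt z <= rh (th, z) & rh (th, z) <= 2 * sqrt z"
  and rho_mem: "!!th z r. z > z1 ==> r > 0 ==> vector [r * cos th, r * sin th, z] \<in> M \<longleftrightarrow> r = rh (th, z)"
  and polar: "!!x. x \<in> M ==> x $ 3 > z1 ==> EX th. x = vector [rh (th, x $ 3) * cos th, rh (th, x $ 3) * sin th, x $ 3]"
  and rho_less: "!!th z z'. z1 < z ==> z < z' ==> rh (th, z) < rh (th, z')"
  and rho_per: "!!th z. rh (th + 2 * pi, z) = rh (th, z)"
  and rho_DERIV: "!!th z. z > z1 ==> DERIV (%th. rh (th, z)) th :> rh' (th, z)"
  and rho_lin: "!!eps. eps > 0 ==> \<forall>\<^sub>F z in at_top. ALL th. \<bar>rh' (th, z) - (a2 * cos th - a1 * sin th)\<bar> <= eps"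
  and conf: "!!x. x \<in> M ==> r0^2 <= hr x ==> hr x < 100 * \<bar>x $ 3\<bar>"
  and below: "!!x. x \<in> M ==> x $ 3 >= - K"

lemma translator_end_exists:
 assumes M: "properly_embedded_translator M" "converges_to_cylinder M"
 obtains rh rh' z1 a1 a2 K r0 where "translator_end M rh rh' z1 a1 a2 K r0"
proof -
 obtain z0 where z0: "z0 >= 1" "Sym z0 (1 / 2) (rho M)" and pos: "!!th z. z > z0 ==> rho M (th, z) > 0"
  and mem: "!!th z r. z > z0 ==> r > 0 ==> vector [r * cos th, r * sin th, z] \<in> M \<longleftrightarrow> r = rho M (th, z)"
  and pol: "!!x. x \<in> M ==> x $ 3 > z0 ==> EX th. x = vector [rho M (th, x $ 3) * cos th, rho M (th, x $ 3) * sin th, x $ 3]"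
  and small: "!!eps. eps > 0 ==> \<forall>\<^sub>F z in at_top. ALL th. \<bar>rho M (th, z) - sqrt 2 * sqrt z\<bar> <= eps * sqrt z &
  \<bar>D1 (rho M) (th, z)\<bar> <= eps * sqrt z & \<bar>D1 (D1 (rho M)) (th, z)\<bar> <= eps * sqrt z"
  by (rule end_structure[OF M]) blast
 have patch: "!!x. x \<in> M ==> translator_patch M x" and cl: "closed M" and con: "connected M"
  using M(1) unfolding properly_embedded_translator_def by auto
 have per: "rho M (th + 2 * pi, z) = rho M (th, z)" for th z by (simp add: rho_def)
 interpret polar_end "rho M" z0
 proof
  fix p assume p: "p \<in> half z0"
  show "0 < rho M p" using pos[of "snd p" "fst p"] p by simp
  then show "(1 + (D2 (rho M) p)^2) * (rho M p * D1 (D1 (rho M)) p - (rho M p)^2 - 2 * (D1 (rho M) p)^2)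
  - 2 * D1 (rho M) p * D2 (rho M) p * (rho M p * D1 (D2 (rho M)) p - D1 (rho M) p * D2 (rho M) p)
  + ((D1 (rho M) p)^2 + (rho M p)^2) * rho M p * D2 (D2 (rho M)) p
  = - ((D1 (rho M) p)^2 + (rho M p)^2 + (rho M p)^2 * (D2 (rho M) p)^2) * rho M p * D2 (rho M) p"
  by (intro translator_polar_equation[OF patch open_half p Sym_smooth[OF z0(2)]]) (use mem pos in auto)
 qed (use z0 per small in auto)
 obtain a1 a2 where lin: "!!eps. eps > 0 ==> \<forall>\<^sub>F z in at_top. ALL th. \<bar>D1 (rho M) (th, z) - (a2 * cos th - a1 * sin th)\<bar> <= eps"
  by (rule linear_asymptotics) blast
 have h2: "(1 / 2 :: real) > 0" by simp
 have "\<forall>\<^sub>F z in at_top. z > z0 & (ALL th. D2 (rho M) (th, z) > 0) & (ALL th. sqrt z <= rho M (th, z)) & (ALL th. rho M (th, z) <= 2 * sqrt z)"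
  using D2_rho_pos rho_lower small[OF h2] eventually_gt_at_top[of z0]
 proof eventually_elim
  case (elim z)
  have "rho M (th, z) <= 2 * sqrt z" for th
  proof -
  have "sqrt 2 * sqrt z <= 3 / 2 * sqrt z" using sqrt2_bounds elim(4) z0(1) by (intro mult_right_mono) auto
  moreover have "\<bar>rho M (th, z) - sqrt 2 * sqrt z\<bar> <= 1 / 2 * sqrt z" using elim(3) by blast
  ultimately show ?thesis by linarith
  qed
  then show ?case using elim by blast
 qed
 then obtain z1 where z1: "!!z. z >= z1 ==> z > z0 & (ALL th. D2 (rho M) (th, z) > 0) & (ALL th. sqrt z <= rho M (th, z)) & (ALL th. rho M (th, z) <= 2 * sqrt z)"
  unfolding eventually_at_top_linorder by blast
 have zz: "z > z0" if "z > z1" for z using z1[of z] that by auto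
 obtain r0 where r0: "r0 > 0" "\<forall>x\<in>M. r0^2 <= hr x --> hr x < 100 * \<bar>x $ 3\<bar>" using sphere_confinement[OF M] by blast
 obtain K where K: "\<forall>x\<in>M. x $ 3 >= - K" using bounded_below[OF M] by blast
 have "translator_end M (rho M) (D1 (rho M)) z1 a1 a2 K r0"
 proof
  show "z1 >= 1" using z1[of z1] z0(1) by auto
  show "rho M (th, z) < rho M (th, z')" if "z1 < z" "z < z'" for th z z'
  proof (rule DERIV_pos_imp_increasing[OF that(2)])
  fix x assume "z <= x" "x <= z'"
  then have x: "x >= z1" "(th, x) \<in> half z0" using that zz[of x] by auto
  show "EX y. DERIV (%z. rho M (th, z)) x :> y & 0 < y"
  using DERIV_D2[OF smooth2_differentiable[OF smooth_rho x(2)]] z1[OF x(1)] by blast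
  qed
  show "DERIV (%th. rho M (th, z)) th :> D1 (rho M) (th, z)" if "z > z1" for th z
  by (rule half_slice(1)[OF smooth_rho zz[OF that]])
 qed (use z1 zz per patch cl con r0 K lin mem pol in auto)
 then show ?thesis by (rule that)
qed

lemma connected_spread:
 fixes M A :: "'a :: metric_space set"
 assumes "connected M" "closed A" "x \<in> M" "x \<in> A"
  and "!!y. y \<in> M ==> y \<in> A ==> \<exists>r>0. \<forall>z\<in>M. dist z y < r --> z \<in> A"
 shows "M \<subseteq> A"
proof -
 have "openin (top_of_set M) (M \<inter> A)"
  unfolding openin_euclidean_subtopology_iff using assms(5) by (auto simp: dist_commute)
 moreover have "closedin (top_of_set M) (M \<inter> A)" using assms(2) by (rule closedin_closed_Int)
 ultimately have "M \<inter> A = {} \<or> M \<inter> A = M" using assms(1) connected_clopen by blast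
 then show ?thesis using assms(3,4) by blast
qed

definition pr :: "real^3 => real \<times> real" where "pr x = (x $ 1, x $ 2)"

lemma pr_eq: "pr x = pr y \<longleftrightarrow> x $ 1 = y $ 1 & x $ 2 = y $ 2" by (simp add: pr_def)

lemma continuous_pr [continuous_intros]: "continuous_on S f ==> continuous_on S (%x. pr (f x))"
 unfolding pr_def by (intro continuous_intros)

lemma pr_vertical: "pr (x + s *\<^sub>R tau) = pr x" "pr (x - s *\<^sub>R tau) = pr x"
 by (simp_all add: pr_def)

lemma translator_patch_vertical:
 assumes "translator_patch M p"
 shows "translator_patch ((%x. x + s *\<^sub>R tau) ` M) (p + s *\<^sub>R tau)"
 using translator_patch_isometry[of "%x. x" M p "s *\<^sub>R tau"] assms by (simp add: orthogonal_transformation_id[unfolded id_def])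

context translator_end
begin

lemma compact_slab: "compact (M \<inter> {x. x $ 3 <= z})"
proof (rule compact_eq_bounded_closed[THEN iffD2, OF conjI])
 show "closed (M \<inter> {x. x $ 3 <= z})"
  by (intro closed_Int clM closed_Collect_le continuous_intros)
 define h where "h = \<bar>K\<bar> + \<bar>z\<bar>"
 show "bounded (M \<inter> {x. x $ 3 <= z})"
  unfolding bounded_iff
 proof (intro exI ballI)
  fix x assume "x \<in> M \<inter> {x. x $ 3 <= z}"
  then have x: "x \<in> M" "\<bar>x $ 3\<bar> <= h" using below[of x] unfolding h_def by auto
  have "hr x <= r0^2 + 100 * h"
  proof (cases "r0^2 <= hr x")
  case True
  then show ?thesis using conf[OF x(1) True] x(2) by (smt (verit) zero_le_power2)
  next
  case False
  then show ?thesis unfolding h_def by simp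
  qed
  moreover have "(x $ 3)^2 <= h^2" using x(2) by (simp add: abs_le_square_iff[symmetric])
  ultimately have "(norm x)^2 <= r0^2 + 100 * h + h^2" unfolding norm3 by linarith
  then show "norm x <= sqrt (r0^2 + 100 * h + h^2)" by (rule real_le_rsqrt)
 qed
qed

lemma high_wide:
 assumes "x \<in> M" "x $ 3 > z1"
 shows "x $ 3 <= hr x"
proof -
 obtain th where x: "x = vector [rh (th, x $ 3) * cos th, rh (th, x $ 3) * sin th, x $ 3]" using polar[OF assms] by blast
 define r where "r = rh (th, x $ 3)"
 have c: "x $ 1 = r * cos th" "x $ 2 = r * sin th" using x unfolding r_def vec3_eq by auto
 have "hr x = r^2 * ((cos th)^2 + (sin th)^2)" unfolding hr_def c by (simp only: power_mult_distrib distrib_left)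
 then have "hr x = r^2" by (simp only: sin_cos_squared_add2 mult_1_right)
 moreover have "x $ 3 = (sqrt (x $ 3))^2" using assms(2) z1 by simp
 moreover have "(sqrt (x $ 3))^2 <= r^2" using rho_bounds[OF assms(2)] assms(2) z1 unfolding r_def by (intro power_mono) auto
 ultimately show ?thesis by linarith
qed

text \<open>Above \<open>z1\<close> the radius at a fixed angle increases strictly with the height,
  so the lower of two points on a vertical line cannot lie there.\<close>

lemma double_low:
 assumes "x \<in> M" "y \<in> M" "pr x = pr y" "x $ 3 < y $ 3"
 shows "x $ 3 <= z1"
proof (rule ccontr)
 assume "\<not> x $ 3 <= z1"
 then have h: "x $ 3 > z1" by simp
 obtain th where x: "x = vector [rh (th, x $ 3) * cos th, rh (th, x $ 3) * sin th, x $ 3]" using polar[OF assms(1) h] by blast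
 define r where "r = rh (th, x $ 3)"
 have "r >= sqrt (x $ 3)" "sqrt (x $ 3) > 0" unfolding r_def using rho_bounds[OF h] h z1 by auto
 then have r: "r > 0" by linarith
 have "x $ 1 = r * cos th" "x $ 2 = r * sin th" using x unfolding r_def vec3_eq by auto
 then have "y = vector [r * cos th, r * sin th, y $ 3]" using assms(3) unfolding vec3_eq pr_eq by simp
 then have "r = rh (th, y $ 3)" using rho_mem[of "y $ 3" r th] r h assms(2,4) by simp
 then show False using rho_less[OF h assms(4), of th] unfolding r_def by simp
qed

text \<open>The largest vertical gap \<open>s\<close> between two points of \<open>M\<close> is
  attained, by compactness of the set of candidate pairs. At such a pair \<open>M\<close> touches
  its translate by \<open>s\<close> from one side, so the maximum principle and connectedness give
  invariance under lowering by \<open>s\<close>, and iteration contradicts the bound from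
  below.\<close>

lemma graphical:
 assumes "x \<in> M" "y \<in> M" "pr x = pr y"
 shows "x = y"
proof (rule ccontr)
 assume ne: "x ~= y"
 obtain x0 y0 where xy0: "x0 \<in> M" "y0 \<in> M" "pr x0 = pr y0" "x0 $ 3 < y0 $ 3"
 proof -
  have "x $ 3 ~= y $ 3" using ne assms(3) unfolding vec3_eq pr_eq by auto
  then show ?thesis using that[of x y] that[of y x] assms by (metis linorder_neqE_linordered_idom)
 qed
 define K1 where "K1 = M \<inter> {x. x $ 3 <= z1}"
 have cK1: "compact K1" unfolding K1_def by (rule compact_slab)
 have "bounded (hr ` K1)"
  by (intro compact_imp_bounded compact_continuous_image cK1) (auto simp: hr_def intro!: continuous_intros)
 then obtain B where B: "!!x. x \<in> K1 ==> hr x <= B" unfolding bounded_iff by fastforce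
 define K2 where "K2 = M \<inter> {x. x $ 3 <= max z1 B}"
 define P where "P = (K1 \<times> K2) \<inter> {p. pr (fst p) = pr (snd p)}"
 have cP: "compact P"
  unfolding P_def K2_def by (intro compact_Int_closed compact_Times cK1 compact_slab closed_Collect_eq continuous_intros)
 have inP: "(x, y) \<in> P" if "x \<in> M" "y \<in> M" "pr x = pr y" "x $ 3 < y $ 3" for x y
 proof -
  have x: "x \<in> K1" unfolding K1_def using double_low[OF that] that by simp
  have "hr y = hr x" using that(3) unfolding hr_def pr_eq by simp
  then have "y $ 3 <= max z1 B" using B[OF x] high_wide[OF that(2)] by fastforce
  then show ?thesis unfolding P_def K2_def using x that by simp
 qed
 have neP: "P ~= {}" using inP[OF xy0] by blast
 obtain q where q: "q \<in> P" "!!p. p \<in> P ==> snd p $ 3 - fst p $ 3 <= snd q $ 3 - fst q $ 3"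
 proof -
  have "continuous_on P (%p. snd p $ 3 - fst p $ 3)" by (intro continuous_intros)
  from continuous_attains_sup[OF cP neP this] show ?thesis using that by blast
 qed
 define s where "s = snd q $ 3 - fst q $ 3"
 have s0: "s > 0" using q(2)[OF inP[OF xy0]] xy0(4) unfolding s_def by simp
 \<comment> \<open>Maximality of \<open>s\<close>: lowering a point of \<open>M\<close> by more than
   \<open>s\<close> never meets \<open>M\<close>, which is the disjointness that the maximum
   principle asks for.\<close>
 have gap: "t <= s" if "x \<in> M" "x + t *\<^sub>R tau \<in> M" for x t
 proof (cases "t > 0")
  case True
  have "(x, x + t *\<^sub>R tau) \<in> P" by (rule inP[OF that]) (use True in "auto simp: pr_vertical")
  then show ?thesis using q(2) unfolding s_def by fastforce
 qed (use s0 in simp)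
 have qm: "fst q \<in> M" "snd q \<in> M" "snd q - s *\<^sub>R tau = fst q"
  using q(1) unfolding P_def K1_def K2_def s_def pr_eq vec3_eq by auto
 define T where "T = {y. y - s *\<^sub>R tau \<in> M}"
 have Te: "T = (%x. x + s *\<^sub>R tau) ` M"
  unfolding T_def by (auto intro!: image_eqI[of _ _ "x - s *\<^sub>R tau" for x])
 have "M \<subseteq> T"
 proof (rule connected_spread[OF conM _ qm(2)])
  show "closed T" unfolding Te using closed_translation[OF clM, of "s *\<^sub>R tau"] by (simp add: add.commute)
  show "snd q \<in> T" unfolding T_def using qm by simp
  fix y assume y: "y \<in> M" "y \<in> T"
  have "y - s *\<^sub>R tau \<in> M" using y(2) unfolding T_def by blast
  from translator_patch_vertical[OF patch[OF this], of s]
  have ty: "translator_patch T y" unfolding Te by simp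
  show "\<exists>r>0. \<forall>z\<in>M. dist z y < r --> z \<in> T"
  proof (rule strong_maximum_principle[OF patch[OF y(1)] y(1) ty y(2), of 1 1])
  fix x t :: _ assume h: "x \<in> M" "0 < t" "t < (1 :: real)"
  show "x - t *\<^sub>R tau \<notin> T"
  proof
  assume "x - t *\<^sub>R tau \<in> T"
  then have "x - (t + s) *\<^sub>R tau \<in> M" unfolding T_def by (simp add: algebra_simps)
  then show False using gap[of "x - (t + s) *\<^sub>R tau" "t + s"] h by simp
  qed
  qed auto
 qed
 then have step: "x - s *\<^sub>R tau \<in> M" if "x \<in> M" for x using that unfolding T_def by blast
 have "x0 - (real n * s) *\<^sub>R tau \<in> M" for n
 proof (induction n)
  case (Suc n)
  then show ?case using step[OF Suc] by (simp add: algebra_simps)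
 qed (use xy0 in simp)
 then have "x0 $ 3 - real n * s >= - K" for n using below by fastforce
 moreover obtain n where "real n * s > x0 $ 3 + K" using reals_Archimedean3[OF s0] by blast
 ultimately show False by (smt (verit))
qed

lemma hr_bound_height: "x \<in> M ==> x $ 3 <= max z1 (hr x)"
 using high_wide[of x] by linarith

lemma norm_pr: "(norm (pr x))^2 = hr x"
 by (simp add: pr_def hr_def norm_Pair)

lemma pr_closed_part:
 assumes "R >= 0"
 shows "compact (pr ` (M \<inter> {x. x $ 3 <= max z1 (R^2)}))" "pr ` M \<inter> cball 0 R \<subseteq> pr ` (M \<inter> {x. x $ 3 <= max z1 (R^2)})"
proof -
 show "compact (pr ` (M \<inter> {x. x $ 3 <= max z1 (R^2)}))"
  by (intro compact_continuous_image compact_slab continuous_intros)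
 show "pr ` M \<inter> cball 0 R \<subseteq> pr ` (M \<inter> {x. x $ 3 <= max z1 (R^2)})"
 proof
  fix v assume "v \<in> pr ` M \<inter> cball 0 R"
  then obtain x where x: "x \<in> M" "v = pr x" "norm (pr x) <= R" by auto
  have "hr x <= R^2" unfolding norm_pr[symmetric] using x(3) by (intro power_mono) auto
  then have "x $ 3 <= max z1 (R^2)" using hr_bound_height[OF x(1)] by linarith
  then show "v \<in> pr ` (M \<inter> {x. x $ 3 <= max z1 (R^2)})" using x by blast
 qed
qed

text \<open>The projection is injective on patches, so invariance of domain makes its image open,
  even where the tangent plane is vertical. The image is closed since heights over bounded sets are
  bounded.\<close>

lemma entire: "\<exists>x\<in>M. pr x = v"
proof -
 have op: "open (pr ` M)"
  unfolding open_subopen[of "pr ` M"]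
 proof
  fix v assume "v \<in> pr ` M"
  then obtain p where p: "p \<in> M" "v = pr p" by blast
  obtain e1 e2 n u dl eta where fr: "tframe M p e1 e2 n u dl eta" by (rule translator_patch_tframe[OF patch[OF p(1)] p(1)])
  let ?f = "%z. pr (graph_map p e1 e2 n u z)"
  have "open (?f ` ball 0 eta)"
  proof (rule invariance_of_domain)
  show "continuous_on (ball 0 eta) ?f"
  by (intro continuous_pr graph_map_continuous continuous_on_subset[OF smooth2_continuous[OF tframeD(4)[OF fr]]])
  (use tframeD(3)[OF fr] in auto)
  show "inj_on ?f (ball 0 eta)"
  proof (rule inj_onI)
  fix z w assume h: "z \<in> ball 0 eta" "w \<in> ball 0 eta" "?f z = ?f w"
  have "graph_map p e1 e2 n u z = graph_map p e1 e2 n u w"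
  by (rule graphical[OF tframe_graph_in[OF fr h(1)] tframe_graph_in[OF fr h(2)] h(3)])
  then show "z = w" using proj_graph_map(1)[OF tframeD(1)[OF fr]] by metis
  qed
  qed simp
  moreover have "v \<in> ?f ` ball 0 eta"
  by (rule image_eqI[of _ _ 0]) (use p(2) tframeD(2,5)[OF fr] in "auto simp: graph_map_def zero_prod_def")
  moreover have "?f ` ball 0 eta \<subseteq> pr ` M" using tframe_graph_in[OF fr] by auto
  ultimately show "EX T. open T & v \<in> T & T \<subseteq> pr ` M" by blast
 qed
 have cl: "closed (pr ` M)"
  unfolding closed_sequential_limits
 proof (intro allI impI, elim conjE)
  fix f l assume f: "ALL n. f n \<in> pr ` M" "f \<longlonglongrightarrow> l"
  then obtain R where R: "R > 0" "!!n. norm (f n) <= R" using convergent_imp_bounded[OF f(2)] unfolding bounded_pos by auto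
  have Rn: "R >= 0" using R by simp
  note cp = pr_closed_part[OF Rn]
  have "ALL n. f n \<in> pr ` (M \<inter> {x. x $ 3 <= max z1 (R^2)})"
  proof
  fix n
  have "f n \<in> pr ` M \<inter> cball 0 R" using f(1) R(2) by simp
  then show "f n \<in> pr ` (M \<inter> {x. x $ 3 <= max z1 (R^2)})" using cp(2) by (rule subsetD[rotated])
  qed
  then have "l \<in> pr ` (M \<inter> {x. x $ 3 <= max z1 (R^2)})"
  using compact_imp_closed[OF cp(1)] f(2) unfolding closed_sequential_limits by blast
  then show "l \<in> pr ` M" by blast
 qed
 have ne: "pr ` M ~= {}"
 proof -
  have "sqrt (z1 + 1) <= rh (0, z1 + 1)" "sqrt (z1 + 1) > 0" using rho_bounds[of "z1 + 1" 0] z1 by auto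
  then have "vector [rh (0, z1 + 1) * cos 0, rh (0, z1 + 1) * sin 0, z1 + 1] \<in> M"
  using rho_mem[of "z1 + 1" "rh (0, z1 + 1)" 0] by (meson less_add_one less_le_trans)
  then show ?thesis by blast
 qed
 have "pr ` M = {} \<or> pr ` M = UNIV" by (rule iffD1[OF clopen conjI[OF cl op]])
 then have "pr ` M = UNIV" using ne by simp
 then have "v \<in> pr ` M" by simp
 then show ?thesis unfolding image_iff by metis
qed

definition hgt :: "real \<times> real => real" where "hgt v = (THE z. vector [fst v, snd v, z] \<in> M)"

lemma mem_iff: "x \<in> M \<longleftrightarrow> x $ 3 = hgt (pr x)"
proof -
 have vx: "vector [fst (pr x), snd (pr x), x $ 3] = x" for x unfolding vec3_eq by (simp add: pr_def)
 have u: "hgt (pr x) = x $ 3" if "x \<in> M" for x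
  unfolding hgt_def
 proof (rule the_equality)
  show "vector [fst (pr x), snd (pr x), x $ 3] \<in> M" unfolding vx by (rule that)
  fix z assume "vector [fst (pr x), snd (pr x), z] \<in> M"
  then have "vector [fst (pr x), snd (pr x), z] = x" by (rule graphical[OF _ that]) (simp add: pr_def)
  then show "z = x $ 3" unfolding vec3_eq by simp
 qed
 show ?thesis
 proof
  assume "x $ 3 = hgt (pr x)"
  moreover obtain y where y: "y \<in> M" "pr y = pr x" using entire by blast
  ultimately have "y $ 3 = x $ 3" using u[OF y(1)] by simp
  then have "y = x" using y(2) unfolding vec3_eq pr_eq by simp
  then show "x \<in> M" using y(1) by simp
 qed (use u in auto)
qed

text \<open>Over a disc the relevant part of \<open>M\<close> is compact, and the inverse of a
  continuous injection on a compact set is continuous.\<close>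

lemma continuous_hgt: "continuous_on UNIV hgt"
proof -
 have "continuous_on (ball 0 (real R)) hgt" for R
 proof -
  let ?C = "M \<inter> {x. x $ 3 <= max z1 ((real R)^2)}"
  define g where "g = (%v. vector [fst v, snd v, hgt v] :: real^3)"
  have "continuous_on (pr ` ?C) g"
  proof (rule continuous_on_inv)
  show "\<forall>x\<in>?C. g (pr x) = x"
  unfolding g_def vec3_eq using mem_iff by (auto simp: pr_def)
  qed (intro continuous_intros compact_slab)+
  moreover have "ball 0 (real R) \<subseteq> pr ` ?C"
  proof
  fix v :: "real \<times> real" assume v: "v \<in> ball 0 (real R)"
  obtain x where "x \<in> M" "pr x = v" using entire by blast
  then show "v \<in> pr ` ?C" using pr_closed_part(2)[of "real R"] v by auto
  qed
  ultimately have "continuous_on (ball 0 (real R)) g" using continuous_on_subset by blast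
  then have "continuous_on (ball 0 (real R)) (%v. g v $ 3)" by (intro continuous_intros)
  then show ?thesis unfolding g_def by simp
 qed
 then have "continuous_on (\<Union>R. ball 0 (real R)) hgt" by (intro continuous_on_open_UN) auto
 moreover have "(\<Union>R. ball 0 (real R)) = (UNIV :: (real \<times> real) set)"
  using reals_Archimedean2 by auto
 ultimately show ?thesis by simp
qed

end

section \<open>Moving planes and rotational symmetry\<close>

text \<open>For a unit vector \<open>(c, s)\<close> this is the reflection in the vertical plane
  with normal \<open>(c, s, 0)\<close> at signed distance \<open>l\<close> from the axis;
  \<open>mirror2\<close> is its horizontal trace.\<close>

definition mirror :: "real => real => real => real^3 => real^3" where
 "mirror c s l x = x + (2 * (l - (x $ 1 * c + x $ 2 * s))) *\<^sub>R vector [c, s, 0]"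

definition mirror2 :: "real => real => real => real \<times> real => real \<times> real" where
 "mirror2 c s l v = (fst v + 2 * (l - (fst v * c + snd v * s)) * c, snd v + 2 * (l - (fst v * c + snd v * s)) * s)"

lemma mirror_nth [simp]:
 "mirror c s l x $ 1 = x $ 1 + 2 * (l - (x $ 1 * c + x $ 2 * s)) * c"
 "mirror c s l x $ 2 = x $ 2 + 2 * (l - (x $ 1 * c + x $ 2 * s)) * s" "mirror c s l x $ 3 = x $ 3"
 by (simp_all add: mirror_def)

lemma pr_mirror: "pr (mirror c s l x) = mirror2 c s l (pr x)"
 by (simp add: pr_def mirror2_def)

lemma mirror2_involutive:
 assumes "c^2 + s^2 = 1"
 shows "mirror2 c s l (mirror2 c s l v) = v"
proof -
 have h: "a + 2 * (l - (a * c + b * s)) * c + 2 * (l - ((a + 2 * (l - (a * c + b * s)) * c) * c + (b + 2 * (l - (a * c + b * s)) * s) * s)) * c = a"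
  "b + 2 * (l - (a * c + b * s)) * s + 2 * (l - ((a + 2 * (l - (a * c + b * s)) * c) * c + (b + 2 * (l - (a * c + b * s)) * s) * s)) * s = b" for a b
  using assms by algebra+
 show ?thesis by (rule prod_eqI) (simp_all only: mirror2_def fst_conv snd_conv h)
qed

lemma mirror_isometry:
 assumes cs: "c^2 + s^2 = 1"
 shows "translator_patch M p ==> translator_patch ((%x. mirror c s l x + t *\<^sub>R tau) ` M) (mirror c s l p + t *\<^sub>R tau)"
  "dist (mirror c s l x + t *\<^sub>R tau) (mirror c s l y + t *\<^sub>R tau) = dist x y"
proof -
 define e :: "real^3" where "e = vector [c, s, 0]"
 define L where "L = (%x :: real^3. x - (2 * (x <.> e)) *\<^sub>R e)"
 have ee: "e <.> e = 1" unfolding e_def inner3 using cs by (simp add: power2_eq_square)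
 have O: "orthogonal_transformation L"
  unfolding orthogonal_transformation_def
 proof
  show "linear L" unfolding L_def by (rule linearI) (simp_all add: inner_add_left algebra_simps scaleR_add_left)
  show "ALL v w. L v <.> L w = v <.> w"
  unfolding L_def by (simp add: inner_diff_left inner_diff_right ee inner_commute)
 qed
 have Lt: "L tau = tau" unfolding L_def e_def by (simp add: inner_commute[of tau])
 have eq: "mirror c s l x + t *\<^sub>R tau = L x + ((2 * l) *\<^sub>R e + t *\<^sub>R tau)" for x
  unfolding vec3_eq L_def e_def inner3 by (simp add: algebra_simps)
 show "translator_patch M p ==> translator_patch ((%x. mirror c s l x + t *\<^sub>R tau) ` M) (mirror c s l p + t *\<^sub>R tau)"
  unfolding eq by (rule translator_patch_isometry[OF O Lt])
 have "L x - L y = L (x - y)" using O by (simp add: orthogonal_transformation_def linear_diff)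
 then show "dist (mirror c s l x + t *\<^sub>R tau) (mirror c s l y + t *\<^sub>R tau) = dist x y"
  unfolding eq dist_norm using orthogonal_transformation_norm[OF O, of "x - y"] by simp
qed

lemma sin_ge_half:
 fixes t :: real
 assumes "0 <= t" "t <= pi / 2"
 shows "t / 2 <= sin t"
proof (cases "t <= pi / 3")
 case True
 have "sin 0 - 0 / 2 <= sin t - t / 2"
 proof (rule DERIV_nonneg_imp_nondecreasing[OF assms(1)])
  fix x assume x: "0 <= x" "x <= t"
  have "cos (pi / 3) <= cos x" using x True by (intro cos_monotone_0_pi_le) auto
  then show "EX y. DERIV (%t. sin t - t / 2) x :> y & 0 <= y"
  by (intro exI[of _ "cos x - 1 / 2"]) (auto intro!: derivative_eq_intros simp: cos_60)
 qed
 then show ?thesis by simp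
next
 case False
 then have "sin (pi / 3) <= sin t" using assms by (intro sin_monotone_2pi_le) auto
 moreover have "sqrt 3 >= (17 / 10 :: real)" by (rule real_le_rsqrt) (simp add: power2_eq_square)
 ultimately show ?thesis using assms(2) pi_approx(2) unfolding sin_60 by simp
qed

lemma one_minus_cos_ge:
 assumes "\<bar>t\<bar> <= pi"
 shows "t^2 / 8 <= 1 - cos t"
proof -
 have "\<bar>t\<bar> / 2 / 2 <= sin (\<bar>t\<bar> / 2)" using assms by (intro sin_ge_half) auto
 then have "(\<bar>t\<bar> / 4)^2 <= (sin (\<bar>t\<bar> / 2))^2" by (intro power_mono) auto
 moreover have "cos (2 * (\<bar>t\<bar> / 2)) = 1 - 2 * (sin (\<bar>t\<bar> / 2))^2" by (rule cos_double_sin)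
 then have "cos t = 1 - 2 * (sin (\<bar>t\<bar> / 2))^2" by simp
 ultimately show ?thesis by (simp add: power_divide)
qed

context translator_end
begin

lemma rho_shift: "rh (th + 2 * pi * real_of_int n, z) = rh (th, z)"
 by (rule periodic_int) (rule rho_per)

text \<open>Suppose the surface over the mirror image is lower than \<open>x\<close>. Let
  \<open>d\<close> be the distance from \<open>x\<close> to the plane and \<open>dl\<close> that of
  the plane from the centre. Reflection raises the squared distance to the centre by
  \<open>4 * dl * d\<close>. But at a fixed height this squared distance varies with the angle at a
  rate of at most \<open>5 * eps\<close> times the radius scale, and the angle changes by at most
  \<open>6 * d\<close> divided by that scale. This forces \<open>d = 0\<close>.\<close>

lemma far_reflection:
 assumes cs: "c^2 + s^2 = 1" and l: "a1 * c + a2 * s < l"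
 obtains Z where "!!x y. x \<in> M ==> y \<in> M ==> x $ 1 * c + x $ 2 * s <= l ==> pr y = pr (mirror c s l x) ==> x $ 3 > Z ==> x $ 3 <= y $ 3"
proof -
 define S where "S = \<bar>a1\<bar> + \<bar>a2\<bar> + 1"
 define dl where "dl = l - (a1 * c + a2 * s)"
 have dl: "dl > 0" unfolding dl_def using l by simp
 \<comment> \<open>\<open>5 * 6 * eps = 3 * dl\<close> is less than the gain
   \<open>4 * dl\<close>.\<close>
 define eps where "eps = dl / 10"
 have eps: "eps > 0" unfolding eps_def using dl by simp
 obtain z2 where z2: "!!z th. z >= z2 ==> \<bar>rh' (th, z) - (a2 * cos th - a1 * sin th)\<bar> <= eps"
  using rho_lin[OF eps] unfolding eventually_at_top_linorder by blast
 have "bounded (hr ` (M \<inter> {x. x $ 3 <= z1}))"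
  by (intro compact_imp_bounded compact_continuous_image compact_slab) (auto simp: hr_def intro!: continuous_intros)
 then obtain B where B: "B > 0" "!!x. x \<in> M ==> x $ 3 <= z1 ==> hr x <= B" unfolding bounded_pos by fastforce
 define Q where "Q = 8 * \<bar>l\<bar> + B + 2 + 2 * S + 2 * S * (eps + S) / eps"
 have S1: "S >= 1" unfolding S_def by simp
 have Qt: "2 * S * (eps + S) / eps >= 0" using S1 eps by simp
 have Q: "Q >= 8 * \<bar>l\<bar>" "Q >= B + 2" "Q >= 2 * S" "Q >= 2 * S * (eps + S) / eps" "Q > 0"
  unfolding Q_def using Qt S1 B(1) by linarith+
 show ?thesis
 proof (rule that[of "max z1 (max z2 (Q^2))"], rule ccontr)
  fix x y assume x: "x \<in> M" and y: "y \<in> M" and xl: "x $ 1 * c + x $ 2 * s <= l" and pry: "pr y = pr (mirror c s l x)"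
  and xz: "x $ 3 > max z1 (max z2 (Q^2))" and nle: "\<not> x $ 3 <= y $ 3"
  define z where "z = x $ 3"
  have z: "z > z1" "z >= z2" "z > Q^2" "y $ 3 < z" using xz nle unfolding z_def by auto
  define w where "w = sqrt z"
  have w: "w > Q" unfolding w_def using z(3) by (rule real_less_rsqrt)
  obtain th where "x = vector [rh (th, x $ 3) * cos th, rh (th, x $ 3) * sin th, x $ 3]" using polar[OF x] z(1) unfolding z_def by blast
  then have x12: "x $ 1 = rh (th, z) * cos th" "x $ 2 = rh (th, z) * sin th" unfolding vec3_eq z_def by auto
  define R where "R = rh (th, z)"
  have R: "w <= R" "R <= 2 * w" using rho_bounds[OF z(1), of th] unfolding R_def w_def by auto
  note x12' = x12[folded R_def]
  define d where "d = l - (x $ 1 * c + x $ 2 * s)"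
  have d0: "d >= 0" unfolding d_def using xl by simp
  have y12: "y $ 1 = R * cos th + 2 * d * c" "y $ 2 = R * sin th + 2 * d * s"
  proof -
  have "y $ 1 = x $ 1 + 2 * d * c" "y $ 2 = x $ 2 + 2 * d * s" using pry unfolding pr_eq mirror_nth d_def by simp_all
  then show "y $ 1 = R * cos th + 2 * d * c" "y $ 2 = R * sin th + 2 * d * s" using x12' by simp_all
  qed
  have tt: "(cos th)^2 + (sin th)^2 = 1" by simp
  have de: "R * cos th * c + R * sin th * s = l - d" unfolding d_def x12' by simp
  have hry: "hr y = R^2 + 4 * d * l" unfolding hr_def y12 using cs tt de by algebra
  have xe: "\<bar>R * cos th * c + R * sin th * s\<bar> <= R"
  proof -
  have "(R * cos th * c + R * sin th * s)^2 + (R * cos th * s - R * sin th * c)^2 = R^2" using cs tt by algebra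
  then have "(R * cos th * c + R * sin th * s)^2 <= R^2" by (smt (verit) zero_le_power2)
  then show ?thesis using R w Q by (simp add: abs_le_square_iff[symmetric])
  qed
  have dml: "d * l >= - (R * \<bar>l\<bar>)"
  proof (cases "l >= 0")
  case True
  then have "d * l >= 0" "R * \<bar>l\<bar> >= 0" using d0 R w Q by auto
  then show ?thesis by linarith
  next
  case False
  then have "d <= R" using xe de by linarith
  then have "d * \<bar>l\<bar> <= R * \<bar>l\<bar>" by (rule mult_right_mono) simp
  then show ?thesis using False by simp
  qed
  have "R * (8 * \<bar>l\<bar>) <= R * R" using R w Q by (intro mult_left_mono) auto
  then have "R^2 / 2 <= hr y" unfolding hry using dml by (simp add: power2_eq_square)
  moreover have "w^2 <= R^2" using R w Q by (intro power_mono) auto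
  ultimately have hy: "w^2 / 2 <= hr y" by linarith
  have "(B + 2)^2 <= w^2" using w Q B(1) by (intro power_mono) auto
  moreover have "(B + 2)^2 = B^2 + 4 * B + 4" by (simp add: power2_eq_square algebra_simps)
  ultimately have "B < w^2 / 2" using B(1) zero_le_power2[of B] by linarith
  then have yz: "y $ 3 > z1" using B(2)[OF y] hy by linarith
  obtain th0 where y0: "y = vector [rh (th0, y $ 3) * cos th0, rh (th0, y $ 3) * sin th0, y $ 3]" using polar[OF y yz] by blast
  \<comment> \<open>Selects the polar angle of \<open>y\<close> that is within \<open>pi\<close> of
    that of \<open>x\<close>, as the quadratic lower bound for \<open>1 - cos\<close>
    requires.\<close>
  define n where "n = round ((th - th0) / (2 * pi))"
  define ph where "ph = th0 + 2 * pi * real_of_int n"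
  have near: "\<bar>ph - th\<bar> <= pi"
  proof -
  have "ph - th = 2 * pi * (real_of_int n - (th - th0) / (2 * pi))" unfolding ph_def by (simp add: field_simps)
  then have "\<bar>ph - th\<bar> = 2 * pi * \<bar>real_of_int n - (th - th0) / (2 * pi)\<bar>" by (simp add: abs_mult)
  also have "... <= 2 * pi * (1 / 2)" unfolding n_def by (intro mult_left_mono of_int_round_abs_le) simp
  finally show ?thesis by simp
  qed
  define r where "r = rh (ph, y $ 3)"
  have sc: "sin (a + 2 * pi * real_of_int k) = sin a" "cos (a + 2 * pi * real_of_int k) = cos a" for a k
  by (rule periodic_int[of sin], simp, rule periodic_int[of cos], simp)
  have "cos ph = cos th0" "sin ph = sin th0" "r = rh (th0, y $ 3)"
  unfolding ph_def r_def by (simp_all only: sc rho_shift)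
  then have yr: "y $ 1 = r * cos ph" "y $ 2 = r * sin ph" using y0 unfolding vec3_eq by auto
  have "sqrt (y $ 3) <= r" "0 < sqrt (y $ 3)" using rho_bounds[OF yz, of ph] yz z1 unfolding r_def by auto
  then have r0': "r > 0" by linarith
  have pp: "(cos ph)^2 + (sin ph)^2 = 1" by simp
  have hr2: "hr y = r^2" unfolding hr_def yr using pp by algebra
  have rw: "w / 2 <= r"
  proof (rule power2_le_imp_le)
  have "(w / 2)^2 = w^2 / 4" by (simp add: power_divide)
  then show "(w / 2)^2 <= r^2" using hy hr2 zero_le_power2[of w] by linarith
  qed (use r0' in simp)
  define R' where "R' = rh (ph, z)"
  have rR: "r < R'" unfolding r_def R'_def by (rule rho_less[OF yz z(4)])
  have R': "w <= R'" using rho_bounds[OF z(1), of ph] unfolding R'_def w_def by auto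
  define De where "De = ph - th"
  have "4 * d^2 = (R - r)^2 + 2 * R * r * (1 - cos De)"
  proof -
  have e1: "r * cos ph = R * cos th + 2 * d * c" "r * sin ph = R * sin th + 2 * d * s" using yr y12 by auto
  have "cos De = cos ph * cos th + sin ph * sin th" unfolding De_def by (rule cos_diff)
  moreover have "4 * d^2 = (r * cos ph - R * cos th)^2 + (r * sin ph - R * sin th)^2" unfolding e1 using cs by algebra
  ultimately show ?thesis using tt pp by algebra
  qed
  moreover have "w^2 * De^2 / 8 <= 2 * R * r * (1 - cos De)"
  proof -
  have "w * (w / 2) <= R * r" using R rw w Q by (intro mult_mono) auto
  moreover have "De^2 / 8 <= 1 - cos De" by (rule one_minus_cos_ge) (use near in "simp add: De_def")
  ultimately have "(w * (w / 2)) * (De^2 / 8) <= (R * r) * (1 - cos De)" using R r0' rw w Q by (intro mult_mono mult_nonneg_nonneg) auto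
  then show ?thesis by (simp add: power2_eq_square)
  qed
  ultimately have "w^2 * De^2 / 8 <= 4 * d^2" using zero_le_power2[of "R - r"] by linarith
  then have "w^2 * De^2 <= 36 * d^2" using zero_le_power2[of d] by linarith
  then have "(w * De)^2 <= (6 * d)^2" by (simp add: power_mult_distrib)
  then have wd: "w * \<bar>De\<bar> <= 6 * d"
  unfolding abs_le_square_iff[symmetric] using d0 w Q by (simp add: abs_mult)
  \<comment> \<open>Up to a constant, the squared distance to the centre of the cross-section at
    height \<open>z\<close>. Its derivative is controlled by \<open>rho_lin\<close>.\<close>
  define g where "g = (%t. (rh (t, z))^2 - 2 * rh (t, z) * (a1 * cos t + a2 * sin t))"
  have ar: "\<bar>a1 * cos t + a2 * sin t\<bar> <= S" "\<bar>a2 * cos t - a1 * sin t\<bar> <= S" for t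
  proof -
  have "\<bar>a1 * cos t\<bar> <= \<bar>a1\<bar> * 1" "\<bar>a2 * sin t\<bar> <= \<bar>a2\<bar> * 1" "\<bar>a2 * cos t\<bar> <= \<bar>a2\<bar> * 1" "\<bar>a1 * sin t\<bar> <= \<bar>a1\<bar> * 1"
  unfolding abs_mult by (intro mult_left_mono; simp)+
  then show "\<bar>a1 * cos t + a2 * sin t\<bar> <= S" "\<bar>a2 * cos t - a1 * sin t\<bar> <= S" unfolding S_def by linarith+
  qed
  have lip: "\<bar>g ph - g th\<bar> <= (5 * eps * w) * \<bar>ph - th\<bar>"
  proof -
  define g' where "g' = (%t. 2 * rh (t, z) * (rh' (t, z) - (a2 * cos t - a1 * sin t)) - 2 * rh' (t, z) * (a1 * cos t + a2 * sin t))"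
  have dg: "DERIV g t :> g' t" for t
  unfolding g_def g'_def power2_eq_square
  by (auto intro!: derivative_eq_intros rho_DERIV z simp: algebra_simps)
  have bg: "\<bar>g' t\<bar> <= 5 * eps * w" for t
  proof -
  define D where "D = rh' (t, z) - (a2 * cos t - a1 * sin t)"
  have D: "\<bar>D\<bar> <= eps" unfolding D_def by (rule z2[OF z(2)])
  have r': "\<bar>rh' (t, z)\<bar> <= eps + S" using D ar(2)[of t] unfolding D_def by linarith
  have "\<bar>rh (t, z) * D\<bar> <= (2 * w) * eps"
  proof -
  have "rh (t, z) <= 2 * w" "w <= rh (t, z)" using rho_bounds[OF z(1), of t] unfolding w_def by auto
  then show ?thesis unfolding abs_mult using D w Q by (intro mult_mono) auto
  qed
  moreover have "\<bar>rh' (t, z) * (a1 * cos t + a2 * sin t)\<bar> <= (eps + S) * S"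
  unfolding abs_mult using r' ar(1)[of t] S1 eps by (intro mult_mono) auto
  moreover have "2 * ((eps + S) * S) <= eps * w"
  proof -
  have "2 * S * (eps + S) / eps <= w" using w Q(4) by linarith
  then show ?thesis using eps by (simp add: field_simps)
  qed
  moreover have "g' t = 2 * (rh (t, z) * D) - 2 * (rh' (t, z) * (a1 * cos t + a2 * sin t))" unfolding g'_def D_def by simp
  moreover have "2 * w * eps = 2 * (eps * w)" "5 * eps * w = 5 * (eps * w)" by simp_all
  ultimately show ?thesis by linarith
  qed
  show ?thesis
  using field_differentiable_bound[of UNIV g g' "5 * eps * w" ph th] dg bg by simp
  qed
  \<comment> \<open>The point \<open>y\<close> is below height \<open>z\<close>, so moving outward
    along its ray to the section at height \<open>z\<close> can only increase the squared distance
    to the centre.\<close>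
  have "4 * dl * d <= g ph - g th"
  proof -
  have "a1 * cos ph + a2 * sin ph <= S" using ar(1)[of ph] by (simp add: abs_le_iff)
  moreover have "2 * S <= R'" using R' w Q(3) by linarith
  ultimately have "0 <= (R' - r) * (R' + r - 2 * (a1 * cos ph + a2 * sin ph))" using rR r0' by (intro mult_nonneg_nonneg) auto
  then have "r^2 - 2 * r * (a1 * cos ph + a2 * sin ph) <= g ph"
  unfolding g_def R'_def[symmetric] by (simp add: power2_eq_square algebra_simps)
  moreover have "r^2 - 2 * r * (a1 * cos ph + a2 * sin ph) = g th + 4 * dl * d"
  proof -
  have "r^2 - 2 * r * (a1 * cos ph + a2 * sin ph) = hr y - 2 * (a1 * y $ 1 + a2 * y $ 2)"
  unfolding hr2 yr by (simp add: algebra_simps)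
  also have "... = R^2 + 4 * d * l - 2 * (a1 * (R * cos th + 2 * d * c) + a2 * (R * sin th + 2 * d * s))" unfolding hry y12 by simp
  also have "... = g th + 4 * dl * d" unfolding g_def R_def[symmetric] dl_def by (simp add: algebra_simps)
  finally show ?thesis .
  qed
  ultimately show ?thesis by linarith
  qed
  also have "... <= (5 * eps) * (w * \<bar>De\<bar>)" using lip unfolding De_def by (simp add: mult.assoc)
  also have "... <= (5 * eps) * (6 * d)" using wd eps by (intro mult_left_mono) auto
  also have "... = 3 * dl * d" unfolding eps_def by simp
  finally have "dl * d <= 0" by (simp add: mult.commute)
  then have "d = 0" using dl d0 by (simp add: mult_le_0_iff)
  then have "pr y = pr x" using y12 x12' unfolding pr_eq by simp
  then have "y = x" by (rule graphical[OF y x])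
  then show False using nle by simp
 qed
qed

text \<open>No continuous motion of planes takes place; every plane beyond the centre is treated
  directly. By \<open>far_reflection\<close> bad pairs lie in a compact set, so a largest drop
  \<open>t\<close> exists. The mirror image of \<open>M\<close> lowered by \<open>t\<close> then
  touches \<open>M\<close>, and the contact spreads over all of \<open>M\<close> while staying on
  one side of the plane, although \<open>M\<close> is an entire graph.\<close>

lemma reflection_le:
 assumes cs: "c^2 + s^2 = 1" and l: "a1 * c + a2 * s < l"
  and xy: "x \<in> M" "y \<in> M" "x $ 1 * c + x $ 2 * s <= l" "pr y = pr (mirror c s l x)"
 shows "x $ 3 <= y $ 3"
proof (rule ccontr)
 assume bad: "\<not> x $ 3 <= y $ 3"
 obtain Z where Z: "!!x y. x \<in> M ==> y \<in> M ==> x $ 1 * c + x $ 2 * s <= l ==> pr y = pr (mirror c s l x) ==> x $ 3 > Z ==> x $ 3 <= y $ 3"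
  using far_reflection[OF cs l] by blast
 define KK where "KK = M \<inter> {x. x $ 3 <= Z}"
 define P where "P = (KK \<times> KK) \<inter> {p. pr (snd p) = mirror2 c s l (pr (fst p)) & fst p $ 1 * c + fst p $ 2 * s <= l}"
 have "compact P"
  unfolding P_def KK_def mirror2_def by (intro compact_Int_closed compact_Times compact_slab closed_Collect_conj closed_Collect_eq closed_Collect_le continuous_intros)
 have inP: "(x, y) \<in> P" if "x \<in> M" "y \<in> M" "x $ 1 * c + x $ 2 * s <= l" "pr y = pr (mirror c s l x)" "y $ 3 < x $ 3" for x y
 proof -
  have "x $ 3 <= Z" using Z[OF that(1-4)] that(5) by linarith
  then show ?thesis unfolding P_def KK_def using that by (simp add: pr_mirror)
 qed
 have q0: "(x, y) \<in> P" by (rule inP[OF xy]) (use bad in simp)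
 have "continuous_on P (%p. fst p $ 3 - snd p $ 3)" by (intro continuous_intros)
 from continuous_attains_sup[OF \<open>compact P\<close> _ this] q0
 obtain q where q: "q \<in> P" "!!p. p \<in> P ==> fst p $ 3 - snd p $ 3 <= fst q $ 3 - snd q $ 3" by blast
 define t where "t = fst q $ 3 - snd q $ 3"
 have t0: "t > 0" using q(2)[OF q0] bad unfolding t_def by simp
 have gap: "t' <= t" if "x \<in> M" "x $ 1 * c + x $ 2 * s <= l" "mirror c s l x - t' *\<^sub>R tau \<in> M" for x t'
 proof (cases "t' > 0")
  case True
  have "(x, mirror c s l x - t' *\<^sub>R tau) \<in> P" by (rule inP[OF that(1,3,2)]) (use True in "simp_all add: pr_vertical")
  then show ?thesis using q(2) unfolding t_def by fastforce
 qed (use t0 in simp)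
 define T where "T = {x. mirror c s l x + (- t) *\<^sub>R tau \<in> M & x $ 1 * c + x $ 2 * s <= l}"
 have qm: "fst q \<in> M" "fst q \<in> T"
 proof -
  have "pr (snd q) = pr (mirror c s l (fst q))" using q(1) unfolding P_def by (simp add: pr_mirror)
  then have "mirror c s l (fst q) + (- t) *\<^sub>R tau = snd q" unfolding t_def pr_eq vec3_eq by simp
  then show "fst q \<in> M" "fst q \<in> T" using q(1) unfolding P_def KK_def T_def by auto
 qed
 have "M \<subseteq> T"
 proof (rule connected_spread[OF conM _ qm])
  have "T = (%x. mirror c s l x + (- t) *\<^sub>R tau) -` M \<inter> {x. x $ 1 * c + x $ 2 * s <= l}" unfolding T_def by auto
  moreover have "closed ((%x. mirror c s l x + (- t) *\<^sub>R tau) -` M)"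
  unfolding mirror_def by (intro closed_vimage clM continuous_intros)
  moreover have "closed {x :: real^3. x $ 1 * c + x $ 2 * s <= l}" by (intro closed_Collect_le continuous_intros)
  ultimately show "closed T" by (simp add: closed_Int)
  fix x assume x: "x \<in> M" "x \<in> T"
  define p where "p = mirror c s l x + (- t) *\<^sub>R tau"
  define N where "N = (%x. mirror c s l x + (- t) *\<^sub>R tau) ` M"
  have pM: "p \<in> M" and pN: "p \<in> N" using x unfolding T_def p_def N_def by auto
  \<comment> \<open>The contact is not on the plane: there the mirror image has the same projection,
    and a positive drop would give two points of \<open>M\<close> on one vertical line.\<close>
  define h where "h = l - (x $ 1 * c + x $ 2 * s)"
  have "h ~= 0"
  proof
  assume "h = 0"
  then have "mirror c s l x = x" unfolding h_def mirror_def by simp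
  then have "pr x = pr p" "x $ 3 ~= p $ 3" using t0 unfolding p_def pr_eq by auto
  then show False using graphical[OF x(1) pM] by simp
  qed
  then have h: "h > 0" using x(2) unfolding T_def h_def by simp
  have near: "z $ 1 * c + z $ 2 * s <= l" if "dist z x < h" for z
  proof -
  have cse: "norm (vector [c, s, 0] :: real^3) = 1"
  unfolding norm_eq_1 inner3 using cs by (simp add: power2_eq_square)
  have "\<bar>(z - x) <.> vector [c, s, 0]\<bar> <= norm (z - x) * norm (vector [c, s, 0] :: real^3)" by (rule Cauchy_Schwarz_ineq2)
  then have "\<bar>(z $ 1 * c + z $ 2 * s) - (x $ 1 * c + x $ 2 * s)\<bar> <= dist z x"
  unfolding cse inner3 dist_norm by (simp add: algebra_simps)
  then show ?thesis using that unfolding h_def by linarith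
  qed
  have "\<exists>r>0. \<forall>w\<in>N. dist w p < r --> w \<in> M"
  proof (rule strong_maximum_principle[OF _ pN patch[OF pM] pM, of 1 h])
  show "translator_patch N p" unfolding N_def p_def by (rule mirror_isometry(1)[OF cs patch[OF x(1)]])
  fix w t' :: _ assume w: "w \<in> N" "dist w p < h" "0 < t'" "t' < (1 :: real)"
  then obtain z where z: "z \<in> M" "w = mirror c s l z + (- t) *\<^sub>R tau" unfolding N_def by blast
  have "dist z x < h" using w(2) unfolding z(2) p_def mirror_isometry(2)[OF cs] .
  from gap[OF z(1) near[OF this], of "t + t'"] w(3)
  show "w - t' *\<^sub>R tau \<notin> M" unfolding z(2) by (auto simp: algebra_simps)
  qed (use h in auto)
  then obtain r where r: "r > 0" "!!w. w \<in> N ==> dist w p < r ==> w \<in> M" by blast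
  show "\<exists>r>0. \<forall>z\<in>M. dist z x < r --> z \<in> T"
  proof (intro exI conjI ballI impI)
  show "min r h > 0" using r h by simp
  fix z assume z: "z \<in> M" "dist z x < min r h"
  have "mirror c s l z + (- t) *\<^sub>R tau \<in> M"
  proof (rule r(2))
  show "mirror c s l z + (- t) *\<^sub>R tau \<in> N" unfolding N_def using z(1) by (rule imageI)
  show "dist (mirror c s l z + (- t) *\<^sub>R tau) p < r" unfolding p_def mirror_isometry(2)[OF cs] using z(2) by simp
  qed
  then show "z \<in> T" unfolding T_def using near z(2) by simp
  qed
 qed
 moreover obtain z where z: "z \<in> M" "pr z = ((l + 1) * c, (l + 1) * s)" using entire by blast
 moreover have "z $ 1 * c + z $ 2 * s = (l + 1) * (c^2 + s^2)"
  using z(2) unfolding pr_def by (simp add: power2_eq_square algebra_simps)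
 ultimately show False unfolding T_def cs by auto
qed

text \<open>Planes beyond the centre tend to the plane through it, and the height is
  continuous.\<close>

lemma hgt_mirror2_le:
 assumes cs: "c^2 + s^2 = 1" and v: "fst v * c + snd v * s <= a1 * c + a2 * s"
 shows "hgt v <= hgt (mirror2 c s (a1 * c + a2 * s) v)"
proof -
 let ?l = "a1 * c + a2 * s"
 obtain x where x: "x \<in> M" "pr x = v" using entire by blast
 have le: "hgt v <= hgt (mirror2 c s l v)" if l: "l > ?l" for l
 proof -
  obtain y where y: "y \<in> M" "pr y = mirror2 c s l v" using entire by blast
  have "x $ 3 <= y $ 3"
  proof (rule reflection_le[OF cs l x(1) y(1)])
  have "fst v = x $ 1" "snd v = x $ 2" using x(2) unfolding pr_def by auto
  then show "x $ 1 * c + x $ 2 * s <= l" using v l by simp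
  show "pr y = pr (mirror c s l x)" using x(2) y(2) by (simp only: pr_mirror)
  qed
  then show ?thesis using x y mem_iff[of x] mem_iff[of y] by simp
 qed
 have "isCont hgt w" for w using continuous_hgt unfolding continuous_on_eq_continuous_at[OF open_UNIV] by (rule bspec) simp
 then have "((%l. hgt (mirror2 c s l v)) \<longlongrightarrow> hgt (mirror2 c s ?l v)) (at_right ?l)"
  by (rule isCont_tendsto_compose) (auto simp: mirror2_def intro!: tendsto_eq_intros)
 then show ?thesis
  by (rule tendsto_lowerbound) (use le in \<open>auto simp: eventually_at_right_field intro: exI[of _ "?l + 1"]\<close>)
qed

text \<open>Opposite normals give opposite inequalities, hence symmetry in each vertical plane
  through the centre; two points at equal distance from the centre are exchanged by such a
  reflection.\<close>

lemma hgt_symmetric: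
 assumes "(fst v - a1)^2 + (snd v - a2)^2 = (fst w - a1)^2 + (snd w - a2)^2"
 shows "hgt v = hgt w"
proof -
 have eq: "hgt v = hgt (mirror2 c s (a1 * c + a2 * s) v)" if cs: "c^2 + s^2 = 1" and v: "fst v * c + snd v * s <= a1 * c + a2 * s" for c s v
 proof (rule antisym)
  let ?l = "a1 * c + a2 * s"
  show "hgt v <= hgt (mirror2 c s ?l v)" by (rule hgt_mirror2_le[OF that])
  define w where "w = mirror2 c s ?l v"
  have "fst w * c + snd w * s = 2 * ?l - (fst v * c + snd v * s)"
  unfolding w_def mirror2_def fst_conv snd_conv using cs by algebra
  then have "fst w * (- c) + snd w * (- s) <= a1 * (- c) + a2 * (- s)" using v by simp
  moreover have "(- c)^2 + (- s)^2 = 1" using cs by simp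
  ultimately have "hgt w <= hgt (mirror2 (- c) (- s) (a1 * (- c) + a2 * (- s)) w)" using hgt_mirror2_le by blast
  moreover have "mirror2 (- c) (- s) (a1 * (- c) + a2 * (- s)) w = mirror2 c s ?l w"
  unfolding mirror2_def by (simp add: algebra_simps)
  moreover have "mirror2 c s ?l w = v" unfolding w_def by (rule mirror2_involutive[OF cs])
  ultimately show "hgt (mirror2 c s ?l v) <= hgt v" unfolding w_def by simp
 qed
 show ?thesis
 proof (cases "v = w")
  case False
  define D where "D = sqrt ((fst w - fst v)^2 + (snd w - snd v)^2)"
  have D2: "D^2 = (fst w - fst v)^2 + (snd w - snd v)^2" unfolding D_def by simp
  have "(fst w - fst v)^2 + (snd w - snd v)^2 > 0" using False by (auto simp: prod_eq_iff sum_power2_gt_zero_iff)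
  then have D: "D > 0" unfolding D_def by simp
  define c s where "c = (fst w - fst v) / D" and "s = (snd w - snd v) / D"
  have e: "fst w - fst v = D * c" "snd w - snd v = D * s" unfolding c_def s_def using D by simp_all
  have cs: "c^2 + s^2 = 1"
  proof -
  have "D^2 * (c^2 + s^2) = D^2 * 1" using D2 unfolding e by (simp add: power_mult_distrib distrib_left)
  then show ?thesis using D by simp
  qed
  have w12: "fst w = fst v + D * c" "snd w = snd v + D * s" using e by simp_all
  \<comment> \<open>Equality of the distances says that the perpendicular bisector of the two points
    passes through the centre.\<close>
  have "D * (2 * (a1 * c + a2 * s - (fst v * c + snd v * s))) = D * D"
  using assms cs unfolding w12 by algebra
  then have k: "2 * (a1 * c + a2 * s - (fst v * c + snd v * s)) = D" using D by simp
  then have "0 < 2 * (a1 * c + a2 * s - (fst v * c + snd v * s))" using D by (simp only:)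
  then have "0 < a1 * c + a2 * s - (fst v * c + snd v * s)" by (rule zero_less_mult_pos) simp
  then have "fst v * c + snd v * s <= a1 * c + a2 * s" by (simp only: diff_gt_0_iff_gt less_imp_le)
  moreover have "mirror2 c s (a1 * c + a2 * s) v = w"
  unfolding mirror2_def k using w12 by (simp add: prod_eq_iff)
  ultimately show ?thesis using eq[OF cs] by metis
 qed simp
qed

end

section \<open>Convexity and smoothness of the radial graph\<close>

text \<open>At a zero of the radial slope ratio \<open>k\<close> the equation forces \<open>k' > 0\<close> and where \<open>k = 1\<close> it forces
 \<open>k' < 0\<close>, so \<open>k\<close> cannot leave the interval \<open>(0, 1)\<close>.\<close>

lemma slope_ratio_trapped:
 fixes k :: "real => real"
 assumes d: "!!r. r > 0 ==> DERIV k r :> ((1 - k r) * (1 + r^2 * (k r)^2) - k r) / r"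
  and l: "(k \<longlongrightarrow> 1 / 2) (at_right 0)" and r: "r > 0"
 shows "0 < k r & k r < 1"
proof (rule ccontr)
 assume bad: "\<not> (0 < k r & k r < 1)"
 have "\<forall>\<^sub>F x in at_right 0. 0 < k x & k x < 1"
  by (intro eventually_conj order_tendstoD[OF l]) auto
 then obtain r0 where r0: "r0 > 0" "!!x. 0 < x ==> x < r0 ==> 0 < k x & k x < 1"
  unfolding eventually_at_right_field by blast
 define B where "B = {x. r0 / 2 <= x & x <= r & (k x <= 0 \<or> 1 <= k x)}"
 have cont: "continuous_on {r0 / 2..r} k"
  by (intro continuous_at_imp_continuous_on ballI, rule DERIV_isCont[OF d]) (use r0(1) in auto)
 have Be: "B = {x \<in> {r0 / 2..r}. k x <= 0} \<union> {x \<in> {r0 / 2..r}. 1 <= k x}" unfolding B_def by auto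
 have "closed B" unfolding Be
  by (intro closed_Un continuous_on_closed_Collect_le cont continuous_intros closed_atLeastAtMost)
 moreover have rr: "r0 <= r" using bad r0(2)[of r] r by fastforce
 then have rB: "r \<in> B" unfolding B_def using bad r0(1) by auto
 moreover have "bdd_below B" unfolding B_def by (rule bdd_belowI[of _ "r0 / 2"]) auto
 ultimately have "Inf B \<in> B" using closed_contains_Inf[of B] by blast
 define x where "x = Inf B"
 have xB: "x \<in> B" unfolding x_def by (rule \<open>Inf B \<in> B\<close>)
 have x0: "x > 0" using xB r0(1) unfolding B_def by auto
 have before: "0 < k y & k y < 1" if "0 < y" "y < x" for y
 proof (cases "y < r0")
  case False
  then have "y \<notin> B" using cInf_lower[OF _ \<open>bdd_below B\<close>, of y] that(2) unfolding x_def by auto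
  then show ?thesis using False that xB unfolding B_def by auto
 qed (use r0(2) that in auto)
 have ck: "isCont k x" using d[OF x0] by (rule DERIV_isCont)
 have lim: "(k \<longlongrightarrow> k x) (at_left x)" using ck unfolding isCont_def by (rule filterlim_at_split[THEN iffD1, THEN conjunct1])
 have ev: "\<forall>\<^sub>F y in at_left x. 0 < k y & k y < 1"
  unfolding eventually_at_left_field using before x0 by (intro exI[of _ 0]) auto
 have "0 <= k x" by (rule tendsto_lowerbound[OF lim]) (use ev in "auto elim: eventually_mono")
 moreover have "k x <= 1" by (rule tendsto_upperbound[OF lim]) (use ev in "auto elim: eventually_mono")
 ultimately consider "k x = 0" | "k x = 1" using xB unfolding B_def by force
 then show False
 proof cases
  case 1
  then have kd: "DERIV k x :> 1 / x" using d[OF x0] by simp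
  then obtain e where e: "e > 0" "\<forall>h>0. h < e --> k (x - h) < k x" using DERIV_pos_inc_left[OF kd] x0 by auto
  define h where "h = min (e / 2) (x / 2)"
  have "0 < h" "h < e" "h < x" using e(1) x0 unfolding h_def by auto
  then show False using e(2) before[of "x - h"] 1 by fastforce
 next
  case 2
  then have kd: "DERIV k x :> - 1 / x" using d[OF x0] by simp
  then obtain e where e: "e > 0" "\<forall>h>0. h < e --> k x < k (x - h)" using DERIV_neg_dec_left[OF kd] x0 by auto
  define h where "h = min (e / 2) (x / 2)"
  have "0 < h" "h < e" "h < x" using e(1) x0 unfolding h_def by auto
  then show False using e(2) before[of "x - h"] 2 by fastforce
 qed
qed

text \<open>Differentiating the rotation identity determines the Hessian: off the origin its
  eigenvalues are \<open>ph2\<close> in the radial direction and the slope ratio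
  \<open>k = ph1 / t\<close> in the angular one. The equation becomes
  \<open>ph2 = (1 - k) * (1 + t^2 * k^2)\<close>, so \<open>0 < k < 1\<close> makes both
  positive.\<close>

lemma radial_translator_convex:
 fixes u :: "real \<times> real => real"
 assumes sm: "smooth2 UNIV u" and rot: "!!x y. x * D2 u (x, y) = y * D1 u (x, y)"
  and pde: "!!z. (1 + (D2 u z)^2) * D1 (D1 u) z - 2 * D1 u z * D2 u z * D1 (D2 u) z + (1 + (D1 u z)^2) * D2 (D2 u) z
  = 1 + (D1 u z)^2 + (D2 u z)^2"
 shows "D1 (D1 u) z > 0" "D1 (D1 u) z * D2 (D2 u) z - (D1 (D2 u) z)^2 > 0"
proof -
 have comm: "D2 (D1 u) z = D1 (D2 u) z" for z using smooth2_commute[OF open_UNIV sm] by simp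
 note d = smooth2_differentiable[OF sm UNIV_I]
 note d1 = smooth2_differentiable[OF smooth2_D(1)[OF sm] UNIV_I]
 note d2 = smooth2_differentiable[OF smooth2_D(2)[OF sm] UNIV_I]
 have e: "(%z. fst z * D2 u z) = (%z. snd z * D1 u z)" using rot by (auto simp: fun_eq_iff)
 have df: "fst differentiable (at z)" "snd differentiable (at z)" for z :: "real \<times> real"
  using smooth2_differentiable[of UNIV fst z] smooth2_differentiable[of UNIV snd z] by auto
 have I: "D2 u z + fst z * D1 (D2 u) z = snd z * D1 (D1 u) z" "fst z * D2 (D2 u) z = D1 u z + snd z * D1 (D2 u) z" for z
  using fun_cong[OF arg_cong[OF e, of D1], of z] fun_cong[OF arg_cong[OF e, of D2], of z]
  unfolding D_mult(2,3)[OF df(1) d2] D_mult(2,3)[OF df(2) d1] comm by simp_all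
 have o: "D1 u 0 = 0" "D2 u 0 = 0" using I[of 0] by simp_all
 have dc: "D1 (D2 u) differentiable (at z)" "D1 (D1 u) differentiable (at z)" "D2 (D2 u) differentiable (at z)" for z
  using sm by (auto intro!: smooth2_differentiable[where U = UNIV] smooth2_D)
 have e1: "(%z. D2 u z + fst z * D1 (D2 u) z) = (%z. snd z * D1 (D1 u) z)" and e2: "(%z. fst z * D2 (D2 u) z) = (%z. D1 u z + snd z * D1 (D2 u) z)"
  using I by (auto simp: fun_eq_iff)
 have o12: "D1 (D2 u) 0 = 0" and o22: "D2 (D2 u) 0 = D1 (D1 u) 0"
  using fun_cong[OF arg_cong[OF e1, of D1], of 0] fun_cong[OF arg_cong[OF e2, of D1], of 0]
  unfolding D_add(2)[OF d2 D_mult(1)[OF df(1) dc(1)]] D_add(2)[OF d1 D_mult(1)[OF df(2) dc(1)]]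
  D_mult(2)[OF df(1) dc(1)] D_mult(2)[OF df(2) dc(2)] D_mult(2)[OF df(1) dc(3)] D_mult(2)[OF df(2) dc(1)] by simp_all
 \<comment> \<open>At the origin the gradient vanishes and the Hessian is a multiple of the identity
   of trace 1; this is also the initial value \<open>1 / 2\<close> of the slope ratio.\<close>
 have o11: "D1 (D1 u) 0 = 1 / 2" using pde[of 0] o o12 o22 by simp
 show "D1 (D1 u) z > 0" "D1 (D1 u) z * D2 (D2 u) z - (D1 (D2 u) z)^2 > 0"
 proof (atomize (full), cases "z = 0")
  case True
  then show "D1 (D1 u) z > 0 & D1 (D1 u) z * D2 (D2 u) z - (D1 (D2 u) z)^2 > 0" using o11 o12 o22 by simp
 next
  case False
  define r where "r = norm z"
  have r: "r > 0" unfolding r_def using False by simp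
  define c s where "c = fst z / r" and "s = snd z / r"
  have zr: "z = (r * c, r * s)" unfolding c_def s_def using r by simp
  have cs: "c^2 + s^2 = 1"
  proof -
  have "r^2 = (fst z)^2 + (snd z)^2" unfolding r_def norm_prod_def by simp
  moreover have "c^2 + s^2 = ((fst z)^2 + (snd z)^2) / r^2" unfolding c_def s_def by (simp add: power_divide add_divide_distrib)
  ultimately have "c^2 + s^2 = r^2 / r^2" by simp
  then show ?thesis using r by simp
  qed
  define ph1 where "ph1 = (%t. c * D1 u (t * c, t * s) + s * D2 u (t * c, t * s))"
  define ph2 where "ph2 = (%t. c^2 * D1 (D1 u) (t * c, t * s) + 2 * c * s * D1 (D2 u) (t * c, t * s) + s^2 * D2 (D2 u) (t * c, t * s))"
  have ray: "DERIV (%t. f (t * c, t * s)) t :> c * D1 f (t * c, t * s) + s * D2 f (t * c, t * s)"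
  if "f differentiable (at (t * c, t * s))" for f t
  proof -
  have "((%t. (t * c, t * s)) has_derivative (%h. (h * c, h * s))) (at t)"
  by (auto intro!: derivative_eq_intros)
  from has_derivative_compose[OF this has_derivative_D[OF that]]
  show ?thesis unfolding has_field_derivative_def by (rule has_derivative_eq_rhs) (auto simp: algebra_simps)
  qed
  have Dph1: "DERIV ph1 t :> ph2 t" for t
  unfolding ph1_def ph2_def
  by (rule DERIV_cong[OF DERIV_add[OF DERIV_cmult[OF ray[OF d1]] DERIV_cmult[OF ray[OF d2]]]])
  (simp add: comm algebra_simps power2_eq_square)
  have str: "D1 u (t * c, t * s) = c * ph1 t & D2 u (t * c, t * s) = s * ph1 t" if "t > 0" for t
  proof -
  have "(t * c) * D2 u (t * c, t * s) = (t * s) * D1 u (t * c, t * s)" by (rule rot)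
  then have q: "c * D2 u (t * c, t * s) = s * D1 u (t * c, t * s)" using that by simp
  show ?thesis unfolding ph1_def by (intro conjI) (use q cs in algebra)+
  qed
  have hess: "D1 (D1 u) (t * c, t * s) = s^2 * k + c^2 * ph2 t" "D1 (D2 u) (t * c, t * s) = c * s * (ph2 t - k)"
  "D2 (D2 u) (t * c, t * s) = c^2 * k + s^2 * ph2 t" if t: "t > 0" and k: "k = ph1 t / t" for t k
  proof -
  define a b g where "a = D1 (D1 u) (t * c, t * s)" and "b = D1 (D2 u) (t * c, t * s)" and "g = D2 (D2 u) (t * c, t * s)"
  have kt: "ph1 t = k * t" using t k by simp
  have "s * (k * t) + t * c * b = t * s * a" "t * c * g = c * (k * t) + t * s * b"
  using I[of "(t * c, t * s)"] str[OF t] unfolding a_def b_def g_def kt by simp_all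
  then have "t * (s * k + c * b) = t * (s * a)" "t * (c * g) = t * (c * k + s * b)" by (simp_all add: algebra_simps)
  then have i: "s * a = s * k + c * b" "c * g = c * k + s * b" using t by auto
  have p: "ph2 t = c^2 * a + 2 * c * s * b + s^2 * g" unfolding ph2_def a_def b_def g_def by simp
  have c2: "c^2 = 1 - s^2" using cs by simp
  have "a = (c^2 + s^2) * a" "b = (c^2 + s^2) * b" "g = (c^2 + s^2) * g" using cs by simp_all
  show "a = s^2 * k + c^2 * ph2 t" "b = c * s * (ph2 t - k)" "g = c^2 * k + s^2 * ph2 t"
  unfolding p using i cs by algebra+
  qed
  have ode: "ph2 t = (1 - k) * (1 + t^2 * k^2)" if t: "t > 0" and k: "k = ph1 t / t" for t k
  proof -
  have kt: "ph1 t = k * t" using t k by simp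
  have "(1 + (s * (k * t))^2) * (s^2 * k + c^2 * ph2 t) - 2 * (c * (k * t)) * (s * (k * t)) * (c * s * (ph2 t - k)) + (1 + (c * (k * t))^2) * (c^2 * k + s^2 * ph2 t)
  = 1 + (c * (k * t))^2 + (s * (k * t))^2"
  using pde[of "(t * c, t * s)"] str[OF t] hess[OF t k] unfolding kt by simp
  then show ?thesis using cs by algebra
  qed
  define k where "k = (%t. ph1 t / t)"
  have kk: "0 < k r & k r < 1"
  proof (rule slope_ratio_trapped[OF _ _ r])
  fix t :: real assume t: "t > 0"
  have "DERIV k t :> (ph2 t * t - ph1 t * 1) / (t * t)"
  unfolding k_def by (rule DERIV_divide[OF Dph1 DERIV_ident]) (use t in simp)
  moreover have "(ph2 t * t - ph1 t * 1) / (t * t) = (ph2 t - k t) / t"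
  unfolding k_def using t by (simp add: field_simps)
  ultimately show "DERIV k t :> ((1 - k t) * (1 + t^2 * (k t)^2) - k t) / t"
  using ode[OF t, of "k t"] by (simp add: k_def)
  next
  have p0: "ph1 0 = 0" "ph2 0 = 1 / 2"
  unfolding ph1_def ph2_def using cs by (simp_all add: zero_prod_def[symmetric] o o11 o12 o22 flip: add_divide_distrib)
  have "((%h. (ph1 (0 + h) - ph1 0) / h) \<longlongrightarrow> ph2 0) (at 0)" using Dph1[of 0] unfolding DERIV_def .
  then have "(k \<longlongrightarrow> 1 / 2) (at 0)" unfolding p0 k_def by simp
  then show "(k \<longlongrightarrow> 1 / 2) (at_right 0)" by (rule tendsto_within_subset) simp
  qed
  have P2: "ph2 r > 0" using ode[OF r, of "k r"] kk by (simp add: k_def add_pos_nonneg)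
  have zz: "z = (r * c, r * s)" by (rule zr)
  have h: "D1 (D1 u) z = s^2 * k r + c^2 * ph2 r" "D1 (D2 u) z = c * s * (ph2 r - k r)" "D2 (D2 u) z = c^2 * k r + s^2 * ph2 r"
  unfolding zz using hess[OF r, of "k r"] by (simp_all add: k_def)
  have "D1 (D1 u) z > 0"
  proof (cases "s = 0")
  case True
  then show ?thesis unfolding h using cs P2 by simp
  next
  case False
  then have "s^2 * k r > 0" using kk by simp
  moreover have "c^2 * ph2 r >= 0" using P2 by simp
  ultimately show ?thesis unfolding h by linarith
  qed
  moreover have "D1 (D1 u) z * D2 (D2 u) z - (D1 (D2 u) z)^2 = k r * ph2 r"
  unfolding h using cs by algebra
  ultimately show "D1 (D1 u) z > 0 & D1 (D1 u) z * D2 (D2 u) z - (D1 (D2 u) z)^2 > 0" using kk P2 by simp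
 qed
qed

text \<open>Implicit differentiation of a function known only to be continuous. The linearisation
  error \<open>R\<close> is at most \<open>e'\<close> times the distance in space, which is bounded
  by a multiple of the horizontal displacement plus \<open>R\<close>; with
  \<open>e' <= 1 / 2\<close> this last \<open>R\<close> is absorbed.\<close>

lemma has_derivative_implicit:
 fixes G :: "real^3 => real" and u :: "real \<times> real => real"
 assumes G: "(G has_derivative (%v. g <.> v)) (at q)" and g: "g $ 3 ~= 0" and u: "isCont u (pr q)" and q: "q $ 3 = u (pr q)"
  and ev: "\<forall>\<^sub>F v in nhds (pr q). G (vector [fst v, snd v, u v]) = 0"
 shows "(u has_derivative (%h. fst h * (- g $ 1 / g $ 3) + snd h * (- g $ 2 / g $ 3))) (at (pr q))"
 unfolding has_derivative_at_alt
proof (intro conjI allI impI)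
 let ?L = "%h :: real \<times> real. fst h * (- g $ 1 / g $ 3) + snd h * (- g $ 2 / g $ 3)"
 define X where "X = (%v. vector [fst v, snd v, u v] :: real^3)"
 have Xq: "X (pr q) = q" unfolding X_def vec3_eq using q by (simp add: pr_def)
 show bl: "bounded_linear ?L" by (intro bounded_linear_add bounded_linear_mult_const bounded_linear_fst bounded_linear_snd)
 fix e :: real assume e: "e > 0"
 define C where "C = \<bar>g $ 1 / g $ 3\<bar> + \<bar>g $ 2 / g $ 3\<bar>"
 have C: "\<bar>?L h\<bar> <= C * norm h" for h
 proof -
  have "\<bar>fst h\<bar> <= norm h" "\<bar>snd h\<bar> <= norm h"
  using norm_fst_le[of "fst h" "snd h"] norm_snd_le[of "snd h" "fst h"] by simp_all
  then have "\<bar>fst h * (- g $ 1 / g $ 3)\<bar> <= norm h * \<bar>g $ 1 / g $ 3\<bar>" "\<bar>snd h * (- g $ 2 / g $ 3)\<bar> <= norm h * \<bar>g $ 2 / g $ 3\<bar>"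
  unfolding abs_mult by (intro mult_mono; simp)+
  then show ?thesis unfolding C_def mult.commute[of _ "norm h"] distrib_left by (rule order_trans[OF abs_triangle_ineq add_mono])
 qed
 have C0: "C >= 0" unfolding C_def by simp
 define e' where "e' = min (1 / 2) (e / (2 * (1 + C)))"
 have e': "e' > 0" "e' <= 1 / 2" "2 * e' * (1 + C) <= e"
 proof -
  show "e' > 0" unfolding e'_def using e C0 by auto
  show "e' <= 1 / 2" unfolding e'_def by (rule min.cobounded1)
  have "e' <= e / (2 * (1 + C))" unfolding e'_def by simp
  then show "2 * e' * (1 + C) <= e" using C0 by (simp add: field_simps)
 qed
 have "0 < e' * \<bar>g $ 3\<bar>" using e' g by simp
 then have "\<exists>d>0. ALL y. norm (y - q) < d --> norm (G y - G q - g <.> (y - q)) <= e' * \<bar>g $ 3\<bar> * norm (y - q)"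
  using G[unfolded has_derivative_at_alt, THEN conjunct2] by (elim allE impE) assumption+
 then obtain d where d: "d > 0" "ALL y. norm (y - q) < d --> norm (G y - G q - g <.> (y - q)) <= e' * \<bar>g $ 3\<bar> * norm (y - q)"
  by (elim exE conjE) (rule that)
 have "isCont X (pr q)"
 proof -
  have "vector [a, b, c] = a *\<^sub>R axis 1 1 + b *\<^sub>R axis 2 1 + c *\<^sub>R tau" for a b c :: real
  unfolding vec3_eq by (simp add: axis_def)
  then show ?thesis unfolding X_def by (simp only:) (intro continuous_intros u)
 qed
 then have "(X \<longlongrightarrow> X (pr q)) (nhds (pr q))" unfolding isCont_def tendsto_at_iff_tendsto_nhds .
 then have "\<forall>\<^sub>F v in nhds (pr q). dist (X v) q < d" using d(1) unfolding Xq by (rule tendstoD)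
 then have "\<forall>\<^sub>F v in nhds (pr q). dist (X v) q < d & G (X v) = 0" using ev unfolding X_def by (rule eventually_conj)
 then obtain d' where d': "d' > 0" "!!v. dist v (pr q) < d' ==> dist (X v) q < d & G (X v) = 0"
  unfolding eventually_nhds_metric by blast
 have Gq: "G q = 0" using d'(2)[of "pr q"] d'(1) Xq by simp
 show "\<exists>d>0. ALL y. norm (y - pr q) < d --> norm (u y - u (pr q) - ?L (y - pr q)) <= e * norm (y - pr q)"
 proof (intro exI[of _ d'] conjI d' allI impI)
  fix v assume "norm (v - pr q) < d'"
  then have h: "norm (X v - q) < d" "G (X v) = 0" using d'(2)[of v] by (auto simp: dist_norm)
  define w where "w = v - pr q"
  define De where "De = u v - u (pr q)"
  define R where "R = \<bar>De - ?L w\<bar>"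
  have comp: "(X v - q) $ 1 = fst w" "(X v - q) $ 2 = snd w" "(X v - q) $ 3 = De"
  unfolding X_def w_def De_def using q by (simp_all add: pr_def)
  have "g <.> (X v - q) = g $ 3 * (De - ?L w)" unfolding inner3 comp using g by (simp add: field_simps)
  then have "\<bar>g $ 3\<bar> * R <= e' * \<bar>g $ 3\<bar> * norm (X v - q)"
  using d(2)[rule_format, OF h(1)] h(2) Gq unfolding R_def by (simp add: abs_mult)
  then have "\<bar>g $ 3\<bar> * R <= \<bar>g $ 3\<bar> * (e' * norm (X v - q))" by (simp add: mult.left_commute mult.assoc)
  then have 1: "R <= e' * norm (X v - q)" using g by simp
  have "norm (X v - q) <= norm w + \<bar>De\<bar>"
  proof (rule power2_le_imp_le)
  have "(norm (X v - q))^2 = (norm w)^2 + De^2" unfolding norm3 hr_def comp norm_prod_def by simp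
  moreover have "(norm w + \<bar>De\<bar>)^2 = (norm w)^2 + 2 * norm w * \<bar>De\<bar> + De^2" by (simp add: power2_sum)
  moreover have "2 * norm w * \<bar>De\<bar> >= 0" by simp
  ultimately show "(norm (X v - q))^2 <= (norm w + \<bar>De\<bar>)^2" by linarith
  qed simp
  moreover have "\<bar>De\<bar> <= R + C * norm w" using C[of w] unfolding R_def by linarith
  ultimately have "norm (X v - q) <= (1 + C) * norm w + R" by (simp add: algebra_simps)
  then have "e' * norm (X v - q) <= e' * ((1 + C) * norm w + R)" using e' by (intro mult_left_mono) auto
  moreover have "e' * R <= 1 / 2 * R" using e' unfolding R_def by (intro mult_right_mono) auto
  ultimately have "R <= 2 * (e' * ((1 + C) * norm w))" using 1 by (simp add: distrib_left)
  also have "... = 2 * e' * (1 + C) * norm w" by simp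
  also have "... <= e * norm w" using e' by (intro mult_right_mono) auto
  finally show "norm (u v - u (pr q) - ?L (v - pr q)) <= e * norm (v - pr q)" unfolding R_def De_def w_def by simp
 qed
qed

text \<open>The centred surface as the graph of a continuous rotationally symmetric function.
  Smoothness of \<open>u\<close> is derived from the patches, after vertical tangent planes have
  been excluded.\<close>

locale radial_translator =
 fixes M :: "(real^3) set" and u :: "real \<times> real => real"
 assumes patch: "!!x. x \<in> M ==> translator_patch M x"
  and mem: "!!x. x \<in> M \<longleftrightarrow> x $ 3 = u (pr x)" and cont: "continuous_on UNIV u"
  and sym: "!!v w. (fst v)^2 + (snd v)^2 = (fst w)^2 + (snd w)^2 ==> u v = u w"
begin

lemma isCont_u: "isCont u v"
 using cont unfolding continuous_on_eq_continuous_at[OF open_UNIV] by (rule bspec) simp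

lemma sym_hr: "hr x = hr y ==> u (pr x) = u (pr y)"
 by (rule sym) (simp add: hr_def pr_def)

lemma frame_derivatives:
 assumes fr: "tframe M p e1 e2 n h dl eta" and x: "x \<in> ball p dl"
 shows "(lev p e1 e2 n h has_derivative (%v. nrm e1 e2 n h (proj p e1 e2 x) <.> v)) (at x)"
  "((%x. nrm e1 e2 n h (proj p e1 e2 x)) has_derivative hss e1 e2 h (proj p e1 e2 x)) (at x)"
  "x \<in> M \<longleftrightarrow> lev p e1 e2 n h x = 0"
proof -
 note pz = tframe_proj_in[OF fr x] and sm = tframeD(4)[OF fr]
 show "(lev p e1 e2 n h has_derivative (%v. nrm e1 e2 n h (proj p e1 e2 x) <.> v)) (at x)"
  by (rule lev_has_derivative[OF smooth2_differentiable[OF sm pz]])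
 show "((%x. nrm e1 e2 n h (proj p e1 e2 x)) has_derivative hss e1 e2 h (proj p e1 e2 x)) (at x)"
  by (rule nrm_has_derivative[OF smooth2_differentiable[OF smooth2_D(1)[OF sm] pz] smooth2_differentiable[OF smooth2_D(2)[OF sm] pz]])
 show "x \<in> M \<longleftrightarrow> lev p e1 e2 n h x = 0" by (rule tframeD(6)[OF fr x])
qed

text \<open>If the tangent plane is vertical at \<open>q\<close>, a point of \<open>M\<close> close to \<open>q\<close> on the inner side (off the axis), or a pair of
 opposite points (on the axis), contradicts the monotonicity of the level function in the normal direction.\<close>

lemma not_vertical:
 assumes fr: "tframe M p e1 e2 n h dl eta" and q: "q \<in> M" "q \<in> ball p dl"
 shows "nrm e1 e2 n h (proj p e1 e2 q) $ 3 ~= 0"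
proof
 define G where "G = lev p e1 e2 n h"
 define g where "g = (%x. nrm e1 e2 n h (proj p e1 e2 x))"
 define H where "H = hss e1 e2 h (proj p e1 e2 q)"
 assume "nrm e1 e2 n h (proj p e1 e2 q) $ 3 = 0"
 then have g3: "g q $ 3 = 0" unfolding g_def .
 have dG: "(G has_derivative (%v. g x <.> v)) (at x)" if "x \<in> ball p dl" for x
  using frame_derivatives(1)[OF fr that] unfolding G_def g_def .
 have dg: "(g has_derivative H) (at q)"
  using frame_derivatives(2)[OF fr q(2)] unfolding g_def H_def .
 have mG: "x \<in> M \<longleftrightarrow> G x = 0" if "x \<in> ball p dl" for x
  using frame_derivatives(3)[OF fr that] unfolding G_def .
 have le: "(g q <.> g q) * (tr3 H + g q <.> tau) = H (g q) <.> g q" "g q <.> g q > 0"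
  unfolding g_def H_def
  by (rule tframe_level_equation(1)[OF fr tframe_proj_in[OF fr q(2)]])
  (unfold tframe_level_equation(2)[OF fr tframe_proj_in[OF fr q(2)]], intro add_pos_nonneg, auto)
 obtain eps0 where eps0: "eps0 > 0" "ball q eps0 \<subseteq> ball p dl" using q(2) open_ball open_contains_ball by metis
 have line: "DERIV (%t. G (y + t *\<^sub>R v)) t :> g (y + t *\<^sub>R v) <.> v" if "y + t *\<^sub>R v \<in> ball q eps0" for y v t
 proof -
  have "((%t. y + t *\<^sub>R v) has_derivative (%s. s *\<^sub>R v)) (at t)" by (auto intro!: derivative_eq_intros)
  from has_derivative_compose[OF this dG] that eps0(2)
  show ?thesis unfolding has_field_derivative_def by (force intro: has_derivative_eq_rhs simp: mult.commute)
 qed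
 have gcont: "isCont g q" using dg by (rule has_derivative_continuous)
 have mono: "\<exists>eps>0. eps <= eps0 & (\<forall>x\<in>ball q eps. g x <.> v > 0)" if v: "g q <.> v > 0" for v
 proof -
  have "((%x. g x <.> v) \<longlongrightarrow> g q <.> v) (nhds q)"
  using gcont by (intro tendsto_inner tendsto_const) (simp add: isCont_def tendsto_at_iff_tendsto_nhds)
  then have "\<forall>\<^sub>F x in nhds q. g x <.> v > 0" using v by (rule order_tendstoD)
  then obtain d where "d > 0" "!!x. dist x q < d ==> g x <.> v > 0" unfolding eventually_nhds_metric by blast
  then show ?thesis using eps0(1) by (intro exI[of _ "min d eps0"]) (auto simp: dist_commute)
 qed
 have incr: "G (y + a *\<^sub>R v) < G (y + b *\<^sub>R v)"
  if "a < b" and inn: "!!t. a <= t ==> t <= b ==> y + t *\<^sub>R v \<in> ball q eps" and m: "eps <= eps0" "\<forall>x\<in>ball q eps. g x <.> v > 0" for y a b v eps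
 proof (rule DERIV_pos_imp_increasing[OF that(1)])
  fix t assume t: "a <= t" "t <= b"
  have "y + t *\<^sub>R v \<in> ball q eps0" using inn[OF t] m(1) by auto
  then show "EX D. DERIV (%t. G (y + t *\<^sub>R v)) t :> D & 0 < D" using line m(2) inn[OF t] by blast
 qed
 have gg: "g q <.> g q = (g q $ 1)^2 + (g q $ 2)^2" unfolding inner3 using g3 by (simp add: power2_eq_square)
 have near: "\<exists>t>0. norm (t *\<^sub>R v) < eps / 2 & \<bar>u (pr (q + (s * t) *\<^sub>R v)) - q $ 3\<bar> < eps / 2" if "eps > 0" for eps s :: real and v :: "real^3"
 proof -
  have "((%t. pr (q + (s * t) *\<^sub>R v)) \<longlongrightarrow> pr (q + (s * 0) *\<^sub>R v)) (at_right 0)"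
  unfolding pr_def by (intro tendsto_intros)
  then have "((%t. u (pr (q + (s * t) *\<^sub>R v))) \<longlongrightarrow> u (pr (q + (s * 0) *\<^sub>R v))) (at_right 0)"
  by (rule isCont_tendsto_compose[OF isCont_u])
  then have "((%t. u (pr (q + (s * t) *\<^sub>R v))) \<longlongrightarrow> q $ 3) (at_right 0)" using mem[of q] q(1) by simp
  note 1 = tendstoD[OF this, of "eps / 2"]
  have "((%t. t *\<^sub>R v) \<longlongrightarrow> 0 *\<^sub>R v) (at_right 0)" by (intro tendsto_intros)
  note 2 = tendstoD[OF this, of "eps / 2"]
  have e2: "eps / 2 > 0" using that by simp
  obtain t where "dist (u (pr (q + (s * t) *\<^sub>R v))) (q $ 3) < eps / 2 & dist (t *\<^sub>R v) (0 *\<^sub>R v) < eps / 2 & 0 < t"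
  using eventually_happens'[OF trivial_limit_at_right_real eventually_conj[OF 1[OF e2] eventually_conj[OF 2[OF e2] eventually_at_right_less]]] by blast
  then show ?thesis by (intro exI[of _ t]) (auto simp: dist_real_def)
 qed
 have inb: "q + s *\<^sub>R tau + t *\<^sub>R v \<in> ball q eps" if "\<bar>s\<bar> < eps / 2" "norm (t *\<^sub>R v) < eps / 2" for s t eps v
 proof -
  have "norm (s *\<^sub>R tau + t *\<^sub>R v) < eps" using norm_triangle_ineq[of "s *\<^sub>R tau" "t *\<^sub>R v"] that by simp
  then show ?thesis unfolding mem_ball dist_norm by (subst norm_minus_commute) (simp add: add.assoc)
 qed
 show False
 proof (cases "pr q = 0")
  case True
  then have q12: "q $ 1 = 0" "q $ 2 = 0" unfolding pr_def zero_prod_def by auto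
  obtain eps where eps: "eps > 0" "eps <= eps0" "\<forall>x\<in>ball q eps. g x <.> g q > 0" using mono[OF le(2)] by blast
  obtain t where t: "t > 0" "norm (t *\<^sub>R g q) < eps / 2" "\<bar>u (pr (q + (1 * t) *\<^sub>R g q)) - q $ 3\<bar> < eps / 2"
  using near[OF eps(1)] by metis
  define s where "s = u (pr (q + t *\<^sub>R g q)) - q $ 3"
  define y where "y = q + s *\<^sub>R tau"
  have s: "\<bar>s\<bar> < eps / 2" using t(3) unfolding s_def by simp
  have M: "y + t *\<^sub>R g q \<in> M" "y + (- t) *\<^sub>R g q \<in> M"
  proof -
  have "u (pr (y + (- t) *\<^sub>R g q)) = u (pr (y + t *\<^sub>R g q))" by (rule sym_hr) (simp add: y_def hr_def q12)
  moreover have "pr (y + t *\<^sub>R g q) = pr (q + t *\<^sub>R g q)" unfolding y_def pr_def by simp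
  ultimately show "y + t *\<^sub>R g q \<in> M" "y + (- t) *\<^sub>R g q \<in> M" unfolding mem by (simp_all add: y_def s_def g3)
  qed
  have inn: "y + r *\<^sub>R g q \<in> ball q eps" if "- t <= r" "r <= t" for r
  proof -
  have "norm (r *\<^sub>R g q) <= norm (t *\<^sub>R g q)" unfolding norm_scaleR using that t(1) by (intro mult_right_mono) auto
  then show ?thesis unfolding y_def using t(2) by (intro inb s) auto
  qed
  have "G (y + (- t) *\<^sub>R g q) < G (y + t *\<^sub>R g q)" by (rule incr[OF _ inn eps(2,3)]) (use t in auto)
  moreover have "y + t *\<^sub>R g q \<in> ball p dl" "y + (- t) *\<^sub>R g q \<in> ball p dl"
  by (rule subsetD[OF order_trans[OF subset_ball[OF eps(2)] eps0(2)] inn]; use t(1) in simp)+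
  ultimately show False using M mG by auto
 next
  case False
  define r where "r = sqrt (hr q)"
  have r: "r > 0" "r^2 = hr q" using False unfolding r_def hr_def pr_def zero_prod_def by (auto simp: sum_power2_gt_zero_iff)
  define er et :: "real^3" where "er = (1 / r) *\<^sub>R vector [q $ 1, q $ 2, 0]" and "et = (1 / r) *\<^sub>R vector [- q $ 2, q $ 1, 0]"
  have q12: "q $ 1 = r * er $ 1" "q $ 2 = r * er $ 2" "et $ 1 = - er $ 2" "et $ 2 = er $ 1" "er $ 3 = 0" "et $ 3 = 0"
  unfolding er_def et_def using r by simp_all
  have e1: "(er $ 1)^2 + (er $ 2)^2 = 1"
  proof -
  have "r^2 * ((er $ 1)^2 + (er $ 2)^2) = r^2 * 1" using r(2) unfolding hr_def q12 by (simp add: power_mult_distrib distrib_left)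
  then show ?thesis using r(1) by simp
  qed
  have on: "orthonormal3 er et tau"
  unfolding orthonormal3_def norm_eq_1 inner3 q12(3-6) using e1 by (simp add: power2_eq_square algebra_simps)
  define c where "c = (%t. q + (r * (cos t - 1)) *\<^sub>R er + (r * sin t) *\<^sub>R et)"
  define c' where "c' = (%t. (- r * sin t) *\<^sub>R er + (r * cos t) *\<^sub>R et)"
  have dc: "(c has_derivative (%s. s *\<^sub>R c' t)) (at t)" for t
  unfolding c_def c'_def by (auto intro!: derivative_eq_intros simp: algebra_simps)
  have dc': "(c' has_derivative (%s. s *\<^sub>R (- r *\<^sub>R er))) (at 0)"
  unfolding c'_def by (auto intro!: derivative_eq_intros simp: algebra_simps)
  have c0: "c 0 = q" "c' 0 = r *\<^sub>R et" unfolding c_def c'_def by simp_all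
  have cM: "c t \<in> M" for t
  proof -
  have cc: "c t $ 1 = r * (cos t * er $ 1 - sin t * er $ 2)" "c t $ 2 = r * (cos t * er $ 2 + sin t * er $ 1)" "c t $ 3 = q $ 3"
  unfolding c_def using q12 by (simp_all add: algebra_simps)
  have "hr (c t) = hr q" unfolding hr_def cc q12(1,2) using sin_cos_squared_add[of t] by algebra
  then show ?thesis using sym_hr[of "c t" q] mem[of q] mem[of "c t"] q(1) cc(3) by simp
  qed
  have "isCont c 0" using dc by (rule has_derivative_continuous)
  then have "(c \<longlongrightarrow> c 0) (nhds 0)" unfolding isCont_def tendsto_at_iff_tendsto_nhds .
  then have "\<forall>\<^sub>F t in nhds 0. dist (c t) q < eps0" using eps0(1) unfolding c0(1) by (rule tendstoD)
  then obtain d where d: "d > 0" "!!t. \<bar>t\<bar> < d ==> c t \<in> ball p dl"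
  unfolding eventually_nhds_metric using eps0(2) by (force simp: dist_commute)
  have z1: "g (c t) <.> c' t = 0" if "\<bar>t\<bar> < d" for t
  proof -
  have "DERIV (%t. G (c t)) t :> g (c t) <.> c' t"
  using has_derivative_compose[OF dc dG[OF d(2)[OF that]]] unfolding has_field_derivative_def
  by (rule has_derivative_eq_rhs) (auto simp: mult.commute)
  moreover have "DERIV (%t. G (c t)) t :> 0"
  proof (rule has_field_derivative_transform_within_open[OF DERIV_const, of "{- d<..<d}"])
  show "0 = G (c s)" if "s \<in> {- d<..<d}" for s using mG[OF d(2)[of s]] cM that by auto
  qed (use that in auto)
  ultimately show ?thesis by (rule DERIV_unique)
  qed
  have get: "g q <.> et = 0" using z1[of 0] d(1) r(1) unfolding c0 by simp
  \<comment> \<open>The horizontal circle through \<open>q\<close> lies in \<open>M\<close>, so the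
    gradient is orthogonal to its velocity all along it. Differentiating relates the Hessian in the
    circle direction to the radial part of the gradient.\<close>
  have "DERIV (%t. g (c t) <.> c' t) 0 :> g q <.> (- r *\<^sub>R er) + H (c' 0) <.> c' 0"
  proof -
  have "((%t. g (c t)) has_derivative (%s. H (s *\<^sub>R c' 0))) (at 0)"
  by (rule has_derivative_compose[OF dc]) (use dg c0 in simp)
  from has_derivative_inner[OF this dc']
  have "((%t. g (c t) <.> c' t) has_derivative (%s. g (c 0) <.> (s *\<^sub>R (- r *\<^sub>R er)) + H (s *\<^sub>R c' 0) <.> c' 0)) (at 0)" .
  then show ?thesis unfolding has_field_derivative_def c0(1)
  by (rule has_derivative_eq_rhs)
  (auto simp: fun_eq_iff linear_scale[OF has_derivative_linear[OF dg]] algebra_simps)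
  qed
  moreover have "DERIV (%t. g (c t) <.> c' t) 0 :> 0"
  proof (rule has_field_derivative_transform_within_open[OF DERIV_const, of "{- d<..<d}"])
  show "0 = g (c s) <.> c' s" if "s \<in> {- d<..<d}" for s using z1[of s] that by auto
  qed (use d in auto)
  ultimately have "g q <.> (- r *\<^sub>R er) + H (c' 0) <.> c' 0 = 0" by (rule DERIV_unique)
  then have "r * (r * (H et <.> et)) = r * (g q <.> er)"
  unfolding c0 linear_scale[OF has_derivative_linear[OF dg]] by simp
  then have Hee: "r * (H et <.> et) = g q <.> er" using r(1) by simp
  define ka where "ka = g q <.> er"
  have gq: "g q = ka *\<^sub>R er"
  using orthonormal3_expand[OF on, of "g q"] get g3 unfolding ka_def by simp
  have k0: "ka ~= 0" using le(2) unfolding gq by auto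
  \<comment> \<open>The gradient is horizontal and radial, so the drift vanishes and the tangential
    trace of \<open>H\<close> is zero: in the vertical direction the surface bends oppositely to the
    circle, as at the neck of a catenoid.\<close>
  have "(ka * ka) * tr3 H = (ka * ka) * (H er <.> er)"
  using le(1) g3 orthonormal3_inner(7)[OF on] q12(5) unfolding gq linear_scale[OF has_derivative_linear[OF dg]] by simp
  then have "tr3 H = H er <.> er" using k0 by simp
  then have Htt: "H tau <.> tau = - (H et <.> et)"
  using tr3_frame[OF on has_derivative_linear[OF dg]] by linarith
  have kH: "ka * (H tau <.> tau) < 0"
  proof -
  have "r * (ka * (H tau <.> tau)) = - (ka * ka)" unfolding Htt using Hee unfolding ka_def by (simp add: mult.left_commute)
  also have "... < 0"
  proof -
  have "0 < ka * ka" by (rule ccontr) (use k0 in simp)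
  then show ?thesis by simp
  qed
  finally show ?thesis using r(1) by (simp add: mult_less_0_iff)
  qed
  have "g q <.> (ka *\<^sub>R er) > 0" using le(2) unfolding gq .
  from mono[OF this] obtain eps where eps: "eps > 0" "eps <= eps0" "\<forall>x\<in>ball q eps. g x <.> (ka *\<^sub>R er) > 0" by blast
  define f where "f = (%b. ka * (g (q + b *\<^sub>R tau) <.> tau))"
  have df': "DERIV f 0 :> ka * (H tau <.> tau)"
  proof -
  have "((%b. q + b *\<^sub>R tau) has_derivative (%s. s *\<^sub>R tau)) (at 0)" by (auto intro!: derivative_eq_intros)
  from has_derivative_compose[OF this, of g H] dg
  have "((%b. g (q + b *\<^sub>R tau)) has_derivative (%s. H (s *\<^sub>R tau))) (at 0)" by simp
  from has_derivative_mult_right[OF has_derivative_inner_left[OF this]]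
  show ?thesis unfolding has_field_derivative_def f_def
  by (rule has_derivative_eq_rhs) (auto simp: fun_eq_iff linear_scale[OF has_derivative_linear[OF dg]] simp del: inner_tau)
  qed
  have f0: "f 0 = 0" using g3 by (simp add: f_def)
  obtain b1 where b1: "b1 > 0" "!!b. 0 < b ==> b < b1 ==> f b < 0"
  using DERIV_neg_dec_right[OF df' kH] f0 by auto
  obtain b2 where b2: "b2 > 0" "!!b. 0 < b ==> b < b2 ==> f (- b) > 0"
  using DERIV_neg_dec_left[OF df' kH] f0 by auto
  define eps1 where "eps1 = min eps (min b1 b2)"
  have eps1: "eps1 > 0" "eps1 <= eps" "eps1 <= b1" "eps1 <= b2" unfolding eps1_def using eps b1 b2 by auto
  \<comment> \<open>The vertical line through \<open>q\<close> stays on the nonpositive side of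
    \<open>ka * G\<close>; moving inward from it makes the value strictly negative, but
    \<open>M\<close> has a point there.\<close>
  have Gle: "ka * G (q + b *\<^sub>R tau) <= 0" if b: "\<bar>b\<bar> < eps1 / 2" for b
  proof -
  have Dl: "DERIV (%b. ka * G (q + b *\<^sub>R tau)) t :> f t" if "\<bar>t\<bar> < eps1 / 2" for t
  unfolding f_def by (intro DERIV_cmult line) (use that eps1 eps(2) in "auto simp: dist_norm")
  have G0: "ka * G (q + 0 *\<^sub>R tau) = 0" using mG[OF q(2)] q(1) by simp
  show ?thesis
  proof (cases "b >= 0")
  case True
  have "ka * G (q + b *\<^sub>R tau) <= ka * G (q + 0 *\<^sub>R tau)"
  proof (rule DERIV_nonpos_imp_nonincreasing[OF True])
  fix t assume t: "0 <= t" "t <= b"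
  have "f t <= 0"
  using b1(2)[of t] t b eps1 f0 by (cases "t = 0") auto
  then show "EX y. DERIV (%b. ka * G (q + b *\<^sub>R tau)) t :> y & y <= 0" using Dl[of t] t b by auto
  qed
  then show ?thesis unfolding G0 .
  next
  case False
  have "ka * G (q + b *\<^sub>R tau) <= ka * G (q + 0 *\<^sub>R tau)"
  proof (rule DERIV_nonneg_imp_nondecreasing[of b 0 "%b. ka * G (q + b *\<^sub>R tau)"])
  show "b <= 0" using False by simp
  fix t assume t: "b <= t" "t <= 0"
  have "f t >= 0"
  using b2(2)[of "- t"] t b eps1 f0 by (cases "t = 0") auto
  then show "EX y. DERIV (%b. ka * G (q + b *\<^sub>R tau)) t :> y & 0 <= y" using Dl[of t] t b by auto
  qed
  then show ?thesis unfolding G0 .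
  qed
  qed
  obtain t where t: "t > 0" "norm (t *\<^sub>R er) < eps1 / 2" "\<bar>u (pr (q + ((- 1) * t) *\<^sub>R er)) - q $ 3\<bar> < eps1 / 2"
  using near[OF eps1(1)] by metis
  define s where "s = u (pr (q + (- t) *\<^sub>R er)) - q $ 3"
  define y where "y = q + s *\<^sub>R tau"
  have s: "\<bar>s\<bar> < eps1 / 2" using t(3) unfolding s_def by simp
  have M: "y + (- t) *\<^sub>R er \<in> M"
  proof -
  have "pr (y + (- t) *\<^sub>R er) = pr (q + (- t) *\<^sub>R er)" unfolding y_def pr_def by simp
  then show ?thesis unfolding mem by (simp add: y_def s_def q12)
  qed
  have inn: "y + a *\<^sub>R er \<in> ball q eps" if "- t <= a" "a <= 0" for a
  proof -
  have "norm (a *\<^sub>R er) <= norm (t *\<^sub>R er)" unfolding norm_scaleR using that t(1) by (intro mult_right_mono) auto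
  then have "y + a *\<^sub>R er \<in> ball q eps1" unfolding y_def using t(2) by (intro inb s) auto
  then show ?thesis using eps1 by auto
  qed
  have "ka * G (y + (- t) *\<^sub>R er) < ka * G (y + 0 *\<^sub>R er)"
  proof (rule DERIV_pos_imp_increasing[of "- t" 0 "%a. ka * G (y + a *\<^sub>R er)"])
  fix a assume a: "- t <= a" "a <= 0"
  have "DERIV (%a. ka * G (y + a *\<^sub>R er)) a :> ka * (g (y + a *\<^sub>R er) <.> er)"
  by (intro DERIV_cmult line) (use inn[OF a] eps(2) in auto)
  moreover have "ka * (g (y + a *\<^sub>R er) <.> er) > 0" using eps(3) inn[OF a] by simp
  ultimately show "EX D. DERIV (%a. ka * G (y + a *\<^sub>R er)) a :> D & 0 < D" by blast
  qed (use t in simp)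
  also have "... <= 0" using Gle[OF s] unfolding y_def by simp
  finally have "G (y + (- t) *\<^sub>R er) ~= 0" by auto
  moreover have "y + (- t) *\<^sub>R er \<in> ball p dl"
  by (rule subsetD[OF order_trans[OF subset_ball[OF eps(2)] eps0(2)] inn]) (use t(1) in auto)
  ultimately show False using M mG by auto
 qed
qed

definition X where "X v = fst v *\<^sub>R axis 1 1 + snd v *\<^sub>R axis 2 1 + u v *\<^sub>R tau"

lemma X_nth [simp]: "X v $ 1 = fst v" "X v $ 2 = snd v" "X v $ 3 = u v"
 by (simp_all add: X_def axis_def)

lemma X_vector: "vector [fst v, snd v, u v] = X v" unfolding vec3_eq by simp

lemma pr_X [simp]: "pr (X v) = v" by (simp add: pr_def)

lemma X_mem: "X v \<in> M" unfolding mem by simp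

lemma continuous_X: "continuous_on UNIV X"
 unfolding X_def[abs_def] by (intro continuous_intros cont)

lemma open_patch: "open (X -` ball p dl)"
 by (rule open_vimage[OF open_ball continuous_X])

lemma u_derivatives:
 assumes fr: "tframe M p e1 e2 n h dl eta" and v: "X v \<in> ball p dl"
 defines "g \<equiv> nrm e1 e2 n h (proj p e1 e2 (X v))"
 shows "u differentiable (at v)" "D1 u v = - g $ 1 / g $ 3" "D2 u v = - g $ 2 / g $ 3"
proof -
 have ev: "\<forall>\<^sub>F w in nhds (pr (X v)). lev p e1 e2 n h (vector [fst w, snd w, u w]) = 0"
  unfolding eventually_nhds
 proof (intro exI[of _ "X -` ball p dl"] conjI open_patch ballI)
  show "pr (X v) \<in> X -` ball p dl" using v by simp
  fix w assume "w \<in> X -` ball p dl"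
  then show "lev p e1 e2 n h (vector [fst w, snd w, u w]) = 0"
  unfolding X_vector using frame_derivatives(3)[OF fr, of "X w"] X_mem by simp
 qed
 have "(u has_derivative (%k. fst k * (- g $ 1 / g $ 3) + snd k * (- g $ 2 / g $ 3))) (at (pr (X v)))"
  by (rule has_derivative_implicit[OF frame_derivatives(1)[OF fr v, folded g_def] _ isCont_u _ ev])
  (use not_vertical[OF fr X_mem v] in "simp_all add: g_def")
 then have "(u has_derivative (%k. fst k * (- g $ 1 / g $ 3) + snd k * (- g $ 2 / g $ 3))) (at v)" by simp
 from D_eqI[OF this] show "u differentiable (at v)" "D1 u v = - g $ 1 / g $ 3" "D2 u v = - g $ 2 / g $ 3" .
qed

text \<open>The gradient of \<open>u\<close> is a quotient of components of the patch normal at the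
  point above, that is, a smooth function composed with \<open>u\<close>. So each order of
  regularity of \<open>u\<close> yields the next.\<close>

lemma Ck_u: "Ck k UNIV u"
proof (induction k)
 case 0
 show ?case using cont by simp
next
 case (Suc k)
 have loc: "EX V. open V & v \<in> V & u differentiable (at v) & Ck k V (D1 u) & Ck k V (D2 u)" for v
 proof -
  define p where "p = X v"
  have p: "p \<in> M" unfolding p_def by (rule X_mem)
  obtain e1 e2 n h dl eta where fr: "tframe M p e1 e2 n h dl eta" by (rule translator_patch_tframe[OF patch[OF p] p])
  define V where "V = X -` ball p dl"
  have V: "open V" unfolding V_def by (rule open_patch)
  have uV: "Ck k V u" by (rule Ck_subset[OF Suc]) simp
  have vV: "v \<in> V" unfolding V_def p_def[symmetric] using tframeD(2,3)[OF fr] p_def by simp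
  define al where "al = (%e w. (fst w * e $ 1 + snd w * e $ 2) + u w * e $ (3 :: 3) + - (p <.> e))"
  have al: "Ck k V (al e)" for e :: "real^3" unfolding al_def by (intro Ck_add Ck_mult V uV Ck_const Ck_fst Ck_snd)
  have pe: "proj p e1 e2 (X w) = (al e1 w, al e2 w)" for w
  unfolding proj_def al_def inner_diff_left by (simp add: inner3)
  have pin: "(al e1 w, al e2 w) \<in> ball 0 dl" if "w \<in> V" for w
  using tframe_proj_in[OF fr, of "X w"] that unfolding pe V_def by simp
  have sm: "Ck k (ball 0 dl) (D1 h)" "Ck k (ball 0 dl) (D2 h)"
  using smooth2_D[OF tframeD(4)[OF fr]] unfolding smooth2_def by auto
  define g where "g = (%i w. nrm e1 e2 n h (proj p e1 e2 (X w)) $ i)"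
  have g: "Ck k V (g i)" for i
  proof -
  have "g i = (%w. n $ i - D1 h (al e1 w, al e2 w) * e1 $ i - D2 h (al e1 w, al e2 w) * e2 $ i)"
  unfolding g_def nrm_def pe by (simp add: fun_eq_iff)
  moreover have "Ck k V (%w. n $ i - D1 h (al e1 w, al e2 w) * e1 $ i - D2 h (al e1 w, al e2 w) * e2 $ i)"
  by (intro Ck_diff Ck_mult V Ck_const Ck_compose[OF V al al sm(1) pin] Ck_compose[OF V al al sm(2) pin])
  ultimately show ?thesis by simp
  qed
  have g3: "g 3 w ~= 0" if "w \<in> V" for w
  unfolding g_def by (rule not_vertical[OF fr X_mem]) (use that V_def in simp)
  note d = u_derivatives[OF fr, of w for w]
  have q: "Ck k V (%w. (- g i w) * inverse (g 3 w))" for i by (intro Ck_mult Ck_uminus Ck_inverse V g g3)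
  have "Ck k V (D1 u)" by (rule Ck_cong[OF V _ q[of 1]]) (use d(2) in "simp add: g_def V_def divide_inverse")
  moreover have "Ck k V (D2 u)" by (rule Ck_cong[OF V _ q[of 2]]) (use d(3) in "simp add: g_def V_def divide_inverse")
  moreover have "u differentiable (at v)" by (rule d(1)) (use vV V_def in simp)
  ultimately show ?thesis using V vV by blast
 qed
 have "Ck k UNIV (D1 u)" "Ck k UNIV (D2 u)" by (rule Ck_local, use loc in blast)+
 moreover have "\<forall>z\<in>UNIV. u differentiable (at z)" using loc by blast
 ultimately show ?case by (simp only: Ck.simps)
qed

lemma smooth_u: "smooth2 UNIV u"
 unfolding smooth2_def by (rule allI) (rule Ck_u)

lemma rotation_field: "x * D2 u (x, y) = y * D1 u (x, y)"
proof -
 have "((%t. (x * cos t - y * sin t, x * sin t + y * cos t)) has_derivative (%s. (s * (- y), s * x))) (at 0)"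
  by (auto intro!: derivative_eq_intros)
 from has_derivative_compose[OF this has_derivative_D[OF smooth2_differentiable[OF smooth_u UNIV_I]]]
 have "DERIV (%t. u (x * cos t - y * sin t, x * sin t + y * cos t)) 0 :> x * D2 u (x, y) - y * D1 u (x, y)"
  unfolding has_field_derivative_def by (rule has_derivative_eq_rhs) (auto simp: algebra_simps)
 moreover have c: "u (x * cos t - y * sin t, x * sin t + y * cos t) = u (x, y)" for t
  by (rule sym, unfold fst_conv snd_conv) (use sin_cos_squared_add[of t] in algebra)
 have "DERIV (%t. u (x * cos t - y * sin t, x * sin t + y * cos t)) 0 :> 0" unfolding c by simp
 ultimately have "x * D2 u (x, y) - y * D1 u (x, y) = 0" by (rule DERIV_unique)
 then show ?thesis by simp
qed

lemma graph_equation: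
 "(1 + (D2 u z)^2) * D1 (D1 u) z - 2 * D1 u z * D2 u z * D1 (D2 u) z + (1 + (D1 u z)^2) * D2 (D2 u) z
  = 1 + (D1 u z)^2 + (D2 u z)^2"
proof -
 note du = has_derivative_D[OF smooth2_differentiable[OF smooth_u UNIV_I]]
 note d1 = has_derivative_D[OF smooth2_differentiable[OF smooth2_D(1)[OF smooth_u] UNIV_I]]
 note d2 = has_derivative_D[OF smooth2_differentiable[OF smooth2_D(2)[OF smooth_u] UNIV_I]]
 have comm: "D2 (D1 u) w = D1 (D2 u) w" for w using smooth2_commute[OF open_UNIV smooth_u] by simp
 define X1 where "X1 = (%w. axis 1 1 + D1 u w *\<^sub>R tau)"
 define X2 where "X2 = (%w. axis 2 1 + D2 u w *\<^sub>R tau)"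
 define N where "N = (- D1 u z) *\<^sub>R axis 1 1 + (- D2 u z) *\<^sub>R axis 2 1 + tau"
 have dX: "(X has_derivative (%k. fst k *\<^sub>R X1 w + snd k *\<^sub>R X2 w)) (at w)" for w
  unfolding X_def[abs_def] X1_def X2_def
  by (rule has_derivative_eq_rhs[OF has_derivative_add[OF has_derivative_add[OF
  has_derivative_scaleR_left[OF has_derivative_fst[OF has_derivative_ident]]
  has_derivative_scaleR_left[OF has_derivative_snd[OF has_derivative_ident]]]
  has_derivative_scaleR_left[OF du]]])
  (auto simp: fun_eq_iff algebra_simps)
 have dX1: "(X1 has_derivative (%k. fst k *\<^sub>R (D1 (D1 u) z *\<^sub>R tau) + snd k *\<^sub>R (D1 (D2 u) z *\<^sub>R tau))) (at z)"
  unfolding X1_def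
  by (rule has_derivative_eq_rhs[OF has_derivative_add[OF has_derivative_const has_derivative_scaleR_left[OF d1]]])
  (auto simp: fun_eq_iff comm algebra_simps)
 have dX2: "(X2 has_derivative (%k. fst k *\<^sub>R (D1 (D2 u) z *\<^sub>R tau) + snd k *\<^sub>R (D2 (D2 u) z *\<^sub>R tau))) (at z)"
  unfolding X2_def
  by (rule has_derivative_eq_rhs[OF has_derivative_add[OF has_derivative_const has_derivative_scaleR_left[OF d2]]])
  (auto simp: fun_eq_iff algebra_simps)
 have c: "X1 z $ 1 = 1" "X1 z $ 2 = 0" "X1 z $ 3 = D1 u z" "X2 z $ 1 = 0" "X2 z $ 2 = 1" "X2 z $ 3 = D2 u z"
  "N $ 1 = - D1 u z" "N $ 2 = - D2 u z" "N $ 3 = 1"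
  unfolding X1_def X2_def N_def by (simp_all add: axis_def)
 have N: "N <.> X1 z = 0" "N <.> X2 z = 0" unfolding inner3 c by simp_all
 have D: "(X1 z <.> X1 z) * (X2 z <.> X2 z) - (X1 z <.> X2 z)^2 = 1 + (D1 u z)^2 + (D2 u z)^2"
  unfolding inner3 c by (simp add: power2_eq_square algebra_simps)
 have D0: "(X1 z <.> X1 z) * (X2 z <.> X2 z) - (X1 z <.> X2 z)^2 > 0" unfolding D by (intro add_pos_nonneg) auto
 from translator_immersion_equation[OF patch[OF X_mem] open_UNIV UNIV_I dX X_mem dX1 dX2 N D0]
 show ?thesis unfolding D unfolding inner3 by (simp add: c power2_eq_square algebra_simps)
qed

lemma is_bowl_graph:
 "is_bowl_soliton ((%x. a + x) ` M)"
 unfolding is_bowl_soliton_def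
proof (intro exI conjI allI impI)
 show "smooth2 UNIV u" by (rule smooth_u)
 show "u (x, y) = u (x', y')" if "x^2 + y^2 = x'^2 + y'^2" for x y x' y' by (rule sym) (use that in simp)
 show "D1 (D1 u) z > 0" "D1 (D1 u) z * D2 (D2 u) z - (D1 (D2 u) z)^2 > 0" for z
  using radial_translator_convex[OF smooth_u rotation_field graph_equation] .
 show "graph_mean_curv u z = 1 / sqrt (1 + (D1 u z)^2 + (D2 u z)^2)" for z
 proof -
  define W where "W = 1 + (D1 u z)^2 + (D2 u z)^2"
  have W: "W > 0" unfolding W_def by (intro add_pos_nonneg) auto
  have "graph_mean_curv u z = W / (sqrt W) ^ 3"
  unfolding graph_mean_curv_def Let_def using graph_equation[of z] unfolding W_def by simp
  also have "... = 1 / sqrt W" using W by (simp add: power3_eq_cube)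
  finally show ?thesis unfolding W_def .
 qed
 show "(%x. a + x) ` M = (%(x, y). a + vector [x, y, u (x, y)]) ` UNIV"
 proof -
  have "M = X ` UNIV"
  proof
  show "M \<subseteq> X ` UNIV"
  proof
  fix x assume "x \<in> M"
  then have "x = X (pr x)" using mem[of x] unfolding vec3_eq by (simp add: pr_def)
  then show "x \<in> X ` UNIV" by blast
  qed
  qed (use X_mem in blast)
  moreover have "X v = (case v of (x, y) => vector [x, y, u (x, y)])" for v
  using X_vector[of v] by (cases v) simp
  ultimately show ?thesis by (auto simp: image_image case_prod_unfold)
 qed
qed

end

theorem theorem0p2:
  fixes M :: "(real^3) set"
  assumes "properly_embedded_translator M"
    and "converges_to_cylinder M"
  shows "is_bowl_soliton M"
proof -
 obtain rh rh' z1 a1 a2 K r0 where te: "translator_end M rh rh' z1 a1 a2 K r0"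
  by (rule translator_end_exists[OF assms])
 interpret translator_end M rh rh' z1 a1 a2 K r0 by (rule te)
 define a :: "real^3" where "a = vector [a1, a2, 0]"
 define u where "u = (%v. hgt (fst v + a1, snd v + a2))"
 \<comment> \<open>The surface is recentred so that its axis of symmetry becomes the
   \<open>z\<close>-axis.\<close>
 define M0 where "M0 = (%x. x + (- a)) ` M"
 have M0: "x \<in> M0 \<longleftrightarrow> x + a \<in> M" for x
  unfolding M0_def by (auto intro!: image_eqI[of _ _ "x + a"])
 interpret radial_translator M0 u
 proof
  fix x assume x: "x \<in> M0"
  have "translator_patch ((%x. x + (- a)) ` M) ((x + a) + (- a))"
  using translator_patch_isometry[of "%x. x" M "x + a" "- a"] patch[of "x + a"] x M0
  by (simp add: orthogonal_transformation_id[unfolded id_def])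
  then show "translator_patch M0 x" unfolding M0_def by simp
 next
  fix x
  show "x \<in> M0 \<longleftrightarrow> x $ 3 = u (pr x)"
  unfolding M0 mem_iff u_def pr_def a_def by simp
 next
  show "continuous_on UNIV u"
  unfolding u_def by (rule continuous_on_compose2[OF continuous_hgt]) (auto intro!: continuous_intros)
 next
  fix v w :: "real \<times> real" assume "(fst v)^2 + (snd v)^2 = (fst w)^2 + (snd w)^2"
  then show "u v = u w" unfolding u_def by (intro hgt_symmetric) simp
 qed
 have "M = (%x. a + x) ` M0" unfolding M0_def by (auto simp: image_image)
 then show ?thesis using is_bowl_graph[of a] by simp
qed

end
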